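(* Let $n\ge2$, $k_0\ge2$, $d=c(n,k_0)$, and let a holomorphic $d$-web of codimension one (in weak general position) on an $n$-dimensional complex manifold $M_0$ be ordinary, with associated analytic subset $S\subset M_0$. Then the space $\mathcal E=R_{k_0-3}$ of formal abelian relations at order $k_0-2$ is a holomorphic vector bundle of rank $\pi'(n,d)$ over $M_0\setminus S$, and there is a holomorphic connection $\nabla$ on $\mathcal E$ over $M_0\setminus S$ such that, at each point $m\in M_0\setminus S$, the map $u\mapsto j^{k_0-2}u$ is an isomorphism from the vector space of germs at $m$ of abelian relations onto the vector space of germs at $m$ of holomorphic sections $s$ of $\mathcal E$ with $\nabla s=0$. Consequently the curvature of $\nabla$ is an obstruction for the rank to reach $\pi'(n,d)$: if the rank of the web at a point $m\in M_0\setminus S$ equals $\pi'(n,d)$, then the curvature of $\nabla$ vanishes in a neighbourhood of $m$.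
   Context: **Webs.** A $d$-web of codimension one on an $n$-dimensional complex manifold $M_0$ ($d>n$) is here a non-singular one: near each point of $M_0$ it is given by $d$ non-singular holomorphic foliations $\mathcal F_1,\dots,\mathcal F_d$ of codimension one whose tangent hyperplanes $T_1,\dots,T_d$ are pairwise distinct at each point (globally, the $d$ foliations are given by a $d$-fold covering $W_0\subset \mathbb P(T^*M_0)\to M_0$). The web is in weak general position: at each point of $M_0$ there exist $n$ of the $d$ leaves through that point whose defining covectors are linearly independent. **Numbers.** $c(n,h)=\binom{n-1+h}{h}$. For $d=c(n,k_0)$ with $k_0\ge 2$, $\pi'(n,d)=\sum_{h=1}^{k_0}\bigl(d-c(n,h)\bigr)$. **Abelian relations, $A$, $R_k$.** $A$ is the holomorphic vector bundle of rank $d-n$ on $M_0$ whose fiber at $m$ is the space of families $(\omega_i)_{1\le i\le d}$ of covectors $\omega_i\in T_m^*M_0$ with $T_i\subset\ker\omega_i$ and $\sum_i\omega_i=0$. $B$ is the bundle whose fiber is the space of families $(\varpi_i)_{1\le i\le d}$ in $\bigwedge^2T^*_mM_0$ with $\sum_i\varpi_i=0$. The first order linear differential operator $(\omega_i)\mapsto(d\omega_i)$ from sections of $A$ to sections of $B$ corresponds to a bundle morphism $D=D_0:J^1A\to B$; for $k\ge0$ let $D_k:J^{k+1}A\to J^kB$ be its $k$-th prolongation, and $R_k=\ker D_k\subset J^{k+1}A$ (fiberwise kernel), the space of formal abelian relations at order $k+1$. By convention $R_{-1}=A$ (and $J^0A=A$). An abelian relation is a holomorphic section $u=(\omega_i)$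 of $A$ (or germ of such) with $d\omega_i=0$ for all $i$. The rank of the web at $m$ is the dimension of the space of germs at $m$ of abelian relations. **The set $S$ and ordinary webs (here $d\ge c(n,2)$).** Let $\eta_i$ be a local non-vanishing 1-form defining $\mathcal F_i$, $(\eta_i)^h\in S^h(T^*M_0)$ its $h$-th symmetric power, $r_h(m)$ the dimension of the span of $(\eta_1)^h(m),\dots,(\eta_d)^h(m)$ in $S^h(T_m^*M_0)$, $S_h=\{m\in M_0: r_h(m)<\min(d,c(n,h))\}$, and $S=\bigcup_{h=2}^{k_0}S_h$. The web is ordinary if $S$ is empty or has dimension at most $n-1$. *)

theory Defs
  imports "HOL-Analysis.Analysis" "HOL-Library.Function_Algebras"
begin

section \<open>Complex vector spaces of functions\<close>

text \<open>All vector spaces below (covectors, polynomials on a tangent space, jets, values of sections)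
  consist of complex-valued functions on some index type, with pointwise operations.\<close>

definition fscale :: "complex \<Rightarrow> ('x \<Rightarrow> complex) \<Rightarrow> 'x \<Rightarrow> complex" (infixr "*\<^sub>F" 75)
  where "a *\<^sub>F f = (\<lambda>x. a * f x)"

global_interpretation cfun: vector_space "fscale :: complex \<Rightarrow> ('x \<Rightarrow> complex) \<Rightarrow> 'x \<Rightarrow> complex"
  by unfold_locales (auto simp: fscale_def fun_eq_iff algebra_simps)


section \<open>Holomorphic functions of several variables\<close>

definition holomorphic_several :: "(complex^'n \<Rightarrow> complex) \<Rightarrow> (complex^'n) set \<Rightarrow> bool"
  where "holomorphic_several f U \<longleftrightarrow>
    open U \<and> (\<forall>z\<in>U. \<exists>L. (f has_derivative L) (at z) \<and> (\<forall>a v. L (a *s v) = a * L v))"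

definition pderiv_dir :: "'n \<Rightarrow> (complex^'n \<Rightarrow> complex) \<Rightarrow> complex^'n \<Rightarrow> complex"
  where "pderiv_dir i f z = deriv (\<lambda>t. f (z + t *s axis i 1)) 0"

fun iter_pderiv :: "'n list \<Rightarrow> (complex^'n \<Rightarrow> complex) \<Rightarrow> complex^'n \<Rightarrow> complex"
  where
    "iter_pderiv [] f = f"
  | "iter_pderiv (i # is) f = pderiv_dir i (iter_pderiv is f)"


section \<open>Complex manifolds\<close>

type_synonym ('m, 'n) chart = "'m set \<times> ('m \<Rightarrow> complex^'n)"

abbreviation chart_inv :: "('m, 'n) chart \<Rightarrow> complex^'n \<Rightarrow> 'm"
  where "chart_inv c \<equiv> inv_into (fst c) (snd c)"

text \<open>The manifold is the union of the domains of the charts of an atlas; the Hausdorff and second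
  countability axioms are imposed on the ambient type in the statements.\<close>

definition complex_atlas :: "('m::topological_space, 'n::finite) chart set \<Rightarrow> bool"
  where "complex_atlas A \<longleftrightarrow>
    (\<forall>c\<in>A. open (fst c) \<and> open (snd c ` fst c) \<and>
       homeomorphism (fst c) (snd c ` fst c) (snd c) (chart_inv c)) \<and>
    (\<forall>c\<in>A. \<forall>c'\<in>A. \<forall>i.
       holomorphic_several (\<lambda>z. snd c' (chart_inv c z) $ i) (snd c ` (fst c \<inter> fst c')))"

definition manifold :: "('m, 'n) chart set \<Rightarrow> 'm set"
  where "manifold A = (\<Union>c\<in>A. fst c)"

definition hol_on :: "('m::topological_space, 'n::finite) chart set \<Rightarrow> ('m \<Rightarrow> complex) \<Rightarrow> 'm set \<Rightarrow> bool"
  where "hol_on A f V \<longleftrightarrow> open V \<and> V \<subseteq> manifold A \<and>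
    (\<forall>c\<in>A. holomorphic_several (\<lambda>z. f (chart_inv c z)) (snd c ` (V \<inter> fst c)))"

definition hol_near :: "('m::topological_space, 'n::finite) chart set \<Rightarrow> 'm \<Rightarrow> ('m \<Rightarrow> complex) \<Rightarrow> bool"
  where "hol_near A m f \<longleftrightarrow> (\<exists>V. m \<in> V \<and> hol_on A f V)"

text \<open>A (holomorphic) tangent vector at \<open>m\<close> is a derivation of the germs of holomorphic functions
  at \<open>m\<close>, given in a chart by \<open>f \<mapsto> \<Sum>\<^sub>i a\<^sub>i \<partial>f/\<partial>z\<^sub>i(m)\<close>; as a function on all of \<open>'m \<Rightarrow> complex\<close> it is
  extended by 0 to the functions that are not holomorphic near \<open>m\<close>.  Thus \<open>v f\<close> is \<open>df(v)\<close>.\<close>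

type_synonym 'm tvec = "('m \<Rightarrow> complex) \<Rightarrow> complex"

definition tangent_of ::
    "('m::topological_space, 'n::finite) chart set \<Rightarrow> ('m, 'n) chart \<Rightarrow> 'm \<Rightarrow> complex^'n \<Rightarrow> 'm tvec"
  where "tangent_of A c m a = (\<lambda>f. if hol_near A m f
      then \<Sum>i\<in>UNIV. a $ i * pderiv_dir i (\<lambda>z. f (chart_inv c z)) (snd c m) else 0)"

definition tangent_space :: "('m::topological_space, 'n::finite) chart set \<Rightarrow> 'm \<Rightarrow> 'm tvec set"
  where "tangent_space A m = {tangent_of A c m a | c a. c \<in> A \<and> m \<in> fst c}"

definition coord_vec ::
    "('m::topological_space, 'n::finite) chart set \<Rightarrow> ('m, 'n) chart \<Rightarrow> 'n \<Rightarrow> 'm \<Rightarrow> 'm tvec"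
  where "coord_vec A c i m = tangent_of A c m (axis i 1)"

text \<open>Covectors are linear functionals on the tangent space, extended by 0.\<close>

type_synonym 'm covec = "'m tvec \<Rightarrow> complex"

definition cotangent_space :: "('m::topological_space, 'n::finite) chart set \<Rightarrow> 'm \<Rightarrow> 'm covec set"
  where "cotangent_space A m = {\<eta>.
    (\<forall>v\<in>tangent_space A m. \<forall>w\<in>tangent_space A m. \<forall>a. \<eta> (v + a *\<^sub>F w) = \<eta> v + a * \<eta> w) \<and>
    (\<forall>v. v \<notin> tangent_space A m \<longrightarrow> \<eta> v = 0)}"

definition hol_vector_field ::
    "('m::topological_space, 'n::finite) chart set \<Rightarrow> 'm set \<Rightarrow> ('m \<Rightarrow> 'm tvec) \<Rightarrow> bool"
  where "hol_vector_field A V X \<longleftrightarrow> open V \<and> V \<subseteq> manifold A \<and>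
    (\<forall>x\<in>V. X x \<in> tangent_space A x) \<and>
    (\<forall>c\<in>A. \<forall>i. hol_on A (\<lambda>x. X x (\<lambda>y. snd c y $ i)) (V \<inter> fst c))"

definition lie_bracket ::
    "('m::topological_space, 'n::finite) chart set \<Rightarrow> ('m \<Rightarrow> 'm tvec) \<Rightarrow> ('m \<Rightarrow> 'm tvec) \<Rightarrow> 'm \<Rightarrow> 'm tvec"
  where "lie_bracket A X Y x = (\<lambda>f. if hol_near A x f
      then X x (\<lambda>y. Y y f) - Y x (\<lambda>y. X y f) else 0)"

definition hol_one_form ::
    "('m::topological_space, 'n::finite) chart set \<Rightarrow> 'm set \<Rightarrow> ('m \<Rightarrow> 'm covec) \<Rightarrow> bool"
  where "hol_one_form A V \<omega> \<longleftrightarrow> open V \<and> V \<subseteq> manifold A \<and>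
    (\<forall>x\<in>V. \<omega> x \<in> cotangent_space A x) \<and>
    (\<forall>c\<in>A. \<forall>i. hol_on A (\<lambda>x. \<omega> x (coord_vec A c i x)) (V \<inter> fst c))"

text \<open>The coefficient \<open>d\<omega>(\<partial>\<^sub>i, \<partial>\<^sub>j) = \<partial>\<^sub>i\<omega>\<^sub>j - \<partial>\<^sub>j\<omega>\<^sub>i\<close> of the exterior derivative in the chart \<open>c\<close>.\<close>

definition ext_deriv_coeff ::
    "('m::topological_space, 'n::finite) chart set \<Rightarrow> ('m, 'n) chart \<Rightarrow> ('m \<Rightarrow> 'm covec) \<Rightarrow> 'n \<Rightarrow> 'n \<Rightarrow> 'm \<Rightarrow> complex"
  where "ext_deriv_coeff A c \<omega> i j x =
    coord_vec A c i x (\<lambda>y. \<omega> y (coord_vec A c j y)) - coord_vec A c j x (\<lambda>y. \<omega> y (coord_vec A c i y))"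


section \<open>Webs\<close>

text \<open>A codimension one foliation is given by its field of tangent hyperplanes, which is locally the
  field of kernels of \<open>df\<close> for a holomorphic submersion \<open>f\<close>.\<close>

type_synonym 'm hyp = "'m tvec set"

definition hol_foliation ::
    "('m::topological_space, 'n::finite) chart set \<Rightarrow> 'm set \<Rightarrow> ('m \<Rightarrow> 'm hyp) \<Rightarrow> bool"
  where "hol_foliation A V T \<longleftrightarrow> open V \<and> V \<subseteq> manifold A \<and>
    (\<forall>m\<in>V. \<exists>V' f. m \<in> V' \<and> V' \<subseteq> V \<and> hol_on A f V' \<and>
      (\<forall>x\<in>V'. (\<exists>v\<in>tangent_space A x. v f \<noteq> 0) \<and> T x = {v \<in> tangent_space A x. v f = 0}))"

text \<open>A web is given by the set \<open>W m\<close> of the tangent hyperplanes of its \<open>d\<close> leaves through \<open>m\<close>, that is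
  by the fibre at \<open>m\<close> of the \<open>d\<close>-fold covering inside the projectivized cotangent bundle; the foliations
  can be numbered only locally.\<close>

definition hol_web ::
    "('m::topological_space, 'n::finite) chart set \<Rightarrow> nat \<Rightarrow> ('m \<Rightarrow> 'm hyp set) \<Rightarrow> bool"
  where "hol_web A d W \<longleftrightarrow> (\<forall>m\<in>manifold A. \<exists>V T. m \<in> V \<and>
    (\<forall>i<d. hol_foliation A V (T i)) \<and> open V \<and> V \<subseteq> manifold A \<and>
    (\<forall>x\<in>V. inj_on (\<lambda>i. T i x) {..<d} \<and> W x = (\<lambda>i. T i x) ` {..<d}))"

definition conormals ::
    "('m::topological_space, 'n::finite) chart set \<Rightarrow> ('m \<Rightarrow> 'm hyp set) \<Rightarrow> 'm \<Rightarrow> 'm covec set"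
  where "conormals A W m = {\<eta> \<in> cotangent_space A m. \<eta> \<noteq> 0 \<and> {v \<in> tangent_space A m. \<eta> v = 0} \<in> W m}"

definition weak_general_position ::
    "('m::topological_space, 'n::finite) chart set \<Rightarrow> ('m \<Rightarrow> 'm hyp set) \<Rightarrow> bool"
  where "weak_general_position A W \<longleftrightarrow> (\<forall>m\<in>manifold A.
    \<exists>B \<subseteq> conormals A W m. finite B \<and> card B = CARD('n) \<and> cfun.independent B)"

definition web_c :: "nat \<Rightarrow> nat \<Rightarrow> nat"
  where "web_c n h = (n - 1 + h) choose h"

text \<open>For \<open>d = web_c n k\<^sub>0\<close> the subtractions are not truncated, \<open>web_c n\<close> being monotone.\<close>

definition web_pi' :: "nat \<Rightarrow> nat \<Rightarrow> nat \<Rightarrow> nat"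
  where "web_pi' n k\<^sub>0 d = (\<Sum>h=1..k\<^sub>0. d - web_c n h)"

text \<open>The symmetric power \<open>S\<^sup>h\<close> of the cotangent space is realized as the space of homogeneous
  polynomial functions of degree \<open>h\<close> on the tangent space.  The span does not depend on which
  conormal is chosen for each leaf, so all of them are admitted.\<close>

definition web_r ::
    "('m::topological_space, 'n::finite) chart set \<Rightarrow> ('m \<Rightarrow> 'm hyp set) \<Rightarrow> nat \<Rightarrow> 'm \<Rightarrow> nat"
  where "web_r A W h m = cfun.dim ((\<lambda>\<eta>. \<lambda>v. \<eta> v ^ h) ` conormals A W m)"

definition web_S ::
    "('m::topological_space, 'n::finite) chart set \<Rightarrow> ('m \<Rightarrow> 'm hyp set) \<Rightarrow> nat \<Rightarrow> nat \<Rightarrow> 'm set"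
  where "web_S A W k\<^sub>0 d =
    (\<Union>h\<in>{2..k\<^sub>0}. {m \<in> manifold A. web_r A W h m < min d (web_c CARD('n) h)})"

definition regular_point ::
    "('m::topological_space, 'n::finite) chart set \<Rightarrow> 'm set \<Rightarrow> nat \<Rightarrow> 'm \<Rightarrow> bool"
  where "regular_point A S p m \<longleftrightarrow> m \<in> S \<and>
    (\<exists>c I. complex_atlas (insert c A) \<and> m \<in> fst c \<and> fst c \<subseteq> manifold A \<and> card I = p \<and>
       S \<inter> fst c = {x \<in> fst c. \<forall>i. i \<notin> I \<longrightarrow> snd c x $ i = 0})"

text \<open>Dimension of a nonempty analytic subset: the largest dimension at its regular points.\<close>

definition analytic_dim :: "('m::topological_space, 'n::finite) chart set \<Rightarrow> 'm set \<Rightarrow> nat"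
  where "analytic_dim A S = Sup {p. \<exists>m. regular_point A S p m}"

definition ordinary_web ::
    "('m::topological_space, 'n::finite) chart set \<Rightarrow> ('m \<Rightarrow> 'm hyp set) \<Rightarrow> nat \<Rightarrow> nat \<Rightarrow> bool"
  where "ordinary_web A W k\<^sub>0 d \<longleftrightarrow>
    web_S A W k\<^sub>0 d = {} \<or> analytic_dim A (web_S A W k\<^sub>0 d) \<le> CARD('n) - 1"


section \<open>The bundle \<open>A\<close>, its jets, and formal abelian relations\<close>

text \<open>An element \<open>(\<omega>\<^sub>i)\<close> of the fibre of \<open>A\<close> at \<open>m\<close> is indexed by the hyperplanes \<open>T \<in> W m\<close>; it is the
  function sending \<open>(T, v)\<close> to the value at \<open>v\<close> of the covector attached to \<open>T\<close>.\<close>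

definition A_fibre ::
    "('m::topological_space, 'n::finite) chart set \<Rightarrow> ('m \<Rightarrow> 'm hyp set) \<Rightarrow> 'm \<Rightarrow> ('m hyp \<times> 'm tvec \<Rightarrow> complex) set"
  where "A_fibre A W m = {\<omega>.
    (\<forall>T\<in>W m. (\<lambda>v. \<omega> (T, v)) \<in> cotangent_space A m \<and> (\<forall>v\<in>T. \<omega> (T, v) = 0)) \<and>
    (\<forall>T v. T \<notin> W m \<longrightarrow> \<omega> (T, v) = 0) \<and>
    (\<forall>v. (\<Sum>T\<in>W m. \<omega> (T, v)) = 0)}"

definition web_branch ::
    "('m::topological_space, 'n::finite) chart set \<Rightarrow> ('m \<Rightarrow> 'm hyp set) \<Rightarrow> 'm set \<Rightarrow> ('m \<Rightarrow> 'm hyp) \<Rightarrow> bool"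
  where "web_branch A W V F \<longleftrightarrow> hol_foliation A V F \<and> (\<forall>x\<in>V. F x \<in> W x)"

text \<open>A local foliation of the web tangent to \<open>T \<in> W m\<close> at \<open>m\<close>; its germ at \<open>m\<close> is unique.\<close>

definition branch_at ::
    "('m::topological_space, 'n::finite) chart set \<Rightarrow> ('m \<Rightarrow> 'm hyp set) \<Rightarrow> 'm \<Rightarrow> 'm hyp \<Rightarrow> 'm \<Rightarrow> 'm hyp"
  where "branch_at A W m T = (SOME F. \<exists>V. m \<in> V \<and> web_branch A W V F \<and> F m = T)"

abbreviation along ::
    "('m \<Rightarrow> 'm hyp \<times> 'm tvec \<Rightarrow> complex) \<Rightarrow> ('m \<Rightarrow> 'm hyp) \<Rightarrow> 'm \<Rightarrow> 'm covec"
  where "along u F \<equiv> \<lambda>x v. u x (F x, v)"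

definition A_section ::
    "('m::topological_space, 'n::finite) chart set \<Rightarrow> ('m \<Rightarrow> 'm hyp set) \<Rightarrow> 'm set \<Rightarrow>
     ('m \<Rightarrow> 'm hyp \<times> 'm tvec \<Rightarrow> complex) \<Rightarrow> bool"
  where "A_section A W V u \<longleftrightarrow> open V \<and> V \<subseteq> manifold A \<and> (\<forall>x\<in>V. u x \<in> A_fibre A W x) \<and>
    (\<forall>V' F. V' \<subseteq> V \<longrightarrow> web_branch A W V' F \<longrightarrow> hol_one_form A V' (along u F))"

text \<open>The jet of order \<open>q\<close> of a section \<open>u = (\<omega>\<^sub>i)\<close> of \<open>A\<close> at \<open>m\<close> is represented by the partial
  derivatives of order at most \<open>q\<close> (order of \<open>\<alpha>\<close> = \<open>length \<alpha>\<close>), at \<open>m\<close>, of the components of the \<open>\<omega>\<^sub>i\<close>,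
  simultaneously in all charts around \<open>m\<close>.\<close>

type_synonym ('m, 'n) jet = "('m, 'n) chart \<times> 'm hyp \<times> 'n \<times> 'n list \<Rightarrow> complex"

definition jet_A ::
    "('m::topological_space, 'n::finite) chart set \<Rightarrow> ('m \<Rightarrow> 'm hyp set) \<Rightarrow> nat \<Rightarrow> 'm \<Rightarrow>
     ('m \<Rightarrow> 'm hyp \<times> 'm tvec \<Rightarrow> complex) \<Rightarrow> ('m, 'n) jet"
  where "jet_A A W q m u = (\<lambda>(c, T, i, \<alpha>).
    if c \<in> A \<and> m \<in> fst c \<and> T \<in> W m \<and> length \<alpha> \<le> q
    then iter_pderiv \<alpha>
      (\<lambda>z. along u (branch_at A W m T) (chart_inv c z) (coord_vec A c i (chart_inv c z))) (snd c m)
    else 0)"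

text \<open>Fibre and holomorphic sections of \<open>J\<^sup>qA\<close>.\<close>

definition JA_fibre ::
    "('m::topological_space, 'n::finite) chart set \<Rightarrow> ('m \<Rightarrow> 'm hyp set) \<Rightarrow> nat \<Rightarrow> 'm \<Rightarrow> ('m, 'n) jet set"
  where "JA_fibre A W q m = {jet_A A W q m u | u. \<exists>V. m \<in> V \<and> A_section A W V u}"

definition JA_section ::
    "('m::topological_space, 'n::finite) chart set \<Rightarrow> ('m \<Rightarrow> 'm hyp set) \<Rightarrow> nat \<Rightarrow> 'm set \<Rightarrow>
     ('m \<Rightarrow> ('m, 'n) jet) \<Rightarrow> bool"
  where "JA_section A W q V s \<longleftrightarrow> open V \<and> V \<subseteq> manifold A \<and> (\<forall>x\<in>V. s x \<in> JA_fibre A W q x) \<and>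
    (\<forall>V' F. V' \<subseteq> V \<longrightarrow> web_branch A W V' F \<longrightarrow>
       (\<forall>c\<in>A. \<forall>i \<alpha>. hol_on A (\<lambda>x. s x (c, F x, i, \<alpha>)) (V' \<inter> fst c)))"

text \<open>For \<open>u = (\<omega>\<^sub>i)\<close>, the partial derivatives of order less than \<open>q\<close> at \<open>m\<close> of the coefficients of the
  \<open>d\<omega>\<^sub>i\<close>.  For \<open>q = k + 1\<close> this is \<open>j\<^sup>k(d\<omega>\<^sub>i)\<close> at \<open>m\<close>, the image under the prolonged morphism \<open>D\<^sub>k\<close> of the
  jet of \<open>u\<close> of order \<open>k + 1\<close>; for \<open>q = 0\<close> it is always 0.\<close>

definition jet_D ::
    "('m::topological_space, 'n::finite) chart set \<Rightarrow> ('m \<Rightarrow> 'm hyp set) \<Rightarrow> nat \<Rightarrow> 'm \<Rightarrow>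
     ('m \<Rightarrow> 'm hyp \<times> 'm tvec \<Rightarrow> complex) \<Rightarrow>
     ('m, 'n) chart \<times> 'm hyp \<times> 'n \<times> 'n \<times> 'n list \<Rightarrow> complex"
  where "jet_D A W q m u = (\<lambda>(c, T, i, j, \<alpha>).
    if c \<in> A \<and> m \<in> fst c \<and> T \<in> W m \<and> length \<alpha> < q
    then iter_pderiv \<alpha>
      (\<lambda>z. ext_deriv_coeff A c (along u (branch_at A W m T)) i j (chart_inv c z)) (snd c m)
    else 0)"

text \<open>Formal abelian relations at order \<open>q\<close>: the fibre at \<open>m\<close> of \<open>R\<^bsub>q-1\<^esub> = ker D\<^bsub>q-1\<^esub>\<close>; for \<open>q = 0\<close> this is
  \<open>R\<^bsub>-1\<^esub> = J\<^sup>0A = A\<close>.\<close>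

definition formal_relations ::
    "('m::topological_space, 'n::finite) chart set \<Rightarrow> ('m \<Rightarrow> 'm hyp set) \<Rightarrow> nat \<Rightarrow> 'm \<Rightarrow> ('m, 'n) jet set"
  where "formal_relations A W q m =
    {jet_A A W q m u | u. (\<exists>V. m \<in> V \<and> A_section A W V u) \<and> jet_D A W q m u = 0}"

definition abelian_relation ::
    "('m::topological_space, 'n::finite) chart set \<Rightarrow> ('m \<Rightarrow> 'm hyp set) \<Rightarrow> 'm set \<Rightarrow>
     ('m \<Rightarrow> 'm hyp \<times> 'm tvec \<Rightarrow> complex) \<Rightarrow> bool"
  where "abelian_relation A W V u \<longleftrightarrow> A_section A W V u \<and>
    (\<forall>V' F. V' \<subseteq> V \<longrightarrow> web_branch A W V' F \<longrightarrow>
       (\<forall>c\<in>A. \<forall>x\<in>V' \<inter> fst c. \<forall>i j. ext_deriv_coeff A c (along u F) i j x = 0))"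


section \<open>Germs\<close>

definition germ :: "'m::topological_space \<Rightarrow> ('m \<Rightarrow> 'x \<Rightarrow> complex) \<Rightarrow> ('m \<Rightarrow> 'x \<Rightarrow> complex) set"
  where "germ m s = {t. \<forall>\<^sub>F x in nhds m. t x = s x}"

definition germ_add ::
    "'m::topological_space \<Rightarrow> ('m \<Rightarrow> 'x \<Rightarrow> complex) set \<Rightarrow> ('m \<Rightarrow> 'x \<Rightarrow> complex) set \<Rightarrow> ('m \<Rightarrow> 'x \<Rightarrow> complex) set"
  where "germ_add m G H = {t. \<exists>g\<in>G. \<exists>h\<in>H. \<forall>\<^sub>F x in nhds m. t x = g x + h x}"

definition germ_scale ::
    "'m::topological_space \<Rightarrow> complex \<Rightarrow> ('m \<Rightarrow> 'x \<Rightarrow> complex) set \<Rightarrow> ('m \<Rightarrow> 'x \<Rightarrow> complex) set"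
  where "germ_scale m a G = {t. \<exists>g\<in>G. \<forall>\<^sub>F x in nhds m. t x = a *\<^sub>F g x}"

definition germ_iso ::
    "'m::topological_space \<Rightarrow> (('m \<Rightarrow> 'x \<Rightarrow> complex) set \<Rightarrow> ('m \<Rightarrow> 'y \<Rightarrow> complex) set) \<Rightarrow>
     ('m \<Rightarrow> 'x \<Rightarrow> complex) set set \<Rightarrow> ('m \<Rightarrow> 'y \<Rightarrow> complex) set set \<Rightarrow> bool"
  where "germ_iso m \<Phi> X Y \<longleftrightarrow> bij_betw \<Phi> X Y \<and>
    (\<forall>G\<in>X. \<forall>H\<in>X. \<Phi> (germ_add m G H) = germ_add m (\<Phi> G) (\<Phi> H)) \<and>
    (\<forall>G\<in>X. \<forall>a. \<Phi> (germ_scale m a G) = germ_scale m a (\<Phi> G))"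

text \<open>The vector space \<open>X\<close> of germs at \<open>m\<close> has a basis with \<open>r\<close> elements.\<close>

definition germ_dim :: "'m::topological_space \<Rightarrow> ('m \<Rightarrow> 'x \<Rightarrow> complex) set set \<Rightarrow> nat \<Rightarrow> bool"
  where "germ_dim m X r \<longleftrightarrow> (\<exists>b. (\<forall>j<r. germ m (b j) \<in> X) \<and>
    (\<forall>G\<in>X. \<exists>!a. a \<in> {..<r} \<rightarrow>\<^sub>E UNIV \<and> G = germ m (\<lambda>x. \<Sum>j<r. a j *\<^sub>F b j x)))"

definition abelian_germs ::
    "('m::topological_space, 'n::finite) chart set \<Rightarrow> ('m \<Rightarrow> 'm hyp set) \<Rightarrow> 'm \<Rightarrow>
     ('m \<Rightarrow> 'm hyp \<times> 'm tvec \<Rightarrow> complex) set set"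
  where "abelian_germs A W m = {germ m u | u. \<exists>V. m \<in> V \<and> abelian_relation A W V u}"

definition web_has_rank ::
    "('m::topological_space, 'n::finite) chart set \<Rightarrow> ('m \<Rightarrow> 'm hyp set) \<Rightarrow> 'm \<Rightarrow> nat \<Rightarrow> bool"
  where "web_has_rank A W m r \<longleftrightarrow> germ_dim m (abelian_germs A W m) r"


section \<open>Subbundles of \<open>J\<^sup>qA\<close>, connections, curvature\<close>

definition bundle_section ::
    "('m::topological_space, 'n::finite) chart set \<Rightarrow> ('m \<Rightarrow> 'm hyp set) \<Rightarrow> nat \<Rightarrow>
     ('m \<Rightarrow> ('m, 'n) jet set) \<Rightarrow> 'm set \<Rightarrow> ('m \<Rightarrow> ('m, 'n) jet) \<Rightarrow> bool"
  where "bundle_section A W q E V s \<longleftrightarrow> JA_section A W q V s \<and> (\<forall>x\<in>V. s x \<in> E x)"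

text \<open>\<open>E\<close> is, over the open set \<open>U\<close>, a holomorphic vector (sub)bundle of rank \<open>r\<close>: it has local
  holomorphic frames.\<close>

definition hol_bundle ::
    "('m::topological_space, 'n::finite) chart set \<Rightarrow> ('m \<Rightarrow> 'm hyp set) \<Rightarrow> nat \<Rightarrow>
     ('m \<Rightarrow> ('m, 'n) jet set) \<Rightarrow> 'm set \<Rightarrow> nat \<Rightarrow> bool"
  where "hol_bundle A W q E U r \<longleftrightarrow> (\<forall>m\<in>U. \<exists>V e. m \<in> V \<and> V \<subseteq> U \<and>
    (\<forall>j<r. bundle_section A W q E V (e j)) \<and> open V \<and>
    (\<forall>x\<in>V. inj_on (\<lambda>j. e j x) {..<r} \<and> cfun.independent ((\<lambda>j. e j x) ` {..<r}) \<and>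
       cfun.span ((\<lambda>j. e j x) ` {..<r}) = E x))"

text \<open>\<open>nabla m v s\<close> is the covariant derivative at \<open>m\<close> of the local section \<open>s\<close> along the tangent vector
  \<open>v\<close> at \<open>m\<close>.\<close>

type_synonym ('m, 'n) connection = "'m \<Rightarrow> 'm tvec \<Rightarrow> ('m \<Rightarrow> ('m, 'n) jet) \<Rightarrow> ('m, 'n) jet"

definition hol_connection ::
    "('m::topological_space, 'n::finite) chart set \<Rightarrow> ('m \<Rightarrow> 'm hyp set) \<Rightarrow> nat \<Rightarrow>
     ('m \<Rightarrow> ('m, 'n) jet set) \<Rightarrow> 'm set \<Rightarrow> ('m, 'n) connection \<Rightarrow> bool"
  where "hol_connection A W q E U nabla \<longleftrightarrow>
    (\<forall>V \<subseteq> U. \<forall>s. bundle_section A W q E V s \<longrightarrow>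
       (\<forall>m\<in>V. \<forall>v\<in>tangent_space A m. nabla m v s \<in> E m) \<and>
       (\<forall>m\<in>V. \<forall>v\<in>tangent_space A m. \<forall>w\<in>tangent_space A m. \<forall>a.
          nabla m (v + a *\<^sub>F w) s = nabla m v s + a *\<^sub>F nabla m w s) \<and>
       (\<forall>t. \<forall>m\<in>V. \<forall>v\<in>tangent_space A m. t \<in> germ m s \<longrightarrow> nabla m v t = nabla m v s) \<and>
       (\<forall>t. bundle_section A W q E V t \<longrightarrow> (\<forall>m\<in>V. \<forall>v\<in>tangent_space A m.
          nabla m v (\<lambda>x. s x + t x) = nabla m v s + nabla m v t)) \<and>
       (\<forall>f. hol_on A f V \<longrightarrow> (\<forall>m\<in>V. \<forall>v\<in>tangent_space A m.
          nabla m v (\<lambda>x. f x *\<^sub>F s x) = v f *\<^sub>F s m + f m *\<^sub>F nabla m v s)) \<and>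
       (\<forall>X. hol_vector_field A V X \<longrightarrow> bundle_section A W q E V (\<lambda>x. nabla x (X x) s)))"

definition flat_germs ::
    "('m::topological_space, 'n::finite) chart set \<Rightarrow> ('m \<Rightarrow> 'm hyp set) \<Rightarrow> nat \<Rightarrow>
     ('m \<Rightarrow> ('m, 'n) jet set) \<Rightarrow> 'm set \<Rightarrow> ('m, 'n) connection \<Rightarrow> 'm \<Rightarrow> ('m \<Rightarrow> ('m, 'n) jet) set set"
  where "flat_germs A W q E U nabla m = {germ m s | s. \<exists>V. m \<in> V \<and> V \<subseteq> U \<and>
    bundle_section A W q E V s \<and> (\<forall>x\<in>V. \<forall>v\<in>tangent_space A x. nabla x v s = 0)}"

definition curvature ::
    "('m::topological_space, 'n::finite) chart set \<Rightarrow> ('m, 'n) connection \<Rightarrow>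
     ('m \<Rightarrow> 'm tvec) \<Rightarrow> ('m \<Rightarrow> 'm tvec) \<Rightarrow> ('m \<Rightarrow> ('m, 'n) jet) \<Rightarrow> 'm \<Rightarrow> ('m, 'n) jet"
  where "curvature A nabla X Y s x =
    nabla x (X x) (\<lambda>y. nabla y (Y y) s) - nabla x (Y x) (\<lambda>y. nabla y (X y) s) - nabla x (lie_bracket A X Y x) s"

definition curvature_vanishes_on ::
    "('m::topological_space, 'n::finite) chart set \<Rightarrow> ('m \<Rightarrow> 'm hyp set) \<Rightarrow> nat \<Rightarrow>
     ('m \<Rightarrow> ('m, 'n) jet set) \<Rightarrow> ('m, 'n) connection \<Rightarrow> 'm set \<Rightarrow> bool"
  where "curvature_vanishes_on A W q E nabla V \<longleftrightarrow> (\<forall>V' \<subseteq> V. \<forall>X Y s.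
    hol_vector_field A V' X \<longrightarrow> hol_vector_field A V' Y \<longrightarrow> bundle_section A W q E V' s \<longrightarrow>
    (\<forall>x\<in>V'. curvature A nabla X Y s x = 0))"

end

theory Submission
  imports Defs "HOL-Complex_Analysis.Cauchy_Integral_Formula"
begin

text \<open>
  Near a point of \<open>M\<^sub>0 - S\<close> choose first integrals \<open>f\<^sub>i\<close> of the foliations.  A formally closed form along the
  \<open>i\<close>-th foliation is, to finite order, \<open>d(F\<^sub>i \<circ> f\<^sub>i)\<close>, so a formal abelian relation at order \<open>p\<close> is given by the
  derivatives \<open>w\<^sub>i\<^sub>j\<close>, \<open>1 \<le> j \<le> p + 1\<close>, of the \<open>F\<^sub>i\<close> at \<open>f\<^sub>i(x)\<close>, subject to the vanishing of the derivatives of orders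
  \<open>1, ..., p + 1\<close> of the sum of the \<open>F\<^sub>i \<circ> f\<^sub>i\<close>.  By the formula of Faa di Bruno the equations of order \<open>s\<close> involve
  the \<open>w\<^sub>i\<^sub>s\<close> through the \<open>s\<close>-th symmetric powers of the \<open>df\<^sub>i\<close>, which span off \<open>S\<close>.  Hence the equations of order
  less than \<open>k\<^sub>0\<close> are independent, which gives the rank \<open>\<pi>'(n, d)\<close>, while for \<open>d = c(n, k\<^sub>0)\<close> those of order \<open>k\<^sub>0\<close> determine
  the \<open>w\<^sub>i\<^sub>s\<close> with \<open>s = k\<^sub>0\<close>: every formal relation at order \<open>k\<^sub>0 - 2\<close> extends uniquely to order \<open>k\<^sub>0 - 1\<close>.

  The connection measures how far a section is from being the jet of its extension; in coordinates
  it is \<open>dw\<^sub>i\<^sub>j - w\<^sub>i\<^sub>,\<^sub>j\<^sub>+\<^sub>1 df\<^sub>i\<close>.  So the flat sections are the jets of abelian relations, with components \<open>w\<^sub>i\<^sub>1 df\<^sub>i\<close>.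
  A flat section is determined by its value at one point, so if the rank is \<open>\<pi>'(n, d)\<close>, the jets of a basis of
  abelian relations form a flat frame, and the curvature is zero.
\<close>

section \<open>Holomorphic functions of several variables\<close>

text \<open>Two levels of exactness have to be reconciled. A solution w of the finite system gives
  polynomials in the first integrals whose differentials have sum zero at x only up to finite order,
  whereas a jet in the bundle must come from a section whose components have sum zero identically
  near x. The error is removed by a holomorphic right inverse of the symbol of order one, which weak
  general position provides; the correction vanishes to so high an order that the jet does not
  change.

  The unknowns w refer to the first integrals alone. They therefore describe a jet in all charts at
  once, although jets are recorded chart by chart. Jets of order k0 - 2 involve the derivatives of
  orders 1 to k0 - 1, and the summand h = k0 of \<pi>' is zero, so the equations of orders below k0
  already account for the whole rank.

  The covariant derivative is defined without a preferred chart or numbering of the foliations, so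
  nothing has to be glued. Uniqueness of flat sections rests on Taylor coefficients and the identity
  theorem; the differential system is never integrated.\<close>

definition cdiff_at :: "(complex^'n \<Rightarrow> complex) \<Rightarrow> complex^'n \<Rightarrow> bool"
  where "cdiff_at f z \<longleftrightarrow> (\<exists>L. (f has_derivative L) (at z) \<and> (\<forall>a v. L (a *s v) = a * L v))"

lemma holomorphic_several_iff:
  "holomorphic_several f U \<longleftrightarrow> open U \<and> (\<forall>z\<in>U. cdiff_at f z)"
  by (simp add: holomorphic_several_def cdiff_at_def)

lemma norm_smult_vec: "norm (x *s (v::complex^'n)) = cmod x * norm v"
  unfolding norm_vec_def
  by (simp add: norm_mult L2_set_def power_mult_distrib sum_distrib_left[symmetric] real_sqrt_mult)

lemma bounded_linear_smult_vec: "bounded_linear (\<lambda>t::complex. t *s (v :: complex^'n))"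
proof (rule bounded_linear_intro)
  show "(x + y) *s v = x *s v + y *s v" for x y by (simp add: vec_eq_iff algebra_simps)
  show "(r *\<^sub>R x) *s v = r *\<^sub>R (x *s v)" for r x by (simp add: vec_eq_iff)
  show "norm (x *s v) \<le> norm x * norm v" for x by (simp add: norm_smult_vec)
qed

lemma cdiff_at_line:
  fixes f :: "complex^'n \<Rightarrow> complex"
  assumes "(f has_derivative L) (at (z + t0 *s v))" "\<forall>a v. L (a *s v) = a * L v"
  shows "((\<lambda>t. f (z + t *s v)) has_field_derivative L v) (at t0)"
proof -
  have "((\<lambda>t. z + t *s v) has_derivative (\<lambda>h. h *s v)) (at t0)"
    by (auto intro!: derivative_eq_intros bounded_linear_imp_has_derivative bounded_linear_smult_vec)
  from has_derivative_compose[OF this assms(1)]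
  have "((\<lambda>t. f (z + t *s v)) has_derivative (\<lambda>h. L (h *s v))) (at t0)" .
  moreover have "(\<lambda>h. L (h *s v)) = (*) (L v)" using assms(2) by auto
  ultimately show ?thesis by (simp add: has_field_derivative_def)
qed

lemma pderiv_dir_eq:
  assumes "(f has_derivative L) (at z)" "\<forall>a v. L (a *s v) = a * L v"
  shows "pderiv_dir i f z = L (axis i 1)"
  using cdiff_at_line[of f L z 0 "axis i 1"] assms unfolding pderiv_dir_def
  by (auto intro: DERIV_imp_deriv)

lemma vec_sum_axis: "(v :: complex^'n) = (\<Sum>i\<in>UNIV. (v $ i) *s axis i 1)"
  by (simp add: vec_eq_iff axis_def if_distrib if_distribR sum.If_cases cong: if_cong)

text \<open>Complex linearity pins the derivative down by its values on the standard basis. Together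
  with \<open>cdiff_atI\<close>, every later rule becomes a matter of exhibiting one real Frechet
  derivative, from which differentiability and partial derivatives are read off together.\<close>

lemma cdiff_at_derivative:
  assumes "cdiff_at f z"
  shows "(f has_derivative (\<lambda>v. \<Sum>i\<in>UNIV. v $ i * pderiv_dir i f z)) (at z)"
proof -
  obtain L where L: "(f has_derivative L) (at z)" "\<forall>a v. L (a *s v) = a * L v"
    using assms by (auto simp: cdiff_at_def)
  have lin: "linear L" using L(1) has_derivative_linear by blast
  have "L v = (\<Sum>i\<in>UNIV. v $ i * pderiv_dir i f z)" for v
  proof -
    have "L v = L (\<Sum>i\<in>UNIV. (v $ i) *s axis i 1)" using vec_sum_axis[of v] by simp
    also have "\<dots> = (\<Sum>i\<in>UNIV. L ((v $ i) *s axis i 1))" using linear_sum[OF lin] .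
    also have "\<dots> = (\<Sum>i\<in>UNIV. v $ i * pderiv_dir i f z)" using L pderiv_dir_eq[OF L] by simp
    finally show ?thesis .
  qed
  hence "L = (\<lambda>v. \<Sum>i\<in>UNIV. v $ i * pderiv_dir i f z)" by auto
  thus ?thesis using L(1) by simp
qed

lemma cdiff_atI:
  assumes "(f has_derivative (\<lambda>v. \<Sum>i\<in>UNIV. v $ i * p i)) (at z)"
  shows "cdiff_at f z" and "pderiv_dir i f z = p i"
proof -
  have c: "\<forall>a v. (\<Sum>i\<in>UNIV. (a *s v) $ i * p i) = a * (\<Sum>i\<in>UNIV. v $ i * p i)"
    by (simp add: sum_distrib_left mult.assoc)
  show "cdiff_at f z" using assms c unfolding cdiff_at_def by blast
  have "pderiv_dir i f z = (\<Sum>k\<in>UNIV. (axis i 1 :: complex^'a) $ k * p k)"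
    by (rule pderiv_dir_eq[OF assms c])
  also have "\<dots> = p i" by (simp add: axis_def if_distrib if_distribR sum.If_cases cong: if_cong)
  finally show "pderiv_dir i f z = p i" .
qed

lemma cdiff_at_isCont: "cdiff_at f z \<Longrightarrow> isCont f z"
  using cdiff_at_derivative has_derivative_continuous by blast

lemma cdiff_at_cong:
  assumes "\<forall>\<^sub>F y in nhds z. f y = g y"
  shows "cdiff_at f z \<longleftrightarrow> cdiff_at g z"
proof -
  have "f z = g z" "\<forall>\<^sub>F y in at z. f y = g y"
    using assms eventually_nhds_x_imp_x by (auto simp: eventually_at_filter elim: eventually_mono)
  hence "(f has_derivative L) (at z) \<longleftrightarrow> (g has_derivative L) (at z)" for L
    by (metis (mono_tags, lifting) UNIV_I eventually_mono has_derivative_transform_eventually)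
  thus ?thesis by (simp add: cdiff_at_def)
qed

lemma pderiv_dir_cong:
  assumes "\<forall>\<^sub>F y in nhds z. f y = g y"
  shows "pderiv_dir i f z = pderiv_dir i g z"
  unfolding pderiv_dir_def
proof (rule deriv_cong_ev)
  have "((\<lambda>t. z + t *s axis i 1) \<longlongrightarrow> z + 0 *s axis i 1) (nhds (0::complex))"
    by (intro tendsto_intros bounded_linear.tendsto[OF bounded_linear_smult_vec] filterlim_ident)
  hence "filterlim (\<lambda>t. z + t *s axis i 1) (nhds z) (nhds (0::complex))" by simp
  from filterlim_compose[OF _ this, unfolded filterlim_iff] assms
  show "\<forall>\<^sub>F t in nhds 0. f (z + t *s axis i 1) = g (z + t *s axis i 1)"
    using \<open>filterlim _ (nhds z) (nhds 0)\<close> by (auto simp: filterlim_iff)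
qed simp

lemma cdiff_at_const [simp]: "cdiff_at (\<lambda>z. c) z" "pderiv_dir i (\<lambda>z. c) z = 0"
  using cdiff_atI[of "\<lambda>z. c" "\<lambda>i. 0" z] by auto

lemma cdiff_at_coord: "cdiff_at (\<lambda>z::complex^'n. z $ k) z" "pderiv_dir i (\<lambda>z::complex^'n. z $ k) z = (if i = k then 1 else 0)"
proof -
  have "((\<lambda>z::complex^'n. z $ k) has_derivative (\<lambda>v. v $ k)) (at z)"
    by (auto intro!: derivative_eq_intros bounded_linear_imp_has_derivative bounded_linear_vec_nth)
  moreover have "(\<lambda>v::complex^'n. v $ k) = (\<lambda>v. \<Sum>i\<in>UNIV. v $ i * (if i = k then 1 else 0))"
    by (simp add: if_distrib if_distribR sum.If_cases fun_eq_iff cong: if_cong)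
  ultimately have h: "((\<lambda>z::complex^'n. z $ k) has_derivative (\<lambda>v. \<Sum>i\<in>UNIV. v $ i * (if i = k then 1 else 0))) (at z)"
    by simp
  show "cdiff_at (\<lambda>z::complex^'n. z $ k) z" "pderiv_dir i (\<lambda>z::complex^'n. z $ k) z = (if i = k then 1 else 0)"
    by (rule cdiff_atI[OF h])+
qed

lemma cdiff_at_add:
  assumes "cdiff_at f z" "cdiff_at g z"
  shows "cdiff_at (\<lambda>z. f z + g z) z" "pderiv_dir i (\<lambda>z. f z + g z) z = pderiv_dir i f z + pderiv_dir i g z"
proof -
  have h: "((\<lambda>z. f z + g z) has_derivative (\<lambda>v. \<Sum>i\<in>UNIV. v $ i * (pderiv_dir i f z + pderiv_dir i g z))) (at z)"
    by (rule has_derivative_eq_rhs[OF has_derivative_add[OF assms[THEN cdiff_at_derivative]]])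
      (simp add: sum.distrib algebra_simps)
  show "cdiff_at (\<lambda>z. f z + g z) z" "pderiv_dir i (\<lambda>z. f z + g z) z = pderiv_dir i f z + pderiv_dir i g z"
    by (rule cdiff_atI[OF h])+
qed

lemma cdiff_at_mult:
  assumes "cdiff_at f z" "cdiff_at g z"
  shows "cdiff_at (\<lambda>z. f z * g z) z" "pderiv_dir i (\<lambda>z. f z * g z) z = pderiv_dir i f z * g z + f z * pderiv_dir i g z"
proof -
  have h: "((\<lambda>z. f z * g z) has_derivative (\<lambda>v. \<Sum>i\<in>UNIV. v $ i * (pderiv_dir i f z * g z + f z * pderiv_dir i g z))) (at z)"
    by (rule has_derivative_eq_rhs[OF has_derivative_mult[OF assms[THEN cdiff_at_derivative]]])
      (simp add: sum.distrib algebra_simps sum_distrib_left)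
  show "cdiff_at (\<lambda>z. f z * g z) z" "pderiv_dir i (\<lambda>z. f z * g z) z = pderiv_dir i f z * g z + f z * pderiv_dir i g z"
    by (rule cdiff_atI[OF h])+
qed

lemma cdiff_at_inverse:
  assumes "cdiff_at f z" "f z \<noteq> 0"
  shows "cdiff_at (\<lambda>z. inverse (f z)) z"
proof -
  have h: "((\<lambda>z. inverse (f z)) has_derivative (\<lambda>v. \<Sum>i\<in>UNIV. v $ i * (- inverse (f z) * pderiv_dir i f z * inverse (f z)))) (at z)"
    by (rule has_derivative_eq_rhs[OF Deriv.has_derivative_inverse[OF assms(2) assms(1)[THEN cdiff_at_derivative]]])
      (simp add: algebra_simps sum_distrib_left sum_distrib_right sum_negf)
  show ?thesis by (rule cdiff_atI[OF h])
qed

lemma has_derivative_vec_nthI: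
  fixes \<phi> :: "'a::real_normed_vector \<Rightarrow> complex^'n"
  assumes "\<And>k. ((\<lambda>z. \<phi> z $ k) has_derivative (\<lambda>v. L v $ k)) F"
  shows "(\<phi> has_derivative L) F"
proof -
  have "((\<lambda>z. \<Sum>k\<in>UNIV. (\<phi> z $ k) *s axis k 1) has_derivative (\<lambda>v. \<Sum>k\<in>UNIV. (L v $ k) *s axis k 1)) F"
    by (intro has_derivative_sum bounded_linear.has_derivative[OF bounded_linear_smult_vec] assms)
  thus ?thesis by (simp add: vec_sum_axis[symmetric])
qed

lemma cdiff_at_compose:
  fixes \<phi> :: "complex^'k \<Rightarrow> complex^'n"
  assumes "cdiff_at f (\<phi> z)" "\<And>k. cdiff_at (\<lambda>z. \<phi> z $ k) z"
  shows "cdiff_at (\<lambda>z. f (\<phi> z)) z"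
    "pderiv_dir i (\<lambda>z. f (\<phi> z)) z = (\<Sum>k\<in>UNIV. pderiv_dir k f (\<phi> z) * pderiv_dir i (\<lambda>z. \<phi> z $ k) z)"
proof -
  have "(\<phi> has_derivative (\<lambda>v. \<chi> k. \<Sum>i\<in>UNIV. v $ i * pderiv_dir i (\<lambda>z. \<phi> z $ k) z)) (at z)"
    by (rule has_derivative_vec_nthI) (simp add: cdiff_at_derivative assms(2))
  from has_derivative_compose[OF this cdiff_at_derivative[OF assms(1)]]
  have h: "((\<lambda>z. f (\<phi> z)) has_derivative (\<lambda>v. \<Sum>i\<in>UNIV. v $ i * (\<Sum>k\<in>UNIV. pderiv_dir k f (\<phi> z) * pderiv_dir i (\<lambda>z. \<phi> z $ k) z))) (at z)"
    by (rule has_derivative_eq_rhs)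
      (simp add: sum_distrib_left sum_distrib_right fun_eq_iff, subst sum.swap, simp add: algebra_simps)
  show "cdiff_at (\<lambda>z. f (\<phi> z)) z"
    "pderiv_dir i (\<lambda>z. f (\<phi> z)) z = (\<Sum>k\<in>UNIV. pderiv_dir k f (\<phi> z) * pderiv_dir i (\<lambda>z. \<phi> z $ k) z)"
    by (rule cdiff_atI[OF h])+
qed


text \<open>Cauchy's formula on a disc in the i-th coordinate direction. The circle is parametrised
  over the unit interval, so that the right-hand side is an ordinary integral with parameter z, to
  which continuity and differentiation under the integral sign apply.\<close>

lemma pderiv_dir_circle:
  assumes "r > 0" "\<And>\<zeta>. norm \<zeta> \<le> r \<Longrightarrow> cdiff_at f (z + \<zeta> *s axis i 1)"
  shows "pderiv_dir i f z = integral (cbox 0 1)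
    (\<lambda>t::real. f (z + (r * exp (2 * pi * \<i> * t)) *s axis i 1) * (1 / (r * exp (2 * pi * \<i> * t))))"
proof -
  define h where "h = (\<lambda>t. f (z + t *s axis i 1))"
  have d: "(h has_field_derivative pderiv_dir i f (z + \<zeta> *s axis i 1)) (at \<zeta>)" if n: "norm \<zeta> \<le> r" for \<zeta> :: complex
  proof -
    obtain L where L: "(f has_derivative L) (at (z + \<zeta> *s axis i 1))" "\<forall>a v. L (a *s v) = a * L v"
      using assms(2)[OF n] by (auto simp: cdiff_at_def)
    show ?thesis using cdiff_at_line[OF L] pderiv_dir_eq[OF L] by (simp add: h_def)
  qed
  have c: "continuous_on (cball 0 r) h"
    using d by (intro DERIV_continuous_on) (auto intro: has_field_derivative_at_within)
  have o: "h holomorphic_on ball 0 r"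
    unfolding holomorphic_on_open[OF open_ball] using d by (meson less_imp_le mem_ball_0)
  have "pderiv_dir i f z = deriv h 0" by (simp add: pderiv_dir_def h_def)
  also have "\<dots> = (1 / (2 * of_real pi * \<i>) * contour_integral (circlepath 0 r) (\<lambda>u. h u / (u-0)^2))"
    by (rule DERIV_imp_deriv, rule Cauchy_derivative_integral_circlepath(2)[OF c o]) (use assms in auto)
  \<comment> \<open>The velocity of the circle is 2 pi i times the radius vector; the radius vector
    cancels one power of the denominator, the constant cancels in the next step.\<close>
  also have "\<dots> = 1 / (2 * of_real pi * \<i>) * integral (cbox 0 1) (\<lambda>t::real. (2 * of_real pi * \<i>) *
      (h (r * exp (2 * pi * \<i> * t)) * (1 / (r * exp (2 * pi * \<i> * t)))))"
    using assms(1) unfolding contour_integral_integral vector_derivative_circlepath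
    by (simp add: circlepath power2_eq_square field_simps)
  also have "\<dots> = integral (cbox 0 1) (\<lambda>t::real. h (r * exp (2 * pi * \<i> * t)) * (1 / (r * exp (2 * pi * \<i> * t))))"
    by (subst integral_mult_right) simp
  finally show ?thesis by (simp add: h_def)
qed

text \<open>Holomorphy is defined by complex differentiability at each point only, so regularity of
  the partial derivatives has to be earned. Cauchy's formula writes them as integrals over circles,
  which yields continuity and then, by differentiation under the integral sign, differentiability.
  The second claim keeps the resulting mixed derivative as an integral; it is the source of the
  symmetry of second derivatives.\<close>

lemma pderiv_dir_holomorphic:
  fixes f :: "complex^'n \<Rightarrow> complex"
  assumes U: "open U" "\<And>z. z \<in> U \<Longrightarrow> cdiff_at f z"
  shows "\<And>z. z \<in> U \<Longrightarrow> cdiff_at (pderiv_dir i f) z"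
    and "\<And>z k r. r > 0 \<Longrightarrow> ball z (2*r) \<subseteq> U \<Longrightarrow> pderiv_dir k (pderiv_dir i f) z = integral (cbox 0 1)
      (\<lambda>t::real. pderiv_dir k f (z + (r * exp (2 * pi * \<i> * t)) *s axis i 1) * (1 / (r * exp (2 * pi * \<i> * t))))"
proof -
  define \<gamma> where "\<gamma> r t = of_real r * exp (2 * pi * \<i> * of_real t)" for r t :: real
  have n\<gamma>: "norm (\<gamma> r t) = \<bar>r\<bar>" for r t by (simp add: \<gamma>_def norm_mult)
  have n0: "\<gamma> r t \<noteq> 0" if "r > 0" for r t using that by (simp add: \<gamma>_def)
  have c\<gamma>: "continuous_on X (\<lambda>p::(complex^'n) \<times> real. \<gamma> r (snd p))" for X r
    unfolding \<gamma>_def by (intro continuous_intros)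
  have cf: "continuous_on U f"
    using cdiff_at_isCont U(2) continuous_at_imp_continuous_on by blast
  \<comment> \<open>Radius 2r leaves room for a base point within r of z and a circle of radius r
    around it.\<close>
  have near: "x + \<zeta> *s axis j 1 \<in> U" if "ball z (2*r) \<subseteq> U" "x \<in> ball z r" "norm \<zeta> \<le> r" for x z r and \<zeta> :: complex and j :: 'n
  proof -
    have "dist z (x + \<zeta> *s axis j 1) \<le> dist z x + dist x (x + \<zeta> *s axis j 1)" by (rule dist_triangle)
    also have "\<dots> < 2 * r" using that(2,3) by (simp add: dist_norm norm_smult_vec)
    finally show ?thesis using that(1) by auto
  qed
  have circ: "pderiv_dir j g x = integral (cbox 0 1) (\<lambda>t. g (x + \<gamma> r t *s axis j 1) * (1 / \<gamma> r t))"
    if "r > 0" "ball z (2*r) \<subseteq> U" "x \<in> ball z r" "\<And>z. z \<in> U \<Longrightarrow> cdiff_at g z" for x z r j g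
    unfolding \<gamma>_def by (rule pderiv_dir_circle) (use that near in auto)
  have tc: "continuous_on (ball z r \<times> cbox 0 1) (\<lambda>(x,t). g (x + \<gamma> r t *s axis j 1) * (1 / \<gamma> r t))"
    if "r > 0" "ball z (2*r) \<subseteq> U" "continuous_on U g" for z r g and j :: 'n
  proof -
    let ?X = "ball z r \<times> cbox 0 (1::real)"
    have c1: "continuous_on ?X (\<lambda>p. fst p + \<gamma> r (snd p) *s axis j 1)"
      by (intro continuous_on_add continuous_on_fst continuous_on_id
          bounded_linear.continuous_on[OF bounded_linear_smult_vec] c\<gamma>)
    have c2: "continuous_on ?X (\<lambda>p. g (fst p + \<gamma> r (snd p) *s axis j 1))"
    proof (rule continuous_on_compose2[OF that(3) c1], rule image_subsetI)
      fix p assume "p \<in> ?X"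
      thus "fst p + \<gamma> r (snd p) *s axis j 1 \<in> U"
        using near[OF that(2), of "fst p" "\<gamma> r (snd p)" j] n\<gamma> that(1) by (simp add: mem_Times_iff)
    qed
    have c3: "continuous_on ?X (\<lambda>p. 1 / \<gamma> r (snd p))"
      by (intro continuous_on_divide continuous_on_const c\<gamma>) (simp add: n0[OF that(1)])
    show ?thesis unfolding split_beta by (rule continuous_on_mult[OF c2 c3])
  qed
  have ball: "\<exists>r>0. ball z (2*r) \<subseteq> U" if z: "z \<in> U" for z
  proof -
    obtain e where "e > 0" "ball z e \<subseteq> U" using U(1) z by (meson open_contains_ball)
    hence "e/2 > 0 \<and> ball z (2*(e/2)) \<subseteq> U" by simp
    thus ?thesis by blast
  qed
  \<comment> \<open>Continuity of all partial derivatives has to come before differentiation under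
    the integral sign, because the derivative of the integrand contains them.\<close>
  have cp: "continuous_on U (pderiv_dir j f)" for j
  proof (rule continuous_at_imp_continuous_on, rule ballI)
    fix z assume "z \<in> U"
    then obtain r where r: "r > 0" "ball z (2*r) \<subseteq> U" using ball by blast
    have "continuous_on (ball z r) (\<lambda>x. integral (cbox 0 1) (\<lambda>t. f (x + \<gamma> r t *s axis j 1) * (1 / \<gamma> r t)))"
      by (rule integral_continuous_on_param) (rule tc[OF r cf])
    moreover have "\<And>x. x \<in> ball z r \<Longrightarrow> pderiv_dir j f x = integral (cbox 0 1) (\<lambda>t. f (x + \<gamma> r t *s axis j 1) * (1 / \<gamma> r t))"
      by (rule circ[OF r _ U(2)])
    ultimately have "continuous_on (ball z r) (pderiv_dir j f)"
      by (subst continuous_on_cong[OF refl]) 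
    thus "isCont (pderiv_dir j f) z" using r(1) by (simp add: continuous_on_eq_continuous_at)
  qed
  define P where "P r z k = integral (cbox 0 1) (\<lambda>t. pderiv_dir k f (z + \<gamma> r t *s axis i 1) * (1 / \<gamma> r t))" for r z k
  have main: "(pderiv_dir i f has_derivative (\<lambda>v. \<Sum>k\<in>UNIV. v $ k * P r z k)) (at z)"
    if r: "r > 0" "ball z (2*r) \<subseteq> U" for z r
  proof -
    have zb: "z \<in> ball z r" using r(1) by simp
    define F where "F x t v = (\<Sum>k\<in>UNIV. v $ k * pderiv_dir k f (x + \<gamma> r t *s axis i 1)) * (1 / \<gamma> r t)" for x t v
    \<comment> \<open>The derivative of the integrand as a bounded linear map, the type in which
      \<open>leibniz_rule\<close> expects it; its continuity in the parameters is checked vector by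
      vector.\<close>
    define fx where "fx x t = Blinfun (F x t)" for x t
    have hd: "((\<lambda>x. f (x + \<gamma> r t *s axis i 1) * (1 / \<gamma> r t)) has_derivative F x t) (at x)" if "x \<in> ball z r" for x t
    proof -
      have "cdiff_at f (x + \<gamma> r t *s axis i 1)"
        by (rule U(2), rule near[OF r(2) that]) (simp add: n\<gamma> r(1) less_imp_le)
      from cdiff_at_derivative[OF this]
      have "((\<lambda>x. f (x + \<gamma> r t *s axis i 1)) has_derivative (\<lambda>v. \<Sum>k\<in>UNIV. v $ k * pderiv_dir k f (x + \<gamma> r t *s axis i 1))) (at x)"
        by (rule has_derivative_compose[rotated])
          (rule has_derivative_eq_rhs[OF has_derivative_add[OF has_derivative_ident has_derivative_const]], simp)
      from has_derivative_mult_left[OF this, of "1 / \<gamma> r t"] show ?thesis unfolding F_def .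
    qed
    have fxF: "blinfun_apply (fx x t) = F x t" if "x \<in> ball z r" for x t
      unfolding fx_def by (rule bounded_linear_Blinfun_apply) (rule has_derivative_bounded_linear[OF hd[OF that]])
    have "continuous_on (ball z r \<times> cbox 0 1) (\<lambda>p. blinfun_apply (case p of (x,t) \<Rightarrow> fx x t) v)" for v
    proof -
      have "continuous_on (ball z r \<times> cbox 0 1) (\<lambda>(x,t). F x t v)"
        unfolding F_def sum_distrib_right split_beta mult.assoc
        by (intro continuous_intros tc[OF r cp, unfolded split_beta])
      moreover have "(case p of (x,t) \<Rightarrow> F x t v) = blinfun_apply (case p of (x,t) \<Rightarrow> fx x t) v"
        if "p \<in> ball z r \<times> cbox 0 1" for p
        using fxF[of "fst p" "snd p"] that by (simp add: mem_Times_iff split_beta)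
      ultimately show ?thesis by (rule continuous_on_eq)
    qed
    hence cfx: "continuous_on (ball z r \<times> cbox 0 1) (\<lambda>(x,t). fx x t)"
      by (intro continuous_on_blinfun_componentwise)
    have int: "(\<lambda>t. g (x + \<gamma> r t *s axis i 1) * (1 / \<gamma> r t)) integrable_on cbox 0 1"
      if "x \<in> ball z r" "continuous_on U g" for x g
    proof (rule integrable_continuous)
      have "continuous_on (cbox 0 1) (\<lambda>t. (\<lambda>(x,t). g (x + \<gamma> r t *s axis i 1) * (1 / \<gamma> r t)) (x, t))"
        by (rule continuous_on_compose2[OF tc[OF r that(2)]]) (use that in \<open>auto intro!: continuous_intros\<close>)
      thus "continuous_on (cbox 0 1) (\<lambda>t. g (x + \<gamma> r t *s axis i 1) * (1 / \<gamma> r t))" by simp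
    qed
    have "((\<lambda>x. integral (cbox 0 1) (\<lambda>t. f (x + \<gamma> r t *s axis i 1) * (1 / \<gamma> r t))) has_derivative
        integral (cbox 0 1) (fx z)) (at z within ball z r)"
    proof (rule leibniz_rule[OF _ _ cfx])
      fix x t assume "x \<in> ball z r"
      thus "((\<lambda>x. f (x + \<gamma> r t *s axis i 1) * (1 / \<gamma> r t)) has_derivative blinfun_apply (fx x t)) (at x within ball z r)"
        using hd fxF has_derivative_at_withinI by metis
      show "(\<lambda>t. f (x + \<gamma> r t *s axis i 1) * (1 / \<gamma> r t)) integrable_on cbox 0 1"
        by (rule int[OF _ cf]) fact
    qed (rule zb, rule convex_ball)
    hence "((\<lambda>x. integral (cbox 0 1) (\<lambda>t. f (x + \<gamma> r t *s axis i 1) * (1 / \<gamma> r t))) has_derivative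
        integral (cbox 0 1) (fx z)) (at z)"
      by (simp only: at_within_open[OF zb open_ball])
    hence "(pderiv_dir i f has_derivative integral (cbox 0 1) (fx z)) (at z)"
      by (rule has_derivative_transform_within_open[OF _ open_ball zb]) (rule circ[OF r _ U(2), symmetric])
    moreover have "blinfun_apply (integral (cbox 0 1) (fx z)) v = (\<Sum>k\<in>UNIV. v $ k * P r z k)" for v
    proof -
      have "continuous_on (cbox 0 1) (\<lambda>t. (\<lambda>(x,t). fx x t) (z, t))"
        by (rule continuous_on_compose2[OF cfx]) (use r in \<open>auto intro!: continuous_intros\<close>)
      hence "fx z integrable_on cbox 0 1" by (intro integrable_continuous) auto
      from integral_linear[OF this blinfun.bounded_linear_left[of v]]
      have "blinfun_apply (integral (cbox 0 1) (fx z)) v = integral (cbox 0 1) (\<lambda>t. F z t v)"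
        using r(1) by (simp add: o_def fxF)
      also have "\<dots> = integral (cbox 0 1) (\<lambda>t. \<Sum>k\<in>UNIV. v $ k * (pderiv_dir k f (z + \<gamma> r t *s axis i 1) * (1 / \<gamma> r t)))"
        by (simp only: F_def sum_distrib_right mult.assoc)
      also have "\<dots> = (\<Sum>k\<in>UNIV. v $ k * P r z k)"
        unfolding P_def
        by (subst integral_sum, simp, rule integrable_on_mult_right[OF int[OF zb cp]])
          (rule sum.cong[OF refl integral_mult_right])
      finally show ?thesis .
    qed
    hence "blinfun_apply (integral (cbox 0 1) (fx z)) = (\<lambda>v. \<Sum>k\<in>UNIV. v $ k * P r z k)" by blast
    ultimately show ?thesis by simp
  qed
  show cd: "cdiff_at (pderiv_dir i f) z" if "z \<in> U" for z
    using ball[OF that] cdiff_atI(1)[OF main] by blast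
  show "pderiv_dir k (pderiv_dir i f) z = integral (cbox 0 1)
      (\<lambda>t::real. pderiv_dir k f (z + (r * exp (2 * pi * \<i> * t)) *s axis i 1) * (1 / (r * exp (2 * pi * \<i> * t))))"
    if "r > 0" "ball z (2*r) \<subseteq> U" for z r k
    using cdiff_atI(2)[OF main[OF that]] by (simp add: P_def \<gamma>_def)
qed

text \<open>The integral for one mixed derivative is Cauchy's formula for the i-th derivative of the
  k-th partial derivative, which is itself holomorphic.\<close>

lemma pderiv_dir_commute:
  assumes U: "open U" "\<And>z. z \<in> U \<Longrightarrow> cdiff_at f z" and z: "z \<in> U"
  shows "pderiv_dir k (pderiv_dir i f) z = pderiv_dir i (pderiv_dir k f) z"
proof -
  obtain e where e: "e > 0" "ball z e \<subseteq> U" using U(1) z by (meson open_contains_ball)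
  define r where "r = e / 2"
  have r: "r > 0" "ball z (2*r) \<subseteq> U" using e by (auto simp: r_def)
  show ?thesis
  proof (rule trans[OF pderiv_dir_holomorphic(2)[OF U r] pderiv_dir_circle[OF r(1), symmetric]])
    fix \<zeta> :: complex assume "norm \<zeta> \<le> r"
    hence "z + \<zeta> *s axis i 1 \<in> ball z (2*r)" using r(1) by (simp add: dist_norm norm_smult_vec)
    thus "cdiff_at (pderiv_dir k f) (z + \<zeta> *s axis i 1)" using pderiv_dir_holomorphic(1)[OF U] r(2) by blast
  qed
qed

section \<open>Calculus on a complex manifold\<close>

text \<open>Partial derivatives are kept as functions on the manifold, so that they can be iterated,
  compared between charts and combined with germs without passing to coordinate domains.\<close>

definition chart_deriv :: "('m, 'n::finite) chart \<Rightarrow> 'n \<Rightarrow> ('m \<Rightarrow> complex) \<Rightarrow> 'm \<Rightarrow> complex"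
  where "chart_deriv c k f y = pderiv_dir k (\<lambda>z. f (chart_inv c z)) (snd c y)"

fun iter_deriv :: "('m, 'n::finite) chart \<Rightarrow> 'n list \<Rightarrow> ('m \<Rightarrow> complex) \<Rightarrow> 'm \<Rightarrow> complex"
  where
    "iter_deriv c [] f = f"
  | "iter_deriv c (k # \<alpha>) f = chart_deriv c k (iter_deriv c \<alpha> f)"

lemma iter_deriv_append: "iter_deriv c (\<alpha> @ \<beta>) f = iter_deriv c \<alpha> (iter_deriv c \<beta> f)"
  by (induction \<alpha>) auto

lemma isCont_nhds: "isCont f x \<longleftrightarrow> filterlim f (nhds (f x)) (nhds x)"
  by (simp add: isCont_def tendsto_at_iff_tendsto_nhds)

locale atlas =
  fixes A :: "('m::t2_space, 'n::finite) chart set"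
  assumes atlas: "complex_atlas A"
begin

text \<open>Quantifying over all charts makes the notion intrinsic; holomorphic transition maps
  reduce it to a single chart in \<open>cd_at_iff\<close>.\<close>

definition cd_at :: "('m \<Rightarrow> complex) \<Rightarrow> 'm \<Rightarrow> bool"
  where "cd_at f x \<longleftrightarrow> x \<in> manifold A \<and> (\<forall>c\<in>A. x \<in> fst c \<longrightarrow> cdiff_at (\<lambda>z. f (chart_inv c z)) (snd c x))"

abbreviation hn :: "'m \<Rightarrow> ('m \<Rightarrow> complex) \<Rightarrow> bool"
  where "hn x f \<equiv> hol_near A x f"

lemma chart_open: "c \<in> A \<Longrightarrow> open (fst c)" "c \<in> A \<Longrightarrow> open (snd c ` fst c)"
  and chart_homeo: "c \<in> A \<Longrightarrow> homeomorphism (fst c) (snd c ` fst c) (snd c) (chart_inv c)"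
  and chart_trans: "c \<in> A \<Longrightarrow> c' \<in> A \<Longrightarrow> holomorphic_several (\<lambda>z. snd c' (chart_inv c z) $ i) (snd c ` (fst c \<inter> fst c'))"
  using atlas by (auto simp: complex_atlas_def)

lemma chart_inv_left: "c \<in> A \<Longrightarrow> x \<in> fst c \<Longrightarrow> chart_inv c (snd c x) = x"
  using chart_homeo homeomorphism_apply1 by blast

lemma chart_inv_right: "z \<in> snd c ` fst c \<Longrightarrow> snd c (chart_inv c z) = z"
  by (rule f_inv_into_f)

lemma chart_inv_mem: "z \<in> snd c ` fst c \<Longrightarrow> chart_inv c z \<in> fst c"
  by (rule inv_into_into)

lemma fst_manifold: "c \<in> A \<Longrightarrow> x \<in> fst c \<Longrightarrow> x \<in> manifold A"
  by (auto simp: manifold_def)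

lemma manifold_chart: "x \<in> manifold A \<Longrightarrow> \<exists>c\<in>A. x \<in> fst c"
  by (auto simp: manifold_def)

lemma open_manifold: "open (manifold A)"
  using chart_open by (auto simp: manifold_def)

lemma filterlim_chart: "c \<in> A \<Longrightarrow> x \<in> fst c \<Longrightarrow> filterlim (snd c) (nhds (snd c x)) (nhds x)"
  by (rule isCont_nhds[THEN iffD1]) (meson homeomorphism_cont1 chart_homeo chart_open(1) continuous_on_eq_continuous_at)

lemma filterlim_chart_inv:
  assumes "c \<in> A" "x \<in> fst c"
  shows "filterlim (chart_inv c) (nhds x) (nhds (snd c x))"
proof -
  have "isCont (chart_inv c) (snd c x)"
    using homeomorphism_cont2[OF chart_homeo] chart_open(2) assms by (simp add: continuous_on_eq_continuous_at)
  thus ?thesis unfolding isCont_nhds chart_inv_left[OF assms] .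
qed

lemma eventually_chart:
  "c \<in> A \<Longrightarrow> x \<in> fst c \<Longrightarrow> eventually P (nhds (snd c x)) \<Longrightarrow> \<forall>\<^sub>F y in nhds x. P (snd c y)"
  using filterlim_chart by (auto simp: filterlim_iff)

lemma eventually_chart_inv:
  "c \<in> A \<Longrightarrow> x \<in> fst c \<Longrightarrow> eventually P (nhds x) \<Longrightarrow> \<forall>\<^sub>F z in nhds (snd c x). P (chart_inv c z)"
  using filterlim_chart_inv by (auto simp: filterlim_iff)

lemma eventually_fst: "c \<in> A \<Longrightarrow> x \<in> fst c \<Longrightarrow> \<forall>\<^sub>F y in nhds x. y \<in> fst c"
  using chart_open(1) eventually_nhds_in_open by blast

lemma eventually_image: "c \<in> A \<Longrightarrow> x \<in> fst c \<Longrightarrow> \<forall>\<^sub>F z in nhds (snd c x). z \<in> snd c ` fst c"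
  using chart_open(2) eventually_nhds_in_open by blast

lemma eventually_manifold: "x \<in> manifold A \<Longrightarrow> \<forall>\<^sub>F y in nhds x. y \<in> manifold A"
  using open_manifold eventually_nhds_in_open by blast

lemma open_chart_image:
  assumes "c \<in> A" "open V"
  shows "open (snd c ` (V \<inter> fst c))"
proof -
  have "snd c ` (V \<inter> fst c) = snd c ` fst c \<inter> chart_inv c -` V"
    using assms chart_inv_left by (force simp: f_inv_into_f inv_into_into)
  thus ?thesis
    using continuous_open_preimage[OF homeomorphism_cont2[OF chart_homeo[OF assms(1)]] chart_open(2)[OF assms(1)] assms(2)]
    by simp
qed

lemma cdiff_trans:
  assumes "c \<in> A" "c' \<in> A" "x \<in> fst c" "x \<in> fst c'"
  shows "cdiff_at (\<lambda>z. snd c' (chart_inv c z) $ i) (snd c x)"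
  using chart_trans[OF assms(1,2), of i] assms(3,4) by (auto simp: holomorphic_several_iff)

lemma trans_cong:
  assumes "c \<in> A" "c' \<in> A" "x \<in> fst c" "x \<in> fst c'"
  shows "\<forall>\<^sub>F z in nhds (snd c' x). f (chart_inv c' z) = f (chart_inv c (snd c (chart_inv c' z)))"
  using eventually_chart_inv[OF assms(2,4) eventually_fst[OF assms(1,3)]]
  by eventually_elim (simp add: chart_inv_left assms)

text \<open>Near the point, f in the second chart is f in the first chart composed with the
  transition map, and the chain rule applies.\<close>

lemma cdiff_chart_change:
  assumes "c \<in> A" "c' \<in> A" "x \<in> fst c" "x \<in> fst c'" "cdiff_at (\<lambda>z. f (chart_inv c z)) (snd c x)"
  shows "cdiff_at (\<lambda>z. f (chart_inv c' z)) (snd c' x)"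
    and "chart_deriv c' k f x = (\<Sum>l\<in>UNIV. chart_deriv c l f x * chart_deriv c' k (\<lambda>y. snd c y $ l) x)"
proof -
  have h: "cdiff_at (\<lambda>z. f (chart_inv c z)) (snd c (chart_inv c' (snd c' x)))"
    using assms by (simp add: chart_inv_left)
  note cc = cdiff_at_compose[where \<phi>="\<lambda>z. snd c (chart_inv c' z)", OF h cdiff_trans[OF assms(2,1,4,3)]]
  show "cdiff_at (\<lambda>z. f (chart_inv c' z)) (snd c' x)"
    using cdiff_at_cong[OF trans_cong[OF assms(1-4), of f]] cc(1) by blast
  show "chart_deriv c' k f x = (\<Sum>l\<in>UNIV. chart_deriv c l f x * chart_deriv c' k (\<lambda>y. snd c y $ l) x)"
    unfolding chart_deriv_def using pderiv_dir_cong[OF trans_cong[OF assms(1-4), of f], of k] cc(2)[of k]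
    by (simp add: chart_inv_left assms)
qed

lemma cd_at_iff:
  assumes "c \<in> A" "x \<in> fst c"
  shows "cd_at f x \<longleftrightarrow> cdiff_at (\<lambda>z. f (chart_inv c z)) (snd c x)"
  using assms cdiff_chart_change(1) fst_manifold unfolding cd_at_def by blast

lemma chart_deriv_change:
  assumes "c \<in> A" "c' \<in> A" "x \<in> fst c" "x \<in> fst c'" "cd_at f x"
  shows "chart_deriv c' k f x = (\<Sum>l\<in>UNIV. chart_deriv c l f x * chart_deriv c' k (\<lambda>y. snd c y $ l) x)"
  by (rule cdiff_chart_change(2)[OF assms(1-4)]) (use assms cd_at_iff in blast)

lemma cd_at_manifold: "cd_at f x \<Longrightarrow> x \<in> manifold A"
  by (simp add: cd_at_def)

lemma cd_at_cong:
  assumes "\<forall>\<^sub>F y in nhds x. f y = g y"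
  shows "cd_at f x \<longleftrightarrow> cd_at g x"
proof -
  have "cdiff_at (\<lambda>z. f (chart_inv c z)) (snd c x) \<longleftrightarrow> cdiff_at (\<lambda>z. g (chart_inv c z)) (snd c x)"
    if "c \<in> A" "x \<in> fst c" for c
    by (rule cdiff_at_cong) (rule eventually_chart_inv[OF that assms])
  thus ?thesis unfolding cd_at_def by blast
qed

lemma chart_deriv_cong:
  assumes "c \<in> A" "x \<in> fst c" "\<forall>\<^sub>F y in nhds x. f y = g y"
  shows "chart_deriv c k f x = chart_deriv c k g x"
  unfolding chart_deriv_def
  by (rule pderiv_dir_cong) (rule eventually_chart_inv[OF assms])

lemma eventually_chart_deriv_cong:
  assumes "c \<in> A" "x \<in> fst c" "\<forall>\<^sub>F y in nhds x. f y = g y"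
  shows "\<forall>\<^sub>F y in nhds x. chart_deriv c k f y = chart_deriv c k g y"
  using eventually_fst[OF assms(1,2)] eventually_eventually[THEN iffD2, OF assms(3)]
  by eventually_elim (rule chart_deriv_cong[OF assms(1)])

lemma eventually_iter_deriv_cong:
  assumes "c \<in> A" "x \<in> fst c" "\<forall>\<^sub>F y in nhds x. f y = g y"
  shows "\<forall>\<^sub>F y in nhds x. iter_deriv c \<alpha> f y = iter_deriv c \<alpha> g y"
  by (induction \<alpha>) (auto simp: assms intro: eventually_chart_deriv_cong)

lemma iter_deriv_cong:
  assumes "c \<in> A" "x \<in> fst c" "\<forall>\<^sub>F y in nhds x. f y = g y"
  shows "iter_deriv c \<alpha> f x = iter_deriv c \<alpha> g x"
  using eventually_iter_deriv_cong[OF assms] by (rule eventually_nhds_x_imp_x)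

lemma cd_at_const [simp]: "x \<in> manifold A \<Longrightarrow> cd_at (\<lambda>y. a) x"
  by (simp add: cd_at_def)

lemma cd_at_add: "cd_at f x \<Longrightarrow> cd_at g x \<Longrightarrow> cd_at (\<lambda>y. f y + g y) x"
  by (simp add: cd_at_def cdiff_at_add)

lemma cd_at_mult: "cd_at f x \<Longrightarrow> cd_at g x \<Longrightarrow> cd_at (\<lambda>y. f y * g y) x"
  by (simp add: cd_at_def cdiff_at_mult)

lemma cd_at_inverse: "cd_at f x \<Longrightarrow> f x \<noteq> 0 \<Longrightarrow> cd_at (\<lambda>y. inverse (f y)) x"
  using chart_inv_left by (simp add: cd_at_def cdiff_at_inverse)

lemma cd_at_coord: "c \<in> A \<Longrightarrow> x \<in> fst c \<Longrightarrow> cd_at (\<lambda>y. snd c y $ k) x"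
  using cdiff_trans by (auto simp: cd_at_def fst_manifold)

lemma cd_at_sum: "x \<in> manifold A \<Longrightarrow> (\<And>i. i \<in> I \<Longrightarrow> cd_at (f i) x) \<Longrightarrow> cd_at (\<lambda>y. \<Sum>i\<in>I. f i y) x"
  by (induction I rule: infinite_finite_induct) (auto intro: cd_at_add)

lemma chart_deriv_const [simp]: "chart_deriv c k (\<lambda>y. a) x = 0"
  by (simp add: chart_deriv_def)

lemma chart_deriv_add:
  "c \<in> A \<Longrightarrow> x \<in> fst c \<Longrightarrow> cd_at f x \<Longrightarrow> cd_at g x \<Longrightarrow>
    chart_deriv c k (\<lambda>y. f y + g y) x = chart_deriv c k f x + chart_deriv c k g x"
  by (simp add: chart_deriv_def cd_at_def cdiff_at_add)

lemma chart_deriv_mult: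
  "c \<in> A \<Longrightarrow> x \<in> fst c \<Longrightarrow> cd_at f x \<Longrightarrow> cd_at g x \<Longrightarrow>
    chart_deriv c k (\<lambda>y. f y * g y) x = chart_deriv c k f x * g x + f x * chart_deriv c k g x"
  by (simp add: chart_deriv_def cd_at_def cdiff_at_mult chart_inv_left)

lemma chart_deriv_sum:
  assumes "c \<in> A" "x \<in> fst c" "\<And>i. i \<in> I \<Longrightarrow> cd_at (f i) x"
  shows "chart_deriv c k (\<lambda>y. \<Sum>i\<in>I. f i y) x = (\<Sum>i\<in>I. chart_deriv c k (f i) x)"
  using assms(3)
proof (induction I rule: infinite_finite_induct)
  case (insert i I)
  have "chart_deriv c k (\<lambda>y. \<Sum>i\<in>insert i I. f i y) x = chart_deriv c k (\<lambda>y. f i y + (\<Sum>i\<in>I. f i y)) x"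
    using insert by simp
  also have "\<dots> = chart_deriv c k (f i) x + (\<Sum>i\<in>I. chart_deriv c k (f i) x)"
    using insert by (subst chart_deriv_add[OF assms(1,2)]) (auto intro!: cd_at_sum fst_manifold[OF assms(1,2)])
  finally show ?case using insert by simp
qed auto

lemma chart_deriv_coord:
  "c \<in> A \<Longrightarrow> x \<in> fst c \<Longrightarrow> chart_deriv c k (\<lambda>y. snd c y $ l) x = (if k = l then 1 else 0)"
  unfolding chart_deriv_def
  by (subst pderiv_dir_cong[where g="\<lambda>z. z $ l"])
    (auto simp: cdiff_at_coord chart_inv_right intro: eventually_mono[OF eventually_image])

lemma cd_at_isCont:
  assumes "cd_at f x"
  shows "filterlim f (nhds (f x)) (nhds x)"
proof -
  obtain c where c: "c \<in> A" "x \<in> fst c" using manifold_chart[OF cd_at_manifold[OF assms]] by blast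
  have "isCont (\<lambda>z. f (chart_inv c z)) (snd c x)" using cd_at_iff[OF c] assms cdiff_at_isCont by blast
  hence "filterlim (\<lambda>z. f (chart_inv c z)) (nhds (f x)) (nhds (snd c x))"
    unfolding isCont_nhds chart_inv_left[OF c] .
  from filterlim_compose[OF this filterlim_chart[OF c]]
  show ?thesis
    by (rule filterlim_cong[THEN iffD1, OF refl refl, rotated])
      (rule eventually_mono[OF eventually_fst[OF c]], simp add: chart_inv_left c)
qed

section \<open>Germs of holomorphic functions on the manifold\<close>

lemma hol_on_iff: "hol_on A f V \<longleftrightarrow> open V \<and> (\<forall>x\<in>V. cd_at f x)"
proof
  assume h: "hol_on A f V"
  have "cd_at f x" if "x \<in> V" for x
    using h that unfolding hol_on_def cd_at_def holomorphic_several_iff by blast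
  thus "open V \<and> (\<forall>x\<in>V. cd_at f x)" using h by (auto simp: hol_on_def)
next
  assume h: "open V \<and> (\<forall>x\<in>V. cd_at f x)"
  thus "hol_on A f V"
    unfolding hol_on_def holomorphic_several_iff
    using open_chart_image by (auto simp: cd_at_def)
qed

text \<open>Turns holomorphy of a germ into an \<open>eventually\<close> statement: closure
  properties follow from the pointwise ones, and neighbourhoods shrink silently.\<close>

lemma hn_iff: "hn x f \<longleftrightarrow> (\<forall>\<^sub>F y in nhds x. cd_at f y)"
  unfolding hol_near_def hol_on_iff eventually_nhds by auto

lemma hol_on_hn: "hol_on A f V \<longleftrightarrow> open V \<and> (\<forall>x\<in>V. hn x f)"
  unfolding hol_on_iff hn_iff
  by (auto intro: eventually_nhds_x_imp_x eventually_mono[OF eventually_nhds_in_open])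

lemma hn_cd: "hn x f \<Longrightarrow> cd_at f x"
  unfolding hn_iff by (rule eventually_nhds_x_imp_x)

lemma hn_manifold: "hn x f \<Longrightarrow> x \<in> manifold A"
  using hn_cd cd_at_manifold by blast

lemma hn_eventually: "hn x f \<Longrightarrow> \<forall>\<^sub>F y in nhds x. hn y f"
  unfolding hn_iff eventually_eventually .

lemma hn_cong: "\<forall>\<^sub>F y in nhds x. f y = g y \<Longrightarrow> hn x f \<longleftrightarrow> hn x g"
  unfolding hn_iff
  by (intro eventually_cong[OF _ cd_at_cong]) (auto simp: eventually_eventually)

lemma hn_const [simp]: "x \<in> manifold A \<Longrightarrow> hn x (\<lambda>y. a)"
  unfolding hn_iff by (drule eventually_manifold, erule eventually_mono) simp

lemma hn_add: "hn x f \<Longrightarrow> hn x g \<Longrightarrow> hn x (\<lambda>y. f y + g y)"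
  unfolding hn_iff by (erule (1) eventually_elim2) (rule cd_at_add)

lemma hn_mult: "hn x f \<Longrightarrow> hn x g \<Longrightarrow> hn x (\<lambda>y. f y * g y)"
  unfolding hn_iff by (erule (1) eventually_elim2) (rule cd_at_mult)

lemma hn_minus: "hn x f \<Longrightarrow> hn x (\<lambda>y. - f y)"
  using hn_mult[OF hn_const[OF hn_manifold[of x f]], of f "-1"] by simp

lemma hn_diff: "hn x f \<Longrightarrow> hn x g \<Longrightarrow> hn x (\<lambda>y. f y - g y)"
  using hn_add[OF _ hn_minus, of x f g] by simp

lemma hn_sum: "x \<in> manifold A \<Longrightarrow> (\<And>i. i \<in> I \<Longrightarrow> hn x (f i)) \<Longrightarrow> hn x (\<lambda>y. \<Sum>i\<in>I. f i y)"
  by (induction I rule: infinite_finite_induct) (auto intro: hn_add)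

lemma hn_power: "hn x f \<Longrightarrow> hn x (\<lambda>y. f y ^ p)"
  by (induction p) (auto intro: hn_mult simp: hn_manifold)

lemma eventually_nonzero: "cd_at f x \<Longrightarrow> f x \<noteq> 0 \<Longrightarrow> \<forall>\<^sub>F y in nhds x. f y \<noteq> 0"
  using cd_at_isCont tendsto_imp_eventually_ne by blast

lemma hn_inverse:
  assumes "hn x f" "f x \<noteq> 0"
  shows "hn x (\<lambda>y. inverse (f y))"
  using assms(1) eventually_nonzero[OF hn_cd[OF assms(1)] assms(2)] unfolding hn_iff
  by (rule eventually_elim2) (auto intro: cd_at_inverse)

lemma hn_divide: "hn x f \<Longrightarrow> hn x g \<Longrightarrow> g x \<noteq> 0 \<Longrightarrow> hn x (\<lambda>y. f y / g y)"
  unfolding divide_inverse by (intro hn_mult hn_inverse)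

lemma hn_coord: "c \<in> A \<Longrightarrow> x \<in> fst c \<Longrightarrow> hn x (\<lambda>y. snd c y $ k)"
  unfolding hn_iff by (rule eventually_mono[OF eventually_fst]) (auto intro: cd_at_coord)

text \<open>Regularity and symmetry of partial derivatives are transported from the coordinate image
  of a neighbourhood on which f is holomorphic.\<close>

lemma chart_deriv_hol:
  assumes "c \<in> A" "hn x f" "x \<in> fst c"
  shows "hn x (chart_deriv c k f)"
    and "chart_deriv c l (chart_deriv c k f) x = chart_deriv c k (chart_deriv c l f) x"
proof -
  obtain V where V: "open V" "x \<in> V" "\<And>y. y \<in> V \<Longrightarrow> cd_at f y"
    using assms(2) unfolding hn_iff eventually_nhds by blast
  let ?U = "snd c ` (V \<inter> fst c)" and ?F = "\<lambda>z. f (chart_inv c z)"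
  have U: "open ?U" "\<And>z. z \<in> ?U \<Longrightarrow> cdiff_at ?F z"
    using open_chart_image[OF assms(1) V(1)] V(3) assms(1) by (auto simp: cd_at_def)
  have eq: "\<forall>\<^sub>F z in nhds (snd c y). chart_deriv c k f (chart_inv c z) = pderiv_dir k ?F z" if "y \<in> fst c" for y k
    using eventually_image[OF assms(1) that]
    by eventually_elim (simp add: chart_deriv_def chart_inv_right)
  have "cd_at (chart_deriv c k f) y" if "y \<in> V" "y \<in> fst c" for y
    unfolding cd_at_iff[OF assms(1) that(2)] cdiff_at_cong[OF eq[OF that(2)]]
    by (rule pderiv_dir_holomorphic(1)[OF U]) (use that in auto)
  moreover have "\<forall>\<^sub>F y in nhds x. y \<in> V" using V(1,2) eventually_nhds_in_open by blast
  ultimately show "hn x (chart_deriv c k f)"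
    unfolding hn_iff using eventually_fst[OF assms(1,3)] by (auto elim: eventually_elim2)
  have "chart_deriv c l (chart_deriv c k f) x = pderiv_dir l (pderiv_dir k ?F) (snd c x)" for l k
    unfolding chart_deriv_def[of c l] by (rule pderiv_dir_cong[OF eq[OF assms(3)]])
  thus "chart_deriv c l (chart_deriv c k f) x = chart_deriv c k (chart_deriv c l f) x"
    using pderiv_dir_commute[OF U, of "snd c x" l k] V(2) assms(3) by simp
qed

lemma iter_deriv_hol: "c \<in> A \<Longrightarrow> hn x f \<Longrightarrow> x \<in> fst c \<Longrightarrow> hn x (iter_deriv c \<alpha> f)"
  by (induction \<alpha>) (auto intro: chart_deriv_hol)

lemma iter_deriv_iter_pderiv:
  "c \<in> A \<Longrightarrow> x \<in> fst c \<Longrightarrow> iter_deriv c \<alpha> f x = iter_pderiv \<alpha> (\<lambda>z. f (chart_inv c z)) (snd c x)"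
proof (induction \<alpha> arbitrary: x)
  case (Cons k \<alpha>)
  have "\<forall>\<^sub>F z in nhds (snd c x). iter_deriv c \<alpha> f (chart_inv c z) = iter_pderiv \<alpha> (\<lambda>z. f (chart_inv c z)) z"
    using eventually_image[OF Cons.prems]
    by eventually_elim (simp add: Cons.IH[OF Cons.prems(1)] chart_inv_right chart_inv_mem)
  thus ?case by (simp add: chart_deriv_def pderiv_dir_cong)
qed (simp add: chart_inv_left)

lemma hn_D: "c \<in> A \<Longrightarrow> x \<in> fst c \<Longrightarrow> hn x f \<Longrightarrow> hn x (chart_deriv c k f)"
  by (rule chart_deriv_hol)

end

section \<open>Vanishing order and the higher chain rule\<close>

text \<open>The Taylor polynomial whose derivatives at 0 are the \<open>w k\<close>; shifting the
  sequence differentiates it.\<close>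

definition pw :: "(nat \<Rightarrow> complex) \<Rightarrow> nat \<Rightarrow> complex \<Rightarrow> complex"
  where "pw w N t = (\<Sum>k\<le>N. w k * t ^ k / fact k)"

lemma pw_0 [simp]: "pw w N 0 = w 0"
proof -
  have "pw w N 0 = (\<Sum>k\<le>N. if k = 0 then w 0 else 0)" unfolding pw_def by (rule sum.cong) auto
  thus ?thesis by simp
qed

text \<open>The Faa di Bruno coefficients: the derivative along \<open>\<beta>\<close> of \<open>H \<circ> f\<close>
  is the sum over \<open>j\<close> of \<open>faa c f \<beta> j\<close> times the \<open>j\<close>-th derivative of \<open>H\<close> at \<open>f\<close>.\<close>

fun faa :: "('m, 'n::finite) chart \<Rightarrow> ('m \<Rightarrow> complex) \<Rightarrow> 'n list \<Rightarrow> nat \<Rightarrow> 'm \<Rightarrow> complex"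
  where
    "faa c f [] j = (\<lambda>y. if j = 0 then 1 else 0)"
  | "faa c f (k # \<beta>) j = (\<lambda>y. chart_deriv c k (faa c f \<beta> j) y + (if j = 0 then 0 else faa c f \<beta> (j - 1) y * chart_deriv c k f y))"

context atlas begin

text \<open>Membership of the germ in the p-th power of the maximal ideal at x, tested in one
  chart.\<close>

definition van :: "('m, 'n) chart \<Rightarrow> nat \<Rightarrow> ('m \<Rightarrow> complex) \<Rightarrow> 'm \<Rightarrow> bool"
  where "van c p f x \<longleftrightarrow> (\<forall>\<alpha>. length \<alpha> < p \<longrightarrow> iter_deriv c \<alpha> f x = 0)"

lemma van_0 [simp]: "van c 0 f x"
  by (simp add: van_def)

text \<open>The derivative split off is the innermost one, applied directly to f. Inductions on the
  order therefore replace f by its first derivatives.\<close>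

lemma van_Suc: "van c (Suc p) f x \<longleftrightarrow> f x = 0 \<and> (\<forall>k. van c p (chart_deriv c k f) x)"
proof
  assume h: "van c (Suc p) f x"
  have "iter_deriv c \<alpha> (chart_deriv c k f) x = 0" if "length \<alpha> < p" for \<alpha> k
    using h[unfolded van_def, rule_format, of "\<alpha> @ [k]"] that by (simp add: iter_deriv_append)
  thus "f x = 0 \<and> (\<forall>k. van c p (chart_deriv c k f) x)"
    using h[unfolded van_def, rule_format, of "[]"] by (simp add: van_def)
next
  assume h: "f x = 0 \<and> (\<forall>k. van c p (chart_deriv c k f) x)"
  show "van c (Suc p) f x"
    unfolding van_def
  proof (intro allI impI)
    fix \<alpha> :: "'n list" assume l: "length \<alpha> < Suc p"
    show "iter_deriv c \<alpha> f x = 0"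
      using h l by (cases \<alpha> rule: rev_cases) (auto simp: iter_deriv_append van_def)
  qed
qed

lemma van_mono: "van c p f x \<Longrightarrow> p' \<le> p \<Longrightarrow> van c p' f x"
  by (auto simp: van_def)

lemma van_cong:
  assumes "c \<in> A" "x \<in> fst c" "\<forall>\<^sub>F y in nhds x. f y = g y" "van c p f x"
  shows "van c p g x"
  using iter_deriv_cong[OF assms(1-3)] assms(4) by (simp add: van_def)

lemma ev_deriv_add:
  assumes "c \<in> A" "x \<in> fst c" "hn x f" "hn x g"
  shows "\<forall>\<^sub>F y in nhds x. chart_deriv c k (\<lambda>y. f y + g y) y = chart_deriv c k f y + chart_deriv c k g y"
  using eventually_fst[OF assms(1,2)] assms(3,4)[unfolded hn_iff]
  by eventually_elim (rule chart_deriv_add[OF assms(1)])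

lemma ev_deriv_mult:
  assumes "c \<in> A" "x \<in> fst c" "hn x f" "hn x g"
  shows "\<forall>\<^sub>F y in nhds x. chart_deriv c k (\<lambda>y. f y * g y) y = chart_deriv c k f y * g y + f y * chart_deriv c k g y"
  using eventually_fst[OF assms(1,2)] assms(3,4)[unfolded hn_iff]
  by eventually_elim (rule chart_deriv_mult[OF assms(1)])

lemma van_add:
  assumes "c \<in> A" "x \<in> fst c"
  shows "hn x f \<Longrightarrow> hn x g \<Longrightarrow> van c p f x \<Longrightarrow> van c p g x \<Longrightarrow> van c p (\<lambda>y. f y + g y) x"
proof (induction p arbitrary: f g)
  case (Suc p)
  have "van c p (chart_deriv c k (\<lambda>y. f y + g y)) x" for k
  proof (rule van_cong[OF assms eventually_mono[OF ev_deriv_add[OF assms Suc.prems(1,2)]] Suc.IH])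
    show "hn x (chart_deriv c k f)" "hn x (chart_deriv c k g)" using hn_D[OF assms] Suc.prems by auto
    show "van c p (chart_deriv c k f) x" "van c p (chart_deriv c k g) x" using Suc.prems by (auto simp: van_Suc)
  qed (rule sym)
  thus ?case using Suc.prems by (simp add: van_Suc)
qed simp

lemma van_mult:
  assumes "c \<in> A" "x \<in> fst c"
  shows "hn x f \<Longrightarrow> hn x g \<Longrightarrow> van c p f x \<Longrightarrow> van c p (\<lambda>y. f y * g y) x"
proof (induction p arbitrary: f g)
  case (Suc p)
  have "van c p (chart_deriv c k (\<lambda>y. f y * g y)) x" for k
  proof (rule van_cong[OF assms eventually_mono[OF ev_deriv_mult[OF assms Suc.prems(1,2)]]])
    have D: "hn x (chart_deriv c k f)" "hn x (chart_deriv c k g)" using hn_D[OF assms] Suc.prems by auto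
    have "van c p (chart_deriv c k f) x" "van c p f x" using Suc.prems(3) by (auto simp: van_Suc intro: van_mono[OF Suc.prems(3)])
    thus "van c p (\<lambda>y. chart_deriv c k f y * g y + f y * chart_deriv c k g y) x"
      using Suc.prems D by (intro van_add[OF assms] Suc.IH hn_mult)
  qed (rule sym)
  thus ?case using Suc.prems by (simp add: van_Suc)
qed simp

lemma chart_deriv_const_fun [simp]: "chart_deriv c k (\<lambda>y. a) = (\<lambda>y. 0)"
  by (simp add: fun_eq_iff)

lemma iter_deriv_zero [simp]: "iter_deriv c \<alpha> (\<lambda>y. 0) = (\<lambda>y. 0)"
  by (induction \<alpha>) auto

lemma van_zero [simp]: "van c p (\<lambda>y. 0) x"
  by (simp add: van_def)

lemma van_mult':
  assumes "c \<in> A" "x \<in> fst c" "hn x f" "hn x g" "van c p g x"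
  shows "van c p (\<lambda>y. f y * g y) x"
  using van_mult[OF assms(1,2,4,3,5)] by (simp add: mult.commute)

lemma van_minus:
  assumes "c \<in> A" "x \<in> fst c" "hn x f" "van c p f x"
  shows "van c p (\<lambda>y. - f y) x"
  using van_mult'[OF assms(1,2) hn_const[OF hn_manifold[OF assms(3)]] assms(3,4), of "-1"] by simp

lemma van_diff:
  assumes "c \<in> A" "x \<in> fst c" "hn x f" "hn x g" "van c p f x" "van c p g x"
  shows "van c p (\<lambda>y. f y - g y) x"
  using van_add[OF assms(1,2,3) hn_minus[OF assms(4)] assms(5) van_minus[OF assms(1,2,4,6)]] by simp

lemma van_sum:
  assumes "c \<in> A" "x \<in> fst c"
  shows "(\<And>i. i \<in> I \<Longrightarrow> hn x (f i)) \<Longrightarrow> (\<And>i. i \<in> I \<Longrightarrow> van c p (f i) x) \<Longrightarrow> van c p (\<lambda>y. \<Sum>i\<in>I. f i y) x"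
proof (induction I rule: infinite_finite_induct)
  case (insert i I)
  have "van c p (\<lambda>y. f i y + (\<Sum>i\<in>I. f i y)) x"
    using insert by (intro van_add[OF assms] hn_sum) (auto simp: fst_manifold[OF assms])
  thus ?case using insert by simp
qed auto

text \<open>First derivatives in the new chart are combinations of those in the old one with
  holomorphic coefficients, and the order of vanishing survives such combinations.\<close>

lemma van_chart:
  assumes "c \<in> A" "x \<in> fst c" "c' \<in> A" "x \<in> fst c'"
  shows "hn x f \<Longrightarrow> van c p f x \<Longrightarrow> van c' p f x"
proof (induction p arbitrary: f)
  case (Suc p)
  have "van c' p (chart_deriv c' k f) x" for k
  proof (rule van_cong[OF assms(3,4)])
    show "\<forall>\<^sub>F y in nhds x. (\<Sum>l\<in>UNIV. chart_deriv c l f y * chart_deriv c' k (\<lambda>y. snd c y $ l) y) = chart_deriv c' k f y"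
      using eventually_fst[OF assms(1,2)] eventually_fst[OF assms(3,4)] Suc.prems(1)[unfolded hn_iff]
      by eventually_elim (rule chart_deriv_change[symmetric, OF assms(1,3)])
    show "van c' p (\<lambda>y. \<Sum>l\<in>UNIV. chart_deriv c l f y * chart_deriv c' k (\<lambda>y. snd c y $ l) y) x"
      using Suc.prems
      by (intro van_sum van_mult Suc.IH hn_mult hn_D assms hn_coord) (auto simp: van_Suc)
  qed
  thus ?case using Suc.prems by (simp add: van_Suc)
qed simp

lemma iter_deriv_add:
  assumes "c \<in> A" "x \<in> fst c" "hn x f" "hn x g"
  shows "\<forall>\<^sub>F y in nhds x. iter_deriv c \<alpha> (\<lambda>y. f y + g y) y = iter_deriv c \<alpha> f y + iter_deriv c \<alpha> g y"
proof (induction \<alpha>)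
  case (Cons k \<alpha>)
  note e = eventually_chart_deriv_cong[OF assms(1,2) Cons.IH, of k]
  have "hn x (iter_deriv c \<alpha> f)" "hn x (iter_deriv c \<alpha> g)" using iter_deriv_hol assms by blast+
  from ev_deriv_add[OF assms(1,2) this, of k] e show ?case by eventually_elim simp
qed simp

lemma iter_deriv_cmult:
  assumes "c \<in> A" "x \<in> fst c" "hn x f"
  shows "\<forall>\<^sub>F y in nhds x. iter_deriv c \<alpha> (\<lambda>y. a * f y) y = a * iter_deriv c \<alpha> f y"
proof (induction \<alpha>)
  case (Cons k \<alpha>)
  note e = eventually_chart_deriv_cong[OF assms(1,2) Cons.IH, of k]
  have "hn x (iter_deriv c \<alpha> f)" using iter_deriv_hol assms by blast
  from ev_deriv_mult[OF assms(1,2) hn_const[OF fst_manifold[OF assms(1,2)], of a] this, of k] e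
  show ?case by eventually_elim simp
qed simp

lemma iter_deriv_sum:
  assumes "c \<in> A" "x \<in> fst c"
  shows "(\<And>i. i \<in> I \<Longrightarrow> hn x (f i)) \<Longrightarrow>
    \<forall>\<^sub>F y in nhds x. iter_deriv c \<alpha> (\<lambda>y. \<Sum>i\<in>I. f i y) y = (\<Sum>i\<in>I. iter_deriv c \<alpha> (f i) y)"
proof (induction I rule: infinite_finite_induct)
  case (insert i I)
  have "hn x (\<lambda>y. \<Sum>i\<in>I. f i y)" using insert by (intro hn_sum fst_manifold[OF assms]) auto
  have "\<forall>\<^sub>F y in nhds x. iter_deriv c \<alpha> (\<lambda>y. \<Sum>i\<in>I. f i y) y = (\<Sum>i\<in>I. iter_deriv c \<alpha> (f i) y)"
    by (rule insert.IH) (use insert.prems in auto)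
  with iter_deriv_add[OF assms insert.prems[OF insertI1] \<open>hn x (\<lambda>y. \<Sum>i\<in>I. f i y)\<close>, of \<alpha>]
  show ?case by eventually_elim (use insert in auto)
qed auto

lemma iter_deriv_commute:
  assumes "c \<in> A" "x \<in> fst c" "hn x f"
  shows "\<forall>\<^sub>F y in nhds x. iter_deriv c \<beta> (chart_deriv c k f) y = chart_deriv c k (iter_deriv c \<beta> f) y"
proof (induction \<beta>)
  case (Cons l \<beta>)
  have "\<forall>\<^sub>F y in nhds x. hn y (iter_deriv c \<beta> f)" using hn_eventually iter_deriv_hol assms by blast
  with eventually_fst[OF assms(1,2)] eventually_chart_deriv_cong[OF assms(1,2) Cons.IH, of l]
  show ?case by eventually_elim (simp add: chart_deriv_hol(2)[OF assms(1), of _ _ l k])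
qed simp

text \<open>The first letter of one word is found inside the other and moved to the front by
  commuting derivatives.\<close>

lemma iter_deriv_perm:
  assumes "c \<in> A" "x \<in> fst c" "hn x f"
  shows "mset \<beta> = mset \<beta>' \<Longrightarrow> \<forall>\<^sub>F y in nhds x. iter_deriv c \<beta> f y = iter_deriv c \<beta>' f y"
proof (induction \<beta> arbitrary: \<beta>')
  case (Cons k \<beta>)
  have "k \<in> set \<beta>'" using Cons.prems by (metis list.set_intros(1) set_mset_mset)
  then obtain \<gamma> \<delta> where b: "\<beta>' = \<gamma> @ k # \<delta>" by (meson split_list)
  hence "mset \<beta> = mset (\<gamma> @ \<delta>)" using Cons.prems by simp
  from eventually_chart_deriv_cong[OF assms(1,2) Cons.IH[OF this], of k]
    iter_deriv_commute[OF assms(1,2) iter_deriv_hol[OF assms(1,3,2)], of \<gamma> k \<delta>]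
  show ?case by eventually_elim (simp add: b iter_deriv_append)
qed simp

section \<open>Faa di Bruno coefficients and functions of a submersion\<close>

lemma faa_hol: "c \<in> A \<Longrightarrow> x \<in> fst c \<Longrightarrow> hn x f \<Longrightarrow> hn x (faa c f \<beta> j)"
proof (induction \<beta> arbitrary: j)
  case (Cons k \<beta>)
  thus ?case by (cases "j = 0") (auto intro!: hn_add hn_mult hn_D simp: fst_manifold)
qed (auto simp: fst_manifold)

lemma faa_0: "faa c f \<beta> 0 = (\<lambda>y. if \<beta> = [] then 1 else 0)"
proof (induction \<beta>)
  case (Cons k \<beta>)
  thus ?case by (cases "\<beta> = []") auto
qed simp

lemma faa_gt: "j > length \<beta> \<Longrightarrow> faa c f \<beta> j = (\<lambda>y. 0)"
proof (induction \<beta> arbitrary: j)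
  case (Cons k \<beta>)
  have "faa c f \<beta> j = (\<lambda>y. 0)" "faa c f \<beta> (j - 1) = (\<lambda>y. 0)" using Cons.prems by (auto intro!: Cons.IH)
  thus ?case by (cases "j = 0") auto
qed simp

lemma faa_top: "faa c f \<beta> (length \<beta>) = (\<lambda>y. \<Prod>b\<leftarrow>\<beta>. chart_deriv c b f y)"
  by (induction \<beta>) (auto simp: fun_eq_iff faa_gt)

text \<open>Only the relations \<open>dG\<^sub>j = G\<^sub>j\<^sub>+\<^sub>1 df\<close> enter, not
  that the \<open>G j\<close> come from one function of f. The same formula thus serves polynomials
  in f and the coordinates of a flat section. The letter l stands at the end of the word because the
  component of \<open>G\<^sub>1 df\<close> already carries one differentiation.\<close>

lemma iter_deriv_chain:
  assumes "c \<in> A" "x \<in> fst c" "hn x f"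
    and G: "\<And>j. 1 \<le> j \<Longrightarrow> j \<le> Suc N \<Longrightarrow> hn x (G j)"
    and D: "\<And>j k. 1 \<le> j \<Longrightarrow> j \<le> N \<Longrightarrow> \<forall>\<^sub>F y in nhds x. chart_deriv c k (G j) y = G (Suc j) y * chart_deriv c k f y"
  shows "length \<alpha> \<le> N \<Longrightarrow> \<forall>\<^sub>F y in nhds x. iter_deriv c \<alpha> (\<lambda>y. G 1 y * chart_deriv c l f y) y =
    (\<Sum>j=1..Suc (length \<alpha>). faa c f (\<alpha> @ [l]) j y * G j y)"
proof (induction \<alpha>)
  case Nil
  show ?case by (auto simp: mult.commute)
next
  case (Cons k \<alpha>)
  let ?n = "Suc (length \<alpha>)" and ?\<beta> = "\<alpha> @ [l]"
  have l: "length \<alpha> \<le> N" "length \<alpha> < N" using Cons.prems by auto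
  have e1: "\<forall>\<^sub>F y in nhds x. chart_deriv c k (iter_deriv c \<alpha> (\<lambda>y. G 1 y * chart_deriv c l f y)) y =
     chart_deriv c k (\<lambda>y. \<Sum>j=1..?n. faa c f ?\<beta> j y * G j y) y"
    by (rule eventually_chart_deriv_cong[OF assms(1,2) Cons.IH[OF l(1)]])
  have h: "hn x (faa c f ?\<beta> j)" for j by (rule faa_hol[OF assms(1-3)])
  have hG: "\<forall>\<^sub>F y in nhds x. \<forall>j\<in>{1..?n}. cd_at (\<lambda>y. faa c f ?\<beta> j y * G j y) y"
    using hn_mult[OF h G] l by (intro eventually_ball_finite) (auto simp: hn_iff)
  have e2: "\<forall>\<^sub>F y in nhds x. \<forall>j\<in>{1..?n}. chart_deriv c k (\<lambda>y. faa c f ?\<beta> j y * G j y) y =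
     chart_deriv c k (faa c f ?\<beta> j) y * G j y + faa c f ?\<beta> j y * chart_deriv c k (G j) y"
    using l by (intro eventually_ball_finite ballI ev_deriv_mult[OF assms(1,2)] h G) auto
  have e3: "\<forall>\<^sub>F y in nhds x. \<forall>j\<in>{1..?n}. chart_deriv c k (G j) y = G (Suc j) y * chart_deriv c k f y"
    using l by (intro eventually_ball_finite ballI D) auto
  from e1 e2 e3 hG eventually_fst[OF assms(1,2)] show ?case
  proof eventually_elim
    case (elim y)
    have "iter_deriv c (k # \<alpha>) (\<lambda>y. G 1 y * chart_deriv c l f y) y
      = (\<Sum>j=1..?n. chart_deriv c k (\<lambda>y. faa c f ?\<beta> j y * G j y) y)"
      using elim chart_deriv_sum[OF assms(1), of y "{1..?n}" "\<lambda>j y. faa c f ?\<beta> j y * G j y" k] by simp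
    also have "\<dots> = (\<Sum>j=1..?n. chart_deriv c k (faa c f ?\<beta> j) y * G j y) + (\<Sum>j=1..?n. faa c f ?\<beta> j y * chart_deriv c k f y * G (Suc j) y)"
      using elim by (simp add: sum.distrib[symmetric] algebra_simps)
    \<comment> \<open>Both sums are brought to the range \<open>1..Suc ?n\<close>: the added top
      term vanishes by \<open>faa_gt\<close>, the added bottom term by \<open>faa_0\<close>, since
      the word is not empty.\<close>
    also have "(\<Sum>j=1..?n. chart_deriv c k (faa c f ?\<beta> j) y * G j y) = (\<Sum>j=1..Suc ?n. chart_deriv c k (faa c f ?\<beta> j) y * G j y)"
      by (simp add: faa_gt)
    also have "(\<Sum>j=1..?n. faa c f ?\<beta> j y * chart_deriv c k f y * G (Suc j) y) = (\<Sum>j=Suc 1..Suc ?n. faa c f ?\<beta> (j-1) y * chart_deriv c k f y * G j y)"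
      by (subst sum.shift_bounds_cl_Suc_ivl) simp
    also have "\<dots> = (\<Sum>j=1..Suc ?n. faa c f ?\<beta> (j-1) y * chart_deriv c k f y * G j y)"
      by (subst (2) sum.atLeast_Suc_atMost) (auto simp: faa_0)
    finally show ?case by (simp add: sum.distrib[symmetric] algebra_simps del: sum.cl_ivl_Suc)
  qed
qed

lemma chart_deriv_cmult:
  "c \<in> A \<Longrightarrow> x \<in> fst c \<Longrightarrow> cd_at f x \<Longrightarrow> chart_deriv c k (\<lambda>y. a * f y) x = a * chart_deriv c k f x"
  by (subst chart_deriv_mult) (auto simp: fst_manifold)

lemma chart_deriv_diff:
  assumes "c \<in> A" "x \<in> fst c" "cd_at f x" "cd_at g x"
  shows "chart_deriv c k (\<lambda>y. f y - g y) x = chart_deriv c k f x - chart_deriv c k g x"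
  using chart_deriv_add[OF assms(1,2,3) cd_at_mult[OF cd_at_const[OF fst_manifold[OF assms(1,2)]] assms(4)], of k "-1"]
    chart_deriv_cmult[OF assms(1,2,4), of k "-1"] by simp

lemma cd_at_power: "cd_at f x \<Longrightarrow> cd_at (\<lambda>y. f y ^ n) x"
  by (induction n) (auto intro: cd_at_mult simp: cd_at_manifold)

lemma chart_deriv_power:
  assumes "c \<in> A" "x \<in> fst c" "cd_at f x"
  shows "chart_deriv c k (\<lambda>y. f y ^ Suc n) x = of_nat (Suc n) * f x ^ n * chart_deriv c k f x"
proof (induction n)
  case (Suc n)
  have "chart_deriv c k (\<lambda>y. f y * f y ^ Suc n) x = chart_deriv c k f x * f x ^ Suc n + f x * chart_deriv c k (\<lambda>y. f y ^ Suc n) x"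
    by (rule chart_deriv_mult[OF assms cd_at_power[OF assms(3)]])
  thus ?case unfolding Suc by (simp add: algebra_simps)
qed simp

lemma cd_at_pw: "cd_at f x \<Longrightarrow> cd_at (\<lambda>y. pw w N (f y - a)) x"
  unfolding pw_def using cd_at_add[OF _ cd_at_const, of f x "-a"]
  by (auto intro!: cd_at_sum cd_at_mult[where g="\<lambda>y. inverse (fact _)", folded divide_inverse] cd_at_mult cd_at_power simp: cd_at_manifold)

lemma hn_pw: "hn x f \<Longrightarrow> hn x (\<lambda>y. pw w N (f y - a))"
  unfolding hn_iff by (erule eventually_mono) (rule cd_at_pw)

lemma chart_deriv_pw:
  assumes "c \<in> A" "x \<in> fst c" "cd_at f x"
  shows "chart_deriv c k (\<lambda>y. pw w (Suc N) (f y - a)) x = pw (\<lambda>i. w (Suc i)) N (f x - a) * chart_deriv c k f x"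
proof -
  have m: "x \<in> manifold A" using fst_manifold assms by blast
  have g: "cd_at (\<lambda>y. f y - a) x" using cd_at_add[OF assms(3) cd_at_const[OF m], of "-a"] by simp
  have dg: "chart_deriv c k (\<lambda>y. f y - a) x = chart_deriv c k f x"
    using chart_deriv_diff[OF assms cd_at_const[OF m]] by simp
  have e: "(\<lambda>y. pw w (Suc N) (f y - a)) = (\<lambda>y. \<Sum>i\<le>Suc N. (w i / fact i) * (f y - a) ^ i)"
    by (simp add: pw_def fun_eq_iff)
  have "chart_deriv c k (\<lambda>y. pw w (Suc N) (f y - a)) x = (\<Sum>i\<le>Suc N. chart_deriv c k (\<lambda>y. (w i / fact i) * (f y - a) ^ i) x)"
    unfolding e by (rule chart_deriv_sum[OF assms(1,2)]) (intro cd_at_mult cd_at_const m cd_at_power g)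
  also have "\<dots> = (\<Sum>i\<le>Suc N. (w i / fact i) * chart_deriv c k (\<lambda>y. (f y - a) ^ i) x)"
    by (intro sum.cong refl chart_deriv_cmult assms cd_at_power g)
  also have "\<dots> = (\<Sum>i\<le>N. (w (Suc i) / fact (Suc i)) * chart_deriv c k (\<lambda>y. (f y - a) ^ Suc i) x)"
    by (subst sum.atMost_Suc_shift) simp
  also have "\<dots> = (\<Sum>i\<le>N. w (Suc i) * (f x - a) ^ i / fact i * chart_deriv c k f x)"
  proof (intro sum.cong refl)
    fix i
    have "(of_nat (Suc i) :: complex) \<noteq> 0" by (rule of_nat_neq_0)
    thus "w (Suc i) / fact (Suc i) * chart_deriv c k (\<lambda>y. (f y - a) ^ Suc i) x = w (Suc i) * (f x - a) ^ i / fact i * chart_deriv c k f x"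
      unfolding chart_deriv_power[OF assms(1,2) g] dg fact_Suc by (simp add: field_simps del: of_nat_Suc)
  qed
  finally show ?thesis by (simp add: pw_def sum_distrib_right)
qed


text \<open>A function whose differential is proportional to that of the submersion \<open>f\<close> up to order \<open>q\<close> is a
  function of \<open>f\<close> up to order \<open>q\<close>: this is how a formally closed component \<open>g df\<close> is integrated.\<close>

lemma van_poly_approx:
  assumes c: "c \<in> A" "x \<in> fst c" and f: "hn x f" and l0: "chart_deriv c l0 f x \<noteq> 0"
  shows "hn x g \<Longrightarrow> (\<And>k l. van c q (\<lambda>y. chart_deriv c k g y * chart_deriv c l f y - chart_deriv c l g y * chart_deriv c k f y) x) \<Longrightarrow>
    \<exists>w. van c (Suc q) (\<lambda>y. g y - pw w q (f y - f x)) x"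
proof (induction q arbitrary: g)
  case 0
  have "van c (Suc 0) (\<lambda>y. g y - pw (\<lambda>_. g x) 0 (f y - f x)) x" by (simp add: van_Suc)
  thus ?case by (intro exI[of _ "\<lambda>_. g x"])
next
  case (Suc q)
  note D = hn_D[OF c]
  \<comment> \<open>The candidate for the derivative of g with respect to f, read off in a direction
    where df does not vanish.\<close>
  define h where "h y = chart_deriv c l0 g y / chart_deriv c l0 f y" for y
  have h: "hn x h" unfolding h_def using Suc.prems(1) f l0 by (intro hn_divide D)
  define e where "e k y = chart_deriv c k g y - h y * chart_deriv c k f y" for k y
  have e: "hn x (e k)" for k unfolding e_def using Suc.prems(1) f h by (intro hn_diff hn_mult D)
  have nz: "\<forall>\<^sub>F y in nhds x. chart_deriv c l0 f y \<noteq> 0" by (rule eventually_nonzero[OF hn_cd[OF D[OF f]] l0])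
  \<comment> \<open>The error of dg = h df in direction k is the minor for k and l0 divided by a
    nonvanishing derivative of f, so it vanishes to the order given by the hypothesis.\<close>
  have ve: "van c (Suc q) (e k) x" for k
  proof (rule van_cong[OF c])
    show "\<forall>\<^sub>F y in nhds x. (chart_deriv c k g y * chart_deriv c l0 f y - chart_deriv c l0 g y * chart_deriv c k f y) * inverse (chart_deriv c l0 f y) = e k y"
      using nz by eventually_elim (simp add: e_def h_def field_simps)
    show "van c (Suc q) (\<lambda>y. (chart_deriv c k g y * chart_deriv c l0 f y - chart_deriv c l0 g y * chart_deriv c k f y) * inverse (chart_deriv c l0 f y)) x"
      using Suc.prems f l0 by (intro van_mult c hn_diff hn_mult hn_inverse D) auto
  qed
  have De: "\<forall>\<^sub>F y in nhds x. chart_deriv c l (e k) y = chart_deriv c l (chart_deriv c k g) y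
      - (chart_deriv c l h y * chart_deriv c k f y + h y * chart_deriv c l (chart_deriv c k f) y)" for k l
    using eventually_fst[OF c] h[unfolded hn_iff] D[OF f, of k, unfolded hn_iff] D[OF Suc.prems(1), of k, unfolded hn_iff]
    by eventually_elim (simp add: e_def[abs_def] chart_deriv_diff chart_deriv_mult cd_at_mult c(1))
  \<comment> \<open>Antisymmetrizing the derivatives of \<open>e\<close> removes the second
    derivatives of g and f and leaves the minors of h and f. This costs one order, and h meets the
    induction hypothesis.\<close>
  have "van c q (\<lambda>y. chart_deriv c k h y * chart_deriv c l f y - chart_deriv c l h y * chart_deriv c k f y) x" for k l
  proof (rule van_cong[OF c])
    show "\<forall>\<^sub>F y in nhds x. chart_deriv c l (e k) y - chart_deriv c k (e l) y =
        chart_deriv c k h y * chart_deriv c l f y - chart_deriv c l h y * chart_deriv c k f y"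
      using De[of l k] De[of k l] eventually_fst[OF c] hn_eventually[OF f] hn_eventually[OF Suc.prems(1)]
    proof eventually_elim
      case (elim y)
      show ?case
        unfolding elim(1,2) chart_deriv_hol(2)[OF c(1) elim(4,3), of l k] chart_deriv_hol(2)[OF c(1) elim(5,3), of l k]
        by (simp add: algebra_simps)
    qed
    show "van c q (\<lambda>y. chart_deriv c l (e k) y - chart_deriv c k (e l) y) x"
      using ve by (intro van_diff c D e) (auto simp: van_Suc)
  qed
  from Suc.IH[OF h this] obtain w' where w': "van c (Suc q) (\<lambda>y. h y - pw w' q (f y - f x)) x" by blast
  \<comment> \<open>The polynomial for h is integrated: its coefficients move up by one, and the
    constant term is the value of g at x.\<close>
  let ?w = "case_nat (g x) w'"
  let ?d = "\<lambda>y. g y - pw ?w (Suc q) (f y - f x)"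
  have "van c (Suc q) (chart_deriv c k ?d) x" for k
  proof (rule van_cong[OF c])
    show "\<forall>\<^sub>F y in nhds x. e k y + (h y - pw w' q (f y - f x)) * chart_deriv c k f y = chart_deriv c k ?d y"
      using f[unfolded hn_iff] Suc.prems(1)[unfolded hn_iff] eventually_fst[OF c]
      by eventually_elim (simp add: chart_deriv_diff chart_deriv_pw cd_at_pw c(1) e_def algebra_simps)
    show "van c (Suc q) (\<lambda>y. e k y + (h y - pw w' q (f y - f x)) * chart_deriv c k f y) x"
      by (intro van_add van_mult c e hn_mult hn_diff h hn_pw f D ve w')
  qed
  hence "van c (Suc (Suc q)) ?d x" by (simp add: van_Suc[of c "Suc q"])
  thus ?case by (intro exI[of _ ?w])
qed

lemma pw_chain:
  assumes "c \<in> A" "x \<in> fst c" "hn x f" "j \<le> N"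
  shows "\<forall>\<^sub>F y in nhds x. chart_deriv c k (\<lambda>y. pw (\<lambda>i. w (j + i)) (Suc N - j) (f y - a)) y =
    pw (\<lambda>i. w (Suc j + i)) (Suc N - Suc j) (f y - a) * chart_deriv c k f y"
  using assms(3)[unfolded hn_iff] eventually_fst[OF assms(1,2)]
proof eventually_elim
  case (elim y)
  have "Suc N - j = Suc (N - j)" using assms(4) by simp
  thus ?case using chart_deriv_pw[OF assms(1) elim(2,1), of k "\<lambda>i. w (j + i)" "N - j" a] by simp
qed

lemma iter_deriv_pw:
  assumes "c \<in> A" "x \<in> fst c" "hn x f" "length \<alpha> \<le> N"
  shows "iter_deriv c \<alpha> (\<lambda>y. pw (\<lambda>i. w (Suc i)) N (f y - f x) * chart_deriv c l f y) x =
    (\<Sum>j=1..Suc (length \<alpha>). faa c f (\<alpha> @ [l]) j x * w j)"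
proof -
  let ?G = "\<lambda>j y. pw (\<lambda>i. w (j + i)) (Suc N - j) (f y - f x)"
  have "\<forall>\<^sub>F y in nhds x. iter_deriv c \<alpha> (\<lambda>y. ?G 1 y * chart_deriv c l f y) y = (\<Sum>j=1..Suc (length \<alpha>). faa c f (\<alpha> @ [l]) j y * ?G j y)"
    by (rule iter_deriv_chain[OF assms(1-3) _ _ assms(4)]) (use hn_pw[OF assms(3)] pw_chain[OF assms(1-3)] in \<open>simp_all add: Suc_diff_le\<close>)
  from eventually_nhds_x_imp_x[OF this] show ?thesis by simp
qed

text \<open>The function on the right is the j-th power of f - f x divided by j!, whose outer
  function has only its j-th derivative nonzero at the point. As an iterated derivative the
  coefficient is visibly symmetric in the letters of the word, which the recursion hides.\<close>

lemma faa_eq_iter_deriv: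
  assumes "c \<in> A" "x \<in> fst c" "hn x f" "\<beta> \<noteq> []" "1 \<le> j" "j \<le> length \<beta>"
  shows "faa c f \<beta> j x = iter_deriv c \<beta> (\<lambda>y. pw (\<lambda>i. if i = j then 1 else 0) (length \<beta>) (f y - f x)) x"
proof -
  obtain \<alpha> l where b: "\<beta> = \<alpha> @ [l]" using assms(4) by (meson rev_exhaust)
  let ?w = "\<lambda>i. if i = j then 1 else 0 :: complex"
  have "iter_deriv c \<beta> (\<lambda>y. pw ?w (length \<beta>) (f y - f x)) x = iter_deriv c \<alpha> (\<lambda>y. pw (\<lambda>i. ?w (Suc i)) (length \<alpha>) (f y - f x) * chart_deriv c l f y) x"
    using pw_chain[OF assms(1-3), of 0 "length \<alpha>" l ?w "f x"] iter_deriv_cong[OF assms(1,2)]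
    by (simp add: b iter_deriv_append)
  also have "\<dots> = (\<Sum>i=1..length \<beta>. faa c f \<beta> i x * ?w i)"
    using iter_deriv_pw[OF assms(1-3) order_refl, of \<alpha> ?w l] by (simp add: b)
  also have "\<dots> = faa c f \<beta> j x" using assms(5,6) by (simp add: if_distrib cong: if_cong)
  finally show ?thesis by simp
qed

lemma faa_perm:
  assumes "c \<in> A" "x \<in> fst c" "hn x f" "mset \<beta> = mset \<beta>'"
  shows "faa c f \<beta> j x = faa c f \<beta>' j x"
proof -
  have len: "length \<beta> = length \<beta>'" using assms(4) by (metis size_mset)
  consider "\<beta> = []" | "\<beta> \<noteq> []" "j = 0" | "j > length \<beta>" | "\<beta> \<noteq> []" "1 \<le> j" "j \<le> length \<beta>" by linarith
  thus ?thesis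
  proof cases
    case 4
    moreover have "\<beta>' \<noteq> []" "j \<le> length \<beta>'" using 4 len by auto
    ultimately show ?thesis
      using eventually_nhds_x_imp_x[OF iter_deriv_perm[OF assms(1,2) hn_pw[OF assms(3)] assms(4)]]
      by (simp add: faa_eq_iter_deriv[OF assms(1-3)] len)
  qed (use assms(4) len in \<open>auto simp: faa_0 faa_gt\<close>)
qed

text \<open>The identity theorem, reduced to one variable by restricting f to complex lines through
  the point; vanishing to all orders is inherited by the restrictions.\<close>

lemma van_infinite:
  assumes "c \<in> A" "x \<in> fst c" "hn x f" "\<And>p. van c p f x"
  shows "\<forall>\<^sub>F y in nhds x. f y = 0"
proof -
  obtain V where V: "open V" "x \<in> V" "\<And>y. y \<in> V \<Longrightarrow> cd_at f y"
    using assms(3) unfolding hn_iff eventually_nhds by blast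
  define V' where "V' = V \<inter> fst c"
  have V': "open V'" "x \<in> V'" "\<And>y. y \<in> V' \<Longrightarrow> cd_at f y" "\<And>y. y \<in> V' \<Longrightarrow> y \<in> fst c"
    using V assms(1,2) chart_open(1)[OF assms(1)] by (auto simp: V'_def)
  let ?z = "snd c x"
  have "open (snd c ` V')" unfolding V'_def by (rule open_chart_image[OF assms(1) V(1)])
  moreover have "?z \<in> snd c ` V'" using V'(2) by blast
  ultimately obtain e where e: "e > 0" "ball ?z e \<subseteq> snd c ` V'" by (meson open_contains_ball)
  have inV: "chart_inv c z \<in> V'" "snd c (chart_inv c z) = z" if "z \<in> ball ?z e" for z
    using e(2) that V'(4) by (auto simp: chart_inv_left[OF assms(1)] subset_iff image_iff)
  \<comment> \<open>Each line is used on the disc of radius 2, so that the parameter value 1 is an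
    interior point; hence the bound e / 2.\<close>
  have zero: "f (chart_inv c (?z + v)) = 0" if v: "norm v < e / 2" for v
  proof -
    have b: "?z + t *s v \<in> ball ?z e" if "t \<in> ball 0 2" for t
    proof -
      have "cmod t * norm v \<le> 2 * norm v" using that by (intro mult_right_mono) auto
      thus ?thesis using v by (simp add: dist_norm norm_smult_vec)
    qed
    define \<gamma> where "\<gamma> t = chart_inv c (?z + t *s v)" for t
    have der: "((\<lambda>t. F (\<gamma> t)) has_field_derivative (\<Sum>k\<in>UNIV. v $ k * chart_deriv c k F (\<gamma> t))) (at t)"
      if F: "\<And>y. y \<in> V' \<Longrightarrow> cd_at F y" and t: "t \<in> ball 0 2" for F t
    proof -
      have y: "\<gamma> t \<in> V'" "snd c (\<gamma> t) = ?z + t *s v" using inV[OF b[OF t]] by (auto simp: \<gamma>_def)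
      have "cdiff_at (\<lambda>z. F (chart_inv c z)) (?z + t *s v)"
        using F[OF y(1)] cd_at_iff[OF assms(1) V'(4)[OF y(1)]] y(2) by simp
      from cdiff_at_line[OF cdiff_at_derivative[OF this]]
      show ?thesis unfolding \<gamma>_def[symmetric] chart_deriv_def y(2)
        by (simp add: \<gamma>_def sum_distrib_left mult.assoc)
    qed
    have derivs: "(deriv ^^ n) (\<lambda>t. F (\<gamma> t)) 0 = 0"
      if "\<And>y. y \<in> V' \<Longrightarrow> cd_at F y" "\<And>p. van c p F x" for n F
      using that
    proof (induction n arbitrary: F)
      case 0
      have "F x = 0" using 0(2)[of "Suc 0"] by (simp add: van_Suc)
      thus ?case by (simp add: \<gamma>_def chart_inv_left[OF assms(1,2)])
    next
      case (Suc n)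
      \<comment> \<open>Differentiation along the line is the derivative in direction v. It
        preserves vanishing to all orders, which is why the induction is over all such functions at
        once.\<close>
      define G where "G y = (\<Sum>k\<in>UNIV. v $ k * chart_deriv c k F y)" for y
      have hF: "hn y F" if "y \<in> V'" for y
        unfolding hn_iff using eventually_nhds_in_open[OF V'(1) that] by (rule eventually_mono) (rule Suc.prems(1))
      have hG: "hn y G" if "y \<in> V'" for y
        unfolding G_def using that V'(4) fst_manifold[OF assms(1)]
        by (intro hn_sum hn_mult hn_const hn_D assms(1) hF) auto
      have "van c p G x" for p
        unfolding G_def using Suc.prems(2)[of "Suc p"] fst_manifold[OF assms(1,2)]
        by (intro van_sum van_mult' assms(1,2) hn_mult hn_const hn_D hF V'(2)) (auto simp: van_Suc)
      hence IH: "(deriv ^^ n) (\<lambda>t. G (\<gamma> t)) 0 = 0" using Suc.IH[of G] hG hn_cd by blast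
      have "\<forall>\<^sub>F t in nhds 0. t \<in> ball 0 (2::real)" by (intro eventually_nhds_in_open) auto
      hence "\<forall>\<^sub>F t in nhds 0. deriv (\<lambda>t. F (\<gamma> t)) t = G (\<gamma> t)"
      proof -
        have "\<forall>\<^sub>F t in nhds (0::complex). t \<in> ball 0 2" by (intro eventually_nhds_in_open) auto
        thus ?thesis by eventually_elim (auto simp: G_def intro!: DERIV_imp_deriv der[OF Suc.prems(1)])
      qed
      from higher_deriv_cong_ev[OF this refl, of n] IH
      show ?case by (simp add: funpow_Suc_right del: funpow.simps)
    qed
    have "(\<lambda>t. f (\<gamma> t)) holomorphic_on ball 0 2"
      unfolding holomorphic_on_open[OF open_ball] using der[OF V'(3)] by blast
    from holomorphic_fun_eq_0_on_ball[OF this, of 1] derivs[OF V'(3) assms(4)]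
    show ?thesis by (simp add: \<gamma>_def)
  qed
  have "\<forall>\<^sub>F z in nhds ?z. z \<in> ball ?z (e/2)" using e(1) by (intro eventually_nhds_in_open) auto
  hence "\<forall>\<^sub>F z in nhds ?z. f (chart_inv c z) = 0"
  proof eventually_elim
    case (elim z)
    thus ?case using zero[of "z - ?z"] by (simp add: dist_norm norm_minus_commute)
  qed
  from eventually_chart[OF assms(1,2) this] eventually_fst[OF assms(1,2)]
  show ?thesis by eventually_elim (simp add: chart_inv_left[OF assms(1)])
qed


text \<open>The test vectors make the system triangular at \<open>x0\<close> for the rank function \<open>\<rho>\<close>, and they are supported
  in \<open>K\<close>, so the pivots can be taken in \<open>K\<close>.\<close>

lemma elimination:
  fixes lam :: "'i \<Rightarrow> 'j \<Rightarrow> 'm \<Rightarrow> complex" and \<rho> :: "'i \<Rightarrow> nat"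
  assumes "finite J" "K \<subseteq> J" "x0 \<in> manifold A"
  shows "finite I \<Longrightarrow> (\<And>i j. i \<in> I \<Longrightarrow> j \<in> J \<Longrightarrow> hn x0 (lam i j)) \<Longrightarrow>
    (\<And>i. i \<in> I \<Longrightarrow> \<exists>w. (\<forall>j\<in>J - K. w j = 0) \<and> (\<Sum>j\<in>J. lam i j x0 * w j) \<noteq> 0 \<and>
        (\<forall>i'\<in>I. i' \<noteq> i \<longrightarrow> \<rho> i' \<le> \<rho> i \<longrightarrow> (\<Sum>j\<in>J. lam i' j x0 * w j) = 0)) \<Longrightarrow>
    \<exists>K0 b. K0 \<subseteq> K \<and> card K0 = card I \<and> (\<forall>j\<in>J - K0. \<forall>k\<in>K0. hn x0 (b j k)) \<and>
      (\<forall>\<^sub>F x in nhds x0. \<forall>w. (\<forall>i\<in>I. (\<Sum>j\<in>J. lam i j x * w j) = 0) \<longleftrightarrow>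
         (\<forall>k\<in>K0. w k = (\<Sum>j\<in>J - K0. b j k x * w j)))"
proof (induction "card I" arbitrary: I)
  case 0
  hence "I = {}" by simp
  thus ?case by (intro exI[of _ "{}"]) auto
next
  case (Suc N)
  have ne: "I \<noteq> {}" "finite I" using Suc by auto
  \<comment> \<open>An equation of maximal rank is treated last, because its test vector must solve
    all the others.\<close>
  then obtain i0 where i0: "i0 \<in> I" "\<And>i. i \<in> I \<Longrightarrow> \<rho> i \<le> \<rho> i0"
    using Max_in[of "\<rho> ` I"] by (metis (no_types, lifting) Max_ge finite_imageI image_iff image_is_empty)
  define I' where "I' = I - {i0}"
  have I': "I = insert i0 I'" "i0 \<notin> I'" "finite I'" "card I' = N" "I' \<subseteq> I"
    using i0 ne Suc.hyps(2) by (auto simp: I'_def)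
  have "\<exists>K0 b. K0 \<subseteq> K \<and> card K0 = card I' \<and> (\<forall>j\<in>J - K0. \<forall>k\<in>K0. hn x0 (b j k)) \<and>
      (\<forall>\<^sub>F x in nhds x0. \<forall>w. (\<forall>i\<in>I'. (\<Sum>j\<in>J. lam i j x * w j) = 0) \<longleftrightarrow>
         (\<forall>k\<in>K0. w k = (\<Sum>j\<in>J - K0. b j k x * w j)))"
  proof (rule Suc.hyps(1)[OF I'(4)[symmetric] I'(3)])
    show "hn x0 (lam i j)" if "i \<in> I'" "j \<in> J" for i j using that I'(5) Suc.prems(2) by blast
    show "\<exists>w. (\<forall>j\<in>J - K. w j = 0) \<and> (\<Sum>j\<in>J. lam i j x0 * w j) \<noteq> 0 \<and>
        (\<forall>i'\<in>I'. i' \<noteq> i \<longrightarrow> \<rho> i' \<le> \<rho> i \<longrightarrow> (\<Sum>j\<in>J. lam i' j x0 * w j) = 0)" if "i \<in> I'" for i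
      using Suc.prems(3)[of i] that I'(5) by blast
  qed
  then obtain K' b' where K': "K' \<subseteq> K" "card K' = card I'" "\<And>j k. j \<in> J - K' \<Longrightarrow> k \<in> K' \<Longrightarrow> hn x0 (b' j k)"
    and ev: "\<forall>\<^sub>F x in nhds x0. \<forall>w. (\<forall>i\<in>I'. (\<Sum>j\<in>J. lam i j x * w j) = 0) \<longleftrightarrow>
         (\<forall>k\<in>K'. w k = (\<Sum>j\<in>J - K'. b' j k x * w j))" by blast
  have "K' \<subseteq> J" using K'(1) assms(2) by (rule order_trans)
  note fK = finite_subset[OF this assms(1)] this assms(1)
  \<comment> \<open>The last equation after the others have been solved for the pivots
    \<open>K'\<close>.\<close>
  define mu where "mu j x = lam i0 j x + (\<Sum>k\<in>K'. lam i0 k x * b' j k x)" for j x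
  have hmu: "hn x0 (mu j)" if "j \<in> J - K'" for j
    unfolding mu_def
  proof (intro hn_add hn_sum hn_mult assms(3))
    show "hn x0 (lam i0 j)" using that by (intro Suc.prems(2) i0(1)) simp
    show "hn x0 (lam i0 k)" if "k \<in> K'" for k using that fK(2) by (intro Suc.prems(2) i0(1)) blast
    show "hn x0 (b' j k)" if "k \<in> K'" for k by (rule K'(3)[OF \<open>j \<in> J - K'\<close> that])
  qed
  have subst: "(\<Sum>j\<in>J. lam i0 j x * w j) = (\<Sum>j\<in>J - K'. mu j x * w j)"
    if "\<forall>k\<in>K'. w k = (\<Sum>j\<in>J - K'. b' j k x * w j)" for x w
  proof -
    have "(\<Sum>j\<in>J. lam i0 j x * w j) = (\<Sum>j\<in>J - K'. lam i0 j x * w j) + (\<Sum>k\<in>K'. lam i0 k x * w k)"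
      using fK by (simp add: sum.subset_diff)
    also have "(\<Sum>k\<in>K'. lam i0 k x * w k) = (\<Sum>k\<in>K'. \<Sum>j\<in>J - K'. lam i0 k x * b' j k x * w j)"
      using that by (intro sum.cong refl) (simp add: sum_distrib_left mult.assoc)
    also have "\<dots> = (\<Sum>j\<in>J - K'. \<Sum>k\<in>K'. lam i0 k x * b' j k x * w j)" by (rule sum.swap)
    finally show ?thesis by (simp add: mu_def sum.distrib[symmetric] algebra_simps sum_distrib_left sum_distrib_right)
  qed
  \<comment> \<open>The test vector of \<open>i0\<close> solves the other equations, hence has their
    solved form, while the reduced last equation is nonzero on it. Its support in K places the new
    pivot there.\<close>
  obtain j1 where j1: "j1 \<in> J - K'" "j1 \<in> K" "mu j1 x0 \<noteq> 0"
  proof -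
    obtain w where w: "\<forall>j\<in>J - K. w j = 0" "(\<Sum>j\<in>J. lam i0 j x0 * w j) \<noteq> 0"
       "\<forall>i'\<in>I. i' \<noteq> i0 \<longrightarrow> \<rho> i' \<le> \<rho> i0 \<longrightarrow> (\<Sum>j\<in>J. lam i' j x0 * w j) = 0"
      using Suc.prems(3)[OF i0(1)] by blast
    have "\<forall>i\<in>I'. (\<Sum>j\<in>J. lam i j x0 * w j) = 0" using w(3) i0(2) by (auto simp: I'_def)
    hence "\<forall>k\<in>K'. w k = (\<Sum>j\<in>J - K'. b' j k x0 * w j)" using eventually_nhds_x_imp_x[OF ev] by blast
    from subst[OF this] w(2) have "(\<Sum>j\<in>J - K'. mu j x0 * w j) \<noteq> 0" by simp
    then obtain j where "j \<in> J - K'" "mu j x0 * w j \<noteq> 0" by (meson sum.neutral)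
    thus thesis using w(1) that by (metis DiffD1 DiffI mult_eq_0_iff)
  qed
  define K0 where "K0 = insert j1 K'"
  have JK: "J - K' = insert j1 (J - K0)" "j1 \<notin> J - K0" "finite (J - K0)" using j1 fK by (auto simp: K0_def)
  \<comment> \<open>The row of the new pivot solves the last equation; in the old rows the new pivot
    is substituted.\<close>
  define b where "b j k x = (if k = j1 then - mu j x / mu j1 x else b' j k x - b' j1 k x * (mu j x / mu j1 x))" for j k x
  have "K0 \<subseteq> K" using j1(2) K'(1) by (simp add: K0_def)
  moreover have "card K0 = card I" using j1(1) K'(2) I'(1,2,3) fK(1) by (simp add: K0_def)
  moreover have "hn x0 (b j k)" if "j \<in> J - K0" "k \<in> K0" for j k
  proof (cases "k = j1")
    case True
    thus ?thesis unfolding b_def using that(1) j1(1,3) by (auto intro!: hn_divide hn_minus hmu simp: K0_def)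
  next
    case False
    have k: "k \<in> K'" "j \<in> J - K'" using False that by (auto simp: K0_def)
    have "hn x0 (\<lambda>x. b' j k x - b' j1 k x * (mu j x / mu j1 x))"
      by (intro hn_diff hn_mult hn_divide K'(3) hmu k j1)
    thus ?thesis unfolding b_def using False by simp
  qed
  moreover have "\<forall>\<^sub>F x in nhds x0. mu j1 x \<noteq> 0" by (rule eventually_nonzero[OF hn_cd[OF hmu[OF j1(1)]] j1(3)])
  with ev have "\<forall>\<^sub>F x in nhds x0. \<forall>w. (\<forall>i\<in>I. (\<Sum>j\<in>J. lam i j x * w j) = 0) \<longleftrightarrow>
         (\<forall>k\<in>K0. w k = (\<Sum>j\<in>J - K0. b j k x * w j))"
  proof eventually_elim
    case (elim x)
    show ?case
    proof
      fix w
      let ?E' = "\<forall>k\<in>K'. w k = (\<Sum>j\<in>J - K'. b' j k x * w j)"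
      have "(\<forall>i\<in>I. (\<Sum>j\<in>J. lam i j x * w j) = 0) \<longleftrightarrow> ?E' \<and> (\<Sum>j\<in>J. lam i0 j x * w j) = 0"
        unfolding I'(1) ball_simps using elim(1) by blast
      also have "\<dots> \<longleftrightarrow> ?E' \<and> (\<Sum>j\<in>J - K'. mu j x * w j) = 0" using subst[of w x] by (intro conj_cong refl) simp
      also have "(\<Sum>j\<in>J - K'. mu j x * w j) = mu j1 x * w j1 + (\<Sum>j\<in>J - K0. mu j x * w j)"
        unfolding JK(1) using JK by simp
      also have "\<dots> = 0 \<longleftrightarrow> w j1 = (\<Sum>j\<in>J - K0. b j j1 x * w j)"
      proof -
        have "(\<Sum>j\<in>J - K0. b j j1 x * w j) = - (\<Sum>j\<in>J - K0. mu j x * w j) / mu j1 x"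
          by (simp add: b_def sum_divide_distrib sum_negf)
        thus ?thesis using elim(2) by (auto simp: field_simps add_eq_0_iff)
      qed
      also have "?E' \<and> w j1 = (\<Sum>j\<in>J - K0. b j j1 x * w j) \<longleftrightarrow> (\<forall>k\<in>K0. w k = (\<Sum>j\<in>J - K0. b j k x * w j))"
      proof -
        have "(\<Sum>j\<in>J - K'. b' j k x * w j) = (\<Sum>j\<in>J - K0. b j k x * w j)"
          if "w j1 = (\<Sum>j\<in>J - K0. b j j1 x * w j)" "k \<in> K'" for k
        proof -
          have k: "k \<noteq> j1" using that j1 by auto
          have "(\<Sum>j\<in>J - K'. b' j k x * w j) = b' j1 k x * w j1 + (\<Sum>j\<in>J - K0. b' j k x * w j)"
            unfolding JK(1) using JK by simp
          also have "b' j1 k x * w j1 = (\<Sum>j\<in>J - K0. b' j1 k x * (b j j1 x * w j))"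
            by (subst that(1)) (simp add: sum_distrib_left)
          also have "\<dots> + (\<Sum>j\<in>J - K0. b' j k x * w j) = (\<Sum>j\<in>J - K0. b j k x * w j)"
            unfolding sum.distrib[symmetric] using k by (intro sum.cong refl) (simp add: b_def algebra_simps)
          finally show ?thesis .
        qed
        thus ?thesis by (auto simp: K0_def)
      qed
      finally show "(\<forall>i\<in>I. (\<Sum>j\<in>J. lam i j x * w j) = 0) \<longleftrightarrow> (\<forall>k\<in>K0. w k = (\<Sum>j\<in>J - K0. b j k x * w j))" .
    qed
  qed
  ultimately show ?case by blast
qed

end

section \<open>Local branches of a web and sections of \<open>A\<close>\<close>

context atlas begin

lemma hol_near_cong_fun: "\<forall>\<^sub>F y in nhds x. f y = g y \<Longrightarrow> hn x g \<Longrightarrow> hn x f"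
  using hn_cong by blast

lemma tangent_of_apply:
  "tangent_of A c x a f = (if hn x f then \<Sum>i\<in>UNIV. a $ i * chart_deriv c i f x else 0)"
  by (simp add: tangent_of_def chart_deriv_def)

lemma coord_vec_apply: "coord_vec A c k x f = (if hn x f then chart_deriv c k f x else 0)"
  by (simp add: coord_vec_def tangent_of_apply axis_def if_distrib if_distribR cong: if_cong)

lemma coord_vec_tangent: "c \<in> A \<Longrightarrow> x \<in> fst c \<Longrightarrow> coord_vec A c k x \<in> tangent_space A x"
  unfolding tangent_space_def coord_vec_def by blast

lemma tangent_of_tangent: "c \<in> A \<Longrightarrow> x \<in> fst c \<Longrightarrow> tangent_of A c x a \<in> tangent_space A x"
  unfolding tangent_space_def by blast

lemma tangent_zero: "c \<in> A \<Longrightarrow> x \<in> fst c \<Longrightarrow> (\<lambda>f. 0) \<in> tangent_space A x"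
proof -
  assume c: "c \<in> A" "x \<in> fst c"
  have "tangent_of A c x 0 = (\<lambda>f. 0)" by (simp add: fun_eq_iff tangent_of_apply)
  thus ?thesis using tangent_of_tangent[OF c, of 0] by simp
qed

text \<open>The chain rule converts the coefficients of v from one chart to another, and the new
  ones are its values on the coordinate functions.\<close>

lemma tangent_expand:
  assumes "v \<in> tangent_space A x" "c \<in> A" "x \<in> fst c"
  shows "v = tangent_of A c x (\<chi> l. v (\<lambda>y. snd c y $ l))"
proof -
  obtain c' a where c': "c' \<in> A" "x \<in> fst c'" "v = tangent_of A c' x a" using assms(1) by (auto simp: tangent_space_def)
  have "v f = tangent_of A c x (\<chi> l. v (\<lambda>y. snd c y $ l)) f" for f
  proof (cases "hn x f")
    case True
    have "v f = (\<Sum>i\<in>UNIV. a $ i * (\<Sum>l\<in>UNIV. chart_deriv c l f x * chart_deriv c' i (\<lambda>y. snd c y $ l) x))"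
      using True by (simp add: c'(3) tangent_of_apply chart_deriv_change[OF assms(2) c'(1) assms(3) c'(2) hn_cd])
    also have "\<dots> = (\<Sum>l\<in>UNIV. (\<Sum>i\<in>UNIV. a $ i * chart_deriv c' i (\<lambda>y. snd c y $ l) x) * chart_deriv c l f x)"
      by (simp add: sum_distrib_left sum_distrib_right, subst sum.swap, simp add: algebra_simps)
    finally show ?thesis using True hn_coord[OF assms(2,3)] by (simp add: c'(3) tangent_of_apply)
  qed (simp add: c'(3) tangent_of_apply)
  thus ?thesis by blast
qed

lemma tangent_apply:
  assumes "v \<in> tangent_space A x" "c \<in> A" "x \<in> fst c" "hn x f"
  shows "v f = (\<Sum>l\<in>UNIV. v (\<lambda>y. snd c y $ l) * chart_deriv c l f x)"
  by (subst tangent_expand[OF assms(1-3)]) (simp add: tangent_of_apply assms(4))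

lemma tangent_not_hn: "v \<in> tangent_space A x \<Longrightarrow> \<not> hn x f \<Longrightarrow> v f = 0"
  by (auto simp: tangent_space_def tangent_of_apply)

lemma tangent_manifold: "v \<in> tangent_space A x \<Longrightarrow> x \<in> manifold A"
  by (auto simp: tangent_space_def fst_manifold)

lemma tangent_chart:
  assumes "v \<in> tangent_space A x"
  obtains c where "c \<in> A" "x \<in> fst c"
  using tangent_manifold[OF assms] manifold_chart by blast

lemma tangent_cong:
  assumes "v \<in> tangent_space A x" "\<forall>\<^sub>F y in nhds x. f y = g y"
  shows "v f = v g"
proof -
  obtain c where c: "c \<in> A" "x \<in> fst c" using tangent_chart[OF assms(1)] by blast
  show ?thesis
    using tangent_apply[OF assms(1) c] hn_cong[OF assms(2)] tangent_not_hn[OF assms(1)] chart_deriv_cong[OF c assms(2)]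
    by (cases "hn x f") auto
qed

lemma tangent_add:
  assumes "v \<in> tangent_space A x" "hn x f" "hn x g"
  shows "v (\<lambda>y. f y + g y) = v f + v g"
proof -
  obtain c where c: "c \<in> A" "x \<in> fst c" using tangent_chart[OF assms(1)] by blast
  show ?thesis
    using assms by (simp add: tangent_apply[OF assms(1) c] hn_add chart_deriv_add[OF c hn_cd hn_cd] sum.distrib algebra_simps)
qed

lemma tangent_mult:
  assumes "v \<in> tangent_space A x" "hn x f" "hn x g"
  shows "v (\<lambda>y. f y * g y) = v f * g x + f x * v g"
proof -
  obtain c where c: "c \<in> A" "x \<in> fst c" using tangent_chart[OF assms(1)] by blast
  show ?thesis
    using assms by (simp add: tangent_apply[OF assms(1) c] hn_mult chart_deriv_mult[OF c hn_cd hn_cd] sum.distrib algebra_simps sum_distrib_left)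
qed

lemma tangent_const: "v \<in> tangent_space A x \<Longrightarrow> v (\<lambda>y. a) = 0"
  by (auto simp: tangent_space_def tangent_of_apply)

lemma tangent_cmult: "v \<in> tangent_space A x \<Longrightarrow> hn x f \<Longrightarrow> v (\<lambda>y. a * f y) = a * v f"
  by (subst tangent_mult) (auto simp: tangent_const hn_manifold)

lemma tangent_diff:
  assumes "v \<in> tangent_space A x" "hn x f" "hn x g"
  shows "v (\<lambda>y. f y - g y) = v f - v g"
  using tangent_add[OF assms(1,2) hn_minus[OF assms(3)]] tangent_cmult[OF assms(1,3), of "-1"] by simp

lemma tangent_sum:
  assumes "v \<in> tangent_space A x" "\<And>i. i \<in> I \<Longrightarrow> hn x (f i)"
  shows "v (\<lambda>y. \<Sum>i\<in>I. f i y) = (\<Sum>i\<in>I. v (f i))"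
  using assms(2)
proof (induction I rule: infinite_finite_induct)
  case (insert i I)
  have "hn x (\<lambda>y. \<Sum>i\<in>I. f i y)" using insert.prems by (intro hn_sum tangent_manifold[OF assms(1)]) auto
  thus ?case using insert tangent_add[OF assms(1), of "f i" "\<lambda>y. \<Sum>i\<in>I. f i y"] by simp
qed (auto simp: tangent_const[OF assms(1)])

lemma tangent_lin:
  assumes "v \<in> tangent_space A x" "w \<in> tangent_space A x"
  shows "v + a *\<^sub>F w \<in> tangent_space A x"
proof -
  obtain c where c: "c \<in> A" "x \<in> fst c" using tangent_chart[OF assms(1)] by blast
  obtain p q where "v = tangent_of A c x p" "w = tangent_of A c x q"
    using tangent_expand[OF _ c] assms by metis
  hence "v + a *\<^sub>F w = tangent_of A c x (p + a *s q)"
    by (auto simp: fun_eq_iff tangent_of_apply fscale_def sum.distrib algebra_simps sum_distrib_left)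
  thus ?thesis using tangent_of_tangent[OF c] by simp
qed

end

text \<open>The foliations can be numbered, and given by first integrals \<open>f i\<close>, only
  locally. One chart covering V is fixed for the nonvanishing of the differentials and for writing
  equations; jets still refer to all charts.\<close>

locale local_web = atlas A for A :: "('m::t2_space, 'n::finite) chart set" +
  fixes W :: "'m \<Rightarrow> 'm hyp set" and d :: nat and c\<^sub>0 :: "('m, 'n) chart" and V :: "'m set" and f :: "nat \<Rightarrow> 'm \<Rightarrow> complex"
  assumes c0: "c\<^sub>0 \<in> A" and V: "open V" "V \<subseteq> fst c\<^sub>0"
    and f: "\<And>i x. i < d \<Longrightarrow> x \<in> V \<Longrightarrow> hn x (f i)"
    and df: "\<And>i x. i < d \<Longrightarrow> x \<in> V \<Longrightarrow> \<exists>l. chart_deriv c\<^sub>0 l (f i) x \<noteq> 0"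
    and inj: "\<And>x. x \<in> V \<Longrightarrow> inj_on (\<lambda>i. {v \<in> tangent_space A x. v (f i) = 0}) {..<d}"
    and W: "\<And>x. x \<in> V \<Longrightarrow> W x = (\<lambda>i. {v \<in> tangent_space A x. v (f i) = 0}) ` {..<d}"
begin

definition T :: "nat \<Rightarrow> 'm \<Rightarrow> 'm hyp"
  where "T i x = {v \<in> tangent_space A x. v (f i) = 0}"

lemma injT: "x \<in> V \<Longrightarrow> i < d \<Longrightarrow> j < d \<Longrightarrow> T i x = T j x \<Longrightarrow> i = j"
  using inj[of x] by (auto simp: inj_on_def T_def)

lemma WT: "x \<in> V \<Longrightarrow> W x = (\<lambda>i. T i x) ` {..<d}"
  using W by (auto simp: T_def)

lemma T_in_W: "x \<in> V \<Longrightarrow> i < d \<Longrightarrow> T i x \<in> W x"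
  using WT by auto

lemma V_c0: "x \<in> V \<Longrightarrow> x \<in> fst c\<^sub>0" and V_manifold: "x \<in> V \<Longrightarrow> x \<in> manifold A"
  using V(2) fst_manifold[OF c0] by auto

lemma ev_V: "x \<in> V \<Longrightarrow> \<forall>\<^sub>F y in nhds x. y \<in> V"
  using V(1) eventually_nhds_in_open by blast

lemma sum_W: "x \<in> V \<Longrightarrow> (\<Sum>S\<in>W x. h S) = (\<Sum>i<d. h (T i x))"
  unfolding WT by (subst sum.reindex) (auto simp: inj_on_def injT)

lemma T_foliation:
  assumes "open V'" "V' \<subseteq> V" "i < d"
  shows "web_branch A W V' (T i)"
proof -
  have "V' \<subseteq> manifold A" using assms V_manifold by auto
  moreover have "\<exists>v\<in>tangent_space A x. v (f i) \<noteq> 0" if x: "x \<in> V" for x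
  proof -
    obtain l where "chart_deriv c\<^sub>0 l (f i) x \<noteq> 0" using df[OF assms(3) x] by blast
    thus ?thesis using coord_vec_tangent[OF c0 V_c0[OF x]] f[OF assms(3) x]
      by (intro bexI[of _ "coord_vec A c\<^sub>0 l x"]) (auto simp: coord_vec_apply)
  qed
  ultimately have "hol_foliation A V' (T i)"
    unfolding hol_foliation_def
    using assms f[OF assms(3)] by (auto intro!: exI[of _ V'] exI[of _ "f i"] simp: T_def hol_on_hn)
  thus ?thesis using assms T_in_W by (auto simp: web_branch_def)
qed

text \<open>From a nonzero minor of the two differentials one builds, in the plane of the two
  coordinate directions, a vector that kills g but not h.\<close>

lemma kernel_prop:
  assumes "c \<in> A" "x \<in> fst c" "hn x g" "hn x h" "chart_deriv c k g x * chart_deriv c l h x \<noteq> chart_deriv c l g x * chart_deriv c k h x"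
  shows "{v \<in> tangent_space A x. v g = 0} \<noteq> {v \<in> tangent_space A x. v h = 0}"
proof -
  have z: "(0 :: 'm tvec) \<in> tangent_space A x" using tangent_zero[OF assms(1,2)] by (simp add: zero_fun_def)
  let ?v = "(0 + chart_deriv c l g x *\<^sub>F coord_vec A c k x) + (- chart_deriv c k g x) *\<^sub>F coord_vec A c l x"
  have "?v \<in> tangent_space A x" by (intro tangent_lin z coord_vec_tangent assms)
  moreover have "?v g = 0" "?v h \<noteq> 0"
    using assms(3-5) by (auto simp: fscale_def coord_vec_apply algebra_simps)
  ultimately show ?thesis by blast
qed

text \<open>When all minors vanish, the two nonzero differentials are proportional with a nonzero
  factor.\<close>

lemma kernel_prop':
  assumes "c \<in> A" "x \<in> fst c" "hn x g" "hn x h" "\<And>k l. chart_deriv c k g x * chart_deriv c l h x = chart_deriv c l g x * chart_deriv c k h x"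
    "chart_deriv c k0 g x \<noteq> 0" "chart_deriv c l0 h x \<noteq> 0"
  shows "{v \<in> tangent_space A x. v g = 0} = {v \<in> tangent_space A x. v h = 0}"
proof -
  let ?q = "chart_deriv c l0 g x / chart_deriv c l0 h x"
  have e: "chart_deriv c k g x = ?q * chart_deriv c k h x" for k using assms(5)[of k l0] assms(7) by (simp add: field_simps)
  hence "?q \<noteq> 0" using assms(6) by force
  moreover have "v g = ?q * v h" if "v \<in> tangent_space A x" for v
    unfolding tangent_apply[OF that assms(1-3)] tangent_apply[OF that assms(1,2,4)] sum_distrib_left
    by (subst e) (simp add: algebra_simps)
  ultimately have "v g = 0 \<longleftrightarrow> v h = 0" if "v \<in> tangent_space A x" for v
    using that by (metis mult_eq_0_iff)
  thus ?thesis by blast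
qed

text \<open>Being distinct from the j-th foliation shows in a nonzero minor of differentials, an
  open condition. Near x the branch thus avoids all other \<open>T j\<close>, and the fibre of the
  web leaves only \<open>T i\<close>.\<close>

lemma branch_T:
  assumes "web_branch A W V' F" "x \<in> V'" "x \<in> V" "F x = T i x" "i < d"
  shows "\<forall>\<^sub>F y in nhds x. F y = T i y"
proof -
  have "\<exists>V1 g. x \<in> V1 \<and> V1 \<subseteq> V' \<and> hol_on A g V1 \<and>
      (\<forall>y\<in>V1. (\<exists>v\<in>tangent_space A y. v g \<noteq> 0) \<and> F y = {v \<in> tangent_space A y. v g = 0})"
    using assms(1,2) unfolding web_branch_def hol_foliation_def by simp
  then obtain V1 g where g: "x \<in> V1" "V1 \<subseteq> V'" "hol_on A g V1"
    "\<forall>y\<in>V1. (\<exists>v\<in>tangent_space A y. v g \<noteq> 0) \<and> F y = {v \<in> tangent_space A y. v g = 0}"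
    by (elim exE conjE)
  have g4: "\<exists>v\<in>tangent_space A y. v g \<noteq> 0" "F y = {v \<in> tangent_space A y. v g = 0}" if "y \<in> V1" for y
    using g(4) that by auto
  have oV1: "open V1" "\<And>y. y \<in> V1 \<Longrightarrow> hn y g" using g(3) by (auto simp: hol_on_hn)
  note cx = c0 V_c0[OF assms(3)]
  have dg: "\<exists>k. chart_deriv c\<^sub>0 k g x \<noteq> 0"
  proof (rule ccontr)
    assume h: "\<not> ?thesis"
    obtain v where v: "v \<in> tangent_space A x" "v g \<noteq> 0" using g4(1)[OF g(1)] by blast
    thus False using tangent_apply[OF v(1) cx oV1(2)[OF g(1)]] h by simp
  qed
  have "\<forall>\<^sub>F y in nhds x. F y \<noteq> T j y" if j: "j < d" "j \<noteq> i" for j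
  proof -
    have "T j x \<noteq> F x" using assms injT j by metis
    hence "{v \<in> tangent_space A x. v g = 0} \<noteq> {v \<in> tangent_space A x. v (f j) = 0}" using g4(2)[OF g(1)] by (auto simp: T_def)
    hence "\<exists>k l. chart_deriv c\<^sub>0 k g x * chart_deriv c\<^sub>0 l (f j) x \<noteq> chart_deriv c\<^sub>0 l g x * chart_deriv c\<^sub>0 k (f j) x"
      using kernel_prop'[OF cx oV1(2)[OF g(1)] f[OF j(1) assms(3)]] dg df[OF j(1) assms(3)] by blast
    then obtain k l where kl: "chart_deriv c\<^sub>0 k g x * chart_deriv c\<^sub>0 l (f j) x - chart_deriv c\<^sub>0 l g x * chart_deriv c\<^sub>0 k (f j) x \<noteq> 0" by auto
    have "hn x (\<lambda>y. chart_deriv c\<^sub>0 k g y * chart_deriv c\<^sub>0 l (f j) y - chart_deriv c\<^sub>0 l g y * chart_deriv c\<^sub>0 k (f j) y)"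
      by (intro hn_diff hn_mult hn_D cx oV1(2) g(1) f j(1) assms(3))
    from eventually_nonzero[OF hn_cd[OF this] kl] ev_V[OF assms(3)] eventually_nhds_in_open[OF oV1(1) g(1)]
    show ?thesis
    proof eventually_elim
      case (elim y)
      have "{v \<in> tangent_space A y. v g = 0} \<noteq> {v \<in> tangent_space A y. v (f j) = 0}"
        by (rule kernel_prop[OF c0 V_c0[OF elim(2)] oV1(2)[OF elim(3)] f[OF j(1) elim(2)], of k l]) (use elim in auto)
      thus ?case using g4(2)[OF elim(3)] by (simp add: T_def)
    qed
  qed
  hence "\<forall>\<^sub>F y in nhds x. \<forall>j\<in>{..<d} - {i}. F y \<noteq> T j y" by (intro eventually_ball_finite) auto
  with ev_V[OF assms(3)] eventually_nhds_in_open[OF oV1(1) g(1)]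
  show ?thesis
  proof eventually_elim
    case (elim y)
    have "F y \<in> W y" using assms(1) elim g(2) by (auto simp: web_branch_def)
    thus ?case using elim WT by auto
  qed
qed

lemma branch_cases:
  assumes "web_branch A W V' F" "x \<in> V'" "x \<in> V"
  obtains i where "i < d" "F x = T i x" "\<forall>\<^sub>F y in nhds x. F y = T i y"
proof -
  have "F x \<in> W x" using assms(1,2) by (auto simp: web_branch_def)
  then obtain i where "i < d" "F x = T i x" using WT[OF assms(3)] by auto
  thus thesis using that branch_T[OF assms(1-3)] by blast
qed

text \<open>Whatever branch the choice operator returns, its germ is that of \<open>T i\<close>;
  jets do not depend on the choice.\<close>

lemma branch_at_T:
  assumes "x \<in> V" "i < d"
  shows "\<forall>\<^sub>F y in nhds x. branch_at A W x (T i x) y = T i y"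
proof -
  have "\<exists>F V'. x \<in> V' \<and> web_branch A W V' F \<and> F x = T i x"
    using T_foliation[OF V(1) order_refl assms(2)] assms(1) by blast
  from someI_ex[OF this] obtain V' where "x \<in> V'" "web_branch A W V' (branch_at A W x (T i x))" "branch_at A W x (T i x) x = T i x"
    unfolding branch_at_def by blast
  thus ?thesis using branch_T assms by blast
qed

section \<open>Sections of the bundle A through their coefficients\<close>

definition sec :: "'m \<Rightarrow> ('m \<Rightarrow> 'm hyp \<times> 'm tvec \<Rightarrow> complex) \<Rightarrow> bool"
  where "sec x u \<longleftrightarrow> (\<exists>V. x \<in> V \<and> A_section A W V u)"

text \<open>The coefficient of \<open>df\<^sub>i\<close> in the \<open>i\<close>-th component; it does not depend on \<open>l\<close>.\<close>

definition cf :: "('m \<Rightarrow> 'm hyp \<times> 'm tvec \<Rightarrow> complex) \<Rightarrow> nat \<Rightarrow> 'm \<Rightarrow> complex"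
  where "cf u i y = (let l = (SOME l. chart_deriv c\<^sub>0 l (f i) y \<noteq> 0) in u y (T i y, coord_vec A c\<^sub>0 l y) / chart_deriv c\<^sub>0 l (f i) y)"

text \<open>A covector vanishing on the kernel of \<open>df\<^sub>i\<close> is a multiple of
  \<open>df\<^sub>i\<close>: subtracting a multiple of a coordinate vector outside the kernel moves
  any tangent vector into it.\<close>

lemma A_fibre_cf:
  assumes "u y \<in> A_fibre A W y" "y \<in> V" "i < d" "v \<in> tangent_space A y"
  shows "u y (T i y, v) = cf u i y * v (f i)"
proof -
  define l where "l = (SOME l. chart_deriv c\<^sub>0 l (f i) y \<noteq> 0)"
  have l: "chart_deriv c\<^sub>0 l (f i) y \<noteq> 0" unfolding l_def by (rule someI_ex[OF df[OF assms(3,2)]])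
  note cy = c0 V_c0[OF assms(2)]
  let ?e = "coord_vec A c\<^sub>0 l y"
  have e: "?e \<in> tangent_space A y" by (rule coord_vec_tangent[OF cy])
  have ef: "?e (f i) = chart_deriv c\<^sub>0 l (f i) y" using f[OF assms(3,2)] by (simp add: coord_vec_apply)
  let ?q = "- v (f i) / chart_deriv c\<^sub>0 l (f i) y"
  have cot: "(\<lambda>v. u y (T i y, v)) \<in> cotangent_space A y" "\<And>v. v \<in> T i y \<Longrightarrow> u y (T i y, v) = 0"
    using assms(1) T_in_W[OF assms(2,3)] by (auto simp: A_fibre_def)
  have "v + ?q *\<^sub>F ?e \<in> tangent_space A y" by (rule tangent_lin[OF assms(4) e])
  moreover have "(v + ?q *\<^sub>F ?e) (f i) = 0" using l by (simp add: fscale_def ef)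
  ultimately have "u y (T i y, v + ?q *\<^sub>F ?e) = 0" by (intro cot(2)) (simp add: T_def)
  moreover have "u y (T i y, v + ?q *\<^sub>F ?e) = u y (T i y, v) + ?q * u y (T i y, ?e)"
    using cot(1) assms(4) e unfolding cotangent_space_def by blast
  ultimately show ?thesis using l by (simp add: cf_def l_def[symmetric] field_simps)
qed

lemma A_fibre_sum:
  assumes "u y \<in> A_fibre A W y" "y \<in> V" "v \<in> tangent_space A y"
  shows "(\<Sum>i<d. cf u i y * v (f i)) = 0"
proof -
  have "(\<Sum>S\<in>W y. u y (S, v)) = 0" using assms(1) by (simp add: A_fibre_def)
  thus ?thesis using A_fibre_cf[of u y, OF assms(1,2) _ assms(3)] by (simp add: sum_W[OF assms(2), of "\<lambda>S. u y (S, v)"])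
qed

lemma sec_ev: "sec x u \<Longrightarrow> \<forall>\<^sub>F y in nhds x. sec y u \<and> u y \<in> A_fibre A W y"
  unfolding sec_def eventually_nhds A_section_def by blast

lemma sec_fibre: "sec x u \<Longrightarrow> u x \<in> A_fibre A W x"
  by (auto simp: sec_def A_section_def)

text \<open>The direction chosen inside \<open>cf\<close> may jump from point to point; near x it
  can be replaced by one fixed direction in which the derivative of \<open>f i\<close> is
  nonzero.\<close>

lemma sec_cf_hn:
  assumes "sec x u" "x \<in> V" "i < d"
  shows "hn x (cf u i)"
proof -
  obtain V1 where V1: "x \<in> V1" "A_section A W V1 u" using assms(1) by (auto simp: sec_def)
  have o: "open (V1 \<inter> V)" using V1(2) V(1) by (auto simp: A_section_def)
  have "hol_one_form A (V1 \<inter> V) (along u (T i))"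
    using V1(2) T_foliation[OF o _ assms(3)] by (auto simp: A_section_def)
  hence h: "hn x (\<lambda>y. u y (T i y, coord_vec A c\<^sub>0 l y))" for l
    using V1(1) assms(2) V_c0[OF assms(2)] c0 by (auto simp: hol_one_form_def hol_on_hn)
  obtain l where l: "chart_deriv c\<^sub>0 l (f i) x \<noteq> 0" using df[OF assms(3,2)] by blast
  have hD: "hn x (chart_deriv c\<^sub>0 l (f i))" by (rule hn_D[OF c0 V_c0[OF assms(2)] f[OF assms(3,2)]])
  have "\<forall>\<^sub>F y in nhds x. cf u i y = u y (T i y, coord_vec A c\<^sub>0 l y) / chart_deriv c\<^sub>0 l (f i) y"
    using eventually_nonzero[OF hn_cd[OF hD] l] sec_ev[OF assms(1)] ev_V[OF assms(2)]
  proof eventually_elim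
    case (elim y)
    have "u y (T i y, coord_vec A c\<^sub>0 l y) = cf u i y * coord_vec A c\<^sub>0 l y (f i)"
      using elim by (intro A_fibre_cf assms(3) coord_vec_tangent c0 V_c0) auto
    thus ?case using elim f[OF assms(3) elim(3)] by (simp add: coord_vec_apply)
  qed
  thus ?thesis by (rule hol_near_cong_fun) (rule hn_divide[OF h hD l])
qed

lemma sec_sum:
  assumes "sec x u" "x \<in> V" "c \<in> A" "x \<in> fst c"
  shows "\<forall>\<^sub>F y in nhds x. (\<Sum>i<d. cf u i y * chart_deriv c l (f i) y) = 0"
  using sec_ev[OF assms(1)] ev_V[OF assms(2)] eventually_fst[OF assms(3,4)]
proof eventually_elim
  case (elim y)
  show ?case using A_fibre_sum[OF _ elim(2) coord_vec_tangent[OF assms(3) elim(3), of l], of u] elim f[OF _ elim(2)]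
    by (simp add: coord_vec_apply)
qed

lemma along_branch:
  assumes "sec x u" "x \<in> V" "i < d" "c \<in> A" "x \<in> fst c" "\<forall>\<^sub>F y in nhds x. F y = T i y"
  shows "\<forall>\<^sub>F y in nhds x. u y (F y, coord_vec A c l y) = cf u i y * chart_deriv c l (f i) y"
  using sec_ev[OF assms(1)] ev_V[OF assms(2)] eventually_fst[OF assms(4,5)] assms(6)
proof eventually_elim
  case (elim y)
  have "u y (T i y, coord_vec A c l y) = cf u i y * coord_vec A c l y (f i)"
    using elim by (intro A_fibre_cf assms(3) coord_vec_tangent assms) auto
  thus ?case using elim f[OF assms(3) elim(2)] by (simp add: coord_vec_apply)
qed

lemma jet_A_T:
  assumes "sec x u" "x \<in> V" "i < d" "c \<in> A" "x \<in> fst c" "length \<alpha> \<le> q"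
  shows "jet_A A W q x u (c, T i x, l, \<alpha>) = iter_deriv c \<alpha> (\<lambda>y. cf u i y * chart_deriv c l (f i) y) x"
  using assms T_in_W[OF assms(2,3)] iter_deriv_cong[OF assms(4,5) along_branch[OF assms(1-5) branch_at_T[OF assms(2,3)]]]
  by (simp add: jet_A_def iter_deriv_iter_pderiv)

text \<open>Along the i-th foliation the form is a coefficient times \<open>df\<^sub>i\<close>;
  since second derivatives commute, its exterior derivative only sees the differential of the
  coefficient.\<close>

lemma ext_deriv_T:
  assumes "sec x u" "x \<in> V" "i < d" "c \<in> A" "x \<in> fst c" "\<forall>\<^sub>F y in nhds x. F y = T i y"
  shows "\<forall>\<^sub>F y in nhds x. ext_deriv_coeff A c (along u F) k l y =
    chart_deriv c k (cf u i) y * chart_deriv c l (f i) y - chart_deriv c l (cf u i) y * chart_deriv c k (f i) y"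
proof -
  have e: "\<forall>\<^sub>F y in nhds x. coord_vec A c k y (\<lambda>y. u y (F y, coord_vec A c l y)) =
     chart_deriv c k (cf u i) y * chart_deriv c l (f i) y + cf u i y * chart_deriv c k (chart_deriv c l (f i)) y" for k l
    using sec_ev[OF assms(1)] ev_V[OF assms(2)] eventually_fst[OF assms(4,5)] eventually_eventually[THEN iffD2, OF assms(6)]
  proof eventually_elim
    case (elim y)
    have g: "hn y (cf u i)" "hn y (chart_deriv c l (f i))"
      using sec_cf_hn[of y u i] hn_D[OF assms(4) elim(3) f[OF assms(3) elim(2)]] elim assms(3) by auto
    note al = along_branch[OF _ elim(2) assms(3,4) elim(3,4), of u l]
    have "coord_vec A c k y (\<lambda>y. u y (F y, coord_vec A c l y)) = coord_vec A c k y (\<lambda>y. cf u i y * chart_deriv c l (f i) y)"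
      using elim al by (intro tangent_cong[OF coord_vec_tangent[OF assms(4) elim(3)]]) auto
    thus ?case using g by (simp add: coord_vec_apply hn_mult chart_deriv_mult[OF assms(4) elim(3) hn_cd hn_cd])
  qed
  show ?thesis
    using e[of k l] e[of l k] ev_V[OF assms(2)] eventually_fst[OF assms(4,5)]
  proof eventually_elim
    case (elim y)
    show ?case using elim(1,2) chart_deriv_hol(2)[OF assms(4) f[OF assms(3) elim(3)] elim(4), of k l]
      by (simp add: ext_deriv_coeff_def)
  qed
qed

lemma jet_D_T:
  assumes "sec x u" "x \<in> V" "i < d" "c \<in> A" "x \<in> fst c" "length \<alpha> < q"
  shows "jet_D A W q x u (c, T i x, k, l, \<alpha>) = iter_deriv c \<alpha> (\<lambda>y. chart_deriv c k (cf u i) y * chart_deriv c l (f i) y -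
    chart_deriv c l (cf u i) y * chart_deriv c k (f i) y) x"
  using assms T_in_W[OF assms(2,3)] iter_deriv_cong[OF assms(4,5) ext_deriv_T[OF assms(1-5) branch_at_T[OF assms(2,3)]]]
  by (simp add: jet_D_def iter_deriv_iter_pderiv)

lemma jet_D_zero_iff:
  assumes "sec x u" "x \<in> V"
  shows "jet_D A W q x u = 0 \<longleftrightarrow> (\<forall>i<d. \<forall>c\<in>A. x \<in> fst c \<longrightarrow> (\<forall>k l. van c q (\<lambda>y. chart_deriv c k (cf u i) y * chart_deriv c l (f i) y -
    chart_deriv c l (cf u i) y * chart_deriv c k (f i) y) x))"
    (is "?L \<longleftrightarrow> ?R")
proof
  assume L: ?L
  show ?R
    unfolding van_def
  proof (intro allI impI ballI)
    fix i c k l and \<alpha> :: "'n list" assume "i < d" "c \<in> A" "x \<in> fst c" "length \<alpha> < q"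
    from jet_D_T[OF assms this, of k l] L
    show "iter_deriv c \<alpha> (\<lambda>y. chart_deriv c k (cf u i) y * chart_deriv c l (f i) y - chart_deriv c l (cf u i) y * chart_deriv c k (f i) y) x = 0"
      by simp
  qed
next
  assume R: ?R
  have "jet_D A W q x u (c, S, k, l, \<alpha>) = 0" for c S k l \<alpha>
  proof (cases "c \<in> A \<and> x \<in> fst c \<and> S \<in> W x \<and> length \<alpha> < q")
    case True
    then obtain i where "i < d" "S = T i x" using WT[OF assms(2)] by auto
    thus ?thesis using True R jet_D_T[OF assms, of i c \<alpha> q k l] by (auto simp: van_def)
  qed (auto simp: jet_D_def)
  thus ?L by (auto simp: fun_eq_iff)
qed

text \<open>Over V the hyperplanes \<open>T i y\<close> are distinct, so the sum has at most one
  nonzero term. The value 0 off the tangent space is what covectors require.\<close>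

definition mksec :: "(nat \<Rightarrow> 'm \<Rightarrow> complex) \<Rightarrow> 'm \<Rightarrow> 'm hyp \<times> 'm tvec \<Rightarrow> complex"
  where "mksec g y = (\<lambda>(S, v). if v \<in> tangent_space A y then \<Sum>i<d. if S = T i y then g i y * v (f i) else 0 else 0)"

lemma mksec_T:
  assumes "y \<in> V" "i < d" "v \<in> tangent_space A y"
  shows "mksec g y (T i y, v) = g i y * v (f i)"
proof -
  have "(\<Sum>j<d. if T i y = T j y then g j y * v (f j) else 0) = (\<Sum>j<d. if j = i then g i y * v (f i) else 0)"
    using injT[OF assms(1)] assms(2) by (intro sum.cong) auto
  thus ?thesis using assms by (simp add: mksec_def)
qed

lemma mksec_section:
  assumes "open V1" "V1 \<subseteq> V" "\<And>i x. i < d \<Longrightarrow> x \<in> V1 \<Longrightarrow> hn x (g i)"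
    "\<And>x l. x \<in> V1 \<Longrightarrow> (\<Sum>i<d. g i x * chart_deriv c\<^sub>0 l (f i) x) = 0"
  shows "A_section A W V1 (mksec g)"
proof -
  have cot: "(\<lambda>v. mksec g x (T i x, v)) \<in> cotangent_space A x" if "x \<in> V1" "i < d" for x i
  proof -
    have x: "x \<in> V" using that assms(2) by auto
    show ?thesis unfolding cotangent_space_def
      using tangent_lin[of _ x] mksec_T[OF x that(2)] by (auto simp: fscale_def algebra_simps mksec_def)
  qed
  have fib: "mksec g x \<in> A_fibre A W x" if "x \<in> V1" for x
  proof -
    have x: "x \<in> V" using that assms(2) by auto
    have "mksec g x (S, v) = 0" if "S \<notin> W x" for S v
      using that WT[OF x] by (auto simp: mksec_def intro!: sum.neutral)
    moreover have "(\<Sum>S\<in>W x. mksec g x (S, v)) = 0" for v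
    proof (cases "v \<in> tangent_space A x")
      case True
      have "(\<Sum>S\<in>W x. mksec g x (S, v)) = (\<Sum>i<d. g i x * v (f i))" using mksec_T[OF x _ True] by (simp add: sum_W[OF x, of "\<lambda>S. mksec g x (S, v)"])
      also have "\<dots> = (\<Sum>i<d. \<Sum>l\<in>UNIV. v (\<lambda>y. snd c\<^sub>0 y $ l) * (g i x * chart_deriv c\<^sub>0 l (f i) x))"
        using f[OF _ x] by (intro sum.cong refl) (simp add: tangent_apply[OF True c0 V_c0[OF x]] sum_distrib_left algebra_simps)
      also have "\<dots> = (\<Sum>l\<in>UNIV. v (\<lambda>y. snd c\<^sub>0 y $ l) * (\<Sum>i<d. g i x * chart_deriv c\<^sub>0 l (f i) x))"
        by (subst sum.swap) (simp add: sum_distrib_left)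
      finally show ?thesis using assms(4)[OF that] by simp
    qed (simp add: mksec_def)
    moreover have "\<forall>v\<in>T i x. mksec g x (T i x, v) = 0" if "i < d" for i
      using mksec_T[OF x that] by (auto simp: T_def)
    ultimately show ?thesis using cot[OF \<open>x \<in> V1\<close>] WT[OF x] by (auto simp: A_fibre_def)
  qed
  have "hol_one_form A V' (along (mksec g) F)" if V': "V' \<subseteq> V1" "web_branch A W V' F" for V' F
    unfolding hol_one_form_def
  proof (intro conjI ballI allI)
    show o: "open V'" "V' \<subseteq> manifold A" using V'(2) by (auto simp: web_branch_def hol_foliation_def)
    fix x assume x: "x \<in> V'"
    hence xV: "x \<in> V" using V' assms(2) by auto
    obtain i where "i < d" "F x = T i x" using branch_cases[OF V'(2) x xV] by blast
    thus "along (mksec g) F x \<in> cotangent_space A x" using cot[of x i] V' x by auto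
  next
    fix c k assume c: "c \<in> A"
    have "hn x (\<lambda>x. along (mksec g) F x (coord_vec A c k x))" if x: "x \<in> V'" "x \<in> fst c" for x
    proof -
      have xV: "x \<in> V" "x \<in> V1" using V' assms(2) x by auto
      obtain i where i: "i < d" "\<forall>\<^sub>F y in nhds x. F y = T i y" using branch_cases[OF V'(2) x(1) xV(1)] by blast
      have "\<forall>\<^sub>F y in nhds x. along (mksec g) F y (coord_vec A c k y) = g i y * chart_deriv c k (f i) y"
        using i(2) ev_V[OF xV(1)] eventually_fst[OF c x(2)]
      proof eventually_elim
        case (elim y)
        show ?case using mksec_T[OF elim(2) i(1) coord_vec_tangent[OF c elim(3)]] elim(1) f[OF i(1) elim(2)]
          by (simp add: coord_vec_apply)
      qed
      thus ?thesis by (rule hol_near_cong_fun) (intro hn_mult hn_D assms(3) i xV c x f)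
    qed
    thus "hol_on A (\<lambda>x. along (mksec g) F x (coord_vec A c k x)) (V' \<inter> fst c)"
      using V'(2) chart_open(1)[OF c] by (auto simp: hol_on_hn web_branch_def hol_foliation_def)
  qed
  thus ?thesis using assms(1,2) V_manifold fib by (auto simp: A_section_def)
qed

lemma cf_mksec:
  assumes "y \<in> V" "i < d"
  shows "cf (mksec g) i y = g i y"
proof -
  define l where "l = (SOME l. chart_deriv c\<^sub>0 l (f i) y \<noteq> 0)"
  have l: "chart_deriv c\<^sub>0 l (f i) y \<noteq> 0" unfolding l_def by (rule someI_ex[OF df[OF assms(2,1)]])
  show ?thesis using l mksec_T[OF assms coord_vec_tangent[OF c0 V_c0[OF assms(1)]]] f[OF assms(2,1)]
    by (simp add: cf_def l_def[symmetric] coord_vec_apply)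
qed

lemma mksec_cf:
  assumes "u y \<in> A_fibre A W y" "y \<in> V"
  shows "u y = mksec (cf u) y"
proof
  fix p show "u y p = mksec (cf u) y p"
  proof (cases p)
    case (Pair S v)
    show ?thesis
    proof (cases "S \<in> W y")
      case True
      then obtain i where i: "i < d" "S = T i y" using WT[OF assms(2)] by auto
      have "u y (T i y, v) = 0" if "v \<notin> tangent_space A y"
        using assms(1) True that i(2) by (auto simp: A_fibre_def cotangent_space_def)
      thus ?thesis using i A_fibre_cf[of u y, OF assms i(1)] mksec_T[OF assms(2) i(1)] by (cases "v \<in> tangent_space A y") (auto simp: Pair mksec_def)
    next
      case False
      have "\<forall>i<d. S \<noteq> T i y" using False WT[OF assms(2)] by auto
      hence "mksec (cf u) y (S, v) = 0" by (auto simp: mksec_def intro!: sum.neutral)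
      moreover have "u y (S, v) = 0" using assms(1) False by (simp add: A_fibre_def)
      ultimately show ?thesis by (simp add: Pair)
    qed
  qed
qed

end

section \<open>Powers of the conormals\<close>

definition multi_indices :: "nat \<Rightarrow> ('n::finite \<Rightarrow> nat) set"
  where "multi_indices s = {\<mu>. (\<Sum>b\<in>UNIV. \<mu> b) = s}"

text \<open>A fixed word for each multi-index; since everything is symmetric in the letters, which
  one is immaterial.\<close>

definition index_list :: "('n::finite \<Rightarrow> nat) \<Rightarrow> 'n list"
  where "index_list \<mu> = (SOME \<beta>. count (mset \<beta>) = \<mu>)"

lemma count_index_list: "count (mset (index_list \<mu>)) = \<mu>"
proof -
  have "count (\<Sum>b\<in>UNIV. replicate_mset (\<mu> b) b) a = \<mu> a" for a
    by (simp add: count_sum if_distrib cong: if_cong)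
  moreover obtain \<beta> where "mset \<beta> = (\<Sum>b\<in>UNIV. replicate_mset (\<mu> b) b)" using ex_mset by blast
  ultimately have "count (mset \<beta>) = \<mu>" by auto
  thus ?thesis unfolding index_list_def by (rule someI)
qed

lemma sum_count: "(\<Sum>b\<in>UNIV. count (mset \<beta>) b) = length (\<beta> :: 'n::finite list)"
proof -
  have "length \<beta> = (\<Sum>b\<in>set_mset (mset \<beta>). count (mset \<beta>) b)"
    unfolding size_mset[symmetric] by (simp add: size_multiset_overloaded_eq del: size_mset set_mset_mset)
  also have "\<dots> = (\<Sum>b\<in>UNIV. count (mset \<beta>) b)"
    by (rule sum.mono_neutral_left) (auto simp: not_in_iff)
  finally show ?thesis by simp
qed

lemma length_index_list: "\<mu> \<in> multi_indices s \<Longrightarrow> length (index_list \<mu>) = s"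
  using sum_count[of "index_list \<mu>"] by (simp add: count_index_list multi_indices_def)

lemma count_multi_indices: "count (mset \<beta>) \<in> multi_indices (length \<beta>)"
  by (simp add: multi_indices_def sum_count)

lemma mset_index_list: "mset (index_list (count (mset \<beta>))) = mset \<beta>"
  by (rule multiset_eqI) (simp add: count_index_list)

lemma finite_multi_indices [simp]: "finite (multi_indices s)"
proof (rule finite_subset)
  show "multi_indices s \<subseteq> (\<lambda>\<beta> :: 'a list. count (mset \<beta>)) ` {\<beta>. set \<beta> \<subseteq> UNIV \<and> length \<beta> = s}"
  proof
    fix \<mu> :: "'a \<Rightarrow> nat" assume "\<mu> \<in> multi_indices s"
    thus "\<mu> \<in> (\<lambda>\<beta>. count (mset \<beta>)) ` {\<beta>. set \<beta> \<subseteq> UNIV \<and> length \<beta> = s}"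
      using length_index_list by (intro image_eqI[of _ _ "index_list \<mu>"]) (auto simp: count_index_list)
  qed
  show "finite ((\<lambda>\<beta>. count (mset \<beta>)) ` {\<beta> :: 'a list. set \<beta> \<subseteq> UNIV \<and> length \<beta> = s})"
    by (intro finite_imageI finite_lists_length_eq) simp
qed

text \<open>Reading the exponents along an enumeration of the coordinates reduces the count to lists
  of given length and given sum.\<close>

lemma card_multi_indices: "card (multi_indices s :: ('n::finite \<Rightarrow> nat) set) = web_c CARD('n) s"
proof -
  obtain xs :: "'n list" where xs: "set xs = UNIV" "distinct xs" using finite_distinct_list[OF finite_class.finite_UNIV] by blast
  have len: "length xs = CARD('n)" using distinct_card[OF xs(2)] xs(1) by simp
  have "bij_betw (\<lambda>\<mu>. map \<mu> xs) (multi_indices s) {l. length l = CARD('n) \<and> sum_list l = s}"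
  proof (rule bij_betwI')
    fix \<mu> \<nu> :: "'n \<Rightarrow> nat" show "(map \<mu> xs = map \<nu> xs) = (\<mu> = \<nu>)" using xs(1) by (auto simp: fun_eq_iff)
  next
    fix \<mu> :: "'n \<Rightarrow> nat" assume "\<mu> \<in> multi_indices s"
    thus "map \<mu> xs \<in> {l. length l = CARD('n) \<and> sum_list l = s}"
      using sum_list_distinct_conv_sum_set[OF xs(2), of \<mu>] xs(1) by (simp add: multi_indices_def len)
  next
    fix l assume l: "l \<in> {l. length l = CARD('n) \<and> sum_list l = s}"
    define \<mu> where "\<mu> b = the (map_of (zip xs l) b)" for b
    have "map \<mu> xs = l" using l len xs(2) by (auto simp: \<mu>_def map_of_zip_nth intro!: nth_equalityI)
    moreover have "\<mu> \<in> multi_indices s" using sum_list_distinct_conv_sum_set[OF xs(2), of \<mu>] xs(1) l calculation by (simp add: multi_indices_def)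
    ultimately show "\<exists>\<mu>\<in>multi_indices s. l = map \<mu> xs" by auto
  qed
  from bij_betw_same_card[OF this] show ?thesis by (simp add: card_length_sum_list web_c_def add.commute)
qed

lemma prod_list_mset_cong: "mset \<beta> = mset \<beta>' \<Longrightarrow> (\<Prod>b\<leftarrow>\<beta>. t b) = (\<Prod>b\<leftarrow>\<beta>'. (t b :: complex))"
  by (metis mset_map prod_mset_prod_list)

text \<open>The multinomial coefficient.\<close>

definition nperm :: "('n::finite \<Rightarrow> nat) \<Rightarrow> nat"
  where "nperm \<mu> = card {\<beta>. length \<beta> = sum \<mu> UNIV \<and> count (mset \<beta>) = \<mu>}"

text \<open>Expanding the power gives one term per word of length s; words are then grouped by their
  content.\<close>

lemma multinomial:
  "(\<Sum>b\<in>UNIV. t b :: complex) ^ s = (\<Sum>\<mu>\<in>multi_indices s. of_nat (nperm \<mu>) * (\<Prod>b\<leftarrow>index_list \<mu>. t (b::'n::finite)))"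
proof -
  let ?L = "\<lambda>s. {\<beta> :: 'n list. length \<beta> = s}"
  have fin: "finite (?L s)" for s using finite_lists_length_eq[of "UNIV :: 'n set" s] by simp
  have "(\<Sum>b\<in>UNIV. t b) ^ s = (\<Sum>\<beta>\<in>?L s. \<Prod>b\<leftarrow>\<beta>. t b)"
  proof (induction s)
    case (Suc s)
    have inj: "inj_on (\<lambda>(b, \<beta>). b # \<beta>) (UNIV \<times> ?L s)" by (auto simp: inj_on_def)
    have im: "?L (Suc s) = (\<lambda>(b, \<beta>). b # \<beta>) ` (UNIV \<times> ?L s)" by (auto simp: image_iff length_Suc_conv)
    have "(\<Sum>\<beta>\<in>?L (Suc s). \<Prod>b\<leftarrow>\<beta>. t b) = (\<Sum>(b, \<beta>)\<in>UNIV \<times> ?L s. t b * (\<Prod>b\<leftarrow>\<beta>. t b))"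
      unfolding im sum.reindex[OF inj] by (rule sum.cong) auto
    also have "\<dots> = (\<Sum>b\<in>UNIV. t b) * (\<Sum>\<beta>\<in>?L s. \<Prod>b\<leftarrow>\<beta>. t b)"
      unfolding sum_product sum.cartesian_product ..
    finally show ?case using Suc by simp
  qed simp
  also have "\<dots> = (\<Sum>\<mu>\<in>multi_indices s. \<Sum>\<beta>\<in>{\<beta>\<in>?L s. count (mset \<beta>) = \<mu>}. \<Prod>b\<leftarrow>\<beta>. t b)"
    by (rule sum.group[symmetric]) (use fin count_multi_indices in auto)
  also have "\<dots> = (\<Sum>\<mu>\<in>multi_indices s. \<Sum>\<beta>\<in>{\<beta>\<in>?L s. count (mset \<beta>) = \<mu>}. \<Prod>b\<leftarrow>index_list \<mu>. t b)"
    by (intro sum.cong refl prod_list_mset_cong) (auto intro!: multiset_eqI simp: count_index_list)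
  also have "\<dots> = (\<Sum>\<mu>\<in>multi_indices s. of_nat (nperm \<mu>) * (\<Prod>b\<leftarrow>index_list \<mu>. t b))"
    by (intro sum.cong refl) (auto simp: nperm_def multi_indices_def)
  finally show ?thesis .
qed

lemma web_c_mono: "s \<le> t \<Longrightarrow> web_c n s \<le> web_c n t"
  unfolding web_c_def
  using binomial_symmetric[of s "n - 1 + s"] binomial_symmetric[of t "n - 1 + t"] binomial_right_mono[of "n - 1 + s" "n - 1 + t" "n - 1"]
  by simp

lemma web_c_1: "n \<ge> 1 \<Longrightarrow> web_c n 1 = n"
  by (simp add: web_c_def)

lemma web_c_pos: "web_c n s > 0"
  by (simp add: web_c_def)

section \<open>Linear algebra of finite families of functions\<close>

lemma fscale_sum_apply: "(\<Sum>i\<in>I. y i *\<^sub>F g i) v = (\<Sum>i\<in>I. y i * g i v)"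
  by (induction I rule: infinite_finite_induct) (auto simp: fscale_def)

lemma cfun_span_image:
  assumes "finite I" "x \<in> cfun.span (g ` I)"
  shows "\<exists>y. x = (\<Sum>i\<in>I. y i *\<^sub>F g i)"
proof -
  let ?S = "{x. \<exists>y. x = (\<Sum>i\<in>I. y i *\<^sub>F g i)}"
  have "cfun.subspace ?S"
  proof (rule cfun.subspaceI)
    show "0 \<in> ?S" by (auto intro!: exI[of _ "\<lambda>_. 0"] simp: fun_eq_iff fscale_sum_apply)
    fix x z assume "x \<in> ?S" "z \<in> ?S"
    then obtain y y' where "x = (\<Sum>i\<in>I. y i *\<^sub>F g i)" "z = (\<Sum>i\<in>I. y' i *\<^sub>F g i)" by auto
    hence "x + z = (\<Sum>i\<in>I. (y i + y' i) *\<^sub>F g i)" by (simp add: cfun.scale_left_distrib sum.distrib)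
    thus "x + z \<in> ?S" unfolding mem_Collect_eq by (intro exI[of _ "\<lambda>i. y i + y' i"])
  next
    fix c x assume "x \<in> ?S"
    then obtain y where "x = (\<Sum>i\<in>I. y i *\<^sub>F g i)" by auto
    hence "c *\<^sub>F x = (\<Sum>i\<in>I. (c * y i) *\<^sub>F g i)" by (simp add: cfun.scale_sum_right)
    thus "c *\<^sub>F x \<in> ?S" unfolding mem_Collect_eq by (intro exI[of _ "\<lambda>i. c * y i"])
  qed
  moreover have "g ` I \<subseteq> ?S"
  proof safe
    fix i assume "i \<in> I"
    have "(\<Sum>j\<in>I. (if j = i then 1 else 0) *\<^sub>F g j) = (\<Sum>j\<in>I. if j = i then g i else 0)"
      by (intro sum.cong refl) (auto simp: fscale_def fun_eq_iff)
    hence "g i = (\<Sum>j\<in>I. (if j = i then 1 else 0) *\<^sub>F g j)" using \<open>i \<in> I\<close> assms(1) by simp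
    thus "\<exists>y. g i = (\<Sum>i\<in>I. y i *\<^sub>F g i)" by (intro exI[of _ "\<lambda>j. if j = i then 1 else 0"])
  qed
  ultimately show ?thesis using cfun.span_minimal assms(2) by blast
qed

lemma cfun_sum_in_span: "(\<Sum>i\<in>I. y i *\<^sub>F g i) \<in> cfun.span (g ` I)"
  by (intro cfun.span_sum cfun.span_scale cfun.span_base) auto

lemma cfun_independent_image:
  assumes "finite I" "\<And>y. (\<And>v. (\<Sum>i\<in>I. y i * g i v) = 0) \<Longrightarrow> \<forall>i\<in>I. y i = 0"
  shows "inj_on g I \<and> cfun.independent (g ` I)"
proof -
  have inj: "inj_on g I"
  proof (rule inj_onI, rule ccontr)
    fix i j assume h: "i \<in> I" "j \<in> I" "g i = g j" "i \<noteq> j"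
    have "(\<Sum>k\<in>I. (if k = i then 1 else if k = j then -1 else 0) * g k v) = 0" for v
    proof -
      have "(\<Sum>k\<in>I. (if k = i then 1 else if k = j then -1 else 0) * g k v) = (\<Sum>k\<in>I. (if k = i then g i v else 0) - (if k = j then g j v else 0))"
        using h(4) by (intro sum.cong) auto
      thus ?thesis using h assms(1) by (simp add: sum_subtractf)
    qed
    from assms(2)[OF this] h(1) show False by auto
  qed
  moreover have "cfun.independent (g ` I)"
  proof (rule cfun.independent_if_scalars_zero)
    fix u w assume s: "(\<Sum>w\<in>g ` I. u w *\<^sub>F w) = 0" and w: "w \<in> g ` I"
    have "(\<Sum>i\<in>I. u (g i) * g i v) = 0" for v
      using fun_cong[OF s, of v] by (simp add: sum.reindex[OF inj] fscale_sum_apply)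
    from assms(2)[OF this] show "u w = 0" using w by auto
  qed (use assms(1) in auto)
  ultimately show ?thesis ..
qed

lemma cfun_independent_imageD:
  assumes "finite I" "inj_on g I" "cfun.independent (g ` I)" "\<And>v. (\<Sum>i\<in>I. y i * g i v) = 0" "i \<in> I"
  shows "y i = 0"
proof -
  let ?u = "\<lambda>w. y (the_inv_into I g w)"
  have "(\<Sum>w\<in>g ` I. ?u w *\<^sub>F w) = (\<Sum>i\<in>I. y i *\<^sub>F g i)"
    by (simp add: sum.reindex[OF assms(2)] the_inv_into_f_f[OF assms(2)])
  also have "\<dots> = 0" using assms(4) by (simp add: fun_eq_iff fscale_sum_apply)
  finally have "?u (g i) = 0"
    by (intro cfun.independentD[OF assms(3)]) (use assms(1,5) in auto)
  thus ?thesis using the_inv_into_f_f[OF assms(2,5)] by simp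
qed

text \<open>Dimension count: if a member of the family depended on the others, fewer than
  \<open>card B\<close> vectors would span B; if some \<open>g i\<close> lay outside the span of B,
  then B could be enlarged beyond the size of the family.\<close>

lemma cfun_indep_max:
  assumes "cfun.independent B" "finite B" "finite I" "B \<subseteq> cfun.span (g ` I)" "card B = card I"
  shows "inj_on g I" "cfun.independent (g ` I)" "\<And>i. i \<in> I \<Longrightarrow> g i \<in> cfun.span B"
proof -
  have "card I \<le> card (g ` I)"
    using cfun.independent_span_bound[OF _ assms(1,4)] assms(3,5) by simp
  hence "card (g ` I) = card I" using card_image_le[OF assms(3), of g] by simp
  thus inj: "inj_on g I" by (rule eq_card_imp_inj_on[OF assms(3)])
  have c: "card (g ` I) = card I" by (rule card_image[OF inj])
  show "cfun.independent (g ` I)"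
  proof (rule ccontr)
    assume "\<not> cfun.independent (g ` I)"
    then obtain a where a: "a \<in> g ` I" "a \<in> cfun.span (g ` I - {a})" by (auto simp: cfun.dependent_def)
    have "g ` I \<subseteq> cfun.span (g ` I - {a})"
    proof
      fix b assume "b \<in> g ` I"
      thus "b \<in> cfun.span (g ` I - {a})" using a(2) by (cases "b = a") (auto intro: cfun.span_base)
    qed
    from cfun.span_minimal[OF this cfun.subspace_span] have "B \<subseteq> cfun.span (g ` I - {a})" by (rule order_trans[OF assms(4)])
    from cfun.independent_span_bound[OF _ assms(1) this] have "card I \<le> card (g ` I - {a})" using assms(3,5) by simp
    moreover have "card (g ` I - {a}) < card (g ` I)" using a(1) assms(3) by (intro psubset_card_mono) auto
    ultimately show False using c by simp
  qed
  show "g i \<in> cfun.span B" if "i \<in> I" for i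
  proof (rule ccontr)
    assume n: "g i \<notin> cfun.span B"
    hence "cfun.independent (insert (g i) B)" using assms(1) by (simp add: cfun.independent_insertI)
    moreover have "insert (g i) B \<subseteq> cfun.span (g ` I)" using assms(4) that by (auto intro: cfun.span_base)
    ultimately have "card (insert (g i) B) \<le> card (g ` I)"
      using cfun.independent_span_bound[of "g ` I"] assms(3) by blast
    moreover have "g i \<notin> B" using n cfun.span_base by blast
    ultimately show False using assms(2,5) c by simp
  qed
qed

context atlas begin

text \<open>Elimination in the augmented system \<open>lam w = v\<close> with pivots among the \<open>w\<close> expresses \<open>w\<close> through \<open>v\<close>.\<close>

lemma right_inverse:
  fixes lam :: "'i \<Rightarrow> nat \<Rightarrow> 'm \<Rightarrow> complex"
  assumes "finite I" "x0 \<in> manifold A" "\<And>i j. i \<in> I \<Longrightarrow> j < d \<Longrightarrow> hn x0 (lam i j)"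
    and dual: "\<And>i. i \<in> I \<Longrightarrow> \<exists>w. \<forall>i'\<in>I. (\<Sum>j<d. lam i' j x0 * w j) = (if i' = i then 1 else 0)"
  shows "\<exists>N. (\<forall>j<d. \<forall>i\<in>I. hn x0 (N j i)) \<and>
      (\<forall>\<^sub>F x in nhds x0. \<forall>i\<in>I. \<forall>i'\<in>I. (\<Sum>j<d. lam i' j x * N j i x) = (if i' = i then 1 else 0)) \<and>
      (card I = d \<longrightarrow> (\<forall>\<^sub>F x in nhds x0. \<forall>w. (\<forall>i\<in>I. (\<Sum>j<d. lam i j x * w j) = 0) \<longrightarrow> (\<forall>j<d. w j = 0)))"
proof -
  \<comment> \<open>\<open>Inl\<close> indexes the unknowns w and \<open>Inr\<close> the right-hand
    sides v; the equation of index i says that the i-th entry of lam w minus v i is 0.\<close>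
  define J :: "(nat + 'i) set" where "J = Inl ` {..<d} \<union> Inr ` I"
  define K :: "(nat + 'i) set" where "K = Inl ` {..<d}"
  define l where "l i = case_sum (lam i) (\<lambda>i' x. if i = i' then -1 else 0 :: complex)" for i
  have fin: "finite J" "K \<subseteq> J" using assms(1) by (auto simp: J_def K_def)
  have sJ: "(\<Sum>j\<in>J. l i j x * w j) = (\<Sum>j<d. lam i j x * w (Inl j)) - w (Inr i)" if "i \<in> I" for i x w
  proof -
    have "(\<Sum>j\<in>J. l i j x * w j) = (\<Sum>j\<in>Inl ` {..<d}. l i j x * w j) + (\<Sum>j\<in>Inr ` I. l i j x * w j)"
      unfolding J_def using assms(1) by (intro sum.union_disjoint) auto
    also have "(\<Sum>j\<in>Inr ` I. l i j x * w j) = (\<Sum>i'\<in>I. if i' = i then - w (Inr i) else 0)"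
      by (subst sum.reindex) (auto simp: l_def intro!: sum.cong)
    finally show ?thesis using that assms(1) by (simp add: sum.reindex l_def)
  qed
  have hl: "hn x0 (l i j)" if "i \<in> I" "j \<in> J" for i j
    using that assms(2,3) by (auto simp: J_def l_def)
  have "\<exists>K0 b. K0 \<subseteq> K \<and> card K0 = card I \<and> (\<forall>j\<in>J - K0. \<forall>k\<in>K0. hn x0 (b j k)) \<and>
      (\<forall>\<^sub>F x in nhds x0. \<forall>w. (\<forall>i\<in>I. (\<Sum>j\<in>J. l i j x * w j) = 0) \<longleftrightarrow>
         (\<forall>k\<in>K0. w k = (\<Sum>j\<in>J - K0. b j k x * w j)))"
  proof (rule elimination[OF fin assms(2,1) hl, where \<rho>="\<lambda>_. 0"])
    \<comment> \<open>A dual vector, completed by v = 0, is seen by one equation only; so the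
      constant rank function suffices.\<close>
    fix i assume i: "i \<in> I"
    obtain w where w: "\<forall>i'\<in>I. (\<Sum>j<d. lam i' j x0 * w j) = (if i' = i then 1 else 0)" using dual[OF i] by blast
    let ?w = "case_sum w (\<lambda>_. 0)"
    show "\<exists>w. (\<forall>j\<in>J - K. w j = 0) \<and> (\<Sum>j\<in>J. l i j x0 * w j) \<noteq> 0 \<and>
        (\<forall>i'\<in>I. i' \<noteq> i \<longrightarrow> 0 \<le> (0::nat) \<longrightarrow> (\<Sum>j\<in>J. l i' j x0 * w j) = 0)"
    proof (intro exI[of _ ?w] conjI ballI impI)
      show "?w j = 0" if "j \<in> J - K" for j using that by (auto simp: J_def K_def)
      show "(\<Sum>j\<in>J. l i j x0 * ?w j) \<noteq> 0" using w i by (simp add: sJ)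
      show "(\<Sum>j\<in>J. l i' j x0 * ?w j) = 0" if "i' \<in> I" "i' \<noteq> i" for i' using w that by (simp add: sJ)
    qed
  qed
  then obtain K0 b where K0: "K0 \<subseteq> K" "card K0 = card I" "\<And>j k. j \<in> J - K0 \<Longrightarrow> k \<in> K0 \<Longrightarrow> hn x0 (b j k)"
    and ev: "\<forall>\<^sub>F x in nhds x0. \<forall>w. (\<forall>i\<in>I. (\<Sum>j\<in>J. l i j x * w j) = 0) \<longleftrightarrow>
         (\<forall>k\<in>K0. w k = (\<Sum>j\<in>J - K0. b j k x * w j))" by blast
  \<comment> \<open>Column i of the inverse: v is the unit vector of index i, and the unknowns that
    are not pivots are set to 0.\<close>
  define N where "N j i x = (if Inl j \<in> K0 then b (Inr i) (Inl j) x else 0)" for j i x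
  have IJ: "Inr i \<in> J - K0" if "i \<in> I" for i using that K0(1) by (auto simp: J_def K_def)
  have "hn x0 (N j i)" if "j < d" "i \<in> I" for j i
    using K0(3)[OF IJ[OF that(2)], of "Inl j"] assms(2) by (cases "Inl j \<in> K0") (auto simp: N_def[abs_def])
  moreover have "\<forall>\<^sub>F x in nhds x0. \<forall>i\<in>I. \<forall>i'\<in>I. (\<Sum>j<d. lam i' j x * N j i x) = (if i' = i then 1 else 0)"
    using ev
  proof eventually_elim
    case (elim x)
    show ?case
    proof (intro ballI)
      fix i i' assume i: "i \<in> I" "i' \<in> I"
      define w where "w = case_sum (\<lambda>j. N j i x) (\<lambda>i'. if i' = i then 1 else 0 :: complex)"
      have "w k = (\<Sum>j\<in>J - K0. b j k x * w j)" if k: "k \<in> K0" for k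
      proof -
        obtain j where j: "k = Inl j" using k K0(1) by (auto simp: K_def)
        have "(\<Sum>j\<in>J - K0. b j k x * w j) = (\<Sum>j\<in>J - K0. if j = Inr i then b (Inr i) k x else 0)"
          by (intro sum.cong refl) (auto simp: w_def N_def split: sum.splits)
        also have "\<dots> = b (Inr i) k x" using IJ[OF i(1)] fin(1) by simp
        finally show ?thesis using k j by (simp add: w_def N_def)
      qed
      hence "(\<Sum>j\<in>J. l i' j x * w j) = 0" using elim i(2) by blast
      thus "(\<Sum>j<d. lam i' j x * N j i x) = (if i' = i then 1 else 0)" unfolding sJ[OF i(2)] by (simp add: w_def)
    qed
  qed
  moreover have "\<forall>\<^sub>F x in nhds x0. \<forall>w. (\<forall>i\<in>I. (\<Sum>j<d. lam i j x * w j) = 0) \<longrightarrow> (\<forall>j<d. w j = 0)" if cd: "card I = d"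
    using ev
  proof eventually_elim
    case (elim x)
    have "card K = d" by (simp add: K_def card_image)
    \<comment> \<open>In the square case every unknown w is a pivot, so it is a combination of the v
      alone and vanishes with them.\<close>
    hence KK: "K0 = K" using K0(1,2) cd card_subset_eq[of K K0] by (simp add: K_def)
    show ?case
    proof (intro allI impI)
      fix w j assume w: "\<forall>i\<in>I. (\<Sum>j<d. lam i j x * w j) = 0" and j: "j < d"
      let ?w = "case_sum w (\<lambda>_. 0)"
      have "\<forall>i\<in>I. (\<Sum>j\<in>J. l i j x * ?w j) = 0" using w by (simp add: sJ)
      hence "?w (Inl j) = (\<Sum>j'\<in>J - K0. b j' (Inl j) x * ?w j')" using elim[rule_format, of ?w] j KK by (auto simp: K_def)
      also have "\<dots> = 0" by (intro sum.neutral) (auto simp: KK J_def K_def)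
      finally show "w j = 0" by simp
    qed
  qed
  ultimately show ?thesis by blast
qed

text \<open>The first integrals live on different neighbourhoods; the finite intersection of these
  with a chart domain serves all of them.\<close>

lemma local_web_exists:
  assumes "hol_web A d W" "m \<in> manifold A"
  shows "\<exists>c V f. local_web A W d c V f \<and> m \<in> V"
proof -
  obtain V T where V: "m \<in> V" "\<And>i. i < d \<Longrightarrow> hol_foliation A V (T i)" "open V" "V \<subseteq> manifold A"
    "\<And>x. x \<in> V \<Longrightarrow> inj_on (\<lambda>i. T i x) {..<d} \<and> W x = (\<lambda>i. T i x) ` {..<d}"
    using assms(1)[unfolded hol_web_def, rule_format, OF assms(2)] by (elim exE conjE) blast
  obtain c where c: "c \<in> A" "m \<in> fst c" using manifold_chart[OF assms(2)] by blast
  define P where "P i V' f \<longleftrightarrow> m \<in> V' \<and> V' \<subseteq> V \<and> hol_on A f V' \<and>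
      (\<forall>x\<in>V'. (\<exists>v\<in>tangent_space A x. v f \<noteq> 0) \<and> T i x = {v \<in> tangent_space A x. v f = 0})" for i V' f
  have "\<exists>V' f. i < d \<longrightarrow> P i V' f" for i
    using V(2)[of i] V(1) unfolding hol_foliation_def P_def by simp
  then obtain V' f where "\<And>i. i < d \<longrightarrow> P i (V' i) (f i)" by metis
  hence f: "i < d \<Longrightarrow> m \<in> V' i \<and> V' i \<subseteq> V \<and> hol_on A (f i) (V' i) \<and>
      (\<forall>x\<in>V' i. (\<exists>v\<in>tangent_space A x. v (f i) \<noteq> 0) \<and> T i x = {v \<in> tangent_space A x. v (f i) = 0})" for i
    unfolding P_def by blast
  define X where "X = V \<inter> fst c \<inter> (\<Inter>i<d. V' i)"
  have "open X" unfolding X_def using V(3) chart_open(1)[OF c(1)] f by (auto intro!: open_Int open_INT simp: hol_on_def)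
  moreover have "m \<in> X" using V(1) c(2) f by (auto simp: X_def)
  moreover have fx: "hn x (f i)" "\<exists>v\<in>tangent_space A x. v (f i) \<noteq> 0" "T i x = {v \<in> tangent_space A x. v (f i) = 0}" if "i < d" "x \<in> X" for i x
    using f[OF that(1)] that unfolding X_def hol_on_hn by auto
  moreover have "\<exists>l. chart_deriv c l (f i) x \<noteq> 0" if ix: "i < d" "x \<in> X" for i x
  proof (rule ccontr)
    assume n: "\<not> ?thesis"
    obtain v where v: "v \<in> tangent_space A x" "v (f i) \<noteq> 0" using fx(2)[OF ix] by blast
    have "x \<in> fst c" using ix(2) by (simp add: X_def)
    thus False using tangent_apply[OF v(1) c(1) _ fx(1)[OF ix]] v(2) n by simp
  qed
  moreover have "inj_on (\<lambda>i. {v \<in> tangent_space A x. v (f i) = 0}) {..<d} \<and> W x = (\<lambda>i. {v \<in> tangent_space A x. v (f i) = 0}) ` {..<d}" if "x \<in> X" for x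
  proof -
    have "T i x = {v \<in> tangent_space A x. v (f i) = 0}" if "i \<in> {..<d}" for i using fx(3) that \<open>x \<in> X\<close> by simp
    hence e: "inj_on (\<lambda>i. T i x) {..<d} = inj_on (\<lambda>i. {v \<in> tangent_space A x. v (f i) = 0}) {..<d}"
      "(\<lambda>i. T i x) ` {..<d} = (\<lambda>i. {v \<in> tangent_space A x. v (f i) = 0}) ` {..<d}"
      by (auto intro!: inj_on_cong image_cong)
    thus ?thesis using V(5)[of x] that by (simp add: X_def)
  qed
  ultimately have "local_web A W d c X f"
    by unfold_locales (use c in \<open>auto simp: X_def\<close>)
  thus ?thesis using \<open>m \<in> X\<close> by blast
qed

end

section \<open>Symbols of the equations and their surjectivity\<close>

context local_web begin

text \<open>The coefficient of the top unknown \<open>w\<^sub>i\<^sub>s\<close> (\<open>s = length \<beta>\<close>) in the equation of index \<open>\<beta>\<close> of a formal relation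
  is a coefficient of the \<open>s\<close>-th symmetric power of \<open>df\<^sub>i\<close>; by \<open>duals s x\<close> these powers span.\<close>

definition symbol :: "nat \<Rightarrow> 'n list \<Rightarrow> 'm \<Rightarrow> complex"
  where "symbol i \<beta> x = (\<Prod>b\<leftarrow>\<beta>. chart_deriv c\<^sub>0 b (f i) x)"

lemma symbol_hn: "x \<in> V \<Longrightarrow> i < d \<Longrightarrow> hn x (symbol i \<beta>)"
proof -
  assume "x \<in> V" "i < d"
  hence "hn x (faa c\<^sub>0 (f i) \<beta> (length \<beta>))" by (intro faa_hol c0 V_c0 f)
  thus ?thesis by (simp add: faa_top symbol_def[abs_def])
qed

text \<open>Surjectivity of the symbol matrix at one point, as preimages of unit vectors, the form
  that \<open>right_inverse\<close> takes as input.\<close>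

definition duals :: "nat \<Rightarrow> 'm \<Rightarrow> bool"
  where "duals s x \<longleftrightarrow> (\<forall>\<mu>\<in>multi_indices s. \<exists>y. \<forall>\<mu>'\<in>multi_indices s. (\<Sum>i<d. symbol i (index_list \<mu>') x * y i) = (if \<mu>' = \<mu> then 1 else 0))"

text \<open>With the multinomial factor included, the coefficients of a power of
  \<open>df\<^sub>i\<close> are exactly its symbols. The extension by 0 matches that of
  covectors.\<close>

definition coord_monomial :: "'m \<Rightarrow> ('n \<Rightarrow> nat) \<Rightarrow> 'm tvec \<Rightarrow> complex"
  where "coord_monomial x \<mu> v = (if v \<in> tangent_space A x then of_nat (nperm \<mu>) * (\<Prod>b\<leftarrow>index_list \<mu>. v (\<lambda>y. snd c\<^sub>0 y $ b)) else 0)"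

text \<open>Independence of the monomials on the tangent space, stated without reference to a point or a chart:
  once obtained at one point it is available at all nearby points.\<close>

definition indep_mono :: "nat \<Rightarrow> bool"
  where "indep_mono s \<longleftrightarrow> (\<forall>y. (\<forall>a::complex^'n. (\<Sum>\<mu>\<in>multi_indices s. y \<mu> * (of_nat (nperm \<mu>) * (\<Prod>b\<leftarrow>index_list \<mu>. a $ b))) = 0) \<longrightarrow> (\<forall>\<mu>\<in>multi_indices s. y \<mu> = 0))"

lemma power_expand:
  assumes "x \<in> V" "i < d" "v \<in> tangent_space A x"
  shows "v (f i) ^ s = (\<Sum>\<mu>\<in>multi_indices s. coord_monomial x \<mu> v * symbol i (index_list \<mu>) x)"
proof -
  have p: "(\<Prod>b\<leftarrow>\<beta>. p b * (q b :: complex)) = (\<Prod>b\<leftarrow>\<beta>. p b) * (\<Prod>b\<leftarrow>\<beta>. q b)" for p q and \<beta> :: "'n list"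
    by (induction \<beta>) auto
  show ?thesis
    unfolding tangent_apply[OF assms(3) c0 V_c0[OF assms(1)] f[OF assms(2,1)]] multinomial p
    using assms(3) by (simp add: coord_monomial_def symbol_def mult.assoc)
qed

definition conormal_power :: "nat \<Rightarrow> nat \<Rightarrow> 'm \<Rightarrow> 'm tvec \<Rightarrow> complex"
  where "conormal_power s i x v = (if v \<in> tangent_space A x then v (f i) ^ s else 0)"

lemma conormal_power_expand: "x \<in> V \<Longrightarrow> i < d \<Longrightarrow> conormal_power s i x = (\<Sum>\<mu>\<in>multi_indices s. symbol i (index_list \<mu>) x *\<^sub>F coord_monomial x \<mu>)"
  by (auto simp: fun_eq_iff fscale_sum_apply conormal_power_def power_expand mult.commute) (simp add: coord_monomial_def)

text \<open>On the tangent space every conormal of the web is a multiple of some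
  \<open>df\<^sub>i\<close>. The exponent is positive because the power must be 0 off the tangent
  space.\<close>

lemma conormal_conormal_power:
  assumes "x \<in> V" "\<eta> \<in> conormals A W x" "s \<ge> 1"
  shows "\<exists>t i. i < d \<and> (\<lambda>v. \<eta> v ^ s) = t *\<^sub>F conormal_power s i x"
proof -
  have e: "\<eta> \<in> cotangent_space A x" "{v \<in> tangent_space A x. \<eta> v = 0} \<in> W x" using assms(2) by (auto simp: conormals_def)
  then obtain i where i: "i < d" "{v \<in> tangent_space A x. \<eta> v = 0} = T i x" using WT[OF assms(1)] by auto
  obtain l where l: "chart_deriv c\<^sub>0 l (f i) x \<noteq> 0" using df[OF i(1) assms(1)] by blast
  let ?e = "coord_vec A c\<^sub>0 l x"
  have ce: "?e \<in> tangent_space A x" "?e (f i) = chart_deriv c\<^sub>0 l (f i) x"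
    using coord_vec_tangent[OF c0 V_c0[OF assms(1)]] f[OF i(1) assms(1)] by (auto simp: coord_vec_apply)
  have "\<eta> v = \<eta> ?e / ?e (f i) * v (f i)" if v: "v \<in> tangent_space A x" for v
  proof -
    let ?q = "- v (f i) / ?e (f i)"
    have "(v + ?q *\<^sub>F ?e) (f i) = 0" using l ce by (simp add: fscale_def)
    hence "v + ?q *\<^sub>F ?e \<in> T i x" using tangent_lin[OF v ce(1), of ?q] unfolding T_def by blast
    hence "\<eta> (v + ?q *\<^sub>F ?e) = 0" using i(2) by blast
    moreover have "\<eta> (v + ?q *\<^sub>F ?e) = \<eta> v + ?q * \<eta> ?e" using e(1) v ce(1) unfolding cotangent_space_def by blast
    ultimately show ?thesis using l ce by (simp add: field_simps)
  qed
  moreover have "\<eta> v = 0" if "v \<notin> tangent_space A x" for v using e(1) that by (auto simp: cotangent_space_def)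
  ultimately have "(\<lambda>v. \<eta> v ^ s) = ((\<eta> ?e / ?e (f i)) ^ s) *\<^sub>F conormal_power s i x"
    using assms(3) by (auto simp: fun_eq_iff fscale_def conormal_power_def power_mult_distrib power_divide)
  thus ?thesis using i(1) by blast
qed

lemma conormal_power_conormal:
  assumes "x \<in> V" "i < d" "s \<ge> 1"
  shows "conormal_power s i x \<in> (\<lambda>\<eta>. \<lambda>v. \<eta> v ^ s) ` conormals A W x"
proof -
  let ?\<eta> = "\<lambda>v. if v \<in> tangent_space A x then v (f i) else 0"
  obtain l where l: "chart_deriv c\<^sub>0 l (f i) x \<noteq> 0" using df[OF assms(2,1)] by blast
  have nz: "?\<eta> (coord_vec A c\<^sub>0 l x) \<noteq> 0"
    using l coord_vec_tangent[OF c0 V_c0[OF assms(1)]] f[OF assms(2,1)] by (auto simp: coord_vec_apply)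
  have "?\<eta> \<noteq> 0"
  proof
    assume "?\<eta> = 0"
    from fun_cong[OF this, of "coord_vec A c\<^sub>0 l x"] nz show False by (simp only: zero_fun_apply)
  qed
  moreover have "?\<eta> \<in> cotangent_space A x" using tangent_lin by (auto simp: cotangent_space_def fscale_def)
  moreover have "{v \<in> tangent_space A x. ?\<eta> v = 0} = T i x" by (auto simp: T_def)
  ultimately have "?\<eta> \<in> conormals A W x" using T_in_W[OF assms(1,2)] by (simp add: conormals_def)
  moreover have "conormal_power s i x = (\<lambda>v. ?\<eta> v ^ s)" using assms(3) by (auto simp: conormal_power_def fun_eq_iff)
  ultimately show ?thesis by (intro image_eqI[where x="?\<eta>"])
qed

lemma conormal_span:
  assumes "x \<in> V" "s \<ge> 1"
  shows "(\<lambda>\<eta>. \<lambda>v. \<eta> v ^ s) ` conormals A W x \<subseteq> cfun.span ((\<lambda>i. conormal_power s i x) ` {..<d})"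
    and "(\<lambda>i. conormal_power s i x) ` {..<d} \<subseteq> cfun.span (coord_monomial x ` multi_indices s)"
proof -
  show "(\<lambda>\<eta>. \<lambda>v. \<eta> v ^ s) ` conormals A W x \<subseteq> cfun.span ((\<lambda>i. conormal_power s i x) ` {..<d})"
  proof safe
    fix \<eta> assume "\<eta> \<in> conormals A W x"
    from conormal_conormal_power[OF assms(1) this assms(2)] obtain t i where i: "i < d" "(\<lambda>v. \<eta> v ^ s) = t *\<^sub>F conormal_power s i x" by blast
    show "(\<lambda>v. \<eta> v ^ s) \<in> cfun.span ((\<lambda>i. conormal_power s i x) ` {..<d})"
      unfolding i(2) using i(1) by (intro cfun.span_scale cfun.span_base) auto
  qed
  show "(\<lambda>i. conormal_power s i x) ` {..<d} \<subseteq> cfun.span (coord_monomial x ` multi_indices s)"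
    using conormal_power_expand[OF assms(1)] cfun_sum_in_span by auto
qed

text \<open>The powers lie in the span of the monomials, and B has as many elements as there are
  monomials; hence the spans coincide and the monomials are independent. Writing a monomial through
  the powers and comparing coefficients produces its dual vector.\<close>

lemma duals_of_independent:
  assumes x: "x \<in> V" and s: "s \<ge> 1"
    and B: "B \<subseteq> (\<lambda>\<eta>. \<lambda>v. \<eta> v ^ s) ` conormals A W x" "finite B" "card B = web_c CARD('n) s" "cfun.independent B"
  shows "duals s x" "indep_mono s"
proof -
  have B1: "B \<subseteq> cfun.span ((\<lambda>i. conormal_power s i x) ` {..<d})" using B(1) conormal_span(1)[OF x s] by blast
  have "cfun.span ((\<lambda>i. conormal_power s i x) ` {..<d}) \<subseteq> cfun.span (coord_monomial x ` multi_indices s)"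
    by (rule cfun.span_minimal[OF conormal_span(2)[OF x s] cfun.subspace_span])
  hence B2: "B \<subseteq> cfun.span (coord_monomial x ` multi_indices s)" using B1 by blast
  have cB: "card B = card (multi_indices s :: ('n \<Rightarrow> nat) set)" using B(3) card_multi_indices by metis
  note mx = cfun_indep_max[OF B(4,2) finite_multi_indices B2 cB]
  have uniq: "y \<mu> = 0" if "\<And>v. (\<Sum>\<mu>\<in>multi_indices s. y \<mu> * coord_monomial x \<mu> v) = 0" "\<mu> \<in> multi_indices s" for y \<mu>
    using cfun_independent_imageD[OF finite_multi_indices mx(1,2) that] .
  show "indep_mono s"
    unfolding indep_mono_def
  proof (intro allI impI)
    fix y assume y: "\<forall>a::complex^'n. (\<Sum>\<mu>\<in>multi_indices s. y \<mu> * (of_nat (nperm \<mu>) * (\<Prod>b\<leftarrow>index_list \<mu>. a $ b))) = 0"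
    have "(\<Sum>\<mu>\<in>multi_indices s. y \<mu> * coord_monomial x \<mu> v) = 0" for v
    proof (cases "v \<in> tangent_space A x")
      case True
      have "($) (\<chi> b. v (\<lambda>y. snd c\<^sub>0 y $ b)) = (\<lambda>b. v (\<lambda>y. snd c\<^sub>0 y $ b))" by (simp add: fun_eq_iff)
      thus ?thesis using True y[rule_format, of "\<chi> b. v (\<lambda>y. snd c\<^sub>0 y $ b)"] by (simp add: coord_monomial_def)
    qed (simp add: coord_monomial_def)
    thus "\<forall>\<mu>\<in>multi_indices s. y \<mu> = 0" using uniq by blast
  qed
  show "duals s x"
    unfolding duals_def
  proof
    fix \<mu> :: "'n \<Rightarrow> nat" assume \<mu>: "\<mu> \<in> multi_indices s"
    have "cfun.span B \<subseteq> cfun.span ((\<lambda>i. conormal_power s i x) ` {..<d})" by (rule cfun.span_minimal[OF B1 cfun.subspace_span])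
    hence "coord_monomial x \<mu> \<in> cfun.span ((\<lambda>i. conormal_power s i x) ` {..<d})" using mx(3)[OF \<mu>] by blast
    then obtain y where y: "coord_monomial x \<mu> = (\<Sum>i<d. y i *\<^sub>F conormal_power s i x)" using cfun_span_image[of "{..<d}"] by blast
    have "(\<Sum>\<nu>\<in>multi_indices s. ((\<Sum>i<d. symbol i (index_list \<nu>) x * y i) - (if \<nu> = \<mu> then 1 else 0)) * coord_monomial x \<nu> v) = 0" for v
    proof -
      have "coord_monomial x \<mu> v = (\<Sum>i<d. y i * (\<Sum>\<nu>\<in>multi_indices s. symbol i (index_list \<nu>) x * coord_monomial x \<nu> v))"
        unfolding y fscale_sum_apply by (intro sum.cong refl) (simp add: conormal_power_expand[OF x] fscale_sum_apply)
      also have "\<dots> = (\<Sum>\<nu>\<in>multi_indices s. (\<Sum>i<d. symbol i (index_list \<nu>) x * y i) * coord_monomial x \<nu> v)"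
        by (simp add: sum_distrib_left sum_distrib_right, subst sum.swap, simp add: algebra_simps)
      finally have e: "(\<Sum>\<nu>\<in>multi_indices s. (\<Sum>i<d. symbol i (index_list \<nu>) x * y i) * coord_monomial x \<nu> v) = coord_monomial x \<mu> v" ..
      have "(\<Sum>\<nu>\<in>multi_indices s. (if \<nu> = \<mu> then 1 else 0) * coord_monomial x \<nu> v) = (\<Sum>\<nu>\<in>multi_indices s. if \<nu> = \<mu> then coord_monomial x \<mu> v else 0)"
        by (intro sum.cong) auto
      also have "\<dots> = coord_monomial x \<mu> v" using \<mu> by simp
      finally show ?thesis using e by (simp add: left_diff_distrib sum_subtractf)
    qed
    from uniq[OF this] show "\<exists>y. \<forall>\<mu>'\<in>multi_indices s. (\<Sum>i<d. symbol i (index_list \<mu>') x * y i) = (if \<mu>' = \<mu> then 1 else 0)" by force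
  qed
qed

lemma duals_inverse:
  assumes "x \<in> V" "duals s x"
  shows "\<exists>N. (\<forall>j<d. \<forall>\<mu>\<in>multi_indices s. hn x (N j \<mu>)) \<and>
      (\<forall>\<^sub>F z in nhds x. \<forall>\<mu>\<in>multi_indices s. \<forall>\<mu>'\<in>multi_indices s. (\<Sum>j<d. symbol j (index_list \<mu>') z * N j \<mu> z) = (if \<mu>' = \<mu> then 1 else 0)) \<and>
      (web_c CARD('n) s = d \<longrightarrow> (\<forall>\<^sub>F z in nhds x. \<forall>w. (\<forall>\<mu>\<in>multi_indices s. (\<Sum>j<d. symbol j (index_list \<mu>) z * w j) = 0) \<longrightarrow> (\<forall>j<d. w j = 0)))"
  unfolding card_multi_indices[symmetric]
  by (rule right_inverse) (use assms symbol_hn V_manifold in \<open>auto simp: duals_def\<close>)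

text \<open>The right inverse is valid at all points near x, and its columns are dual vectors
  there.\<close>

lemma duals_open:
  assumes "x \<in> V" "duals s x"
  shows "\<forall>\<^sub>F z in nhds x. duals s z"
proof -
  obtain N where "\<forall>\<^sub>F z in nhds x. \<forall>\<mu>\<in>multi_indices s. \<forall>\<mu>'\<in>multi_indices s. (\<Sum>j<d. symbol j (index_list \<mu>') z * N j \<mu> z) = (if \<mu>' = \<mu> then 1 else 0)"
    using duals_inverse[OF assms] by blast
  thus ?thesis
  proof eventually_elim
    case (elim z)
    show ?case unfolding duals_def
    proof
      fix \<mu> :: "'n \<Rightarrow> nat" assume "\<mu> \<in> multi_indices s"
      thus "\<exists>y. \<forall>\<mu>'\<in>multi_indices s. (\<Sum>i<d. symbol i (index_list \<mu>') z * y i) = (if \<mu>' = \<mu> then 1 else 0)"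
        using elim by (intro exI[of _ "\<lambda>j. N j \<mu> z"]) blast
    qed
  qed
qed

text \<open>This serves to keep a neighbourhood away from S. Dual vectors recover the independent
  monomials from the powers of conormals, so the span of these powers has full dimension.\<close>

lemma web_r_duals:
  assumes "x \<in> V" "s \<ge> 1" "duals s x" "indep_mono s"
  shows "web_r A W s x = web_c CARD('n) s"
proof -
  have ind: "inj_on (coord_monomial x) (multi_indices s) \<and> cfun.independent (coord_monomial x ` multi_indices s)"
  proof (rule cfun_independent_image[OF finite_multi_indices])
    fix y assume h: "\<And>v. (\<Sum>\<mu>\<in>multi_indices s. y \<mu> * coord_monomial x \<mu> v) = 0"
    have "(\<Sum>\<mu>\<in>multi_indices s. y \<mu> * (of_nat (nperm \<mu>) * (\<Prod>b\<leftarrow>index_list \<mu>. a $ b))) = 0" for a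
      using h[of "tangent_of A c\<^sub>0 x a"] tangent_of_tangent[OF c0 V_c0[OF assms(1)]] hn_coord[OF c0 V_c0[OF assms(1)]]
      by (simp add: coord_monomial_def tangent_of_apply chart_deriv_coord[OF c0 V_c0[OF assms(1)]] if_distrib cong: if_cong)
    thus "\<forall>\<mu>\<in>multi_indices s. y \<mu> = 0" using assms(4) by (simp add: indep_mono_def)
  qed
  let ?X = "(\<lambda>\<eta>. \<lambda>v. \<eta> v ^ s) ` conormals A W x"
  have "coord_monomial x ` multi_indices s \<subseteq> cfun.span ?X"
  proof safe
    fix \<mu> :: "'n \<Rightarrow> nat" assume \<mu>: "\<mu> \<in> multi_indices s"
    obtain y where y: "\<forall>\<mu>'\<in>multi_indices s. (\<Sum>i<d. symbol i (index_list \<mu>') x * y i) = (if \<mu>' = \<mu> then 1 else 0)"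
      using assms(3) \<mu> by (auto simp: duals_def)
    have "coord_monomial x \<mu> v = (\<Sum>i<d. y i *\<^sub>F conormal_power s i x) v" for v
    proof -
      have "(\<Sum>i<d. y i *\<^sub>F conormal_power s i x) v = (\<Sum>i<d. y i * (\<Sum>\<nu>\<in>multi_indices s. symbol i (index_list \<nu>) x * coord_monomial x \<nu> v))"
        unfolding fscale_sum_apply by (intro sum.cong refl) (simp add: conormal_power_expand[OF assms(1)] fscale_sum_apply)
      also have "\<dots> = (\<Sum>\<nu>\<in>multi_indices s. (\<Sum>i<d. symbol i (index_list \<nu>) x * y i) * coord_monomial x \<nu> v)"
        by (simp add: sum_distrib_left sum_distrib_right, subst sum.swap, simp add: algebra_simps)
      also have "\<dots> = (\<Sum>\<nu>\<in>multi_indices s. if \<nu> = \<mu> then coord_monomial x \<mu> v else 0)" using y by (intro sum.cong) auto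
      finally show ?thesis using \<mu> by simp
    qed
    hence "coord_monomial x \<mu> = (\<Sum>i<d. y i *\<^sub>F conormal_power s i x)" by blast
    also have "\<dots> \<in> cfun.span ?X"
      using conormal_power_conormal[OF assms(1) _ assms(2)] by (intro cfun.span_sum cfun.span_scale cfun.span_base) auto
    finally show "coord_monomial x \<mu> \<in> cfun.span ?X" .
  qed
  moreover have "?X \<subseteq> cfun.span (coord_monomial x ` multi_indices s)"
    using conormal_span[OF assms(1,2)] cfun.span_minimal[OF _ cfun.subspace_span] by blast
  ultimately have "cfun.span (coord_monomial x ` multi_indices s) = cfun.span ?X"
    using cfun.span_minimal[OF _ cfun.subspace_span] by (metis subset_antisym)
  from cfun.dim_eq_card[OF this] ind show ?thesis
    by (simp add: web_r_def card_image card_multi_indices)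
qed

end

section \<open>Formal abelian relations in coordinates\<close>

context atlas begin

lemma iter_deriv_van:
  assumes "c \<in> A" "x \<in> fst c" "hn x g" "hn x h" "van c p (\<lambda>y. g y - h y) x" "length \<alpha> < p"
  shows "iter_deriv c \<alpha> g x = iter_deriv c \<alpha> h x"
proof -
  have "\<forall>\<^sub>F y in nhds x. iter_deriv c \<alpha> (\<lambda>y. h y + (g y - h y)) y = iter_deriv c \<alpha> h y + iter_deriv c \<alpha> (\<lambda>y. g y - h y) y"
    by (rule iter_deriv_add[OF assms(1,2,4) hn_diff[OF assms(3,4)]])
  from eventually_nhds_x_imp_x[OF this] show ?thesis using assms(5,6) by (simp add: van_def)
qed

end

context local_web begin

text \<open>\<open>w i j\<close> is the \<open>j\<close>-th derivative at \<open>f i x\<close> of a function \<open>F\<^sub>i\<close> of one variable; \<open>jetw p x w\<close> is the jet of the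
  family of the \<open>d(F\<^sub>i \<circ> f\<^sub>i)\<close>, and \<open>eqn N x w\<close> says that the sum of the \<open>F\<^sub>i \<circ> f\<^sub>i\<close> is constant up to order \<open>N\<close>.\<close>

definition jetw :: "nat \<Rightarrow> 'm \<Rightarrow> (nat \<Rightarrow> nat \<Rightarrow> complex) \<Rightarrow> ('m, 'n) jet"
  where "jetw p x w = (\<lambda>(c, S, l, \<alpha>). if c \<in> A \<and> x \<in> fst c \<and> length \<alpha> \<le> p then
    \<Sum>i<d. if S = T i x then \<Sum>j=1..Suc (length \<alpha>). faa c (f i) (\<alpha> @ [l]) j x * w i j else 0 else 0)"

definition eqn :: "nat \<Rightarrow> 'm \<Rightarrow> (nat \<Rightarrow> nat \<Rightarrow> complex) \<Rightarrow> bool"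
  where "eqn N x w \<longleftrightarrow> (\<forall>\<beta>. 1 \<le> length \<beta> \<longrightarrow> length \<beta> \<le> N \<longrightarrow>
    (\<Sum>i<d. \<Sum>j=1..length \<beta>. faa c\<^sub>0 (f i) \<beta> j x * w i j) = 0)"

lemma jetw_T:
  assumes "x \<in> V" "i < d" "c \<in> A" "x \<in> fst c" "length \<alpha> \<le> p"
  shows "jetw p x w (c, T i x, l, \<alpha>) = (\<Sum>j=1..Suc (length \<alpha>). faa c (f i) (\<alpha> @ [l]) j x * w i j)"
proof -
  let ?h = "\<lambda>i. \<Sum>j=1..Suc (length \<alpha>). faa c (f i) (\<alpha> @ [l]) j x * w i j"
  have "(\<Sum>k<d. if T i x = T k x then ?h k else 0) = (\<Sum>k<d. if k = i then ?h i else 0)"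
    using injT[OF assms(1)] assms(2) by (intro sum.cong) auto
  thus ?thesis using assms by (simp add: jetw_def)
qed

text \<open>Jets vanish outside the admissible indices, so only components along the numbered
  foliations have to be compared.\<close>

lemma jet_eqI:
  fixes s t :: "('m, 'n) jet"
  assumes "x \<in> V" "\<And>c i l \<alpha>. i < d \<Longrightarrow> c \<in> A \<Longrightarrow> x \<in> fst c \<Longrightarrow> length \<alpha> \<le> p \<Longrightarrow> s (c, T i x, l, \<alpha>) = t (c, T i x, l, \<alpha>)"
    and "\<And>c S l \<alpha>. \<not> (c \<in> A \<and> x \<in> fst c \<and> length \<alpha> \<le> p \<and> S \<in> W x) \<Longrightarrow> s (c, S, l, \<alpha>) = 0"
    and "\<And>c S l \<alpha>. \<not> (c \<in> A \<and> x \<in> fst c \<and> length \<alpha> \<le> p \<and> S \<in> W x) \<Longrightarrow> t (c, S, l, \<alpha>) = 0"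
  shows "s = t"
proof
  fix z :: "('m, 'n) chart \<times> 'm hyp \<times> 'n \<times> 'n list"
  obtain c S l \<alpha> where z: "z = (c, S, l, \<alpha>)" by (cases z) auto
  show "s z = t z"
  proof (cases "c \<in> A \<and> x \<in> fst c \<and> length \<alpha> \<le> p \<and> S \<in> W x")
    case True
    then obtain i where "i < d" "S = T i x" using WT[OF assms(1)] by auto
    thus ?thesis using True assms(2) z by simp
  qed (simp add: z assms(3,4))
qed

lemma jet_A_zero: "\<not> (c \<in> A \<and> x \<in> fst c \<and> length \<alpha> \<le> p \<and> S \<in> W x) \<Longrightarrow> jet_A A W p x u (c, S, l, \<alpha>) = 0"
  by (auto simp: jet_A_def)

lemma jetw_zero:
  assumes "x \<in> V" "\<not> (c \<in> A \<and> x \<in> fst c \<and> length \<alpha> \<le> p \<and> S \<in> W x)"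
  shows "jetw p x w (c, S, l, \<alpha>) = 0"
  using assms T_in_W by (auto simp: jetw_def intro!: sum.neutral)

lemma jetw_lin: "jetw p x (\<lambda>i j. w i j + a * w' i j) = jetw p x w + a *\<^sub>F jetw p x w'"
  by (auto simp: jetw_def fun_eq_iff fscale_def sum.distrib algebra_simps sum_distrib_left if_distrib cong: if_cong
      intro!: sum.cong simp flip: sum.distrib)

lemma jetw_cong:
  assumes "\<And>i j. i < d \<Longrightarrow> j \<in> {1..Suc p} \<Longrightarrow> w i j = w' i j"
  shows "jetw p x w = jetw p x w'"
  unfolding jetw_def using assms by (intro ext) (auto intro!: sum.cong split: prod.splits)

lemma eqn_cong:
  assumes "\<And>i j. i < d \<Longrightarrow> j \<in> {1..N} \<Longrightarrow> w i j = w' i j"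
  shows "eqn N x w = eqn N x w'"
proof -
  have "(\<Sum>i<d. \<Sum>j=1..length \<beta>. faa c\<^sub>0 (f i) \<beta> j x * w i j) = (\<Sum>i<d. \<Sum>j=1..length \<beta>. faa c\<^sub>0 (f i) \<beta> j x * w' i j)"
    if "length \<beta> \<le> N" for \<beta>
    using assms that by (intro sum.cong refl) auto
  thus ?thesis unfolding eqn_def by auto
qed

lemma eqn_lin: "eqn N x w \<Longrightarrow> eqn N x w' \<Longrightarrow> eqn N x (\<lambda>i j. w i j + a * w' i j)"
proof -
  have "(\<Sum>i<d. \<Sum>j=1..length \<beta>. faa c\<^sub>0 (f i) \<beta> j x * (w i j + a * w' i j)) =
     (\<Sum>i<d. \<Sum>j=1..length \<beta>. faa c\<^sub>0 (f i) \<beta> j x * w i j) + a * (\<Sum>i<d. \<Sum>j=1..length \<beta>. faa c\<^sub>0 (f i) \<beta> j x * w' i j)" for \<beta>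
    by (simp add: sum.distrib sum_distrib_left algebra_simps)
  thus "eqn N x w \<Longrightarrow> eqn N x w' \<Longrightarrow> eqn N x (\<lambda>i j. w i j + a * w' i j)" by (simp add: eqn_def)
qed

lemma eqn_mono: "eqn N x w \<Longrightarrow> N' \<le> N \<Longrightarrow> eqn N' x w"
  by (auto simp: eqn_def)

text \<open>Repeating one direction in which the derivative of \<open>f i\<close> is nonzero makes
  the passage from w to the jet triangular; injectivity and holomorphy of the coordinates both rest
  on it. The word has j - 1 letters because the component index l is the remaining
  differentiation.\<close>

lemma jetw_step:
  assumes "x \<in> V" "i < d" "j \<in> {1..Suc p}"
  shows "jetw p x w (c\<^sub>0, T i x, l, replicate (j - 1) l) =
    (\<Sum>j'=1..<j. faa c\<^sub>0 (f i) (replicate j l) j' x * w i j') + chart_deriv c\<^sub>0 l (f i) x ^ j * w i j"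
proof -
  obtain j' where j: "j = Suc j'" using assms(3) by (cases j) auto
  have r: "replicate j' l @ [l] = replicate (Suc j') l" by (simp add: replicate_append_same)
  have top: "faa c\<^sub>0 (f i) (replicate (Suc j') l) (Suc j') x = chart_deriv c\<^sub>0 l (f i) x ^ Suc j'"
    using faa_top[of c\<^sub>0 "f i" "replicate (Suc j') l"] by (simp only: length_replicate map_replicate prod_list_replicate)
  have "jetw p x w (c\<^sub>0, T i x, l, replicate j' l) = (\<Sum>k=1..Suc j'. faa c\<^sub>0 (f i) (replicate (Suc j') l) k x * w i k)"
    using jetw_T[OF assms(1,2) c0 V_c0[OF assms(1)], of "replicate j' l" p w l] assms(3) unfolding r by (simp add: j)
  also have "\<dots> = (\<Sum>k=1..<Suc j'. faa c\<^sub>0 (f i) (replicate (Suc j') l) k x * w i k) + chart_deriv c\<^sub>0 l (f i) x ^ Suc j' * w i (Suc j')"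
    unfolding top[symmetric] by (simp add: atLeastLessThanSuc_atLeastAtMost)
  finally show ?thesis by (simp add: j)
qed

lemma jetw_inj:
  assumes "x \<in> V" "jetw p x w = jetw p x w'" "i < d"
  shows "j \<in> {1..Suc p} \<Longrightarrow> w i j = w' i j"
proof (induction j rule: less_induct)
  case (less j)
  obtain l where l: "chart_deriv c\<^sub>0 l (f i) x \<noteq> 0" using df[OF assms(3,1)] by blast
  have "(\<Sum>j'=1..<j. faa c\<^sub>0 (f i) (replicate j l) j' x * w i j') = (\<Sum>j'=1..<j. faa c\<^sub>0 (f i) (replicate j l) j' x * w' i j')"
    using less by (intro sum.cong refl) auto
  with jetw_step[OF assms(1,3) less.prems, of w l] jetw_step[OF assms(1,3) less.prems, of w' l] assms(2)
  show ?case using l by simp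
qed

text \<open>Formal closedness makes the coefficient of \<open>df\<^sub>i\<close> a polynomial in
  \<open>f i\<close> up to order p, and its Taylor coefficients are the unknowns. The equations come
  from differentiating the vanishing sum of the components of a section.\<close>

lemma formal_to_w:
  assumes "x \<in> V" "sec x u" "jet_D A W p x u = 0"
  shows "\<exists>w. jet_A A W p x u = jetw p x w \<and> eqn (Suc p) x w"
proof -
  note cx = c0 V_c0[OF assms(1)]
  have hcf: "hn x (cf u i)" if "i < d" for i by (rule sec_cf_hn[OF assms(2,1) that])
  have "\<exists>w. van c\<^sub>0 (Suc p) (\<lambda>y. cf u i y - pw w p (f i y - f i x)) x" if i: "i < d" for i
  proof -
    obtain l where l: "chart_deriv c\<^sub>0 l (f i) x \<noteq> 0" using df[OF i assms(1)] by blast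
    show ?thesis
      by (rule van_poly_approx[OF cx f[OF i assms(1)] l hcf[OF i]])
        (use assms(3) i cx in \<open>simp add: jet_D_zero_iff[OF assms(2,1)]\<close>)
  qed
  then obtain w where w: "\<And>i. i < d \<Longrightarrow> van c\<^sub>0 (Suc p) (\<lambda>y. cf u i y - pw (w i) p (f i y - f i x)) x" by metis
  \<comment> \<open>The coefficient of \<open>df\<^sub>i\<close> is the first derivative of
    \<open>F\<^sub>i\<close>, hence the shift by one.\<close>
  define w' where "w' i j = w i (j - 1)" for i j
  have it: "iter_deriv c \<alpha> (\<lambda>y. cf u i y * chart_deriv c l (f i) y) x = (\<Sum>j=1..Suc (length \<alpha>). faa c (f i) (\<alpha> @ [l]) j x * w' i j)"
    if i: "i < d" and c: "c \<in> A" "x \<in> fst c" and a: "length \<alpha> \<le> p" for i c \<alpha> l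
  proof -
    note fi = f[OF i assms(1)]
    have v: "van c (Suc p) (\<lambda>y. cf u i y - pw (w i) p (f i y - f i x)) x"
      by (rule van_chart[OF cx c hn_diff[OF hcf[OF i] hn_pw[OF fi]] w[OF i]])
    have "van c (Suc p) (\<lambda>y. cf u i y * chart_deriv c l (f i) y - pw (w i) p (f i y - f i x) * chart_deriv c l (f i) y) x"
      unfolding left_diff_distrib[symmetric]
      by (intro van_mult c hn_diff hn_pw hn_D fi hcf i v)
    hence "iter_deriv c \<alpha> (\<lambda>y. cf u i y * chart_deriv c l (f i) y) x = iter_deriv c \<alpha> (\<lambda>y. pw (w i) p (f i y - f i x) * chart_deriv c l (f i) y) x"
      using a by (intro iter_deriv_van[OF c, of _ _ "Suc p"] hn_mult hn_D c hn_pw fi hcf i) auto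
    thus ?thesis using iter_deriv_pw[OF c fi a, of "w' i" l] by (simp add: w'_def)
  qed
  have "jet_A A W p x u = jetw p x w'"
  proof (rule jet_eqI[OF assms(1), of p])
    fix c i l and \<alpha> :: "'n list" assume h: "i < d" "c \<in> A" "x \<in> fst c" "length \<alpha> \<le> p"
    show "jet_A A W p x u (c, T i x, l, \<alpha>) = jetw p x w' (c, T i x, l, \<alpha>)"
      unfolding jetw_T[OF assms(1) h] jet_A_T[OF assms(2,1) h] by (rule it[OF h])
  qed (auto simp: jet_A_zero jetw_zero[OF assms(1)])
  moreover have "eqn (Suc p) x w'"
    unfolding eqn_def
  proof (intro allI impI)
    fix \<beta> :: "'n list" assume b: "1 \<le> length \<beta>" "length \<beta> \<le> Suc p"
    then obtain \<alpha> l where a: "\<beta> = \<alpha> @ [l]" by (cases \<beta> rule: rev_cases) auto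
    have la: "length \<alpha> \<le> p" using b(2) a by simp
    have "(\<Sum>i<d. \<Sum>j=1..length \<beta>. faa c\<^sub>0 (f i) \<beta> j x * w' i j) = (\<Sum>i<d. iter_deriv c\<^sub>0 \<alpha> (\<lambda>y. cf u i y * chart_deriv c\<^sub>0 l (f i) y) x)"
      using it[OF _ cx la, of _ l] by (intro sum.cong refl) (simp add: a)
    also have "\<dots> = iter_deriv c\<^sub>0 \<alpha> (\<lambda>y. \<Sum>i<d. cf u i y * chart_deriv c\<^sub>0 l (f i) y) x"
      by (rule eventually_nhds_x_imp_x[OF iter_deriv_sum[OF cx], symmetric])
        (auto intro!: hn_mult hcf hn_D cx f assms(1))
    also have "\<dots> = iter_deriv c\<^sub>0 \<alpha> (\<lambda>y. 0) x"
      by (rule iter_deriv_cong[OF cx sec_sum[OF assms(2,1) cx]])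
    finally show "(\<Sum>i<d. \<Sum>j=1..length \<beta>. faa c\<^sub>0 (f i) \<beta> j x * w' i j) = 0" by simp
  qed
  ultimately show ?thesis by blast
qed

lemma index_list_single: "index_list (count (mset [b])) = [b]"
  using mset_index_list[of "[b]"] by simp

text \<open>Polynomials in the first integrals satisfy the sum condition only up to finite order at
  x. By \<open>duals 1\<close> the differentials span near x, so the defect is a combination of them
  whose coefficients h vanish to the same order; subtracting h gives a genuine section with the same
  jet.\<close>

lemma w_to_formal:
  assumes x: "x \<in> V" and dl: "duals 1 x" and w: "eqn (Suc p) x w"
  shows "\<exists>u. sec x u \<and> jet_A A W p x u = jetw p x w \<and> jet_D A W p x u = 0"
proof -
  note cx = c0 V_c0[OF x] and mx = V_manifold[OF x]
  note fx = f[OF _ x]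
  define g where "g i y = pw (\<lambda>k. w i (Suc k)) p (f i y - f i x)" for i y
  have hg: "hn x (g i)" if "i < d" for i unfolding g_def by (rule hn_pw[OF fx[OF that]])
  \<comment> \<open>The defect of the sum condition in direction l; the equations make it vanish to
    order p + 1.\<close>
  define \<theta> where "\<theta> l y = (\<Sum>i<d. g i y * chart_deriv c\<^sub>0 l (f i) y)" for l y
  have h\<theta>: "hn x (\<theta> l)" for l unfolding \<theta>_def by (intro hn_sum mx hn_mult hg hn_D cx fx) auto
  have itg: "iter_deriv c \<alpha> (\<lambda>y. g i y * chart_deriv c l (f i) y) x = (\<Sum>j=1..Suc (length \<alpha>). faa c (f i) (\<alpha> @ [l]) j x * w i j)"
    if "i < d" "c \<in> A" "x \<in> fst c" "length \<alpha> \<le> p" for i c \<alpha> l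
    unfolding g_def by (rule iter_deriv_pw[OF that(2,3) fx[OF that(1)] that(4)])
  have v\<theta>: "van c\<^sub>0 (Suc p) (\<theta> l) x" for l
    unfolding van_def
  proof (intro allI impI)
    fix \<alpha> :: "'n list" assume a: "length \<alpha> < Suc p"
    have "iter_deriv c\<^sub>0 \<alpha> (\<theta> l) x = (\<Sum>i<d. iter_deriv c\<^sub>0 \<alpha> (\<lambda>y. g i y * chart_deriv c\<^sub>0 l (f i) y) x)"
      unfolding \<theta>_def[abs_def]
      by (rule eventually_nhds_x_imp_x[OF iter_deriv_sum[OF cx]]) (auto intro!: hn_mult hg hn_D cx fx)
    also have "\<dots> = (\<Sum>i<d. \<Sum>j=1..length (\<alpha> @ [l]). faa c\<^sub>0 (f i) (\<alpha> @ [l]) j x * w i j)"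
      using itg[OF _ cx, of _ \<alpha> l] a by (intro sum.cong refl) simp
    also have "\<dots> = 0" using w[unfolded eqn_def, rule_format, of "\<alpha> @ [l]"] a by simp
    finally show "iter_deriv c\<^sub>0 \<alpha> (\<theta> l) x = 0" .
  qed
  let ?\<mu> = "\<lambda>b::'n. count (mset [b])"
  obtain N where N: "\<And>j \<mu>. j < d \<Longrightarrow> \<mu> \<in> multi_indices 1 \<Longrightarrow> hn x (N j \<mu>)"
    "\<forall>\<^sub>F z in nhds x. \<forall>\<mu>\<in>multi_indices 1. \<forall>\<mu>'\<in>multi_indices 1. (\<Sum>j<d. symbol j (index_list \<mu>') z * N j \<mu> z) = (if \<mu>' = \<mu> then 1 else 0)"
    using duals_inverse[OF x dl] by blast
  have m1: "?\<mu> b \<in> multi_indices 1" for b using count_multi_indices[of "[b]"] by simp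
  \<comment> \<open>A preimage of the defect under the symbol of order one; being linear in
    \<theta>, it vanishes to the same order.\<close>
  define h where "h j y = (\<Sum>l\<in>UNIV. \<theta> l y * N j (?\<mu> l) y)" for j y
  have hh: "hn x (h j)" if "j < d" for j unfolding h_def by (intro hn_sum mx hn_mult h\<theta> N(1) that m1)
  have vh: "van c\<^sub>0 (Suc p) (h j) x" if "j < d" for j
    unfolding h_def by (intro van_sum van_mult cx hn_mult h\<theta> N(1) that m1 v\<theta>)
  have Dh: "\<forall>\<^sub>F z in nhds x. \<forall>k. (\<Sum>j<d. h j z * chart_deriv c\<^sub>0 k (f j) z) = \<theta> k z"
    using N(2)
  proof eventually_elim
    case (elim z)
    show ?case
    proof
      fix k
      have "(\<Sum>j<d. h j z * chart_deriv c\<^sub>0 k (f j) z) = (\<Sum>l\<in>UNIV. \<theta> l z * (\<Sum>j<d. symbol j (index_list (?\<mu> k)) z * N j (?\<mu> l) z))"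
        unfolding h_def index_list_single by (simp add: sum_distrib_left sum_distrib_right symbol_def, subst sum.swap, simp add: algebra_simps)
      also have "\<dots> = (\<Sum>l\<in>UNIV. if l = k then \<theta> k z else 0)"
      proof (intro sum.cong refl)
        fix l
        have "?\<mu> k = ?\<mu> l \<longleftrightarrow> l = k" by (auto simp: fun_eq_iff split: if_splits)
        thus "\<theta> l z * (\<Sum>j<d. symbol j (index_list (?\<mu> k)) z * N j (?\<mu> l) z) = (if l = k then \<theta> k z else 0)"
          using elim[rule_format, OF m1[of l] m1[of k]] by auto
      qed
      finally show "(\<Sum>j<d. h j z * chart_deriv c\<^sub>0 k (f j) z) = \<theta> k z" by simp
    qed
  qed
  define g' where "g' i y = g i y - h i y" for i y
  have hg': "hn x (g' i)" if "i < d" for i unfolding g'_def by (intro hn_diff hg hh that)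
  have "\<forall>\<^sub>F z in nhds x. z \<in> V \<and> (\<forall>i\<in>{..<d}. hn z (g' i)) \<and> (\<forall>l. (\<Sum>i<d. g' i z * chart_deriv c\<^sub>0 l (f i) z) = 0)"
  proof -
    have "\<forall>\<^sub>F z in nhds x. \<forall>i\<in>{..<d}. hn z (g' i)"
      by (intro eventually_ball_finite ballI hn_eventually hg') auto
    with Dh ev_V[OF x] show ?thesis
      by eventually_elim (auto simp: g'_def left_diff_distrib sum_subtractf \<theta>_def)
  qed
  then obtain V1 where V1: "open V1" "x \<in> V1" "\<And>z. z \<in> V1 \<Longrightarrow> z \<in> V \<and> (\<forall>i\<in>{..<d}. hn z (g' i)) \<and> (\<forall>l. (\<Sum>i<d. g' i z * chart_deriv c\<^sub>0 l (f i) z) = 0)"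
    unfolding eventually_nhds by blast
  define u where "u = mksec g'"
  have "A_section A W V1 u" unfolding u_def by (rule mksec_section[OF V1(1)]) (use V1(3) in auto)
  hence u: "sec x u" using V1(2) by (auto simp: sec_def)
  have cfu: "\<forall>\<^sub>F y in nhds x. cf u i y = g' i y" if "i < d" for i
    using ev_V[OF x] by eventually_elim (simp add: u_def cf_mksec that)
  have vh': "van c (Suc p) (h j) x" if "j < d" "c \<in> A" "x \<in> fst c" for j c
    by (rule van_chart[OF cx that(2,3) hh[OF that(1)] vh[OF that(1)]])
  have "jet_A A W p x u = jetw p x w"
  proof (rule jet_eqI[OF x, of p])
    fix c i l and \<alpha> :: "'n list" assume i: "i < d" and c: "c \<in> A" "x \<in> fst c" and a: "length \<alpha> \<le> p"
    have "jet_A A W p x u (c, T i x, l, \<alpha>) = iter_deriv c \<alpha> (\<lambda>y. cf u i y * chart_deriv c l (f i) y) x"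
      by (rule jet_A_T[OF u x i c a])
    also have "\<dots> = iter_deriv c \<alpha> (\<lambda>y. g' i y * chart_deriv c l (f i) y) x"
      by (rule iter_deriv_cong[OF c]) (use cfu[OF i] in eventually_elim, simp)
    also have "\<dots> = iter_deriv c \<alpha> (\<lambda>y. g i y * chart_deriv c l (f i) y) x"
    proof (rule iter_deriv_van[OF c, where p="Suc p"])
      have "van c (Suc p) (\<lambda>y. - h i y * chart_deriv c l (f i) y) x"
        by (intro van_mult van_minus c hn_minus hh i hn_D fx vh')
      thus "van c (Suc p) (\<lambda>y. g' i y * chart_deriv c l (f i) y - g i y * chart_deriv c l (f i) y) x"
        by (simp add: g'_def algebra_simps)
    qed (use a in \<open>auto intro!: hn_mult hg' hg i hn_D c fx\<close>)
    also have "\<dots> = jetw p x w (c, T i x, l, \<alpha>)" unfolding jetw_T[OF x i c a] by (rule itg[OF i c a])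
    finally show "jet_A A W p x u (c, T i x, l, \<alpha>) = jetw p x w (c, T i x, l, \<alpha>)" .
  qed (auto simp: jet_A_zero jetw_zero[OF x])
  moreover have "jet_D A W p x u = 0"
    unfolding jet_D_zero_iff[OF u x]
  proof (intro allI impI ballI)
    fix i c k l assume i: "i < d" and c: "c \<in> A" "x \<in> fst c"
    show "van c p (\<lambda>y. chart_deriv c k (cf u i) y * chart_deriv c l (f i) y - chart_deriv c l (cf u i) y * chart_deriv c k (f i) y) x"
    \<comment> \<open>The polynomial part is a function of \<open>f i\<close> and contributes
      nothing to the exterior derivative. The correction contributes through first derivatives of h,
      which vanish to order p.\<close>
    proof (cases p)
      case (Suc p')
      have D: "\<forall>\<^sub>F y in nhds x. chart_deriv c k (cf u i) y = pw (\<lambda>k. w i (Suc (Suc k))) p' (f i y - f i x) * chart_deriv c k (f i) y - chart_deriv c k (h i) y" for k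
        using eventually_chart_deriv_cong[OF c cfu[OF i], of k] eventually_fst[OF c] fx[OF i, unfolded hn_iff] hh[OF i, unfolded hn_iff]
        by eventually_elim (simp add: g'_def[abs_def] g_def[abs_def] Suc chart_deriv_diff chart_deriv_pw cd_at_pw c)
      show ?thesis
      proof (rule van_cong[OF c])
        show "\<forall>\<^sub>F y in nhds x. chart_deriv c l (h i) y * chart_deriv c k (f i) y - chart_deriv c k (h i) y * chart_deriv c l (f i) y =
           chart_deriv c k (cf u i) y * chart_deriv c l (f i) y - chart_deriv c l (cf u i) y * chart_deriv c k (f i) y"
          using D[of k] D[of l]
        proof eventually_elim
          case (elim y)
          show ?case unfolding elim by (simp add: algebra_simps)
        qed
        have "van c p (chart_deriv c k (h i)) x" for k using vh'[OF i c] by (simp add: van_Suc)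
        thus "van c p (\<lambda>y. chart_deriv c l (h i) y * chart_deriv c k (f i) y - chart_deriv c k (h i) y * chart_deriv c l (f i) y) x"
          by (intro van_diff van_mult hn_mult c hn_D hh i fx)
      qed
    qed simp
  qed
  ultimately show ?thesis using u by blast
qed

lemma formal_relations_eq:
  assumes "x \<in> V" "duals 1 x"
  shows "formal_relations A W p x = {jetw p x w | w. eqn (Suc p) x w}"
proof
  show "formal_relations A W p x \<subseteq> {jetw p x w | w. eqn (Suc p) x w}"
    using formal_to_w[OF assms(1)] unfolding formal_relations_def sec_def by blast
  show "{jetw p x w | w. eqn (Suc p) x w} \<subseteq> formal_relations A W p x"
  proof
    fix s assume "s \<in> {jetw p x w | w. eqn (Suc p) x w}"
    then obtain w where w: "s = jetw p x w" "eqn (Suc p) x w" by blast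
    from w_to_formal[OF assms w(2)] show "s \<in> formal_relations A W p x"
      unfolding formal_relations_def sec_def w(1) by (simp, metis)
  qed
qed

text \<open>Coordinates may be chosen point by point: the triangular recursion solves for them by
  dividing by powers of a nonvanishing derivative of \<open>f i\<close>, so they are automatically
  holomorphic.\<close>

lemma jetw_coord_hn:
  assumes "x \<in> V" "i < d" "\<forall>\<^sub>F y in nhds x. s y = jetw p y (w y)"
    and "\<And>l \<alpha>. hn x (\<lambda>y. s y (c\<^sub>0, T i y, l, \<alpha>))"
  shows "j \<in> {1..Suc p} \<Longrightarrow> hn x (\<lambda>y. w y i j)"
proof (induction j rule: less_induct)
  case (less j)
  note cx = c0 V_c0[OF assms(1)]
  obtain l where l: "chart_deriv c\<^sub>0 l (f i) x \<noteq> 0" using df[OF assms(2,1)] by blast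
  have hD: "hn x (chart_deriv c\<^sub>0 l (f i))" by (intro hn_D cx f assms)
  have "\<forall>\<^sub>F y in nhds x. w y i j = (s y (c\<^sub>0, T i y, l, replicate (j - 1) l) -
      (\<Sum>j'=1..<j. faa c\<^sub>0 (f i) (replicate j l) j' y * w y i j')) / chart_deriv c\<^sub>0 l (f i) y ^ j"
    using assms(3) ev_V[OF assms(1)] eventually_nonzero[OF hn_cd[OF hD] l]
  proof eventually_elim
    case (elim y)
    thus ?case using jetw_step[OF elim(2) assms(2) less.prems, of "w y" l] by simp
  qed
  thus ?case
  proof (rule hol_near_cong_fun)
    show "hn x (\<lambda>y. (s y (c\<^sub>0, T i y, l, replicate (j - 1) l) -
      (\<Sum>j'=1..<j. faa c\<^sub>0 (f i) (replicate j l) j' y * w y i j')) / chart_deriv c\<^sub>0 l (f i) y ^ j)"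
      using l less V_manifold[OF assms(1)] by (intro hn_divide hn_diff hn_sum hn_mult hn_power hD assms(4) faa_hol cx f assms(1,2)) auto
  qed
qed

lemma jetw_hn:
  assumes "x \<in> V" "i < d" "c \<in> A" "x \<in> fst c" "\<forall>\<^sub>F y in nhds x. s y = jetw p y (w y)" "\<forall>\<^sub>F y in nhds x. F y = T i y"
    and "\<And>j. j \<in> {1..Suc p} \<Longrightarrow> hn x (\<lambda>y. w y i j)"
  shows "hn x (\<lambda>y. s y (c, F y, l, \<alpha>))"
proof (cases "length \<alpha> \<le> p")
  case True
  have "\<forall>\<^sub>F y in nhds x. s y (c, F y, l, \<alpha>) = (\<Sum>j=1..Suc (length \<alpha>). faa c (f i) (\<alpha> @ [l]) j y * w y i j)"
    using assms(5,6) ev_V[OF assms(1)] eventually_fst[OF assms(3,4)]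
    by eventually_elim (simp add: jetw_T[OF _ assms(2,3) _ True])
  thus ?thesis
  proof (rule hol_near_cong_fun)
    show "hn x (\<lambda>y. \<Sum>j=1..Suc (length \<alpha>). faa c (f i) (\<alpha> @ [l]) j y * w y i j)"
      by (intro hn_sum V_manifold assms(1) hn_mult faa_hol assms(3,4) f assms(2) assms(7)) (use True in auto)
  qed
next
  case False
  have "\<forall>\<^sub>F y in nhds x. s y (c, F y, l, \<alpha>) = 0"
    using assms(5,6) ev_V[OF assms(1)] by eventually_elim (simp add: jetw_zero False)
  thus ?thesis by (rule hol_near_cong_fun) (simp add: V_manifold assms(1))
qed

lemma section_coords:
  assumes "V1 \<subseteq> V" "\<And>x. x \<in> V1 \<Longrightarrow> duals 1 x" "bundle_section A W p (formal_relations A W p) V1 s"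
  shows "\<exists>w. (\<forall>x\<in>V1. s x = jetw p x (w x) \<and> eqn (Suc p) x (w x) \<and> (\<forall>i<d. \<forall>j\<in>{1..Suc p}. hn x (\<lambda>y. w y i j)))"
proof -
  have s: "open V1" "\<And>x. x \<in> V1 \<Longrightarrow> s x \<in> formal_relations A W p x"
    "\<And>V' F c l \<alpha>. V' \<subseteq> V1 \<Longrightarrow> web_branch A W V' F \<Longrightarrow> c \<in> A \<Longrightarrow> hol_on A (\<lambda>x. s x (c, F x, l, \<alpha>)) (V' \<inter> fst c)"
    using assms(3) by (auto simp: bundle_section_def JA_section_def)
  have "\<exists>w. x \<in> V1 \<longrightarrow> s x = jetw p x w \<and> eqn (Suc p) x w" for x
    using s(2)[of x] formal_relations_eq[OF _ assms(2), of x p] assms(1) by blast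
  then obtain w where w: "\<And>x. x \<in> V1 \<Longrightarrow> s x = jetw p x (w x) \<and> eqn (Suc p) x (w x)" by metis
  have "hn x (\<lambda>y. w y i j)" if "x \<in> V1" "i < d" "j \<in> {1..Suc p}" for x i j
  proof -
    have xV: "x \<in> V" using that assms(1) by auto
    have ev: "\<forall>\<^sub>F y in nhds x. s y = jetw p y (w y)"
      using eventually_nhds_in_open[OF s(1) that(1)] by eventually_elim (simp add: w)
    have "hn x (\<lambda>y. s y (c\<^sub>0, T i y, l, \<alpha>))" for l \<alpha>
      using s(3)[OF order_refl T_foliation[OF s(1) assms(1) that(2)] c0, of l \<alpha>] that(1) V_c0[OF xV] by (auto simp: hol_on_hn)
    from jetw_coord_hn[OF xV that(2) ev this that(3)] show ?thesis .
  qed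
  thus ?thesis using w by blast
qed

lemma coords_section:
  assumes "open V1" "V1 \<subseteq> V" "\<And>x. x \<in> V1 \<Longrightarrow> duals 1 x"
    and w: "\<And>x. x \<in> V1 \<Longrightarrow> s x = jetw p x (w x)" "\<And>x. x \<in> V1 \<Longrightarrow> eqn (Suc p) x (w x)"
      "\<And>x i j. x \<in> V1 \<Longrightarrow> i < d \<Longrightarrow> j \<in> {1..Suc p} \<Longrightarrow> hn x (\<lambda>y. w y i j)"
  shows "bundle_section A W p (formal_relations A W p) V1 s"
proof -
  have fr: "s x \<in> formal_relations A W p x" if "x \<in> V1" for x
    using that assms(2) w formal_relations_eq[OF _ assms(3)] by blast
  have "s x \<in> JA_fibre A W p x" if "x \<in> V1" for x
    using fr[OF that] by (auto simp: formal_relations_def JA_fibre_def)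
  moreover have "hol_on A (\<lambda>x. s x (c, F x, l, \<alpha>)) (V' \<inter> fst c)" if V': "V' \<subseteq> V1" "web_branch A W V' F" "c \<in> A" for V' F c l \<alpha>
    unfolding hol_on_hn
  proof
    show "open (V' \<inter> fst c)" using V' chart_open(1)[OF V'(3)] by (auto simp: web_branch_def hol_foliation_def)
    show "\<forall>x\<in>V' \<inter> fst c. hn x (\<lambda>x. s x (c, F x, l, \<alpha>))"
    proof
      fix x assume x: "x \<in> V' \<inter> fst c"
      hence xV: "x \<in> V" "x \<in> V1" "x \<in> V'" "x \<in> fst c" using V' assms(2) by auto
      obtain i where i: "i < d" "\<forall>\<^sub>F y in nhds x. F y = T i y" using branch_cases[OF V'(2) xV(3,1)] by blast
      have "\<forall>\<^sub>F y in nhds x. s y = jetw p y (w y)" using eventually_nhds_in_open[OF assms(1) xV(2)] by eventually_elim (rule w(1))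
      from jetw_hn[OF xV(1) i(1) V'(3) xV(4) this i(2) w(3)[OF xV(2) i(1)]]
      show "hn x (\<lambda>x. s x (c, F x, l, \<alpha>))" .
    qed
  qed
  ultimately show ?thesis
    unfolding bundle_section_def JA_section_def using fr assms(1,2) V_manifold by auto
qed

end

section \<open>The Spencer connection and the frame\<close>

text \<open>Where every formal relation at order \<open>q\<close> extends uniquely to order \<open>q + 1\<close>, let \<open>u\<close> represent the extension of
  \<open>s m\<close>; the covariant derivative of \<open>s\<close> is the derivative at \<open>m\<close> of \<open>s\<close> minus the jet of \<open>u\<close>, which vanishes at \<open>m\<close>.\<close>

definition spencer :: "('m::topological_space, 'n::finite) chart set \<Rightarrow> ('m \<Rightarrow> 'm hyp set) \<Rightarrow> nat \<Rightarrow> ('m, 'n) connection"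
  where "spencer A W q m v s = (let u = SOME u. (\<exists>V. m \<in> V \<and> A_section A W V u) \<and> jet_A A W q m u = s m \<and> jet_D A W (Suc q) m u = 0 in
    (\<lambda>(c, S, l, \<alpha>). if c \<in> A \<and> m \<in> fst c \<and> S \<in> W m \<and> length \<alpha> \<le> q
      then v (\<lambda>y. s y (c, branch_at A W m S y, l, \<alpha>) - jet_A A W q y u (c, branch_at A W m S y, l, \<alpha>)) else 0))"

context atlas begin

lemma branch_subset: "web_branch A W V' F \<Longrightarrow> open V'' \<Longrightarrow> V'' \<subseteq> V' \<Longrightarrow> web_branch A W V'' F"
  unfolding web_branch_def hol_foliation_def
proof (intro conjI ballI; (elim conjE)?)
  assume h: "\<forall>m\<in>V'. \<exists>V'a f. m \<in> V'a \<and> V'a \<subseteq> V' \<and> hol_on A f V'a \<and>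
      (\<forall>x\<in>V'a. (\<exists>v\<in>tangent_space A x. v f \<noteq> 0) \<and> F x = {v \<in> tangent_space A x. v f = 0})"
    and o: "open V''" "V'' \<subseteq> V'"
  fix m assume m: "m \<in> V''"
  then obtain V1 f where V1: "m \<in> V1" "V1 \<subseteq> V'" "hol_on A f V1"
      "\<forall>x\<in>V1. (\<exists>v\<in>tangent_space A x. v f \<noteq> 0) \<and> F x = {v \<in> tangent_space A x. v f = 0}" using h o by (meson subsetD)
  thus "\<exists>V'a f. m \<in> V'a \<and> V'a \<subseteq> V'' \<and> hol_on A f V'a \<and>
      (\<forall>x\<in>V'a. (\<exists>v\<in>tangent_space A x. v f \<noteq> 0) \<and> F x = {v \<in> tangent_space A x. v f = 0})"
    using o m by (intro exI[of _ "V1 \<inter> V''"] exI[of _ f]) (auto simp: hol_on_hn)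
qed auto

lemma bundle_section_subset:
  "bundle_section A W q E V' s \<Longrightarrow> open V'' \<Longrightarrow> V'' \<subseteq> V' \<Longrightarrow> bundle_section A W q E V'' s"
  unfolding bundle_section_def JA_section_def by (meson order_trans subsetD)

text \<open>Coordinates of sections exist only locally. Since branches restrict to smaller open
  sets, holomorphy of the components can be tested near each point.\<close>

lemma bundle_section_local:
  assumes "open V'" "\<And>x. x \<in> V' \<Longrightarrow> \<exists>V1. x \<in> V1 \<and> bundle_section A W q E V1 s"
  shows "bundle_section A W q E V' s"
proof -
  have "hol_on A (\<lambda>x. s x (c, F x, l, \<alpha>)) (V1 \<inter> fst c)" if V1: "V1 \<subseteq> V'" "web_branch A W V1 F" "c \<in> A" for V1 F c l \<alpha>
    unfolding hol_on_hn
  proof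
    have oV1: "open V1" using V1(2) by (auto simp: web_branch_def hol_foliation_def)
    thus "open (V1 \<inter> fst c)" using chart_open(1)[OF V1(3)] by auto
    show "\<forall>x\<in>V1 \<inter> fst c. hn x (\<lambda>x. s x (c, F x, l, \<alpha>))"
    proof
      fix x assume x: "x \<in> V1 \<inter> fst c"
      then obtain V2 where V2: "x \<in> V2" "bundle_section A W q E V2 s" using assms(2) V1(1) by blast
      have "open V2" using V2(2) by (auto simp: bundle_section_def JA_section_def)
      hence "web_branch A W (V1 \<inter> V2) F" using branch_subset[OF V1(2)] oV1 by auto
      hence "hol_on A (\<lambda>x. s x (c, F x, l, \<alpha>)) (V1 \<inter> V2 \<inter> fst c)"
        using V2(2) V1(3) unfolding bundle_section_def JA_section_def by (meson inf_le2)
      thus "hn x (\<lambda>x. s x (c, F x, l, \<alpha>))" using x V2(1) by (auto simp: hol_on_hn)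
    qed
  qed
  moreover have "x \<in> manifold A \<and> s x \<in> JA_fibre A W q x \<and> s x \<in> E x" if "x \<in> V'" for x
    using assms(2)[OF that] by (auto simp: bundle_section_def JA_section_def)
  ultimately show ?thesis using assms(1) by (auto simp: bundle_section_def JA_section_def)
qed

text \<open>The recursion of \<open>faa\<close> contracted with the components of v. It relates the
  equations of one order higher to the derivative along v of the given ones; the shifted term of
  index 0 drops out because the word is not empty.\<close>

lemma faa_tangent:
  assumes "v \<in> tangent_space A x" "c \<in> A" "x \<in> fst c" "hn x f" "\<beta> \<noteq> []"
  shows "(\<Sum>k\<in>UNIV. v (\<lambda>y. snd c y $ k) * (\<Sum>j=1..Suc (length \<beta>). faa c f (k # \<beta>) j x * wb j)) =
    (\<Sum>j=1..length \<beta>. v (faa c f \<beta> j) * wb j + faa c f \<beta> j x * v f * wb (Suc j))"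
proof -
  let ?n = "length \<beta>" and ?a = "\<lambda>k. v (\<lambda>y. snd c y $ k)"
  have s: "(\<Sum>j=1..Suc ?n. faa c f (k # \<beta>) j x * wb j) =
     (\<Sum>j=1..?n. chart_deriv c k (faa c f \<beta> j) x * wb j + faa c f \<beta> j x * chart_deriv c k f x * wb (Suc j))" for k
  proof -
    have "(\<Sum>j=1..Suc ?n. faa c f (k # \<beta>) j x * wb j) = (\<Sum>j=1..Suc ?n. chart_deriv c k (faa c f \<beta> j) x * wb j) +
      (\<Sum>j=1..Suc ?n. faa c f \<beta> (j - 1) x * chart_deriv c k f x * wb j)"
      unfolding sum.distrib[symmetric] by (intro sum.cong refl) (auto simp: algebra_simps)
    also have "(\<Sum>j=1..Suc ?n. chart_deriv c k (faa c f \<beta> j) x * wb j) = (\<Sum>j=1..?n. chart_deriv c k (faa c f \<beta> j) x * wb j)"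
      by (simp add: faa_gt)
    also have "(\<Sum>j=1..Suc ?n. faa c f \<beta> (j - 1) x * chart_deriv c k f x * wb j) = (\<Sum>j=0..?n. faa c f \<beta> j x * chart_deriv c k f x * wb (Suc j))"
      unfolding One_nat_def by (subst sum.shift_bounds_cl_Suc_ivl) simp
    also have "\<dots> = (\<Sum>j=1..?n. faa c f \<beta> j x * chart_deriv c k f x * wb (Suc j))"
      using assms(5) by (subst sum.atLeast_Suc_atMost) (auto simp: faa_0)
    finally show ?thesis by (simp add: sum.distrib)
  qed
  have t: "v g = (\<Sum>k\<in>UNIV. ?a k * chart_deriv c k g x)" if "hn x g" for g by (rule tangent_apply[OF assms(1-3) that])
  have "(\<Sum>k\<in>UNIV. ?a k * (\<Sum>j=1..Suc ?n. faa c f (k # \<beta>) j x * wb j)) =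
    (\<Sum>j=1..?n. \<Sum>k\<in>UNIV. ?a k * (chart_deriv c k (faa c f \<beta> j) x * wb j + faa c f \<beta> j x * chart_deriv c k f x * wb (Suc j)))"
    unfolding s sum_distrib_left by (rule sum.swap)
  also have "\<dots> = (\<Sum>j=1..?n. v (faa c f \<beta> j) * wb j + faa c f \<beta> j x * v f * wb (Suc j))"
  proof (intro sum.cong refl)
    fix j
    show "(\<Sum>k\<in>UNIV. ?a k * (chart_deriv c k (faa c f \<beta> j) x * wb j + faa c f \<beta> j x * chart_deriv c k f x * wb (Suc j))) =
      v (faa c f \<beta> j) * wb j + faa c f \<beta> j x * v f * wb (Suc j)"
      unfolding t[OF faa_hol[OF assms(2-4)]] t[OF assms(4)]
      by (simp add: sum_distrib_left sum_distrib_right sum.distrib[symmetric] algebra_simps)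
  qed
  finally show ?thesis .
qed

end

section \<open>The equations as a linear system; free unknowns and top order\<close>

context local_web begin

lemma jetw_0 [simp]: "jetw p x (\<lambda>i j. 0) = 0"
  by (auto simp: jetw_def fun_eq_iff intro!: sum.neutral)

lemma jetw_sum: "jetw p x (\<lambda>i j. \<Sum>t\<in>P. a t * w t i j) = (\<Sum>t\<in>P. a t *\<^sub>F jetw p x (w t))"
proof (induction P rule: infinite_finite_induct)
  case (insert t P)
  have "jetw p x (\<lambda>i j. \<Sum>t\<in>insert t P. a t * w t i j) = jetw p x (\<lambda>i j. (\<Sum>t\<in>P. a t * w t i j) + a t * w t i j)"
    using insert by (simp add: add.commute)
  also have "\<dots> = (\<Sum>t\<in>P. a t *\<^sub>F jetw p x (w t)) + a t *\<^sub>F jetw p x (w t)" unfolding jetw_lin insert.IH ..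
  also have "\<dots> = (\<Sum>t\<in>insert t P. a t *\<^sub>F jetw p x (w t))" unfolding sum.insert[OF insert(1,2)] by (rule add.commute)
  finally show ?case .
qed simp_all

lemma eqn_sum: "(\<And>t. t \<in> P \<Longrightarrow> eqn N x (w t)) \<Longrightarrow> eqn N x (\<lambda>i j. \<Sum>t\<in>P. a t * w t i j)"
proof (induction P rule: infinite_finite_induct)
  case (insert t P)
  have "eqn N x (\<lambda>i j. \<Sum>t\<in>P. a t * w t i j)" by (rule insert.IH) (rule insert.prems, simp)
  from eqn_lin[OF this insert.prems[OF insertI1], of "a t"]
  show ?case using insert(1,2) by (simp add: add.commute)
qed (simp_all add: eqn_def)

text \<open>Words with the same content give the same equation, so c(n, s) equations of order s
  remain. The range of the unknowns can be made uniform because coefficients beyond the length of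
  the word vanish.\<close>

lemma eqn_multi_indices:
  assumes "x \<in> V"
  shows "eqn N x w \<longleftrightarrow> (\<forall>s\<in>{1..N}. \<forall>\<mu>\<in>multi_indices s. (\<Sum>p\<in>{..<d}\<times>{1..N}. faa c\<^sub>0 (f (fst p)) (index_list \<mu>) (snd p) x * w (fst p) (snd p)) = 0)"
proof -
  have s: "(\<Sum>i<d. \<Sum>j=1..length \<beta>. faa c\<^sub>0 (f i) \<beta> j x * w i j) =
      (\<Sum>p\<in>{..<d}\<times>{1..N}. faa c\<^sub>0 (f (fst p)) (index_list (count (mset \<beta>))) (snd p) x * w (fst p) (snd p))" if "length \<beta> \<le> N" for \<beta>
  proof -
    have "(\<Sum>i<d. \<Sum>j=1..length \<beta>. faa c\<^sub>0 (f i) \<beta> j x * w i j) = (\<Sum>i<d. \<Sum>j=1..N. faa c\<^sub>0 (f i) \<beta> j x * w i j)"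
      using that by (intro sum.cong refl sum.mono_neutral_left) (auto simp: faa_gt)
    also have "\<dots> = (\<Sum>i<d. \<Sum>j=1..N. faa c\<^sub>0 (f i) (index_list (count (mset \<beta>))) j x * w i j)"
    proof (intro sum.cong refl)
      fix i j assume "i \<in> {..<d}"
      hence "faa c\<^sub>0 (f i) (index_list (count (mset \<beta>))) j x = faa c\<^sub>0 (f i) \<beta> j x"
        by (intro faa_perm c0 V_c0 assms f mset_index_list) simp
      thus "faa c\<^sub>0 (f i) \<beta> j x * w i j = faa c\<^sub>0 (f i) (index_list (count (mset \<beta>))) j x * w i j" by simp
    qed
    finally show ?thesis by (simp add: sum.cartesian_product split_beta)
  qed
  show ?thesis
  proof
    assume h: "eqn N x w"
    show "\<forall>s\<in>{1..N}. \<forall>\<mu>\<in>multi_indices s. (\<Sum>p\<in>{..<d}\<times>{1..N}. faa c\<^sub>0 (f (fst p)) (index_list \<mu>) (snd p) x * w (fst p) (snd p)) = 0"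
    proof (intro ballI)
      fix r and \<mu> :: "'n \<Rightarrow> nat" assume r: "r \<in> {1..N}" "\<mu> \<in> multi_indices r"
      thus "(\<Sum>p\<in>{..<d}\<times>{1..N}. faa c\<^sub>0 (f (fst p)) (index_list \<mu>) (snd p) x * w (fst p) (snd p)) = 0"
        using s[of "index_list \<mu>"] h[unfolded eqn_def, rule_format, of "index_list \<mu>"] length_index_list[OF r(2)] by (simp add: count_index_list)
    qed
  next
    assume h: "\<forall>s\<in>{1..N}. \<forall>\<mu>\<in>multi_indices s. (\<Sum>p\<in>{..<d}\<times>{1..N}. faa c\<^sub>0 (f (fst p)) (index_list \<mu>) (snd p) x * w (fst p) (snd p)) = 0"
    show "eqn N x w"
      unfolding eqn_def
    proof (intro allI impI)
      fix \<beta> :: "'n list" assume "1 \<le> length \<beta>" "length \<beta> \<le> N"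
      thus "(\<Sum>i<d. \<Sum>j=1..length \<beta>. faa c\<^sub>0 (f i) \<beta> j x * w i j) = 0"
        using h[rule_format, of "length \<beta>" "count (mset \<beta>)"] count_multi_indices[of \<beta>] s[of \<beta>] by simp
    qed
  qed
qed

end

text \<open>Weak general position (s = 1) and avoidance of S (larger s) in the form used from here
  on: all symbols up to order \<open>k0\<close> are onto.\<close>

locale good_web = local_web A W d c\<^sub>0 V f
  for A :: "('m::t2_space, 'n::finite) chart set" and W d c\<^sub>0 V f +
  fixes k0 :: nat
  assumes k0: "k0 \<ge> 2" and d: "d = web_c CARD('n) k0"
    and duals: "\<And>x s. x \<in> V \<Longrightarrow> 1 \<le> s \<Longrightarrow> s \<le> k0 \<Longrightarrow> duals s x"
begin

lemma duals1: "x \<in> V \<Longrightarrow> duals 1 x"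
  using duals k0 by simp

abbreviation JJ :: "(nat \<times> nat) set"
  where "JJ \<equiv> {..<d} \<times> {1..k0 - 1}"

abbreviation EE :: "'m \<Rightarrow> ('m, 'n) jet set"
  where "EE \<equiv> formal_relations A W (k0 - 2)"

lemma Suc_k0_minus_2: "Suc (k0 - 2) = k0 - 1"
  using k0 by simp

text \<open>Ranked by their order, the equations are triangular with surjective symbols as diagonal
  blocks. They are solved for as many unknowns as there are equations, and the free unknowns P
  parametrise the fibre.\<close>

lemma frame:
  assumes x0: "x0 \<in> V"
  shows "\<exists>P b. P \<subseteq> JJ \<and> card P = web_pi' CARD('n) k0 d \<and>
    (\<forall>\<^sub>F y in nhds x0. y \<in> V \<and> (\<forall>t\<in>P. \<forall>p\<in>JJ. hn y (b t p)) \<and> (\<forall>t\<in>P. \<forall>p\<in>P. b t p y = (if t = p then 1 else 0)) \<and>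
      (\<forall>w. eqn (k0 - 1) y w \<longleftrightarrow> (\<forall>p\<in>JJ. w (fst p) (snd p) = (\<Sum>t\<in>P. w (fst t) (snd t) * b t p y))))"
proof -
  let ?Q = "k0 - 1"
  define I where "I = (\<Union>s\<in>{1..?Q}. multi_indices s :: ('n \<Rightarrow> nat) set)"
  define lam where "lam \<mu> p x = faa c\<^sub>0 (f (fst p)) (index_list \<mu>) (snd p) x" for \<mu> p x
  have finJ: "finite JJ" and finI: "finite I" by (auto simp: I_def)
  have hl: "hn x0 (lam \<mu> p)" if "\<mu> \<in> I" "p \<in> JJ" for \<mu> p
    unfolding lam_def[abs_def] using that x0 by (intro faa_hol c0 V_c0 f) auto
  have "\<exists>K0 b. K0 \<subseteq> JJ \<and> card K0 = card I \<and> (\<forall>j\<in>JJ - K0. \<forall>k\<in>K0. hn x0 (b j k)) \<and>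
      (\<forall>\<^sub>F x in nhds x0. \<forall>w. (\<forall>i\<in>I. (\<Sum>j\<in>JJ. lam i j x * w j) = 0) \<longleftrightarrow>
         (\<forall>k\<in>K0. w k = (\<Sum>j\<in>JJ - K0. b j k x * w j)))"
  proof (rule elimination[OF finJ order_refl V_manifold[OF x0] finI hl, where \<rho>="\<lambda>\<mu>. sum \<mu> UNIV"])
    fix \<mu> assume "\<mu> \<in> I"
    then obtain s where s: "s \<in> {1..?Q}" "\<mu> \<in> multi_indices s" by (auto simp: I_def)
    hence "duals s x0" by (intro duals[OF x0]) auto
    then obtain y where y: "\<And>\<mu>'. \<mu>' \<in> multi_indices s \<Longrightarrow> (\<Sum>i<d. symbol i (index_list \<mu>') x0 * y i) = (if \<mu>' = \<mu> then 1 else 0)"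
      using s(2) unfolding duals_def by blast
    \<comment> \<open>A dual vector of the symbol, placed in order s: it meets the equations of
      order s through the symbol only and does not enter those of lower order.\<close>
    define w where "w p = (if snd p = s then y (fst p) else 0)" for p :: "nat \<times> nat"
    have sw: "(\<Sum>j\<in>JJ. lam \<mu>' j x0 * w j) = (\<Sum>i<d. faa c\<^sub>0 (f i) (index_list \<mu>') s x0 * y i)" for \<mu>'
    proof -
      have "(\<Sum>j\<in>JJ. lam \<mu>' j x0 * w j) = (\<Sum>i<d. \<Sum>j=1..?Q. faa c\<^sub>0 (f i) (index_list \<mu>') j x0 * (if j = s then y i else 0))"
        by (simp add: sum.cartesian_product split_beta lam_def w_def)
      also have "\<dots> = (\<Sum>i<d. \<Sum>j=1..?Q. if j = s then faa c\<^sub>0 (f i) (index_list \<mu>') s x0 * y i else 0)"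
        by (intro sum.cong refl) auto
      finally show ?thesis using s(1) by simp
    qed
    have eqs: "(\<Sum>j\<in>JJ. lam \<mu>' j x0 * w j) = (if \<mu>' = \<mu> then 1 else 0)" if "\<mu>' \<in> multi_indices s" for \<mu>'
      using y[OF that] faa_top[of c\<^sub>0 _ "index_list \<mu>'"] length_index_list[OF that] unfolding sw by (simp add: symbol_def)
    show "\<exists>w. (\<forall>j\<in>JJ - JJ. w j = 0) \<and> (\<Sum>j\<in>JJ. lam \<mu> j x0 * w j) \<noteq> 0 \<and>
        (\<forall>i'\<in>I. i' \<noteq> \<mu> \<longrightarrow> sum i' UNIV \<le> sum \<mu> UNIV \<longrightarrow> (\<Sum>j\<in>JJ. lam i' j x0 * w j) = 0)"
    proof (intro exI[of _ w] conjI ballI impI)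
      show "(\<Sum>j\<in>JJ. lam \<mu> j x0 * w j) \<noteq> 0" using eqs[OF s(2)] by simp
      fix \<mu>' assume m: "\<mu>' \<in> I" "\<mu>' \<noteq> \<mu>" "sum \<mu>' UNIV \<le> sum \<mu> UNIV"
      have "sum \<mu>' UNIV \<le> s" using m(3) s(2) by (simp add: multi_indices_def)
      then consider "\<mu>' \<in> multi_indices s" | "length (index_list \<mu>') < s" using length_index_list[of \<mu>' "sum \<mu>' UNIV"]
        unfolding multi_indices_def mem_Collect_eq by linarith
      thus "(\<Sum>j\<in>JJ. lam \<mu>' j x0 * w j) = 0" 
      proof cases
        case 1 thus ?thesis using eqs[OF 1] m(2) by simp
      next
        case 2 show ?thesis unfolding sw by (intro sum.neutral ballI) (simp add: faa_gt[OF 2])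
      qed
    qed auto
  qed
  then obtain K0 b where K0: "K0 \<subseteq> JJ" "card K0 = card I" "\<forall>j\<in>JJ - K0. \<forall>k\<in>K0. hn x0 (b j k)"
    and ev: "\<forall>\<^sub>F x in nhds x0. \<forall>w. (\<forall>i\<in>I. (\<Sum>j\<in>JJ. lam i j x * w j) = 0) \<longleftrightarrow>
         (\<forall>k\<in>K0. w k = (\<Sum>j\<in>JJ - K0. b j k x * w j))"
    by (elim exE conjE) (rule that)
  define P where "P = JJ - K0"
  \<comment> \<open>The solved form is completed by the identity on the free unknowns, so that one
    formula expresses every coordinate through those in P.\<close>
  define b' where "b' t p y = (if p \<in> K0 then b t p y else if t = p then 1 else 0)" for t p y
  have "card I = (\<Sum>s=1..?Q. web_c CARD('n) s)"
    unfolding I_def by (subst card_UN_disjoint) (auto simp: card_multi_indices, auto simp: multi_indices_def)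
  hence "card P = ?Q * d - (\<Sum>s=1..?Q. web_c CARD('n) s)"
    unfolding P_def using K0(1,2) by (subst card_Diff_subset) (auto intro: finite_subset simp: card_cartesian_product mult.commute)
  also have "\<dots> = (\<Sum>s=1..?Q. d - web_c CARD('n) s)"
    by (subst sum_subtractf_nat) (auto simp: d intro: web_c_mono)
  \<comment> \<open>The summand of index \<open>k0\<close> is 0, since d = c(n, k0).\<close>
  also have "\<dots> = web_pi' CARD('n) k0 d"
  proof -
    have e: "{1..k0} = insert k0 {1..?Q}" "k0 \<notin> {1..?Q}" using k0 by auto
    show ?thesis unfolding web_pi'_def e(1) using e(2) by (subst sum.insert) (auto simp: d)
  qed
  finally have cP: "card P = web_pi' CARD('n) k0 d" .
  have finP: "finite P" by (simp add: P_def)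
  have hb: "hn x0 (b' t p)" if "t \<in> P" "p \<in> JJ" for t p
    using that K0(3)[rule_format, of t p] V_manifold[OF x0] by (cases "p \<in> K0") (auto simp: b'_def[abs_def] P_def)
  have "\<forall>\<^sub>F y in nhds x0. \<forall>t\<in>P. \<forall>p\<in>JJ. hn y (b' t p)"
    using finP finJ by (intro eventually_ball_finite ballI hn_eventually hb) auto
  with ev_V[OF x0] ev have "\<forall>\<^sub>F y in nhds x0. y \<in> V \<and> (\<forall>t\<in>P. \<forall>p\<in>JJ. hn y (b' t p)) \<and> (\<forall>t\<in>P. \<forall>p\<in>P. b' t p y = (if t = p then 1 else 0)) \<and>
      (\<forall>w. eqn (k0 - 1) y w \<longleftrightarrow> (\<forall>p\<in>JJ. w (fst p) (snd p) = (\<Sum>t\<in>P. w (fst t) (snd t) * b' t p y)))"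
  proof eventually_elim
    case (elim y)
    have "eqn (k0 - 1) y w \<longleftrightarrow> (\<forall>p\<in>JJ. w (fst p) (snd p) = (\<Sum>t\<in>P. w (fst t) (snd t) * b' t p y))" for w
    proof -
      let ?w = "\<lambda>p. w (fst p) (snd p)"
      have "eqn (k0 - 1) y w \<longleftrightarrow> (\<forall>i\<in>I. (\<Sum>j\<in>JJ. lam i j y * ?w j) = 0)"
        unfolding eqn_multi_indices[OF elim(1)] I_def lam_def by auto
      also have "\<dots> \<longleftrightarrow> (\<forall>k\<in>K0. ?w k = (\<Sum>j\<in>JJ - K0. b j k y * ?w j))" using elim(2)[rule_format, of ?w] by simp
      also have "\<dots> \<longleftrightarrow> (\<forall>k\<in>K0. ?w k = (\<Sum>t\<in>P. ?w t * b' t k y))"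
        by (intro ball_cong refl) (simp add: b'_def P_def mult.commute)
      also have "\<dots> \<longleftrightarrow> (\<forall>p\<in>JJ. ?w p = (\<Sum>t\<in>P. ?w t * b' t p y))"
      proof -
        have "?w p = (\<Sum>t\<in>P. ?w t * b' t p y)" if "p \<in> P" for p
        proof -
          have "(\<Sum>t\<in>P. ?w t * b' t p y) = (\<Sum>t\<in>P. if t = p then ?w p else 0)"
            using that by (intro sum.cong refl) (auto simp: b'_def P_def)
          thus ?thesis using that finP by simp
        qed
        moreover have "JJ = K0 \<union> P" using K0(1) by (auto simp: P_def)
        ultimately show ?thesis by auto
      qed
      finally show ?thesis .
    qed
    moreover have "\<forall>t\<in>P. \<forall>p\<in>P. b' t p y = (if t = p then 1 else 0)" by (auto simp: b'_def P_def)
    ultimately show ?case using elim by blast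
  qed
  moreover have "P \<subseteq> JJ" by (auto simp: P_def)
  ultimately show ?thesis using cP by blast
qed

text \<open>Since d = c(n, k0), the symbol of order \<open>k0\<close> is a square invertible matrix.
  The equations of that order then have exactly one solution in the top unknowns, linear in the
  lower ones with holomorphic coefficients \<open>tt\<close>.\<close>

lemma top_order:
  assumes x0: "x0 \<in> V"
  shows "\<exists>tt. (\<forall>p\<in>JJ. \<forall>i<d. hn x0 (tt p i)) \<and>
    (\<forall>\<^sub>F y in nhds x0. \<forall>w. eqn k0 y w \<longleftrightarrow> eqn (k0 - 1) y w \<and> (\<forall>i<d. w i k0 = (\<Sum>p\<in>JJ. w (fst p) (snd p) * tt p i y)))"
proof -
  have "duals k0 x0" using duals[OF x0] k0 by simp
  then obtain N where N: "\<And>j \<mu>. j < d \<Longrightarrow> \<mu> \<in> multi_indices k0 \<Longrightarrow> hn x0 (N j \<mu>)"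
    "\<forall>\<^sub>F z in nhds x0. \<forall>\<mu>\<in>multi_indices k0. \<forall>\<mu>'\<in>multi_indices k0. (\<Sum>j<d. symbol j (index_list \<mu>') z * N j \<mu> z) = (if \<mu>' = \<mu> then 1 else 0)"
    "\<forall>\<^sub>F z in nhds x0. \<forall>w. (\<forall>\<mu>\<in>multi_indices k0. (\<Sum>j<d. symbol j (index_list \<mu>) z * w j) = 0) \<longrightarrow> (\<forall>j<d. w j = 0)"
    using duals_inverse[OF x0, of k0] d by blast
  define L where "L \<mu> p y = faa c\<^sub>0 (f (fst p)) (index_list \<mu>) (snd p) y" for \<mu> p y
  define tt where "tt p i y = - (\<Sum>\<mu>\<in>multi_indices k0. N i \<mu> y * L \<mu> p y)" for p i y
  have "hn x0 (tt p i)" if "p \<in> JJ" "i < d" for p i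
    unfolding tt_def[abs_def] L_def using that x0 V_manifold[OF x0]
    by (intro hn_minus hn_sum hn_mult N(1) faa_hol c0 V_c0 f) auto
  moreover have "\<forall>\<^sub>F y in nhds x0. \<forall>w. eqn k0 y w \<longleftrightarrow> eqn (k0 - 1) y w \<and> (\<forall>i<d. w i k0 = (\<Sum>p\<in>JJ. w (fst p) (snd p) * tt p i y))"
    using N(2,3) ev_V[OF x0]
  proof eventually_elim
    case (elim y)
    show ?case
    proof
      fix w :: "nat \<Rightarrow> nat \<Rightarrow> complex"
      let ?w = "\<lambda>p::nat \<times> nat. w (fst p) (snd p)"
      have sp: "(\<Sum>p\<in>{..<d}\<times>{1..k0}. L \<mu> p y * ?w p) = (\<Sum>p\<in>JJ. L \<mu> p y * ?w p) + (\<Sum>i<d. faa c\<^sub>0 (f i) (index_list \<mu>) k0 y * w i k0)" for \<mu>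
      proof -
        have "{..<d}\<times>{1..k0} = JJ \<union> (\<lambda>i. (i, k0)) ` {..<d}" using k0 by auto
        hence "(\<Sum>p\<in>{..<d}\<times>{1..k0}. L \<mu> p y * ?w p) = (\<Sum>p\<in>JJ. L \<mu> p y * ?w p) + (\<Sum>p\<in>(\<lambda>i. (i, k0)) ` {..<d}. L \<mu> p y * ?w p)"
          using k0 by (simp only:) (rule sum.union_disjoint, auto)
        thus ?thesis by (simp add: sum.reindex inj_on_def L_def)
      qed
      have low: "(\<Sum>p\<in>{..<d}\<times>{1..k0}. L \<mu> p y * ?w p) = (\<Sum>p\<in>JJ. L \<mu> p y * ?w p)" if "s \<le> k0 - 1" "\<mu> \<in> multi_indices s" for s \<mu>
        unfolding sp using length_index_list[OF that(2)] that(1) k0 by (simp add: faa_gt)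
      have tp: "(\<Sum>p\<in>{..<d}\<times>{1..k0}. L \<mu> p y * ?w p) = (\<Sum>p\<in>JJ. L \<mu> p y * ?w p) + (\<Sum>i<d. symbol i (index_list \<mu>) y * w i k0)" if "\<mu> \<in> multi_indices k0" for \<mu>
        unfolding sp using faa_top[of c\<^sub>0 _ "index_list \<mu>"] length_index_list[OF that] by (simp add: symbol_def)
      have ins: "{1..k0} = insert k0 {1..k0 - 1}" using k0 by auto
      have "eqn k0 y w \<longleftrightarrow> eqn (k0 - 1) y w \<and> (\<forall>\<mu>\<in>multi_indices k0. (\<Sum>p\<in>JJ. L \<mu> p y * ?w p) + (\<Sum>i<d. symbol i (index_list \<mu>) y * w i k0) = 0)"
      proof -
        define S S' where "S \<mu> = (\<Sum>p\<in>{..<d}\<times>{1..k0}. L \<mu> p y * ?w p)" and "S' \<mu> = (\<Sum>p\<in>JJ. L \<mu> p y * ?w p)" for \<mu>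
        have "eqn k0 y w \<longleftrightarrow> (\<forall>s\<in>{1..k0}. \<forall>\<mu>\<in>multi_indices s. S \<mu> = 0)" "eqn (k0 - 1) y w \<longleftrightarrow> (\<forall>s\<in>{1..k0 - 1}. \<forall>\<mu>\<in>multi_indices s. S' \<mu> = 0)"
          unfolding eqn_multi_indices[OF elim(3)] S_def S'_def L_def by auto
        moreover have "S \<mu> = S' \<mu>" if "s \<in> {1..k0 - 1}" "\<mu> \<in> multi_indices s" for s \<mu>
          using low[OF _ that(2)] that(1) by (simp add: S_def S'_def)
        moreover have "S \<mu> = S' \<mu> + (\<Sum>i<d. symbol i (index_list \<mu>) y * w i k0)" if "\<mu> \<in> multi_indices k0" for \<mu>
          using tp[OF that] by (simp add: S_def S'_def)
        ultimately show ?thesis unfolding ins S'_def[symmetric] ball_simps by (metis (no_types, lifting))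
      qed
      also have "(\<forall>\<mu>\<in>multi_indices k0. (\<Sum>p\<in>JJ. L \<mu> p y * ?w p) + (\<Sum>i<d. symbol i (index_list \<mu>) y * w i k0) = 0) \<longleftrightarrow>
         (\<forall>i<d. w i k0 = (\<Sum>p\<in>JJ. ?w p * tt p i y))"
      proof -
        \<comment> \<open>The solution supplied by the right inverse; that it is the only one
          follows from injectivity of the square symbol.\<close>
        define z where "z i = (\<Sum>p\<in>JJ. ?w p * tt p i y)" for i
        have z: "(\<Sum>i<d. symbol i (index_list \<mu>) y * z i) = - (\<Sum>p\<in>JJ. L \<mu> p y * ?w p)" if \<mu>: "\<mu> \<in> multi_indices k0" for \<mu>
        proof -
          define R where "R \<nu> = (\<Sum>p\<in>JJ. L \<nu> p y * ?w p)" for \<nu>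
          have zi: "z i = - (\<Sum>\<nu>\<in>multi_indices k0. N i \<nu> y * R \<nu>)" for i
            unfolding z_def tt_def R_def
            by (simp add: sum_distrib_left sum_negf[symmetric], subst sum.swap, simp add: algebra_simps)
          have "(\<Sum>i<d. symbol i (index_list \<mu>) y * z i) = - (\<Sum>i<d. \<Sum>\<nu>\<in>multi_indices k0. symbol i (index_list \<mu>) y * N i \<nu> y * R \<nu>)"
            unfolding zi by (simp add: sum_distrib_left sum_negf mult.assoc)
          also have "\<dots> = - (\<Sum>\<nu>\<in>multi_indices k0. (\<Sum>i<d. symbol i (index_list \<mu>) y * N i \<nu> y) * R \<nu>)"
            by (subst sum.swap) (simp add: sum_distrib_right)
          also have "(\<Sum>\<nu>\<in>multi_indices k0. (\<Sum>i<d. symbol i (index_list \<mu>) y * N i \<nu> y) * R \<nu>) = (\<Sum>\<nu>\<in>multi_indices k0. if \<nu> = \<mu> then R \<mu> else 0)"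
            using elim(1) \<mu> by (intro sum.cong refl) auto
          finally show ?thesis using \<mu> by (simp add: R_def)
        qed
        show ?thesis
        proof
          assume h: "\<forall>\<mu>\<in>multi_indices k0. (\<Sum>p\<in>JJ. L \<mu> p y * ?w p) + (\<Sum>i<d. symbol i (index_list \<mu>) y * w i k0) = 0"
          have "\<forall>\<mu>\<in>multi_indices k0. (\<Sum>i<d. symbol i (index_list \<mu>) y * (w i k0 - z i)) = 0"
            using h z by (auto simp: right_diff_distrib sum_subtractf add_eq_0_iff)
          hence "\<forall>i<d. w i k0 - z i = 0" using elim(2)[rule_format, of "\<lambda>i. w i k0 - z i"] by blast
          thus "\<forall>i<d. w i k0 = (\<Sum>p\<in>JJ. ?w p * tt p i y)" by (simp add: z_def)
        next
          assume "\<forall>i<d. w i k0 = (\<Sum>p\<in>JJ. ?w p * tt p i y)"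
          hence "(\<Sum>i<d. symbol i (index_list \<mu>) y * w i k0) = (\<Sum>i<d. symbol i (index_list \<mu>) y * z i)" for \<mu> by (simp add: z_def)
          thus "\<forall>\<mu>\<in>multi_indices k0. (\<Sum>p\<in>JJ. L \<mu> p y * ?w p) + (\<Sum>i<d. symbol i (index_list \<mu>) y * w i k0) = 0" using z by simp
        qed
      qed
      finally show "eqn k0 y w \<longleftrightarrow> eqn (k0 - 1) y w \<and> (\<forall>i<d. w i k0 = (\<Sum>p\<in>JJ. ?w p * tt p i y))" .
    qed
  qed
  ultimately show ?thesis by blast
qed

end

section \<open>The connection in coordinates\<close>

context good_web begin

text \<open>Holomorphic coordinates of a section near x; as an \<open>eventually\<close> statement
  the property passes to nearby points.\<close>

definition coords :: "'m \<Rightarrow> ('m \<Rightarrow> ('m, 'n) jet) \<Rightarrow> ('m \<Rightarrow> nat \<Rightarrow> nat \<Rightarrow> complex) \<Rightarrow> bool"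
  where "coords x s w \<longleftrightarrow> (\<forall>\<^sub>F y in nhds x. y \<in> V \<and> s y = jetw (k0 - 2) y (w y) \<and> eqn (k0 - 1) y (w y) \<and>
    (\<forall>i<d. \<forall>j\<in>{1..k0 - 1}. hn y (\<lambda>z. w z i j)))"

lemma coordsD:
  assumes "coords x s w"
  shows "x \<in> V" "s x = jetw (k0 - 2) x (w x)" "eqn (k0 - 1) x (w x)" "i < d \<Longrightarrow> j \<in> {1..k0 - 1} \<Longrightarrow> hn x (\<lambda>z. w z i j)"
  using eventually_nhds_x_imp_x[OF assms[unfolded coords_def]] by blast+

lemma coords_ev: "coords x s w \<Longrightarrow> \<forall>\<^sub>F y in nhds x. coords y s w"
  unfolding coords_def eventually_eventually .

lemma coords_cong:
  assumes "coords x s w" "\<forall>\<^sub>F y in nhds x. t y = s y"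
  shows "coords x t w"
  using assms unfolding coords_def by eventually_elim simp

lemma coords_of_section:
  assumes "bundle_section A W (k0 - 2) EE V' s" "x \<in> V'" "x \<in> V"
  shows "\<exists>w. coords x s w"
proof -
  have o: "open V'" using assms(1) by (simp add: bundle_section_def JA_section_def)
  have s: "bundle_section A W (k0 - 2) EE (V' \<inter> V) s"
    by (rule bundle_section_subset[OF assms(1)]) (use o V in auto)
  obtain w where w: "\<forall>x\<in>V' \<inter> V. s x = jetw (k0 - 2) x (w x) \<and> eqn (Suc (k0 - 2)) x (w x) \<and> (\<forall>i<d. \<forall>j\<in>{1..Suc (k0 - 2)}. hn x (\<lambda>y. w y i j))"
    using section_coords[OF _ _ s] duals1 by blast
  have "\<forall>\<^sub>F y in nhds x. y \<in> V' \<inter> V" using assms(2,3) o V(1) by (intro eventually_nhds_in_open) auto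
  hence "coords x s w" unfolding coords_def by eventually_elim (use w Suc_k0_minus_2 in auto)
  thus ?thesis by blast
qed

lemma section_of_coords:
  assumes "coords x s w"
  shows "\<exists>V1. x \<in> V1 \<and> V1 \<subseteq> V \<and> bundle_section A W (k0 - 2) EE V1 s"
proof -
  obtain V1 where V1: "open V1" "x \<in> V1" "\<And>y. y \<in> V1 \<Longrightarrow> y \<in> V \<and> s y = jetw (k0 - 2) y (w y) \<and> eqn (k0 - 1) y (w y) \<and>
    (\<forall>i<d. \<forall>j\<in>{1..k0 - 1}. hn y (\<lambda>z. w z i j))"
    using assms unfolding coords_def eventually_nhds by blast
  have "bundle_section A W (k0 - 2) EE V1 s"
    by (rule coords_section[OF V1(1), where w=w]) (use V1(3) duals1 Suc_k0_minus_2 in auto)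
  thus ?thesis using V1 by blast
qed

text \<open>The chosen solution is determined only in the entries with i < d and 1 \<le> j \<le>
  k0.\<close>

definition extend :: "'m \<Rightarrow> (nat \<Rightarrow> nat \<Rightarrow> complex) \<Rightarrow> nat \<Rightarrow> nat \<Rightarrow> complex"
  where "extend x w = (SOME wb. (\<forall>i<d. \<forall>j\<in>{1..k0 - 1}. wb i j = w i j) \<and> eqn k0 x wb)"

lemma extend_exists:
  assumes "x \<in> V" "eqn (k0 - 1) x w"
  shows "\<And>i j. i < d \<Longrightarrow> j \<in> {1..k0 - 1} \<Longrightarrow> extend x w i j = w i j" "eqn k0 x (extend x w)"
proof -
  obtain tt where t: "\<forall>\<^sub>F y in nhds x. \<forall>w. eqn k0 y w \<longleftrightarrow> eqn (k0 - 1) y w \<and> (\<forall>i<d. w i k0 = (\<Sum>p\<in>JJ. w (fst p) (snd p) * tt p i y))"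
    using top_order[OF assms(1)] by (elim exE conjE) (rule that)
  note tx = eventually_nhds_x_imp_x[OF t, rule_format]
  define wb where "wb i j = (if j = k0 then \<Sum>p\<in>JJ. w (fst p) (snd p) * tt p i x else w i j)" for i j
  have low: "wb i j = w i j" if "j \<in> {1..k0 - 1}" for i j using that k0 by (auto simp: wb_def)
  have "eqn (k0 - 1) x wb" using assms(2) eqn_cong[of "k0 - 1" wb w x] low by blast
  moreover have "(\<Sum>p\<in>JJ. wb (fst p) (snd p) * tt p i x) = (\<Sum>p\<in>JJ. w (fst p) (snd p) * tt p i x)" for i
    by (intro sum.cong refl) (use low in auto)
  ultimately have "eqn k0 x wb" unfolding tx by (simp add: wb_def)
  hence "\<exists>wb. (\<forall>i<d. \<forall>j\<in>{1..k0 - 1}. wb i j = w i j) \<and> eqn k0 x wb" using low by blast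
  from someI_ex[OF this] show "\<And>i j. i < d \<Longrightarrow> j \<in> {1..k0 - 1} \<Longrightarrow> extend x w i j = w i j" "eqn k0 x (extend x w)"
    unfolding extend_def by blast+
qed

lemma extend_unique:
  assumes "x \<in> V" "eqn k0 x wb" "eqn k0 x wb'" "\<And>i j. i < d \<Longrightarrow> j \<in> {1..k0 - 1} \<Longrightarrow> wb i j = wb' i j" "i < d" "j \<in> {1..k0}"
  shows "wb i j = wb' i j"
proof (cases "j = k0")
  case True
  obtain tt where t: "\<forall>\<^sub>F y in nhds x. \<forall>w. eqn k0 y w \<longleftrightarrow> eqn (k0 - 1) y w \<and> (\<forall>i<d. w i k0 = (\<Sum>p\<in>JJ. w (fst p) (snd p) * tt p i y))"
    using top_order[OF assms(1)] by (elim exE conjE) (rule that)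
  note tx = eventually_nhds_x_imp_x[OF t, rule_format]
  have "wb i k0 = (\<Sum>p\<in>JJ. wb (fst p) (snd p) * tt p i x)" "wb' i k0 = (\<Sum>p\<in>JJ. wb' (fst p) (snd p) * tt p i x)"
    using tx[of wb] tx[of wb'] assms(2,3,5) by auto
  moreover have "(\<Sum>p\<in>JJ. wb (fst p) (snd p) * tt p i x) = (\<Sum>p\<in>JJ. wb' (fst p) (snd p) * tt p i x)"
    using assms(4) by (intro sum.cong refl) auto
  ultimately show ?thesis using True by simp
next
  case False
  thus ?thesis using assms(4,5,6) by auto
qed

lemma extend_eqI:
  assumes "x \<in> V" "eqn k0 x wb" "\<And>i j. i < d \<Longrightarrow> j \<in> {1..k0 - 1} \<Longrightarrow> wb i j = w i j" "i < d" "j \<in> {1..k0}"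
  shows "extend x w i j = wb i j"
proof -
  have e: "eqn (k0 - 1) x w"
    using eqn_mono[OF assms(2), of "k0 - 1"] eqn_cong[of "k0 - 1" wb w x] assms(3) by auto
  note ex = extend_exists[OF assms(1) e]
  show ?thesis
    by (rule extend_unique[OF assms(1) ex(2) assms(2) _ assms(4,5)]) (simp add: ex(1) assms(3))
qed

lemma extend_hn:
  assumes "coords x s w" "i < d" "j \<in> {1..k0}"
  shows "hn x (\<lambda>y. extend y (w y) i j)"
proof -
  note x = coordsD(1)[OF assms(1)]
  obtain tt where t: "\<forall>p\<in>JJ. \<forall>i<d. hn x (tt p i)"
    "\<forall>\<^sub>F y in nhds x. \<forall>w. eqn k0 y w \<longleftrightarrow> eqn (k0 - 1) y w \<and> (\<forall>i<d. w i k0 = (\<Sum>p\<in>JJ. w (fst p) (snd p) * tt p i y))"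
    using top_order[OF x] by (elim exE conjE) (rule that)
  show ?thesis
  proof (cases "j = k0")
    case True
    have "\<forall>\<^sub>F y in nhds x. extend y (w y) i j = (\<Sum>p\<in>JJ. w y (fst p) (snd p) * tt p i y)"
      using t(2) coords_ev[OF assms(1)]
    proof eventually_elim
      case (elim y)
      note ex = extend_exists[OF coordsD(1,3)[OF elim(2)]]
      have "extend y (w y) i k0 = (\<Sum>p\<in>JJ. extend y (w y) (fst p) (snd p) * tt p i y)" using elim(1)[rule_format, of "extend y (w y)"] ex(2) assms(2) by blast
      also have "\<dots> = (\<Sum>p\<in>JJ. w y (fst p) (snd p) * tt p i y)" by (intro sum.cong refl) (auto simp: ex(1))
      finally show ?case using True by simp
    qed
    thus ?thesis
    proof (rule hol_near_cong_fun)
      show "hn x (\<lambda>y. \<Sum>p\<in>JJ. w y (fst p) (snd p) * tt p i y)"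
        using t(1) assms(2) by (intro hn_sum V_manifold x hn_mult coordsD(4)[OF assms(1)]) auto
    qed
  next
    case False
    hence j: "j \<in> {1..k0 - 1}" using assms(3) by auto
    have "\<forall>\<^sub>F y in nhds x. extend y (w y) i j = w y i j"
      using coords_ev[OF assms(1)] by eventually_elim (rule extend_exists(1)[OF coordsD(1,3) assms(2) j])
    thus ?thesis by (rule hol_near_cong_fun) (rule coordsD(4)[OF assms(1,2) j])
  qed
qed

lemma extend_lin:
  assumes "x \<in> V" "eqn (k0 - 1) x w" "eqn (k0 - 1) x w'" "i < d" "j \<in> {1..k0}"
  shows "extend x (\<lambda>i j. w i j + a * w' i j) i j = extend x w i j + a * extend x w' i j"
  by (rule extend_eqI[OF assms(1) eqn_lin[OF extend_exists(2)[OF assms(1,2)] extend_exists(2)[OF assms(1,3)]] _ assms(4,5)])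
    (simp add: extend_exists(1)[OF assms(1,2)] extend_exists(1)[OF assms(1,3)])

definition conn :: "'m \<Rightarrow> 'm tvec \<Rightarrow> ('m \<Rightarrow> nat \<Rightarrow> nat \<Rightarrow> complex) \<Rightarrow> nat \<Rightarrow> nat \<Rightarrow> complex"
  where "conn x v w i j = v (\<lambda>y. w y i j) - extend x (w x) i (Suc j) * v (f i)"

text \<open>Differentiate the equation of index \<beta> along v and subtract the equations of index
  \<open>k # \<beta>\<close> for the extension, weighted by the components of v: all terms with
  derivatives of the Faa di Bruno coefficients cancel.\<close>

lemma conn_eqn:
  assumes s: "coords x s w" and v: "v \<in> tangent_space A x"
  shows "eqn (k0 - 1) x (conn x v w)"
  unfolding eqn_def
proof (intro allI impI)
  note x = coordsD(1)[OF s]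
  note cx = c0 V_c0[OF x]
  note ex = extend_exists[OF x coordsD(3)[OF s]]
  fix \<beta> :: "'n list" assume b: "1 \<le> length \<beta>" "length \<beta> \<le> k0 - 1"
  have hf: "hn x (faa c\<^sub>0 (f i) \<beta> j)" if "i < d" for i j by (intro faa_hol cx f that x)
  have hw: "hn x (\<lambda>y. w y i j)" if "i < d" "j \<in> {1..length \<beta>}" for i j
    using that b by (intro coordsD(4)[OF s]) auto
  have "\<forall>\<^sub>F y in nhds x. (\<Sum>i<d. \<Sum>j=1..length \<beta>. faa c\<^sub>0 (f i) \<beta> j y * w y i j) = 0"
    using coords_ev[OF s] by eventually_elim (use b in \<open>auto dest!: coordsD(3) simp: eqn_def\<close>)
  from tangent_cong[OF v this] have "v (\<lambda>y. \<Sum>i<d. \<Sum>j=1..length \<beta>. faa c\<^sub>0 (f i) \<beta> j y * w y i j) = 0"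
    by (simp add: tangent_const[OF v])
  also have "v (\<lambda>y. \<Sum>i<d. \<Sum>j=1..length \<beta>. faa c\<^sub>0 (f i) \<beta> j y * w y i j) =
      (\<Sum>i<d. v (\<lambda>y. \<Sum>j=1..length \<beta>. faa c\<^sub>0 (f i) \<beta> j y * w y i j))"
    by (rule tangent_sum[OF v]) (auto intro!: hn_sum hn_mult V_manifold x hf hw)
  also have "\<dots> = (\<Sum>i<d. \<Sum>j=1..length \<beta>. v (faa c\<^sub>0 (f i) \<beta> j) * w x i j + faa c\<^sub>0 (f i) \<beta> j x * v (\<lambda>y. w y i j))"
  proof (rule sum.cong[OF refl])
    fix i assume i: "i \<in> {..<d}"
    have "v (\<lambda>y. \<Sum>j=1..length \<beta>. faa c\<^sub>0 (f i) \<beta> j y * w y i j) = (\<Sum>j=1..length \<beta>. v (\<lambda>y. faa c\<^sub>0 (f i) \<beta> j y * w y i j))"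
      by (rule tangent_sum[OF v]) (use i in \<open>auto intro!: hn_mult hf hw\<close>)
    also have "\<dots> = (\<Sum>j=1..length \<beta>. v (faa c\<^sub>0 (f i) \<beta> j) * w x i j + faa c\<^sub>0 (f i) \<beta> j x * v (\<lambda>y. w y i j))"
      using i by (intro sum.cong refl tangent_mult[OF v] hf hw) auto
    finally show "v (\<lambda>y. \<Sum>j=1..length \<beta>. faa c\<^sub>0 (f i) \<beta> j y * w y i j) = (\<Sum>j=1..length \<beta>. v (faa c\<^sub>0 (f i) \<beta> j) * w x i j + faa c\<^sub>0 (f i) \<beta> j x * v (\<lambda>y. w y i j))" .
  qed
  finally have e1: "(\<Sum>i<d. \<Sum>j=1..length \<beta>. v (faa c\<^sub>0 (f i) \<beta> j) * w x i j + faa c\<^sub>0 (f i) \<beta> j x * v (\<lambda>y. w y i j)) = 0" .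
  \<comment> \<open>The word \<open>k # \<beta>\<close> can have length \<open>k0\<close>, beyond
    the equations known for w; this is where the extension enters.\<close>
  have "(\<Sum>i<d. \<Sum>j=1..Suc (length \<beta>). faa c\<^sub>0 (f i) (k # \<beta>) j x * extend x (w x) i j) = 0" for k
    using ex(2)[unfolded eqn_def, rule_format, of "k # \<beta>"] b by simp
  hence "0 = (\<Sum>k\<in>UNIV. v (\<lambda>y. snd c\<^sub>0 y $ k) * (\<Sum>i<d. \<Sum>j=1..Suc (length \<beta>). faa c\<^sub>0 (f i) (k # \<beta>) j x * extend x (w x) i j))"
    by simp
  also have "\<dots> = (\<Sum>i<d. \<Sum>k\<in>UNIV. v (\<lambda>y. snd c\<^sub>0 y $ k) * (\<Sum>j=1..Suc (length \<beta>). faa c\<^sub>0 (f i) (k # \<beta>) j x * extend x (w x) i j))"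
    unfolding sum_distrib_left[of _ _ "{..<d}"] by (rule sum.swap)
  also have "\<dots> = (\<Sum>i<d. \<Sum>j=1..length \<beta>. v (faa c\<^sub>0 (f i) \<beta> j) * extend x (w x) i j + faa c\<^sub>0 (f i) \<beta> j x * v (f i) * extend x (w x) i (Suc j))"
    using b by (intro sum.cong refl faa_tangent[OF v cx] f x) auto
  also have "\<dots> = (\<Sum>i<d. \<Sum>j=1..length \<beta>. v (faa c\<^sub>0 (f i) \<beta> j) * w x i j + faa c\<^sub>0 (f i) \<beta> j x * v (f i) * extend x (w x) i (Suc j))"
    using b by (intro sum.cong refl) (auto simp: ex(1))
  finally have e2: "(\<Sum>i<d. \<Sum>j=1..length \<beta>. v (faa c\<^sub>0 (f i) \<beta> j) * w x i j + faa c\<^sub>0 (f i) \<beta> j x * v (f i) * extend x (w x) i (Suc j)) = 0" ..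
  have "(\<Sum>i<d. \<Sum>j=1..length \<beta>. faa c\<^sub>0 (f i) \<beta> j x * conn x v w i j) =
    (\<Sum>i<d. \<Sum>j=1..length \<beta>. v (faa c\<^sub>0 (f i) \<beta> j) * w x i j + faa c\<^sub>0 (f i) \<beta> j x * v (\<lambda>y. w y i j)) -
    (\<Sum>i<d. \<Sum>j=1..length \<beta>. v (faa c\<^sub>0 (f i) \<beta> j) * w x i j + faa c\<^sub>0 (f i) \<beta> j x * v (f i) * extend x (w x) i (Suc j))"
    unfolding sum_subtractf[symmetric] by (intro sum.cong refl) (simp add: conn_def algebra_simps)
  thus "(\<Sum>i<d. \<Sum>j=1..length \<beta>. faa c\<^sub>0 (f i) \<beta> j x * conn x v w i j) = 0" unfolding e1 e2 by simp
qed

lemma jet_A_hn: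
  assumes "sec x u" "x \<in> V" "i < d" "c \<in> A" "x \<in> fst c" "length \<alpha> \<le> q" "\<forall>\<^sub>F y in nhds x. F y = T i y"
  shows "hn x (\<lambda>y. jet_A A W q y u (c, F y, l, \<alpha>))"
    and "v \<in> tangent_space A x \<Longrightarrow> v (\<lambda>y. jet_A A W q y u (c, F y, l, \<alpha>)) =
      (\<Sum>k\<in>UNIV. v (\<lambda>y. snd c y $ k) * jet_A A W (Suc q) x u (c, T i x, l, k # \<alpha>))"
proof -
  let ?h = "\<lambda>y. cf u i y * chart_deriv c l (f i) y"
  have h: "hn x ?h" by (intro hn_mult sec_cf_hn hn_D f assms)
  have ev: "\<forall>\<^sub>F y in nhds x. jet_A A W q y u (c, F y, l, \<alpha>) = iter_deriv c \<alpha> ?h y"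
    using sec_ev[OF assms(1)] ev_V[OF assms(2)] eventually_fst[OF assms(4,5)] assms(7)
    by eventually_elim (simp add: jet_A_T[OF _ _ assms(3,4) _ assms(6)])
  show "hn x (\<lambda>y. jet_A A W q y u (c, F y, l, \<alpha>))"
    by (rule hol_near_cong_fun[OF ev]) (intro iter_deriv_hol assms(4,5) h)
  assume v: "v \<in> tangent_space A x"
  have "v (\<lambda>y. jet_A A W q y u (c, F y, l, \<alpha>)) = v (iter_deriv c \<alpha> ?h)" by (rule tangent_cong[OF v ev])
  also have "\<dots> = (\<Sum>k\<in>UNIV. v (\<lambda>y. snd c y $ k) * iter_deriv c (k # \<alpha>) ?h x)"
    using tangent_apply[OF v assms(4,5) iter_deriv_hol[OF assms(4) h assms(5)]] by simp
  also have "\<dots> = (\<Sum>k\<in>UNIV. v (\<lambda>y. snd c y $ k) * jet_A A W (Suc q) x u (c, T i x, l, k # \<alpha>))"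
    using assms(6) by (intro sum.cong refl) (subst jet_A_T[OF assms(1-5)], auto)
  finally show "v (\<lambda>y. jet_A A W q y u (c, F y, l, \<alpha>)) =
      (\<Sum>k\<in>UNIV. v (\<lambda>y. snd c y $ k) * jet_A A W (Suc q) x u (c, T i x, l, k # \<alpha>))" .
qed

lemma jet_A_truncate: "length \<alpha> \<le> q \<Longrightarrow> q \<le> q' \<Longrightarrow> jet_A A W q x u (c, S, l, \<alpha>) = jet_A A W q' x u (c, S, l, \<alpha>)"
  by (simp add: jet_A_def)

lemma jetw_truncate: "length \<alpha> \<le> q \<Longrightarrow> q \<le> q' \<Longrightarrow> jetw q x w (c, S, l, \<alpha>) = jetw q' x w (c, S, l, \<alpha>)"
  by (simp add: jetw_def)

lemma jet_A_trunc_eq: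
  assumes "jet_A A W q' x u = jetw q' x w" "q \<le> q'" "x \<in> V"
  shows "jet_A A W q x u = jetw q x w"
proof (rule jet_eqI[OF assms(3), of q])
  fix c i l and \<alpha> :: "'n list" assume "length \<alpha> \<le> q"
  thus "jet_A A W q x u (c, T i x, l, \<alpha>) = jetw q x w (c, T i x, l, \<alpha>)"
    using jet_A_truncate[of \<alpha> q q' x u] jetw_truncate[of \<alpha> q q' x w] assms(1,2) by simp
qed (auto simp: jet_A_zero jetw_zero[OF assms(3)])

text \<open>By uniqueness of the extension, all sections that prolong the given relation share the
  jet of order k0 - 1. The choice made in \<open>spencer\<close> is therefore harmless.\<close>

lemma formal_extension:
  assumes "x \<in> V" "sec x u" "jet_A A W (k0 - 2) x u = jetw (k0 - 2) x w" "jet_D A W (k0 - 1) x u = 0"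
  shows "jet_A A W (k0 - 1) x u = jetw (k0 - 1) x (extend x w)"
proof -
  obtain w' where w': "jet_A A W (k0 - 1) x u = jetw (k0 - 1) x w'" "eqn (Suc (k0 - 1)) x w'"
    using formal_to_w[OF assms(1,2,4)] by blast
  have e: "eqn k0 x w'" using w'(2) k0 by simp
  have "jetw (k0 - 2) x w' = jetw (k0 - 2) x w" using jet_A_trunc_eq[OF w'(1) _ assms(1), of "k0 - 2"] assms(3) by simp
  hence "w' i j = w i j" if "i < d" "j \<in> {1..k0 - 1}" for i j using jetw_inj[OF assms(1) _ that(1), of "k0 - 2" w' w j] that(2) Suc_k0_minus_2 by simp
  hence "extend x w i j = w' i j" if "i < d" "j \<in> {1..k0}" for i j using extend_eqI[OF assms(1) e _ that, of w] by blast
  hence "jetw (k0 - 1) x (extend x w) = jetw (k0 - 1) x w'" using k0 by (intro jetw_cong) auto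
  thus ?thesis using w'(1) by simp
qed

lemma formal_exists:
  assumes "x \<in> V" "eqn (k0 - 1) x w"
  shows "\<exists>u. sec x u \<and> jet_A A W (k0 - 2) x u = jetw (k0 - 2) x w \<and> jet_D A W (k0 - 1) x u = 0"
proof -
  note ex = extend_exists[OF assms]
  obtain u where u: "sec x u" "jet_A A W (k0 - 1) x u = jetw (k0 - 1) x (extend x w)" "jet_D A W (k0 - 1) x u = 0"
    using w_to_formal[OF assms(1) duals1[OF assms(1)], of "k0 - 1" "extend x w"] ex(2) k0 by auto
  have "jet_A A W (k0 - 2) x u = jetw (k0 - 2) x (extend x w)" by (rule jet_A_trunc_eq[OF u(2) _ assms(1)]) simp
  also have "\<dots> = jetw (k0 - 2) x w" using Suc_k0_minus_2 by (intro jetw_cong ex(1)) auto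
  finally show ?thesis using u by blast
qed

lemma spencer_apply:
  assumes x: "x \<in> V" and ex: "\<exists>u. sec x u \<and> jet_A A W (k0 - 2) x u = s x \<and> jet_D A W (k0 - 1) x u = 0"
  shows "\<exists>u. sec x u \<and> jet_A A W (k0 - 2) x u = s x \<and> jet_D A W (k0 - 1) x u = 0 \<and>
    spencer A W (k0 - 2) x v s = (\<lambda>(c, S, l, \<alpha>). if c \<in> A \<and> x \<in> fst c \<and> S \<in> W x \<and> length \<alpha> \<le> k0 - 2
      then v (\<lambda>y. s y (c, branch_at A W x S y, l, \<alpha>) - jet_A A W (k0 - 2) y u (c, branch_at A W x S y, l, \<alpha>)) else 0)"
proof -
  define u where "u = (SOME u. (\<exists>V. x \<in> V \<and> A_section A W V u) \<and> jet_A A W (k0 - 2) x u = s x \<and> jet_D A W (Suc (k0 - 2)) x u = 0)"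
  have u: "(\<exists>V. x \<in> V \<and> A_section A W V u) \<and> jet_A A W (k0 - 2) x u = s x \<and> jet_D A W (Suc (k0 - 2)) x u = 0"
    unfolding u_def by (rule someI_ex[OF ex[unfolded sec_def Suc_k0_minus_2[symmetric]]])
  have "spencer A W (k0 - 2) x v s = (\<lambda>(c, S, l, \<alpha>). if c \<in> A \<and> x \<in> fst c \<and> S \<in> W x \<and> length \<alpha> \<le> k0 - 2
      then v (\<lambda>y. s y (c, branch_at A W x S y, l, \<alpha>) - jet_A A W (k0 - 2) y u (c, branch_at A W x S y, l, \<alpha>)) else 0)"
    unfolding spencer_def Let_def u_def[symmetric] by (rule refl)
  with u[folded sec_def, unfolded Suc_k0_minus_2] show ?thesis by (intro exI[of _ u]) (elim conjE, intro conjI)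
qed

text \<open>Differentiating s along v produces derivatives of the Faa di Bruno coefficients and of
  w. The jet of the representative produces the same derivatives of the coefficients, because w and
  its extension agree below the top order, so they cancel and \<open>conn\<close> remains.\<close>

lemma spencer_eval:
  assumes s: "coords x s w" and v: "v \<in> tangent_space A x"
  shows "spencer A W (k0 - 2) x v s = jetw (k0 - 2) x (conn x v w)"
proof -
  note x = coordsD(1)[OF s]
  note ex = extend_exists[OF x coordsD(3)[OF s]]
  obtain u where u: "sec x u" "jet_A A W (k0 - 2) x u = s x" "jet_D A W (k0 - 1) x u = 0"
    "spencer A W (k0 - 2) x v s = (\<lambda>(c, S, l, \<alpha>). if c \<in> A \<and> x \<in> fst c \<and> S \<in> W x \<and> length \<alpha> \<le> k0 - 2
      then v (\<lambda>y. s y (c, branch_at A W x S y, l, \<alpha>) - jet_A A W (k0 - 2) y u (c, branch_at A W x S y, l, \<alpha>)) else 0)"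
    using spencer_apply[where s=s and v=v, OF x] formal_exists[OF x coordsD(3)[OF s]] coordsD(2)[OF s] by auto
  have uQ: "jet_A A W (k0 - 1) x u = jetw (k0 - 1) x (extend x (w x))"
    by (rule formal_extension[OF x u(1) _ u(3)]) (simp add: u(2) coordsD(2)[OF s])
  show ?thesis
  proof (rule jet_eqI[OF x, of "k0 - 2"])
    fix c i l and \<alpha> :: "'n list" assume i: "i < d" and c: "c \<in> A" "x \<in> fst c" and a: "length \<alpha> \<le> k0 - 2"
    let ?F = "branch_at A W x (T i x)" and ?\<beta> = "\<alpha> @ [l]"
    note F = branch_at_T[OF x i]
    have lb: "length ?\<beta> = Suc (length \<alpha>)" "length ?\<beta> \<le> k0 - 1" using a k0 by auto
    have hw: "hn x (\<lambda>y. w y i j)" if "j \<in> {1..length ?\<beta>}" for j using that lb(2) by (intro coordsD(4)[OF s i]) auto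
    have hf: "hn x (faa c (f i) ?\<beta> j)" for j by (intro faa_hol c f i x)
    have es: "\<forall>\<^sub>F y in nhds x. s y (c, ?F y, l, \<alpha>) = (\<Sum>j=1..length ?\<beta>. faa c (f i) ?\<beta> j y * w y i j)"
      using F coords_ev[OF s] eventually_fst[OF c]
      by eventually_elim (simp add: coordsD(2) jetw_T[OF coordsD(1) i c(1) _ a])
    have hs: "hn x (\<lambda>y. s y (c, ?F y, l, \<alpha>))"
      by (rule hol_near_cong_fun[OF es]) (intro hn_sum hn_mult V_manifold x hw hf)
    have vs: "v (\<lambda>y. s y (c, ?F y, l, \<alpha>)) = (\<Sum>j=1..length ?\<beta>. v (faa c (f i) ?\<beta> j) * w x i j + faa c (f i) ?\<beta> j x * v (\<lambda>y. w y i j))"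
    proof -
      have "v (\<lambda>y. s y (c, ?F y, l, \<alpha>)) = v (\<lambda>y. \<Sum>j=1..length ?\<beta>. faa c (f i) ?\<beta> j y * w y i j)" by (rule tangent_cong[OF v es])
      also have "\<dots> = (\<Sum>j=1..length ?\<beta>. v (\<lambda>y. faa c (f i) ?\<beta> j y * w y i j))" by (rule tangent_sum[OF v]) (intro hn_mult hf hw)
      also have "\<dots> = (\<Sum>j=1..length ?\<beta>. v (faa c (f i) ?\<beta> j) * w x i j + faa c (f i) ?\<beta> j x * v (\<lambda>y. w y i j))"
        by (intro sum.cong refl tangent_mult[OF v] hf hw)
      finally show ?thesis .
    qed
    have vu: "v (\<lambda>y. jet_A A W (k0 - 2) y u (c, ?F y, l, \<alpha>)) =
       (\<Sum>j=1..length ?\<beta>. v (faa c (f i) ?\<beta> j) * w x i j + faa c (f i) ?\<beta> j x * v (f i) * extend x (w x) i (Suc j))"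
    proof -
      have "v (\<lambda>y. jet_A A W (k0 - 2) y u (c, ?F y, l, \<alpha>)) = (\<Sum>k\<in>UNIV. v (\<lambda>y. snd c y $ k) * jet_A A W (k0 - 1) x u (c, T i x, l, k # \<alpha>))"
        using jet_A_hn(2)[OF u(1) x i c a F v, of l] unfolding Suc_k0_minus_2 .
      also have "\<dots> = (\<Sum>k\<in>UNIV. v (\<lambda>y. snd c y $ k) * (\<Sum>j=1..Suc (length ?\<beta>). faa c (f i) (k # ?\<beta>) j x * extend x (w x) i j))"
      proof (intro sum.cong refl)
        fix k
        have "length (k # \<alpha>) \<le> k0 - 1" using lb by simp
        from jetw_T[OF x i c this, of "extend x (w x)" l]
        show "v (\<lambda>y. snd c y $ k) * jet_A A W (k0 - 1) x u (c, T i x, l, k # \<alpha>) =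
          v (\<lambda>y. snd c y $ k) * (\<Sum>j=1..Suc (length ?\<beta>). faa c (f i) (k # ?\<beta>) j x * extend x (w x) i j)"
          unfolding uQ by (simp del: faa.simps sum.cl_ivl_Suc)
      qed
      also have "\<dots> = (\<Sum>j=1..length ?\<beta>. v (faa c (f i) ?\<beta> j) * extend x (w x) i j + faa c (f i) ?\<beta> j x * v (f i) * extend x (w x) i (Suc j))"
        by (rule faa_tangent[OF v c f[OF i x]]) simp
      also have "\<dots> = (\<Sum>j=1..length ?\<beta>. v (faa c (f i) ?\<beta> j) * w x i j + faa c (f i) ?\<beta> j x * v (f i) * extend x (w x) i (Suc j))"
        using lb(2) by (intro sum.cong refl) (auto simp: ex(1)[OF i])
      finally show ?thesis .
    qed
    have "spencer A W (k0 - 2) x v s (c, T i x, l, \<alpha>) = v (\<lambda>y. s y (c, ?F y, l, \<alpha>) - jet_A A W (k0 - 2) y u (c, ?F y, l, \<alpha>))"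
      unfolding u(4) using c a T_in_W[OF x i] by simp
    also have "\<dots> = v (\<lambda>y. s y (c, ?F y, l, \<alpha>)) - v (\<lambda>y. jet_A A W (k0 - 2) y u (c, ?F y, l, \<alpha>))"
      by (rule tangent_diff[OF v hs jet_A_hn(1)[OF u(1) x i c a F]])
    also have "\<dots> = (\<Sum>j=1..length ?\<beta>. faa c (f i) ?\<beta> j x * conn x v w i j)"
      unfolding vs vu sum_subtractf[symmetric] by (intro sum.cong refl) (simp add: conn_def algebra_simps)
    also have "\<dots> = jetw (k0 - 2) x (conn x v w) (c, T i x, l, \<alpha>)" unfolding jetw_T[OF x i c a] lb(1) ..
    finally show "spencer A W (k0 - 2) x v s (c, T i x, l, \<alpha>) = jetw (k0 - 2) x (conn x v w) (c, T i x, l, \<alpha>)" .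
  qed (auto simp: u(4) jetw_zero[OF x])
qed

text \<open>The representative chosen in \<open>spencer\<close> has the same jet of order k0 - 1 as
  u, so the difference of the jets of order k0 - 2 has zero derivative at x.\<close>

lemma spencer_jet:
  assumes x: "x \<in> V" and u: "sec x u" "jet_D A W (k0 - 1) x u = 0" and v: "v \<in> tangent_space A x"
  shows "spencer A W (k0 - 2) x v (\<lambda>y. jet_A A W (k0 - 2) y u) = 0"
proof -
  obtain u' where u': "sec x u'" "jet_A A W (k0 - 2) x u' = jet_A A W (k0 - 2) x u" "jet_D A W (k0 - 1) x u' = 0"
    "spencer A W (k0 - 2) x v (\<lambda>y. jet_A A W (k0 - 2) y u) = (\<lambda>(c, S, l, \<alpha>). if c \<in> A \<and> x \<in> fst c \<and> S \<in> W x \<and> length \<alpha> \<le> k0 - 2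
      then v (\<lambda>y. jet_A A W (k0 - 2) y u (c, branch_at A W x S y, l, \<alpha>) - jet_A A W (k0 - 2) y u' (c, branch_at A W x S y, l, \<alpha>)) else 0)"
    using spencer_apply[where s="\<lambda>y. jet_A A W (k0 - 2) y u" and v=v, OF x] u by blast
  obtain w where w: "jet_A A W (k0 - 1) x u = jetw (k0 - 1) x w" using formal_to_w[OF x u] by blast
  have w2: "jet_A A W (k0 - 2) x u = jetw (k0 - 2) x w" by (rule jet_A_trunc_eq[OF w _ x]) simp
  have eq: "jet_A A W (k0 - 1) x u = jet_A A W (k0 - 1) x u'"
    using formal_extension[OF x u(1) w2 u(2)] formal_extension[OF x u'(1) _ u'(3)] u'(2) w2 by simp
  show ?thesis
  proof (rule jet_eqI[OF x, of "k0 - 2"])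
    fix c i l and \<alpha> :: "'n list" assume i: "i < d" and c: "c \<in> A" "x \<in> fst c" and a: "length \<alpha> \<le> k0 - 2"
    note F = branch_at_T[OF x i]
    show "spencer A W (k0 - 2) x v (\<lambda>y. jet_A A W (k0 - 2) y u) (c, T i x, l, \<alpha>) = 0 (c, T i x, l, \<alpha>)"
      using c a T_in_W[OF x i] jet_A_hn(2)[OF u(1) x i c a F v, of l] jet_A_hn(2)[OF u'(1) x i c a F v, of l] eq
      by (simp add: u'(4) tangent_diff[OF v jet_A_hn(1)[OF u(1) x i c a F] jet_A_hn(1)[OF u'(1) x i c a F]] Suc_k0_minus_2)
  qed (auto simp: u'(4))
qed

end

section \<open>Flat sections\<close>

context atlas begin

lemma vector_field_hn:
  assumes "hol_vector_field A V' X" "x \<in> V'" "hn x g"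
  shows "hn x (\<lambda>y. X y g)"
proof -
  have X: "open V'" "\<And>y. y \<in> V' \<Longrightarrow> X y \<in> tangent_space A y" "\<And>c k. c \<in> A \<Longrightarrow> hol_on A (\<lambda>x. X x (\<lambda>y. snd c y $ k)) (V' \<inter> fst c)"
    using assms(1) by (auto simp: hol_vector_field_def)
  obtain c where c: "c \<in> A" "x \<in> fst c" using manifold_chart[OF hn_manifold[OF assms(3)]] by blast
  have "\<forall>\<^sub>F y in nhds x. X y g = (\<Sum>l\<in>UNIV. X y (\<lambda>y. snd c y $ l) * chart_deriv c l g y)"
    using eventually_fst[OF c] hn_eventually[OF assms(3)] eventually_nhds_in_open[OF X(1) assms(2)]
    by eventually_elim (rule tangent_apply[OF X(2) c(1)])
  thus ?thesis
  proof (rule hol_near_cong_fun)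
    have "hn x (\<lambda>y. X y (\<lambda>y. snd c y $ l))" for l using X(3)[OF c(1)] assms(2) c(2) by (auto simp: hol_on_hn)
    thus "hn x (\<lambda>y. \<Sum>l\<in>UNIV. X y (\<lambda>y. snd c y $ l) * chart_deriv c l g y)"
      by (intro hn_sum hn_mult hn_D c assms(3) fst_manifold[OF c])
  qed
qed

end

context local_web begin

lemma jetw_scale: "jetw p x (\<lambda>i j. a * w i j) = a *\<^sub>F jetw p x w"
  using jetw_lin[of p x "\<lambda>i j. 0" a w] by simp

lemma eqn_0 [simp]: "eqn N x (\<lambda>i j. 0)"
  by (simp add: eqn_def)

lemma eqn_scale: "eqn N x w \<Longrightarrow> eqn N x (\<lambda>i j. a * w i j)"
  using eqn_lin[of N x "\<lambda>i j. 0" w a] by simp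

text \<open>The part of order 0 of a jet already determines the coefficients of the
  \<open>df\<^sub>i\<close>.\<close>

lemma jet_A_inj:
  assumes "y \<in> V" "sec y u" "sec y u'" "jet_A A W q y u = jet_A A W q y u'"
  shows "u y = u' y"
proof -
  have "cf u i y = cf u' i y" if i: "i < d" for i
  proof -
    obtain l where l: "chart_deriv c\<^sub>0 l (f i) y \<noteq> 0" using df[OF i assms(1)] by blast
    have "cf u i y * chart_deriv c\<^sub>0 l (f i) y = cf u' i y * chart_deriv c\<^sub>0 l (f i) y"
      using jet_A_T[OF assms(2,1) i c0 V_c0[OF assms(1)], of "[]" q l] jet_A_T[OF assms(3,1) i c0 V_c0[OF assms(1)], of "[]" q l]
      unfolding assms(4) by (simp only: list.size le0 iter_deriv.simps)
    thus ?thesis using l by auto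
  qed
  hence "mksec (cf u) y = mksec (cf u') y" by (auto simp: mksec_def fun_eq_iff intro!: sum.cong)
  thus ?thesis using mksec_cf[of u y, OF sec_fibre[OF assms(2)] assms(1)] mksec_cf[of u' y, OF sec_fibre[OF assms(3)] assms(1)] by simp
qed

lemma abelian_sec: "abelian_relation A W V' u \<Longrightarrow> x \<in> V' \<Longrightarrow> sec x u"
  by (auto simp: abelian_relation_def sec_def)

lemma abelian_jet_D:
  assumes "abelian_relation A W V' u" "x \<in> V'" "x \<in> V"
  shows "jet_D A W p x u = 0"
  unfolding jet_D_zero_iff[OF abelian_sec[OF assms(1,2)] assms(3)]
proof (intro allI impI ballI)
  fix i c k l assume i: "i < d" and c: "c \<in> A" "x \<in> fst c"
  have o: "open (V' \<inter> V)" using assms(1) V(1) by (auto simp: abelian_relation_def A_section_def)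
  have e: "ext_deriv_coeff A c (along u (T i)) k l y = 0" if "y \<in> V' \<inter> V" "y \<in> fst c" for y
    using assms(1) T_foliation[OF o _ i] that c(1) unfolding abelian_relation_def by blast
  show "van c p (\<lambda>y. chart_deriv c k (cf u i) y * chart_deriv c l (f i) y - chart_deriv c l (cf u i) y * chart_deriv c k (f i) y) x"
  proof (rule van_cong[OF c _ van_zero])
    have "\<forall>\<^sub>F y in nhds x. T i y = T i y" by simp
    have xx: "x \<in> V' \<inter> V" using assms(2,3) by simp
    from ext_deriv_T[OF abelian_sec[OF assms(1,2)] assms(3) i c \<open>\<forall>\<^sub>F y in nhds x. T i y = T i y\<close>, of k l]
      eventually_nhds_in_open[OF o xx] eventually_fst[OF c]
    have "\<forall>\<^sub>F y in nhds x. chart_deriv c k (cf u i) y * chart_deriv c l (f i) y - chart_deriv c l (cf u i) y * chart_deriv c k (f i) y = 0"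
    proof eventually_elim
      case (elim y)
      thus ?case using e[of y] by simp
    qed
    thus "\<forall>\<^sub>F y in nhds x. 0 = chart_deriv c k (cf u i) y * chart_deriv c l (f i) y - chart_deriv c l (cf u i) y * chart_deriv c k (f i) y"
      by eventually_elim simp
  qed
qed

end

context good_web begin

lemma coords_add:
  assumes "coords x s w" "coords x t w'"
  shows "coords x (\<lambda>y. s y + t y) (\<lambda>y i j. w y i j + w' y i j)"
  using assms unfolding coords_def
proof eventually_elim
  case (elim y)
  have "jetw (k0 - 2) y (\<lambda>i j. w y i j + w' y i j) = jetw (k0 - 2) y (w y) + jetw (k0 - 2) y (w' y)"
    using jetw_lin[of "k0 - 2" y "w y" 1 "w' y"] by (simp add: fscale_def)
  moreover have "eqn (k0 - 1) y (\<lambda>i j. w y i j + w' y i j)" using eqn_lin[of "k0 - 1" y "w y" "w' y" 1] elim by simp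
  ultimately show ?case using elim by (auto intro!: hn_add)
qed

lemma coords_scale:
  assumes "coords x s w" "hn x g"
  shows "coords x (\<lambda>y. g y *\<^sub>F s y) (\<lambda>y i j. g y * w y i j)"
  using assms(1)[unfolded coords_def] hn_eventually[OF assms(2)] unfolding coords_def
proof eventually_elim
  case (elim y)
  thus ?case by (auto simp: jetw_scale intro!: eqn_scale hn_mult)
qed

lemma conn_add:
  assumes s: "coords x s w" and t: "coords x t w'" and v: "v \<in> tangent_space A x" and ij: "i < d" "j \<in> {1..k0 - 1}"
  shows "conn x v (\<lambda>y i j. w y i j + w' y i j) i j = conn x v w i j + conn x v w' i j"
proof -
  have "Suc j \<in> {1..k0}" using ij by auto
  from extend_lin[OF coordsD(1,3)[OF s] coordsD(3)[OF t] ij(1) this, of 1]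
  show ?thesis using tangent_add[OF v coordsD(4)[OF s ij] coordsD(4)[OF t ij]]
    by (simp add: conn_def algebra_simps)
qed

lemma conn_scale:
  assumes s: "coords x s w" and g: "hn x g" and v: "v \<in> tangent_space A x" and ij: "i < d" "j \<in> {1..k0 - 1}"
  shows "conn x v (\<lambda>y i j. g y * w y i j) i j = v g * w x i j + g x * conn x v w i j"
proof -
  have j: "Suc j \<in> {1..k0}" using ij by auto
  have "extend x (\<lambda>i j. g x * w x i j) i (Suc j) = g x * extend x (w x) i (Suc j)"
    by (rule extend_eqI[OF coordsD(1)[OF s] eqn_scale[OF extend_exists(2)[OF coordsD(1,3)[OF s]]] _ ij(1) j])
      (simp add: extend_exists(1)[OF coordsD(1,3)[OF s]])
  thus ?thesis using tangent_mult[OF v g coordsD(4)[OF s ij]] by (simp add: conn_def algebra_simps)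
qed

lemma spencer_add:
  assumes s: "coords x s w" and t: "coords x t w'" and v: "v \<in> tangent_space A x"
  shows "spencer A W (k0 - 2) x v (\<lambda>y. s y + t y) = spencer A W (k0 - 2) x v s + spencer A W (k0 - 2) x v t"
proof -
  have "jetw (k0 - 2) x (conn x v (\<lambda>y i j. w y i j + w' y i j)) = jetw (k0 - 2) x (\<lambda>i j. conn x v w i j + 1 * conn x v w' i j)"
    using conn_add[OF s t v] Suc_k0_minus_2 by (intro jetw_cong) auto
  thus ?thesis unfolding spencer_eval[OF coords_add[OF s t] v] spencer_eval[OF s v] spencer_eval[OF t v]
    using jetw_lin[of "k0 - 2" x "conn x v w" 1 "conn x v w'"] by (simp add: fscale_def)
qed

lemma spencer_scale:
  assumes s: "coords x s w" and g: "hn x g" and v: "v \<in> tangent_space A x"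
  shows "spencer A W (k0 - 2) x v (\<lambda>y. g y *\<^sub>F s y) = v g *\<^sub>F s x + g x *\<^sub>F spencer A W (k0 - 2) x v s"
proof -
  have "jetw (k0 - 2) x (conn x v (\<lambda>y i j. g y * w y i j)) = jetw (k0 - 2) x (\<lambda>i j. v g * w x i j + g x * conn x v w i j)"
    using conn_scale[OF s g v] Suc_k0_minus_2 by (intro jetw_cong) auto
  thus ?thesis unfolding spencer_eval[OF coords_scale[OF s g] v] spencer_eval[OF s v] coordsD(2)[OF s]
    using jetw_lin[of "k0 - 2" x "\<lambda>i j. v g * w x i j" "g x" "conn x v w"] by (simp add: jetw_scale)
qed

lemma spencer_lin:
  assumes s: "coords x s w" and v: "v \<in> tangent_space A x" "v' \<in> tangent_space A x"
  shows "spencer A W (k0 - 2) x (v + a *\<^sub>F v') s = spencer A W (k0 - 2) x v s + a *\<^sub>F spencer A W (k0 - 2) x v' s"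
proof -
  have "conn x (v + a *\<^sub>F v') w = (\<lambda>i j. conn x v w i j + a * conn x v' w i j)"
    by (auto simp: conn_def fun_eq_iff fscale_def algebra_simps)
  thus ?thesis unfolding spencer_eval[OF s tangent_lin[OF v]] spencer_eval[OF s v(1)] spencer_eval[OF s v(2)]
    by (simp add: jetw_lin)
qed

lemma spencer_EE:
  assumes s: "coords x s w" and v: "v \<in> tangent_space A x"
  shows "spencer A W (k0 - 2) x v s \<in> EE x"
  using spencer_eval[OF s v] conn_eqn[OF s v] formal_relations_eq[OF coordsD(1)[OF s] duals1[OF coordsD(1)[OF s]], of "k0 - 2"]
  unfolding Suc_k0_minus_2 by blast

text \<open>Along a holomorphic vector field the coordinates of the covariant derivative are
  holomorphic because those of the extension are; this gives holomorphy of the connection.\<close>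

lemma spencer_coords:
  assumes s: "coords x s w" and X: "hol_vector_field A V' X" "x \<in> V'"
  shows "coords x (\<lambda>y. spencer A W (k0 - 2) y (X y) s) (\<lambda>y. conn y (X y) w)"
proof -
  have Xt: "X y \<in> tangent_space A y" if "y \<in> V'" for y using X(1) that by (auto simp: hol_vector_field_def)
  have "open V'" using X(1) by (simp add: hol_vector_field_def)
  hence "\<forall>\<^sub>F y in nhds x. y \<in> V'" using X(2) eventually_nhds_in_open by blast
  with coords_ev[OF s] show ?thesis unfolding coords_def[of x "\<lambda>y. spencer A W (k0 - 2) y (X y) s"]
  proof eventually_elim
    case (elim y)
    have "hn y (\<lambda>z. conn z (X z) w i j)" if ij: "i < d" "j \<in> {1..k0 - 1}" for i j
      unfolding conn_def
    proof (intro hn_diff hn_mult vector_field_hn[OF X(1) elim(2)] f ij(1))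
      show "hn y (\<lambda>z. w z i j)" by (rule coordsD(4)[OF elim(1) ij])
      show "hn y (\<lambda>z. extend z (w z) i (Suc j))" by (rule extend_hn[OF elim(1) ij(1)]) (use ij(2) in auto)
      show "y \<in> V" by (rule coordsD(1)[OF elim(1)])
    qed
    thus ?case using coordsD(1)[OF elim(1)] spencer_eval[OF elim(1) Xt[OF elim(2)]] conn_eqn[OF elim(1) Xt[OF elim(2)]] by blast
  qed
qed

text \<open>The frame consists of the solutions whose free coordinates are unit vectors. Solutions
  are determined by their free coordinates, hence they span; injectivity of the passage from w to
  jets makes them independent.\<close>

lemma local_bundle:
  assumes x: "x \<in> V"
  shows "\<exists>V1 e. x \<in> V1 \<and> V1 \<subseteq> V \<and> open V1 \<and> (\<forall>j<web_pi' CARD('n) k0 d. bundle_section A W (k0 - 2) EE V1 (e j)) \<and>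
    (\<forall>y\<in>V1. inj_on (\<lambda>j. e j y) {..<web_pi' CARD('n) k0 d} \<and> cfun.independent ((\<lambda>j. e j y) ` {..<web_pi' CARD('n) k0 d}) \<and>
       cfun.span ((\<lambda>j. e j y) ` {..<web_pi' CARD('n) k0 d}) = EE y)"
proof -
  let ?r = "web_pi' CARD('n) k0 d"
  obtain P b where P: "P \<subseteq> JJ" "card P = ?r"
    and ev: "\<forall>\<^sub>F y in nhds x. y \<in> V \<and> (\<forall>t\<in>P. \<forall>p\<in>JJ. hn y (b t p)) \<and> (\<forall>t\<in>P. \<forall>p\<in>P. b t p y = (if t = p then 1 else 0)) \<and>
      (\<forall>w. eqn (k0 - 1) y w \<longleftrightarrow> (\<forall>p\<in>JJ. w (fst p) (snd p) = (\<Sum>t\<in>P. w (fst t) (snd t) * b t p y)))"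
    using frame[OF x] by (elim exE conjE) (rule that)
  have finP: "finite P" by (rule finite_subset[OF P(1)]) simp
  obtain h where h: "bij_betw h {..<?r} P" using ex_bij_betw_nat_finite[OF finP] P(2) by (auto simp: atLeast0LessThan)
  obtain V1 where V1: "open V1" "x \<in> V1" "\<forall>y\<in>V1. y \<in> V \<and> (\<forall>t\<in>P. \<forall>p\<in>JJ. hn y (b t p)) \<and> (\<forall>t\<in>P. \<forall>p\<in>P. b t p y = (if t = p then 1 else 0)) \<and>
      (\<forall>w. eqn (k0 - 1) y w \<longleftrightarrow> (\<forall>p\<in>JJ. w (fst p) (snd p) = (\<Sum>t\<in>P. w (fst t) (snd t) * b t p y)))"
    using ev unfolding eventually_nhds by blast
  have V1V: "V1 \<subseteq> V" using V1(3) by blast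
  define ew where "ew t y i j = b t (i, j) y" for t y i j
  define et where "et t y = jetw (k0 - 2) y (ew t y)" for t y
  have bt: "eqn (k0 - 1) y (ew t y)" if "y \<in> V1" "t \<in> P" for y t
  proof -
    have "ew t y (fst p) (snd p) = (\<Sum>t'\<in>P. ew t y (fst t') (snd t') * b t' p y)" for p
    proof -
      have "(\<Sum>t'\<in>P. ew t y (fst t') (snd t') * b t' p y) = (\<Sum>t'\<in>P. if t' = t then b t p y else 0)"
        using V1(3) that by (intro sum.cong refl) (auto simp: ew_def)
      thus ?thesis using that(2) finP by (simp add: ew_def)
    qed
    thus ?thesis using V1(3) that(1) by blast
  qed
  have sec: "bundle_section A W (k0 - 2) EE V1 (et t)" if t: "t \<in> P" for t
  proof (rule coords_section[OF V1(1) V1V, where w="ew t"])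
    show "duals 1 x" if "x \<in> V1" for x using duals1 V1V that by blast
    show "eqn (Suc (k0 - 2)) x (ew t x)" if "x \<in> V1" for x unfolding Suc_k0_minus_2 by (rule bt[OF that t])
    show "hn x (\<lambda>y. ew t y i j)" if "x \<in> V1" "i < d" "j \<in> {1..Suc (k0 - 2)}" for x i j
      using V1(3) that t Suc_k0_minus_2 unfolding ew_def by simp
  qed (simp add: et_def)
  have ind: "inj_on (\<lambda>t. et t y) P \<and> cfun.independent ((\<lambda>t. et t y) ` P)" if y: "y \<in> V1" for y
  proof (rule cfun_independent_image[OF finP])
    fix a assume a: "\<And>v. (\<Sum>t\<in>P. a t * et t y v) = 0"
    have "(\<Sum>t\<in>P. a t *\<^sub>F et t y) = 0" using a by (simp add: fun_eq_iff fscale_sum_apply)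
    hence z: "jetw (k0 - 2) y (\<lambda>i j. \<Sum>t\<in>P. a t * ew t y i j) = jetw (k0 - 2) y (\<lambda>i j. 0)"
      unfolding jetw_sum et_def by simp
    show "\<forall>t\<in>P. a t = 0"
    proof
      fix t assume t: "t \<in> P"
      obtain i j where ij: "t = (i, j)" "i < d" "j \<in> {1..k0 - 1}" using t P(1) by auto
      have "(\<Sum>t'\<in>P. a t' * ew t' y i j) = 0"
        using jetw_inj[OF _ z ij(2), of j] V1V y ij(3) Suc_k0_minus_2 by auto
      moreover have "(\<Sum>t'\<in>P. a t' * ew t' y i j) = (\<Sum>t'\<in>P. if t' = t then a t else 0)"
        using V1(3) y t ij(1) by (intro sum.cong refl) (auto simp: ew_def)
      ultimately show "a t = 0" using t finP by simp
    qed
  qed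
  have sp: "cfun.span ((\<lambda>t. et t y) ` P) = EE y" if y: "y \<in> V1" for y
  proof -
    have E: "EE y = {jetw (k0 - 2) y w | w. eqn (k0 - 1) y w}"
      using formal_relations_eq[of y "k0 - 2"] duals1 V1V y unfolding Suc_k0_minus_2 by blast
    show ?thesis
    proof (intro equalityI subsetI)
      fix z assume "z \<in> cfun.span ((\<lambda>t. et t y) ` P)"
      then obtain a where "z = (\<Sum>t\<in>P. a t *\<^sub>F et t y)" using cfun_span_image[OF finP] by blast
      hence "z = jetw (k0 - 2) y (\<lambda>i j. \<Sum>t\<in>P. a t * ew t y i j)" by (simp add: jetw_sum et_def)
      moreover have "eqn (k0 - 1) y (\<lambda>i j. \<Sum>t\<in>P. a t * ew t y i j)" by (intro eqn_sum bt y)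
      ultimately show "z \<in> EE y" unfolding E by blast
    next
      fix z assume "z \<in> EE y"
      then obtain w where w: "z = jetw (k0 - 2) y w" "eqn (k0 - 1) y w" unfolding E by blast
      have "jetw (k0 - 2) y w = jetw (k0 - 2) y (\<lambda>i j. \<Sum>t\<in>P. w (fst t) (snd t) * ew t y i j)"
      proof (rule jetw_cong)
        fix i j assume "i < d" "j \<in> {1..Suc (k0 - 2)}"
        hence "(i, j) \<in> JJ" using Suc_k0_minus_2 by simp
        moreover have "\<forall>p\<in>JJ. w (fst p) (snd p) = (\<Sum>t\<in>P. w (fst t) (snd t) * b t p y)" using V1(3) y w(2) by blast
        ultimately show "w i j = (\<Sum>t\<in>P. w (fst t) (snd t) * ew t y i j)" unfolding ew_def by fastforce
      qed
      also have "\<dots> = (\<Sum>t\<in>P. w (fst t) (snd t) *\<^sub>F et t y)" by (simp add: jetw_sum et_def)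
      also have "\<dots> \<in> cfun.span ((\<lambda>t. et t y) ` P)" by (rule cfun_sum_in_span)
      finally show "z \<in> cfun.span ((\<lambda>t. et t y) ` P)" using w(1) by simp
    qed
  qed
  have im: "(\<lambda>j. et (h j) y) ` {..<?r} = (\<lambda>t. et t y) ` P" for y
    using h by (auto simp: bij_betw_def image_iff)
  have "inj_on (\<lambda>j. et (h j) y) {..<?r}" if "y \<in> V1" for y
  proof -
    have "inj_on ((\<lambda>t. et t y) \<circ> h) {..<?r}" using ind[OF that] h by (intro comp_inj_on) (auto simp: bij_betw_def)
    thus ?thesis by (simp add: o_def)
  qed
  moreover have "bundle_section A W (k0 - 2) EE V1 (\<lambda>y. et (h j) y)" if "j < ?r" for j
    using sec[of "h j"] h that by (auto simp: bij_betw_def)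
  ultimately show ?thesis
    using V1(1,2) V1V ind sp by (intro exI[of _ V1] exI[of _ "\<lambda>j y. et (h j) y"]) (simp add: im)
qed

definition flat :: "'m \<Rightarrow> ('m \<Rightarrow> ('m, 'n) jet) \<Rightarrow> bool"
  where "flat x s \<longleftrightarrow> (\<forall>\<^sub>F y in nhds x. \<forall>v\<in>tangent_space A y. spencer A W (k0 - 2) y v s = 0)"

lemma flat_deriv:
  assumes "coords x s w" "flat x s" "i < d" "j \<in> {1..k0 - 1}"
  shows "\<forall>\<^sub>F y in nhds x. \<forall>v\<in>tangent_space A y. v (\<lambda>z. w z i j) = extend y (w y) i (Suc j) * v (f i)"
  using coords_ev[OF assms(1)] assms(2)[unfolded flat_def]
proof eventually_elim
  case (elim y)
  show ?case
  proof
    fix v assume v: "v \<in> tangent_space A y"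
    have "jetw (k0 - 2) y (conn y v w) = jetw (k0 - 2) y (\<lambda>i j. 0)" using spencer_eval[OF elim(1) v] elim(2) v by simp
    from jetw_inj[OF coordsD(1)[OF elim(1)] this assms(3), of j] assms(4) Suc_k0_minus_2
    show "v (\<lambda>z. w z i j) = extend y (w y) i (Suc j) * v (f i)" by (simp add: conn_def)
  qed
qed

text \<open>Stated for the extended coordinates, whose derivatives stay in the same family up to
  index \<open>k0\<close>; this is the chain that \<open>iter_deriv_chain\<close> consumes.\<close>

lemma flat_chart_deriv:
  assumes "coords x s w" "flat x s" "i < d" "j \<in> {1..k0 - 1}" "c \<in> A" "x \<in> fst c"
  shows "\<forall>\<^sub>F y in nhds x. chart_deriv c k (\<lambda>z. extend z (w z) i j) y = extend y (w y) i (Suc j) * chart_deriv c k (f i) y"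
proof -
  have "\<forall>\<^sub>F y in nhds x. extend y (w y) i j = w y i j"
    using coords_ev[OF assms(1)] by eventually_elim (rule extend_exists(1)[OF coordsD(1,3) assms(3,4)])
  from eventually_chart_deriv_cong[OF assms(5,6) this, of k] flat_deriv[OF assms(1-4)] coords_ev[OF assms(1)] eventually_fst[OF assms(5,6)]
  show ?thesis
  proof eventually_elim
    case (elim y)
    have "coord_vec A c k y (\<lambda>z. w z i j) = extend y (w y) i (Suc j) * coord_vec A c k y (f i)"
      using elim(2) coord_vec_tangent[OF assms(5) elim(4)] by blast
    thus ?case using elim(1) coordsD(4)[OF elim(3) assms(3,4)] f[OF assms(3) coordsD(1)[OF elim(3)]] by (simp add: coord_vec_apply)
  qed
qed

text \<open>The equations \<open>dw\<^sub>i\<^sub>j = w\<^sub>i\<^sub>,\<^sub>j\<^sub>+\<^sub>1 df\<^sub>i\<close> form a linear system in closed form, so all derivatives vanish at \<open>x\<close>.\<close>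

lemma flat_unique:
  assumes s: "coords x s w" "flat x s" and z: "s x = 0"
  shows "\<forall>\<^sub>F y in nhds x. s y = 0"
proof -
  note x = coordsD(1)[OF s(1)]
  note cx = c0 V_c0[OF x]
  let ?G = "\<lambda>i j y. extend y (w y) i j"
  obtain tt where t: "\<forall>p\<in>JJ. \<forall>i<d. hn x (tt p i)"
    "\<forall>\<^sub>F y in nhds x. \<forall>w. eqn k0 y w \<longleftrightarrow> eqn (k0 - 1) y w \<and> (\<forall>i<d. w i k0 = (\<Sum>p\<in>JJ. w (fst p) (snd p) * tt p i y))"
    using top_order[OF x] by (elim exE conjE) (rule that)
  have hG: "hn x (?G i j)" if "i < d" "j \<in> {1..k0}" for i j by (rule extend_hn[OF s(1) that])
  have tG: "\<forall>\<^sub>F y in nhds x. ?G i k0 y = (\<Sum>p\<in>JJ. ?G (fst p) (snd p) y * tt p i y)" if "i < d" for i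
    using t(2) coords_ev[OF s(1)]
  proof eventually_elim
    case (elim y)
    show ?case using elim(1)[rule_format, of "extend y (w y)"] extend_exists(2)[OF coordsD(1,3)[OF elim(2)]] that by blast
  qed
  have w0: "w x i j = 0" if "i < d" "j \<in> {1..k0 - 1}" for i j
  proof -
    have "jetw (k0 - 2) x (w x) = jetw (k0 - 2) x (\<lambda>i j. 0)" using z coordsD(2)[OF s(1)] by simp
    from jetw_inj[OF x this that(1), of j] that(2) Suc_k0_minus_2 show ?thesis by simp
  qed
  have van: "van c\<^sub>0 p (?G i j) x" if "i < d" "j \<in> {1..k0 - 1}" for p i j
    using that
  proof (induction p arbitrary: i j)
    case (Suc p)
    \<comment> \<open>The coordinate of index \<open>k0\<close> lies outside the induction
      hypothesis; \<open>tt\<close> expresses it through the lower ones and closes the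
      induction.\<close>
    have top_van: "van c\<^sub>0 p (?G i k0) x" if i: "i < d" for i
    proof (rule van_cong[OF cx])
      show "\<forall>\<^sub>F y in nhds x. (\<Sum>q\<in>JJ. ?G (fst q) (snd q) y * tt q i y) = ?G i k0 y" using tG[OF i] by eventually_elim simp
      show "van c\<^sub>0 p (\<lambda>y. \<Sum>q\<in>JJ. ?G (fst q) (snd q) y * tt q i y) x"
        using i t(1) by (intro van_sum van_mult hn_mult cx hG Suc.IH) auto
    qed
    have "van c\<^sub>0 p (?G i (Suc j)) x"
      by (cases "Suc j = k0") (use top_van[OF Suc.prems(1)] Suc.IH[OF Suc.prems(1), of "Suc j"] Suc.prems in auto)
    note vS = this
    have hS: "hn x (?G i (Suc j))" by (rule hG[OF Suc.prems(1)]) (use Suc.prems(2) in auto)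
    have "van c\<^sub>0 p (chart_deriv c\<^sub>0 k (?G i j)) x" for k
    proof (rule van_cong[OF cx])
      show "\<forall>\<^sub>F y in nhds x. ?G i (Suc j) y * chart_deriv c\<^sub>0 k (f i) y = chart_deriv c\<^sub>0 k (?G i j) y"
        using flat_chart_deriv[OF s Suc.prems cx, of k] by eventually_elim simp
      show "van c\<^sub>0 p (\<lambda>y. ?G i (Suc j) y * chart_deriv c\<^sub>0 k (f i) y) x"
        by (rule van_mult[OF cx hS hn_D[OF cx f[OF Suc.prems(1) x]] vS])
    qed
    moreover have "?G i j x = 0" using extend_exists(1)[OF x coordsD(3)[OF s(1)] Suc.prems] w0[OF Suc.prems] by simp
    ultimately show ?case by (simp add: van_Suc)
  qed simp
  have "\<forall>\<^sub>F y in nhds x. ?G i j y = 0" if "i < d" "j \<in> {1..k0 - 1}" for i j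
    by (rule van_infinite[OF cx hG van]) (use that in auto)
  hence "\<forall>\<^sub>F y in nhds x. \<forall>p\<in>JJ. ?G (fst p) (snd p) y = 0" by (intro eventually_ball_finite) auto
  with coords_ev[OF s(1)] show ?thesis
  proof eventually_elim
    case (elim y)
    have "w y i j = 0" if "i < d" "j \<in> {1..Suc (k0 - 2)}" for i j
      using elim(2)[rule_format, of "(i, j)"] extend_exists(1)[OF coordsD(1,3)[OF elim(1)], of i j] that Suc_k0_minus_2 by simp
    hence "jetw (k0 - 2) y (w y) = jetw (k0 - 2) y (\<lambda>i j. 0)" by (intro jetw_cong)
    thus ?case using coordsD(2)[OF elim(1)] by simp
  qed
qed

lemma abelian_coords:
  assumes "abelian_relation A W V' u" "x \<in> V'" "x \<in> V"
  shows "\<exists>w. coords x (\<lambda>y. jet_A A W (k0 - 2) y u) w" "flat x (\<lambda>y. jet_A A W (k0 - 2) y u)"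
proof -
  let ?s = "\<lambda>y. jet_A A W (k0 - 2) y u"
  have o: "open (V' \<inter> V)" using assms(1) V(1) by (auto simp: abelian_relation_def A_section_def)
  have ev: "\<forall>\<^sub>F y in nhds x. y \<in> V' \<inter> V" using assms(2,3) o by (intro eventually_nhds_in_open) auto
  have "\<exists>w. y \<in> V' \<inter> V \<longrightarrow> ?s y = jetw (k0 - 2) y w \<and> eqn (Suc (k0 - 2)) y w" for y
    using formal_to_w[of y u "k0 - 2"] abelian_sec[OF assms(1)] abelian_jet_D[OF assms(1)] by blast
  then obtain w where w: "\<And>y. y \<in> V' \<inter> V \<longrightarrow> ?s y = jetw (k0 - 2) y (w y) \<and> eqn (Suc (k0 - 2)) y (w y)" by metis
  have "hn y (\<lambda>z. w z i j)" if y: "y \<in> V' \<inter> V" and ij: "i < d" "j \<in> {1..k0 - 1}" for y i j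
  proof (rule jetw_coord_hn[where s="?s" and p="k0 - 2", OF _ ij(1)])
    show "y \<in> V" using y by simp
    show "\<forall>\<^sub>F z in nhds y. ?s z = jetw (k0 - 2) z (w z)"
      using eventually_nhds_in_open[OF o y] by eventually_elim (use w in blast)
    show "hn y (\<lambda>y. ?s y (c\<^sub>0, T i y, l, \<alpha>))" for l \<alpha>
    proof (cases "length \<alpha> \<le> k0 - 2")
      case True
      show ?thesis by (rule jet_A_hn(1)[OF abelian_sec[OF assms(1)] _ ij(1) c0 _ True]) (use y V_c0 in auto)
    next
      case False
      thus ?thesis using V_manifold y by (simp add: jet_A_def)
    qed
    show "j \<in> {1..Suc (k0 - 2)}" using ij Suc_k0_minus_2 by simp
  qed
  hence "coords x ?s w" unfolding coords_def using ev by (auto elim!: eventually_mono) (use w Suc_k0_minus_2 in auto)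
  thus "\<exists>w. coords x ?s w" by blast
  show "flat x ?s"
    unfolding flat_def using ev
  proof eventually_elim
    case (elim y)
    show ?case
    proof
      fix v assume "v \<in> tangent_space A y"
      thus "spencer A W (k0 - 2) y v ?s = 0"
        using elim by (intro spencer_jet abelian_sec[OF assms(1)] abelian_jet_D[OF assms(1)]) auto
    qed
  qed
qed

text \<open>The coefficients \<open>w i 1\<close> define the forms: the equations of order 1 make
  their sum vanish, and flatness makes the differential of \<open>w i 1\<close> proportional to
  \<open>df\<^sub>i\<close>, so each form is closed. The remaining flatness relations, fed into the
  chain rule, identify the jet with the given section.\<close>

lemma flat_abelian:
  assumes s: "coords x s w" "flat x s"
  shows "\<exists>V1 u. x \<in> V1 \<and> V1 \<subseteq> V \<and> abelian_relation A W V1 u \<and> (\<forall>y\<in>V1. jet_A A W (k0 - 2) y u = s y)"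
proof -
  have fl: "\<forall>\<^sub>F y in nhds x. flat y s" using s(2) unfolding flat_def eventually_eventually .
  obtain V1 where V1: "open V1" "x \<in> V1" "\<forall>y\<in>V1. coords y s w \<and> flat y s"
    using eventually_conj[OF coords_ev[OF s(1)] fl] unfolding eventually_nhds by blast
  have cy: "coords y s w" "flat y s" "y \<in> V" if "y \<in> V1" for y using V1(3) that coordsD(1) by auto
  \<comment> \<open>Extended coordinates are used throughout, because for k0 = 2 already the
    derivative of \<open>w i 1\<close> is a top entry of the extension.\<close>
  let ?G = "\<lambda>i j y. extend y (w y) i j"
  have hG: "hn y (?G i j)" if "y \<in> V1" "i < d" "j \<in> {1..k0}" for y i j by (rule extend_hn[OF cy(1)[OF that(1)] that(2,3)])
  define u where "u = mksec (\<lambda>i. ?G i 1)"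
  have k1: "1 \<in> {1..k0 - 1}" "1 \<in> {1..k0}" using k0 by auto
  have A: "A_section A W V1 u"
    unfolding u_def
  proof (rule mksec_section[OF V1(1)])
    show "V1 \<subseteq> V" using cy by auto
    show "hn y (?G i 1)" if "i < d" "y \<in> V1" for i y using hG[OF that(2,1) k1(2)] .
    show "(\<Sum>i<d. ?G i 1 y * chart_deriv c\<^sub>0 l (f i) y) = 0" if y: "y \<in> V1" for y l
    proof -
      have "(\<Sum>i<d. \<Sum>j=1..length [l]. faa c\<^sub>0 (f i) [l] j y * ?G i j y) = 0"
        by (rule extend_exists(2)[OF coordsD(1,3)[OF cy(1)[OF y]], unfolded eqn_def, rule_format]) (use k0 in auto)
      thus ?thesis by (simp add: mult.commute)
    qed
  qed
  have sec: "sec y u" if "y \<in> V1" for y using A that by (auto simp: sec_def)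
  have cfu: "\<forall>\<^sub>F z in nhds y. cf u i z = ?G i 1 z" if "y \<in> V1" "i < d" for y i
    using ev_V[OF cy(3)[OF that(1)]] by eventually_elim (simp add: u_def cf_mksec that(2))
  have "ext_deriv_coeff A c (along u F) k l y = 0"
    if V': "V' \<subseteq> V1" "web_branch A W V' F" and c: "c \<in> A" "y \<in> V' \<inter> fst c" for V' F c y k l
  proof -
    have y: "y \<in> V1" "y \<in> V" "y \<in> fst c" "y \<in> V'" using V' c cy by auto
    obtain i where i: "i < d" "\<forall>\<^sub>F z in nhds y. F z = T i z" using branch_cases[OF V'(2) y(4,2)] by blast
    have D: "chart_deriv c k (cf u i) y = ?G i 2 y * chart_deriv c k (f i) y" for k
    proof -
      have "chart_deriv c k (cf u i) y = chart_deriv c k (?G i 1) y" by (rule chart_deriv_cong[OF c(1) y(3) cfu[OF y(1) i(1)]])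
      also have "\<dots> = ?G i 2 y * chart_deriv c k (f i) y"
        using eventually_nhds_x_imp_x[OF flat_chart_deriv[OF cy(1,2)[OF y(1)] i(1) k1(1) c(1) y(3)]] by (simp add: numeral_2_eq_2)
      finally show ?thesis .
    qed
    show ?thesis
      using eventually_nhds_x_imp_x[OF ext_deriv_T[OF sec[OF y(1)] y(2) i(1) c(1) y(3) i(2), of k l]] by (simp add: D)
  qed
  hence ab: "abelian_relation A W V1 u" unfolding abelian_relation_def using A by blast
  have "jet_A A W (k0 - 2) y u = s y" if y: "y \<in> V1" for y
  proof -
    note yV = cy(3)[OF y] and ex = extend_exists[OF coordsD(1,3)[OF cy(1)[OF y]]]
    have "jet_A A W (k0 - 2) y u = jetw (k0 - 2) y (extend y (w y))"
    proof (rule jet_eqI[OF yV, of "k0 - 2"])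
      fix c i l and \<alpha> :: "'n list" assume i: "i < d" and c: "c \<in> A" "y \<in> fst c" and a: "length \<alpha> \<le> k0 - 2"
      have "jet_A A W (k0 - 2) y u (c, T i y, l, \<alpha>) = iter_deriv c \<alpha> (\<lambda>z. cf u i z * chart_deriv c l (f i) z) y"
        by (rule jet_A_T[OF sec[OF y] yV i c a])
      also have "\<dots> = iter_deriv c \<alpha> (\<lambda>z. ?G i 1 z * chart_deriv c l (f i) z) y"
        by (rule iter_deriv_cong[OF c]) (use cfu[OF y i] in eventually_elim, simp)
      also have "\<dots> = (\<Sum>j=1..Suc (length \<alpha>). faa c (f i) (\<alpha> @ [l]) j y * ?G i j y)"
        by (rule eventually_nhds_x_imp_x[OF iter_deriv_chain[OF c f[OF i yV], where N="k0 - 2" and G="?G i", OF _ _ a]])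
          (use Suc_k0_minus_2 in \<open>auto intro!: hG[OF y i] flat_chart_deriv[OF cy(1,2)[OF y] i _ c]\<close>)
      also have "\<dots> = jetw (k0 - 2) y (extend y (w y)) (c, T i y, l, \<alpha>)" unfolding jetw_T[OF yV i c a] ..
      finally show "jet_A A W (k0 - 2) y u (c, T i y, l, \<alpha>) = jetw (k0 - 2) y (extend y (w y)) (c, T i y, l, \<alpha>)" .
    qed (auto simp: jet_A_zero jetw_zero[OF yV])
    also have "\<dots> = jetw (k0 - 2) y (w y)" using Suc_k0_minus_2 by (intro jetw_cong ex(1)) auto
    finally show ?thesis using coordsD(2)[OF cy(1)[OF y]] by simp
  qed
  moreover have "V1 \<subseteq> V" using cy(3) by blast
  ultimately show ?thesis using V1(2) ab by blast
qed

end

section \<open>Globalization\<close>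

lemma germ_self: "s \<in> germ m s"
  by (simp add: germ_def)

lemma germ_eq_iff: "germ m s = germ m t \<longleftrightarrow> (\<forall>\<^sub>F x in nhds m. s x = t x)"
proof
  assume "germ m s = germ m t"
  hence "s \<in> germ m t" using germ_self by blast
  thus "\<forall>\<^sub>F x in nhds m. s x = t x" by (simp add: germ_def)
next
  assume e: "\<forall>\<^sub>F x in nhds m. s x = t x"
  have "(\<forall>\<^sub>F x in nhds m. u x = s x) \<longleftrightarrow> (\<forall>\<^sub>F x in nhds m. u x = t x)" for u
    by (rule eventually_subst) (use e in \<open>eventually_elim, simp\<close>)
  thus "germ m s = germ m t" by (auto simp: germ_def)
qed

lemma germ_add_germ: "germ_add m (germ m s) (germ m t) = germ m (\<lambda>x. s x + t x)"
proof (intro equalityI subsetI)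
  fix u assume "u \<in> germ_add m (germ m s) (germ m t)"
  then obtain g h where "\<forall>\<^sub>F x in nhds m. g x = s x" "\<forall>\<^sub>F x in nhds m. h x = t x" "\<forall>\<^sub>F x in nhds m. u x = g x + h x"
    by (auto simp: germ_add_def germ_def)
  hence "\<forall>\<^sub>F x in nhds m. u x = s x + t x" by eventually_elim simp
  thus "u \<in> germ m (\<lambda>x. s x + t x)" by (simp add: germ_def)
next
  fix u assume "u \<in> germ m (\<lambda>x. s x + t x)"
  hence "\<forall>\<^sub>F x in nhds m. u x = s x + t x" by (simp add: germ_def)
  thus "u \<in> germ_add m (germ m s) (germ m t)" using germ_self by (auto simp: germ_add_def)
qed

lemma germ_scale_germ: "germ_scale m a (germ m s) = germ m (\<lambda>x. a *\<^sub>F s x)"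
proof (intro equalityI subsetI)
  fix u assume "u \<in> germ_scale m a (germ m s)"
  then obtain g where "\<forall>\<^sub>F x in nhds m. g x = s x" "\<forall>\<^sub>F x in nhds m. u x = a *\<^sub>F g x"
    by (auto simp: germ_scale_def germ_def)
  hence "\<forall>\<^sub>F x in nhds m. u x = a *\<^sub>F s x" by eventually_elim simp
  thus "u \<in> germ m (\<lambda>x. a *\<^sub>F s x)" by (simp add: germ_def)
next
  fix u assume "u \<in> germ m (\<lambda>x. a *\<^sub>F s x)"
  hence "\<forall>\<^sub>F x in nhds m. u x = a *\<^sub>F s x" by (simp add: germ_def)
  thus "u \<in> germ_scale m a (germ m s)" using germ_self by (auto simp: germ_scale_def)
qed

context atlas begin

lemma jet_A_germ:
  assumes "\<forall>\<^sub>F y in nhds x. u y = u' y"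
  shows "jet_A A W q x u = jet_A A W q x u'"
proof
  fix z :: "('m, 'n) chart \<times> 'm hyp \<times> 'n \<times> 'n list"
  obtain c S l \<alpha> where z: "z = (c, S, l, \<alpha>)" by (cases z) auto
  show "jet_A A W q x u z = jet_A A W q x u' z"
  proof (cases "c \<in> A \<and> x \<in> fst c")
    case True
    let ?F = "branch_at A W x S"
    have "\<forall>\<^sub>F y in nhds x. u y (?F y, coord_vec A c l y) = u' y (?F y, coord_vec A c l y)"
      using assms by eventually_elim simp
    from iter_deriv_cong[OF _ _ this, of c \<alpha>] True show ?thesis by (simp add: z jet_A_def iter_deriv_iter_pderiv)
  qed (auto simp: z jet_A_def)
qed

text \<open>In coordinates X(Yg) has a first-order part and a second-order part; by symmetry of
  second derivatives the latter is unchanged when X and Y are exchanged, so it cancels.\<close>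

lemma lie_bracket_tangent:
  assumes "hol_vector_field A V' X" "hol_vector_field A V' Y" "x \<in> V'"
  shows "lie_bracket A X Y x \<in> tangent_space A x"
proof -
  have X: "open V'" "\<And>y. y \<in> V' \<Longrightarrow> X y \<in> tangent_space A y" "\<And>y. y \<in> V' \<Longrightarrow> Y y \<in> tangent_space A y"
    using assms by (auto simp: hol_vector_field_def)
  obtain c where c: "c \<in> A" "x \<in> fst c" using tangent_chart[OF X(2)[OF assms(3)]] by blast
  have XY: "X' x (\<lambda>y. Y' y g) = (\<Sum>l\<in>UNIV. X' x (\<lambda>y. Y' y (\<lambda>y. snd c y $ l)) * chart_deriv c l g x) +
      (\<Sum>l\<in>UNIV. \<Sum>k\<in>UNIV. Y' x (\<lambda>y. snd c y $ l) * X' x (\<lambda>y. snd c y $ k) * chart_deriv c k (chart_deriv c l g) x)"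
    if V: "hol_vector_field A V' X'" "hol_vector_field A V' Y'" and g: "hn x g" for X' Y' g
  proof -
    have t: "\<And>y. y \<in> V' \<Longrightarrow> X' y \<in> tangent_space A y" "\<And>y. y \<in> V' \<Longrightarrow> Y' y \<in> tangent_space A y"
      using V by (auto simp: hol_vector_field_def)
    note tx = t(1)[OF assms(3)]
    have hY: "hn x (\<lambda>y. Y' y (\<lambda>y. snd c y $ l))" for l by (rule vector_field_hn[OF V(2) assms(3) hn_coord[OF c]])
    have hD: "hn x (chart_deriv c l g)" for l by (rule hn_D[OF c g])
    have "\<forall>\<^sub>F y in nhds x. Y' y g = (\<Sum>l\<in>UNIV. Y' y (\<lambda>y. snd c y $ l) * chart_deriv c l g y)"
      using eventually_fst[OF c] hn_eventually[OF g] eventually_nhds_in_open[OF X(1) assms(3)]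
      by eventually_elim (rule tangent_apply[OF t(2) c(1)])
    from tangent_cong[OF tx this] have "X' x (\<lambda>y. Y' y g) = X' x (\<lambda>y. \<Sum>l\<in>UNIV. Y' y (\<lambda>y. snd c y $ l) * chart_deriv c l g y)" .
    also have "\<dots> = (\<Sum>l\<in>UNIV. X' x (\<lambda>y. Y' y (\<lambda>y. snd c y $ l) * chart_deriv c l g y))"
      by (rule tangent_sum[OF tx]) (intro hn_mult hY hD)
    also have "\<dots> = (\<Sum>l\<in>UNIV. X' x (\<lambda>y. Y' y (\<lambda>y. snd c y $ l)) * chart_deriv c l g x +
       Y' x (\<lambda>y. snd c y $ l) * (\<Sum>k\<in>UNIV. X' x (\<lambda>y. snd c y $ k) * chart_deriv c k (chart_deriv c l g) x))"
      by (intro sum.cong refl) (simp only: tangent_mult[OF tx hY hD] tangent_apply[OF tx c hD])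
    finally show ?thesis by (simp add: sum.distrib sum_distrib_left mult.assoc)
  qed
  have "lie_bracket A X Y x = tangent_of A c x (\<chi> l. X x (\<lambda>y. Y y (\<lambda>y. snd c y $ l)) - Y x (\<lambda>y. X y (\<lambda>y. snd c y $ l)))"
  proof
    fix g
    show "lie_bracket A X Y x g = tangent_of A c x (\<chi> l. X x (\<lambda>y. Y y (\<lambda>y. snd c y $ l)) - Y x (\<lambda>y. X y (\<lambda>y. snd c y $ l))) g"
    proof (cases "hn x g")
      case True
      have "(\<Sum>l\<in>UNIV. \<Sum>k\<in>UNIV. X x (\<lambda>y. snd c y $ l) * Y x (\<lambda>y. snd c y $ k) * chart_deriv c k (chart_deriv c l g) x) =
        (\<Sum>l\<in>UNIV. \<Sum>k\<in>UNIV. Y x (\<lambda>y. snd c y $ l) * X x (\<lambda>y. snd c y $ k) * chart_deriv c k (chart_deriv c l g) x)"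
        by (subst sum.swap) (simp add: chart_deriv_hol(2)[OF c(1) True c(2)] mult.commute)
      thus ?thesis using True XY[OF assms(1,2) True] XY[OF assms(2,1) True]
        by (simp add: lie_bracket_def tangent_of_apply left_diff_distrib sum_subtractf)
    qed (simp add: lie_bracket_def tangent_of_apply)
  qed
  thus ?thesis using tangent_of_tangent[OF c] by simp
qed

lemma A_section_lin:
  assumes "A_section A W V u" "A_section A W V' u'"
  shows "A_section A W (V \<inter> V') (\<lambda>y. u y + a *\<^sub>F u' y)"
proof -
  have cot: "(\<lambda>v. \<eta> v + a * \<eta>' v) \<in> cotangent_space A x" if "\<eta> \<in> cotangent_space A x" "\<eta>' \<in> cotangent_space A x" for x \<eta> \<eta>'
    using that by (auto simp: cotangent_space_def algebra_simps)
  have "u x + a *\<^sub>F u' x \<in> A_fibre A W x" if x: "x \<in> V \<inter> V'" for x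
  proof -
    have h: "u x \<in> A_fibre A W x" "u' x \<in> A_fibre A W x" using assms x by (auto simp: A_section_def)
    have "(\<lambda>v. (u x + a *\<^sub>F u' x) (S, v)) \<in> cotangent_space A x" if "S \<in> W x" for S
      using cot[of "\<lambda>v. u x (S, v)" x "\<lambda>v. u' x (S, v)"] h that by (simp add: A_fibre_def fscale_def)
    thus ?thesis using h by (auto simp: A_fibre_def fscale_def sum.distrib sum_distrib_left[symmetric])
  qed
  moreover have "hol_one_form A V1 (along (\<lambda>y. u y + a *\<^sub>F u' y) F)" if V1: "V1 \<subseteq> V \<inter> V'" "web_branch A W V1 F" for V1 F
  proof -
    have h: "hol_one_form A V1 (along u F)" "hol_one_form A V1 (along u' F)" using assms V1 by (auto simp: A_section_def)
    have "hol_on A (\<lambda>x. u x (F x, coord_vec A c k x) + a * u' x (F x, coord_vec A c k x)) (V1 \<inter> fst c)" if "c \<in> A" for c k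
      using h that unfolding hol_one_form_def hol_on_hn by (auto intro!: hn_add hn_mult simp: hn_manifold fst_manifold)
    thus ?thesis using h cot by (auto simp: hol_one_form_def fscale_def)
  qed
  ultimately show ?thesis using assms by (auto simp: A_section_def)
qed

end

context local_web begin

lemma sec_lin: "sec x u \<Longrightarrow> sec x u' \<Longrightarrow> sec x (\<lambda>y. u y + a *\<^sub>F u' y)"
  unfolding sec_def using A_section_lin by blast

lemma cf_lin: "cf (\<lambda>y. u y + a *\<^sub>F u' y) i y = cf u i y + a * cf u' i y"
  by (simp add: cf_def Let_def fscale_def add_divide_distrib)

lemma jet_A_lin:
  assumes "sec x u" "sec x u'" "x \<in> V"
  shows "jet_A A W q x (\<lambda>y. u y + a *\<^sub>F u' y) = jet_A A W q x u + a *\<^sub>F jet_A A W q x u'"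
proof (rule jet_eqI[OF assms(3), of q])
  fix c i l and \<alpha> :: "'n list" assume h: "i < d" "c \<in> A" "x \<in> fst c" "length \<alpha> \<le> q"
  let ?g = "\<lambda>u y. cf u i y * chart_deriv c l (f i) y"
  have hg: "hn x (?g u)" "hn x (?g u')" by (intro hn_mult sec_cf_hn assms h hn_D f)+
  have hg2: "hn x (\<lambda>y. a * ?g u' y)" by (intro hn_mult hn_const V_manifold assms sec_cf_hn h hn_D f)
  have "iter_deriv c \<alpha> (\<lambda>y. ?g u y + a * ?g u' y) x = iter_deriv c \<alpha> (?g u) x + a * iter_deriv c \<alpha> (?g u') x"
    using eventually_nhds_x_imp_x[OF iter_deriv_add[OF h(2,3) hg(1) hg2, of \<alpha>]]
      eventually_nhds_x_imp_x[OF iter_deriv_cmult[OF h(2,3) hg(2), of \<alpha> a]] by simp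
  moreover have "jet_A A W q x (\<lambda>y. u y + a *\<^sub>F u' y) (c, T i x, l, \<alpha>) = iter_deriv c \<alpha> (\<lambda>y. ?g u y + a * ?g u' y) x"
    unfolding jet_A_T[OF sec_lin[OF assms(1,2)] assms(3) h] cf_lin by (simp add: algebra_simps)
  ultimately show "jet_A A W q x (\<lambda>y. u y + a *\<^sub>F u' y) (c, T i x, l, \<alpha>) = (jet_A A W q x u + a *\<^sub>F jet_A A W q x u') (c, T i x, l, \<alpha>)"
    unfolding plus_fun_apply fscale_def jet_A_T[OF assms(1,3) h] jet_A_T[OF assms(2,3) h] by simp
qed (auto simp: jet_A_zero fscale_def)

text \<open>A basis taken among the powers has at least c(n, s) elements by hypothesis, and at most
  that many because it lies in the span of the monomials.\<close>

lemma duals_of_web_r: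
  assumes "x \<in> V" "s \<ge> 1" "web_r A W s x \<ge> web_c CARD('n) s"
  shows "duals s x" "indep_mono s"
proof -
  let ?X = "(\<lambda>\<eta>. \<lambda>v. \<eta> v ^ s) ` conormals A W x"
  obtain B where B: "B \<subseteq> ?X" "cfun.independent B" "card B = cfun.dim ?X" using cfun.basis_exists by metis
  have c: "card B \<ge> web_c CARD('n) s" using B(3) assms(3) by (simp add: web_r_def)
  hence fB: "finite B" using web_c_pos[of "CARD('n)" s] by (intro card_ge_0_finite) linarith
  have sub: "cfun.span ((\<lambda>i. conormal_power s i x) ` {..<d}) \<subseteq> cfun.span (coord_monomial x ` multi_indices s)"
    by (rule cfun.span_minimal[OF conormal_span(2)[OF assms(1,2)] cfun.subspace_span])
  have "B \<subseteq> cfun.span (coord_monomial x ` multi_indices s)" using B(1) conormal_span(1)[OF assms(1,2)] sub by (meson order_trans)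
  hence "card B \<le> card (coord_monomial x ` multi_indices s)" using cfun.independent_span_bound[OF _ B(2)] by simp
  also have "\<dots> \<le> web_c CARD('n) s" using card_image_le[OF finite_multi_indices, of "coord_monomial x" s] by (simp add: card_multi_indices)
  finally have "card B = web_c CARD('n) s" using c by simp
  from duals_of_independent[OF assms(1,2) B(1) fB this B(2)] show "duals s x" "indep_mono s" by blast+
qed

lemma local_web_subset:
  assumes "open V'" "V' \<subseteq> V"
  shows "local_web A W d c\<^sub>0 V' f"
  by unfold_locales (use assms V c0 f df inj W in \<open>auto simp: subset_iff\<close>)

end

section \<open>The bundle, the connection and its flat sections off S\<close>

locale web_setup = atlas A for A :: "('m::t2_space, 'n::finite) chart set" +
  fixes W :: "'m \<Rightarrow> 'm hyp set" and d k0 :: nat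
  assumes n2: "CARD('n) \<ge> 2" and k02: "k0 \<ge> 2" and d_eq: "d = web_c CARD('n) k0"
    and web: "hol_web A d W" and wgp: "weak_general_position A W"
begin

abbreviation UU :: "'m set"
  where "UU \<equiv> manifold A - web_S A W k0 d"

abbreviation EU :: "'m \<Rightarrow> ('m, 'n) jet set"
  where "EU \<equiv> formal_relations A W (k0 - 2)"

text \<open>Order 1 is not governed by S and comes from weak general position. For orders 2 to k0
  the spans are full at m, so the symbols are onto there and at nearby points; the latter also shows
  that a neighbourhood of m avoids S.\<close>

lemma good_web_exists:
  assumes m: "m \<in> UU"
  shows "\<exists>c V f. good_web A W d c V f k0 \<and> m \<in> V \<and> V \<subseteq> UU"
proof -
  obtain c V f where lw: "local_web A W d c V f" "m \<in> V" using local_web_exists[OF web] m by blast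
  interpret L: local_web A W d c V f by (rule lw(1))
  have "L.duals s m \<and> (s \<ge> 2 \<longrightarrow> L.indep_mono s)" if s: "s \<in> {1..k0}" for s
  proof (cases "s = 1")
    case True
    obtain B where B: "B \<subseteq> conormals A W m" "finite B" "card B = CARD('n)" "cfun.independent B"
      using wgp m unfolding weak_general_position_def by blast
    have "L.duals 1 m"
      by (rule L.duals_of_independent(1)[OF lw(2) _ _ B(2) _ B(4)]) (use B n2 web_c_1[of "CARD('n)"] in auto)
    thus ?thesis using True by simp
  next
    case False
    hence s2: "s \<in> {2..k0}" using s by auto
    have "\<not> web_r A W s m < min d (web_c CARD('n) s)" using m s2 by (auto simp: web_S_def)
    hence "web_r A W s m \<ge> web_c CARD('n) s" using web_c_mono[of s k0 "CARD('n)"] s d_eq by auto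
    from L.duals_of_web_r[OF lw(2) _ this] s show ?thesis by auto
  qed
  note dm = this
  have "\<forall>\<^sub>F z in nhds m. \<forall>s\<in>{1..k0}. L.duals s z"
    by (intro eventually_ball_finite ballI L.duals_open lw(2)) (use dm in auto)
  then obtain V1 where V1: "open V1" "m \<in> V1" "\<forall>z\<in>V1. \<forall>s\<in>{1..k0}. L.duals s z" unfolding eventually_nhds by blast
  define V' where "V' = V1 \<inter> V"
  have V': "open V'" "V' \<subseteq> V" "m \<in> V'" using V1 L.V(1) lw(2) by (auto simp: V'_def)
  interpret L': local_web A W d c V' f by (rule L.local_web_subset[OF V'(1,2)])
  have "good_web A W d c V' f k0"
    by unfold_locales (use k02 d_eq V1(3) in \<open>auto simp: V'_def\<close>)
  moreover have "V' \<subseteq> UU"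
  proof
    fix z assume z: "z \<in> V'"
    have "web_r A W s z = web_c CARD('n) s" if "s \<in> {2..k0}" for s
      by (rule L.web_r_duals) (use z V'(2) that V1(3) dm in \<open>auto simp: V'_def\<close>)
    thus "z \<in> UU" using L'.V_manifold[OF z] by (auto simp: web_S_def)
  qed
  ultimately show ?thesis using V'(3) by blast
qed

lemma relations_bundle: "hol_bundle A W (k0 - 2) EU UU (web_pi' CARD('n) k0 d)"
  unfolding hol_bundle_def
proof
  fix m assume "m \<in> UU"
  then obtain c V f where g: "good_web A W d c V f k0" "m \<in> V" "V \<subseteq> UU" using good_web_exists by blast
  interpret good_web A W d c V f k0 by (rule g(1))
  obtain V1 e where V1: "m \<in> V1" "V1 \<subseteq> V" "open V1" "\<forall>j<web_pi' CARD('n) k0 d. bundle_section A W (k0 - 2) EU V1 (e j)"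
    "\<forall>y\<in>V1. inj_on (\<lambda>j. e j y) {..<web_pi' CARD('n) k0 d} \<and> cfun.independent ((\<lambda>j. e j y) ` {..<web_pi' CARD('n) k0 d}) \<and>
       cfun.span ((\<lambda>j. e j y) ` {..<web_pi' CARD('n) k0 d}) = EU y"
    using local_bundle[OF g(2)] by (elim exE conjE) (rule that)
  moreover have "V1 \<subseteq> UU" using V1(2) g(3) by (rule order_trans)
  ultimately show "\<exists>V e. m \<in> V \<and> V \<subseteq> UU \<and> (\<forall>j<web_pi' CARD('n) k0 d. bundle_section A W (k0 - 2) EU V (e j)) \<and> open V \<and>
    (\<forall>x\<in>V. inj_on (\<lambda>j. e j x) {..<web_pi' CARD('n) k0 d} \<and> cfun.independent ((\<lambda>j. e j x) ` {..<web_pi' CARD('n) k0 d}) \<and>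
       cfun.span ((\<lambda>j. e j x) ` {..<web_pi' CARD('n) k0 d}) = EU x)"
    by (intro exI[of _ V1] exI[of _ e] conjI)
qed

text \<open>All requirements are local, and \<open>spencer\<close> refers to no preferred chart or
  numbering, so each can be checked in local coordinates around the point.\<close>

lemma spencer_connection: "hol_connection A W (k0 - 2) EU UU (spencer A W (k0 - 2))"
  unfolding hol_connection_def
proof (intro allI impI conjI ballI)
  fix V' s assume V': "V' \<subseteq> UU" and s: "bundle_section A W (k0 - 2) EU V' s"
  have o: "open V'" using s by (simp add: bundle_section_def JA_section_def)
  fix m v assume m: "m \<in> V'" and v: "v \<in> tangent_space A m"
  obtain c V f where g: "good_web A W d c V f k0" "m \<in> V" using good_web_exists V' m by blast
  interpret good_web A W d c V f k0 by (rule g(1))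
  obtain w where w: "coords m s w" using coords_of_section[OF s m g(2)] by blast
  show "spencer A W (k0 - 2) m v s \<in> EU m" by (rule spencer_EE[OF w v])
  show "spencer A W (k0 - 2) m (v + a *\<^sub>F v') s = spencer A W (k0 - 2) m v s + a *\<^sub>F spencer A W (k0 - 2) m v' s"
    if "v' \<in> tangent_space A m" for v' a
    by (rule spencer_lin[OF w v that])
  show "spencer A W (k0 - 2) m v t = spencer A W (k0 - 2) m v s" if "t \<in> germ m s" for t
  proof -
    have "coords m t w" using that by (intro coords_cong[OF w]) (simp add: germ_def)
    thus ?thesis using spencer_eval[OF _ v] w by simp
  qed
  show "spencer A W (k0 - 2) m v (\<lambda>x. s x + t x) = spencer A W (k0 - 2) m v s + spencer A W (k0 - 2) m v t"
    if "bundle_section A W (k0 - 2) EU V' t" for t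
    using spencer_add[OF w _ v] coords_of_section[OF that m g(2)] by blast
  show "spencer A W (k0 - 2) m v (\<lambda>x. h x *\<^sub>F s x) = v h *\<^sub>F s m + h m *\<^sub>F spencer A W (k0 - 2) m v s"
    if "hol_on A h V'" for h
    by (rule spencer_scale[OF w _ v]) (use that m in \<open>simp add: hol_on_hn\<close>)
next
  fix V' s X assume V': "V' \<subseteq> UU" and s: "bundle_section A W (k0 - 2) EU V' s" and X: "hol_vector_field A V' X"
  show "bundle_section A W (k0 - 2) EU V' (\<lambda>x. spencer A W (k0 - 2) x (X x) s)"
  proof (rule bundle_section_local)
    show "open V'" using X by (simp add: hol_vector_field_def)
    fix x assume x: "x \<in> V'"
    obtain c V f where g: "good_web A W d c V f k0" "x \<in> V" using good_web_exists V' x by blast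
    interpret good_web A W d c V f k0 by (rule g(1))
    obtain w where "coords x s w" using coords_of_section[OF s x g(2)] by blast
    from section_of_coords[OF spencer_coords[OF this X x]]
    show "\<exists>V1. x \<in> V1 \<and> bundle_section A W (k0 - 2) EU V1 (\<lambda>x. spencer A W (k0 - 2) x (X x) s)" by blast
  qed
qed

text \<open>Defined through an arbitrary representative; \<open>jetmap_germ\<close> removes the
  choice, since jets depend only on germs.\<close>

definition jetmap :: "'m \<Rightarrow> ('m \<Rightarrow> 'm hyp \<times> 'm tvec \<Rightarrow> complex) set \<Rightarrow> ('m \<Rightarrow> ('m, 'n) jet) set"
  where "jetmap m G = germ m (\<lambda>x. jet_A A W (k0 - 2) x (SOME u. u \<in> G))"

lemma jetmap_germ: "jetmap m (germ m u) = germ m (\<lambda>x. jet_A A W (k0 - 2) x u)"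
proof -
  have "(SOME u'. u' \<in> germ m u) \<in> germ m u" by (rule someI[of _ u]) (rule germ_self)
  hence "\<forall>\<^sub>F x in nhds m. (SOME u'. u' \<in> germ m u) x = u x" by (simp add: germ_def)
  hence "\<forall>\<^sub>F x in nhds m. \<forall>\<^sub>F y in nhds x. (SOME u'. u' \<in> germ m u) y = u y" unfolding eventually_eventually .
  hence "\<forall>\<^sub>F x in nhds m. jet_A A W (k0 - 2) x (SOME u'. u' \<in> germ m u) = jet_A A W (k0 - 2) x u"
    by eventually_elim (rule jet_A_germ)
  thus ?thesis unfolding jetmap_def germ_eq_iff .
qed

text \<open>Injectivity holds because a jet contains the value of its section, surjectivity because
  flat sections come from abelian relations.\<close>

lemma jetmap_iso:
  assumes m: "m \<in> UU"
  shows "germ_iso m (jetmap m) (abelian_germs A W m) (flat_germs A W (k0 - 2) EU UU (spencer A W (k0 - 2)) m)"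
proof -
  obtain c V f where g: "good_web A W d c V f k0" "m \<in> V" "V \<subseteq> UU" using good_web_exists m by blast
  interpret good_web A W d c V f k0 by (rule g(1))
  have sec_near: "\<forall>\<^sub>F x in nhds m. sec x u" if "abelian_relation A W V' u" "m \<in> V'" for u V'
    using sec_ev[OF abelian_sec[OF that]] by (rule eventually_mono) simp
  have inj: "inj_on (jetmap m) (abelian_germs A W m)"
  proof (rule inj_onI)
    fix G H assume "G \<in> abelian_germs A W m" "H \<in> abelian_germs A W m" and eq: "jetmap m G = jetmap m H"
    then obtain u u' V1 V2 where u: "G = germ m u" "m \<in> V1" "abelian_relation A W V1 u" "H = germ m u'" "m \<in> V2" "abelian_relation A W V2 u'"
      unfolding abelian_germs_def by blast
    have "\<forall>\<^sub>F x in nhds m. jet_A A W (k0 - 2) x u = jet_A A W (k0 - 2) x u'" using eq unfolding u(1,4) jetmap_germ germ_eq_iff .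
    with sec_near[OF u(3,2)] sec_near[OF u(6,5)] ev_V[OF g(2)]
    have "\<forall>\<^sub>F x in nhds m. u x = u' x" by eventually_elim (rule jet_A_inj)
    thus "G = H" unfolding u(1,4) germ_eq_iff .
  qed
  have into: "jetmap m G \<in> flat_germs A W (k0 - 2) EU UU (spencer A W (k0 - 2)) m" if G: "G \<in> abelian_germs A W m" for G
  proof -
    obtain u V1 where u: "G = germ m u" "m \<in> V1" "abelian_relation A W V1 u" using G unfolding abelian_germs_def by blast
    let ?s = "\<lambda>y. jet_A A W (k0 - 2) y u"
    obtain w where w: "coords m ?s w" using abelian_coords(1)[OF u(3,2) g(2)] by blast
    obtain V2 where V2: "m \<in> V2" "V2 \<subseteq> V" "bundle_section A W (k0 - 2) EU V2 ?s" using section_of_coords[OF w] by blast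
    have o2: "open V2" using V2(3) by (simp add: bundle_section_def JA_section_def)
    obtain V3 where V3: "open V3" "m \<in> V3" "\<forall>y\<in>V3. \<forall>v\<in>tangent_space A y. spencer A W (k0 - 2) y v ?s = 0"
      using abelian_coords(2)[OF u(3,2) g(2)] unfolding flat_def eventually_nhds by blast
    have "bundle_section A W (k0 - 2) EU (V2 \<inter> V3) ?s" by (rule bundle_section_subset[OF V2(3)]) (use o2 V3(1) in auto)
    moreover have "m \<in> V2 \<inter> V3" "V2 \<inter> V3 \<subseteq> UU" "\<forall>x\<in>V2 \<inter> V3. \<forall>v\<in>tangent_space A x. spencer A W (k0 - 2) x v ?s = 0"
      using V2 V3 g(3) by auto
    ultimately show ?thesis unfolding u(1) jetmap_germ flat_germs_def by blast
  qed
  have onto: "G \<in> jetmap m ` abelian_germs A W m" if "G \<in> flat_germs A W (k0 - 2) EU UU (spencer A W (k0 - 2)) m" for G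
  proof -
    obtain s V1 where s: "G = germ m s" "m \<in> V1" "bundle_section A W (k0 - 2) EU V1 s"
        "\<forall>x\<in>V1. \<forall>v\<in>tangent_space A x. spencer A W (k0 - 2) x v s = 0" using \<open>G \<in> _\<close> unfolding flat_germs_def by blast
    obtain w where w: "coords m s w" using coords_of_section[OF s(3,2) g(2)] by blast
    have "open V1" using s(3) by (simp add: bundle_section_def JA_section_def)
    from eventually_nhds_in_open[OF this s(2)] have "flat m s"
      unfolding flat_def by (rule eventually_mono) (use s(4) in blast)
    then obtain V2 u where u: "m \<in> V2" "abelian_relation A W V2 u" "\<forall>y\<in>V2. jet_A A W (k0 - 2) y u = s y"
      using flat_abelian[OF w] by blast
    have "open V2" using u(2) by (auto simp: abelian_relation_def A_section_def)
    from eventually_nhds_in_open[OF this u(1)] have "\<forall>\<^sub>F y in nhds m. jet_A A W (k0 - 2) y u = s y"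
      by (rule eventually_mono) (use u(3) in blast)
    hence "jetmap m (germ m u) = G" unfolding s(1) jetmap_germ germ_eq_iff .
    thus ?thesis using u(1,2) unfolding abelian_germs_def by blast
  qed
  have lin: "\<forall>\<^sub>F x in nhds m. jet_A A W (k0 - 2) x (\<lambda>y. u y + a *\<^sub>F u' y) = jet_A A W (k0 - 2) x u + a *\<^sub>F jet_A A W (k0 - 2) x u'"
    if "abelian_relation A W V1 u" "m \<in> V1" "abelian_relation A W V2 u'" "m \<in> V2" for u u' V1 V2 a
    using sec_near[OF that(1,2)] sec_near[OF that(3,4)] ev_V[OF g(2)] by eventually_elim (rule jet_A_lin)
  have add: "jetmap m (germ_add m G H) = germ_add m (jetmap m G) (jetmap m H)"
    if GH: "G \<in> abelian_germs A W m" "H \<in> abelian_germs A W m" for G H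
  proof -
    obtain u u' V1 V2 where u: "G = germ m u" "m \<in> V1" "abelian_relation A W V1 u" "H = germ m u'" "m \<in> V2" "abelian_relation A W V2 u'"
      using GH unfolding abelian_germs_def by blast
    show ?thesis unfolding u(1,4) germ_add_germ jetmap_germ germ_eq_iff
      using lin[OF u(3,2) u(6,5), of 1] by (simp add: fscale_def)
  qed
  have scale: "jetmap m (germ_scale m a G) = germ_scale m a (jetmap m G)" if G: "G \<in> abelian_germs A W m" for G a
  proof -
    obtain u V1 where u: "G = germ m u" "m \<in> V1" "abelian_relation A W V1 u" using G unfolding abelian_germs_def by blast
    \<comment> \<open>Linearity is available for sums u + a u' only, so a multiple a u is written as
      u + (a - 1) u.\<close>
    have e: "g + (a - 1) *\<^sub>F g = a *\<^sub>F g" for g :: "'z \<Rightarrow> complex" by (simp add: fun_eq_iff fscale_def algebra_simps)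
    show ?thesis unfolding u(1) germ_scale_germ jetmap_germ germ_eq_iff
      using lin[OF u(3,2) u(3,2), of "a - 1"] unfolding e .
  qed
  have "bij_betw (jetmap m) (abelian_germs A W m) (flat_germs A W (k0 - 2) EU UU (spencer A W (k0 - 2)) m)"
    unfolding bij_betw_def using inj into onto by blast
  thus ?thesis unfolding germ_iso_def using add scale by blast
qed

end

section \<open>Curvature\<close>

context local_web begin

lemma jet_A_zero_imp:
  assumes "y \<in> V" "sec y u" "jet_A A W q y u = 0"
  shows "u y = 0"
proof -
  have "cf u i y = 0" if i: "i < d" for i
  proof -
    obtain l where l: "chart_deriv c\<^sub>0 l (f i) y \<noteq> 0" using df[OF i assms(1)] by blast
    thus ?thesis using jet_A_T[OF assms(2,1) i c0 V_c0[OF assms(1)], of "[]" q l] assms(3) by simp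
  qed
  hence "mksec (cf u) y = 0" by (auto simp: mksec_def fun_eq_iff intro!: sum.neutral)
  thus ?thesis using mksec_cf[of u y, OF sec_fibre[OF assms(2)] assms(1)] by simp
qed

lemma sec_zero: "x \<in> V \<Longrightarrow> sec x (\<lambda>y. 0)"
proof -
  assume x: "x \<in> V"
  have "A_section A W V (mksec (\<lambda>i y. 0))" by (rule mksec_section[OF V(1)]) (auto simp: V_manifold)
  moreover have "mksec (\<lambda>i y. 0) = (\<lambda>y. 0)" by (auto simp: mksec_def fun_eq_iff intro!: sum.neutral)
  ultimately show ?thesis using x by (auto simp: sec_def)
qed

lemma sec_sum_jet:
  assumes "x \<in> V" "\<And>j. j \<in> J \<Longrightarrow> sec x (u j)"
  shows "sec x (\<lambda>y. \<Sum>j\<in>J. t j *\<^sub>F u j y)"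
    "jet_A A W q x (\<lambda>y. \<Sum>j\<in>J. t j *\<^sub>F u j y) = (\<Sum>j\<in>J. t j *\<^sub>F jet_A A W q x (u j))"
proof -
  \<comment> \<open>Linearity applied to this expression shows that the jet of the zero section
    equals its difference with itself.\<close>
  have e: "(\<lambda>y. 0 + (-1) *\<^sub>F 0) = (\<lambda>y. 0)" by (simp only: cfun.scale_zero_right add_0_left)
  have "jet_A A W q x (\<lambda>y. 0) z = 0" for z
    using fun_cong[OF jet_A_lin[OF sec_zero[OF assms(1)] sec_zero[OF assms(1)] assms(1), of q "-1", unfolded e], of z]
    by (simp only: plus_fun_apply fscale_def) simp
  hence z: "jet_A A W q x (\<lambda>y. 0) = 0" by (simp only: fun_eq_iff zero_fun_apply) simp
  have "sec x (\<lambda>y. \<Sum>j\<in>J. t j *\<^sub>F u j y) \<and> jet_A A W q x (\<lambda>y. \<Sum>j\<in>J. t j *\<^sub>F u j y) = (\<Sum>j\<in>J. t j *\<^sub>F jet_A A W q x (u j))"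
    using assms(2)
  proof (induction J rule: infinite_finite_induct)
    case (insert j J)
    have e: "(\<lambda>y. \<Sum>j\<in>insert j J. t j *\<^sub>F u j y) = (\<lambda>y. (\<Sum>j\<in>J. t j *\<^sub>F u j y) + t j *\<^sub>F u j y)"
      unfolding sum.insert[OF insert(1,2)] by (rule ext, rule add.commute)
    have IH: "sec x (\<lambda>y. \<Sum>j\<in>J. t j *\<^sub>F u j y)" "jet_A A W q x (\<lambda>y. \<Sum>j\<in>J. t j *\<^sub>F u j y) = (\<Sum>j\<in>J. t j *\<^sub>F jet_A A W q x (u j))"
      using insert by auto
    have j: "sec x (u j)" using insert.prems by simp
    have "jet_A A W q x (\<lambda>y. (\<Sum>j\<in>J. t j *\<^sub>F u j y) + t j *\<^sub>F u j y) = (\<Sum>j\<in>insert j J. t j *\<^sub>F jet_A A W q x (u j))"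
      by (rule trans[OF jet_A_lin[OF IH(1) j assms(1)]],
          rule trans[OF arg_cong2[where f="(+)", OF IH(2) refl]],
          rule trans[OF add.commute sum.insert[OF insert(1,2), symmetric]])
    with sec_lin[OF IH(1) j, of "t j", folded e] show ?case
      by (intro conjI) (simp_all only: e)
  qed (use z sec_zero[OF assms(1)] in \<open>simp_all only: sum.infinite sum.empty simp_thms not_False_eq_True\<close>)
  thus "sec x (\<lambda>y. \<Sum>j\<in>J. t j *\<^sub>F u j y)"
    "jet_A A W q x (\<lambda>y. \<Sum>j\<in>J. t j *\<^sub>F u j y) = (\<Sum>j\<in>J. t j *\<^sub>F jet_A A W q x (u j))" by blast+
qed

end

context good_web begin

lemma coords_zero: "x \<in> V \<Longrightarrow> coords x (\<lambda>y. 0) (\<lambda>y i j. 0)"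
  unfolding coords_def by (drule ev_V, erule eventually_mono) (simp only: jetw_0 eqn_0, auto simp: V_manifold)

lemma spencer_cong:
  assumes "coords x s w" "\<forall>\<^sub>F y in nhds x. t y = s y" "v \<in> tangent_space A x"
  shows "spencer A W (k0 - 2) x v t = spencer A W (k0 - 2) x v s"
  using spencer_eval[OF coords_cong[OF assms(1,2)] assms(3)] spencer_eval[OF assms(1,3)] by simp

lemma coords_spencer_sum:
  assumes x: "x \<in> V"
    and "\<And>j. j \<in> J \<Longrightarrow> coords x (s j) (w j)" "\<And>j. j \<in> J \<Longrightarrow> hn x (\<phi> j)"
  shows "coords x (\<lambda>y. \<Sum>j\<in>J. \<phi> j y *\<^sub>F s j y) (\<lambda>y i k. \<Sum>j\<in>J. \<phi> j y * w j y i k) \<and>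
    (\<forall>v\<in>tangent_space A x. spencer A W (k0 - 2) x v (\<lambda>y. \<Sum>j\<in>J. \<phi> j y *\<^sub>F s j y) =
      (\<Sum>j\<in>J. v (\<phi> j) *\<^sub>F s j x + \<phi> j x *\<^sub>F spencer A W (k0 - 2) x v (s j)))"
proof -
  have z: "spencer A W (k0 - 2) x v (\<lambda>y. 0) = 0" if v: "v \<in> tangent_space A x" for v
  proof -
    have "spencer A W (k0 - 2) x v (\<lambda>y. 0 *\<^sub>F 0) = v (\<lambda>y. 0) *\<^sub>F 0 + 0 *\<^sub>F spencer A W (k0 - 2) x v (\<lambda>y. 0)"
      by (rule spencer_scale[OF coords_zero[OF x] hn_const[OF V_manifold[OF x]] v])
    thus ?thesis by (simp only: cfun.scale_zero_left cfun.scale_zero_right add_0_left)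
  qed
  show ?thesis
    using assms(2,3)
  proof (induction J rule: infinite_finite_induct)
    case (insert j J)
    let ?S = "\<lambda>y. \<Sum>j\<in>J. \<phi> j y *\<^sub>F s j y" and ?w = "\<lambda>y i k. \<Sum>j\<in>J. \<phi> j y * w j y i k"
    have e: "(\<lambda>y. \<Sum>j\<in>insert j J. \<phi> j y *\<^sub>F s j y) = (\<lambda>y. \<phi> j y *\<^sub>F s j y + ?S y)"
      "(\<lambda>y i k. \<Sum>j\<in>insert j J. \<phi> j y * w j y i k) = (\<lambda>y i k. \<phi> j y * w j y i k + ?w y i k)"
      unfolding sum.insert[OF insert(1,2)] by (rule refl)+
    have j: "coords x (s j) (w j)" "hn x (\<phi> j)" using insert.prems by auto
    have "coords x ?S ?w \<and> (\<forall>v\<in>tangent_space A x. spencer A W (k0 - 2) x v ?S =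
      (\<Sum>j\<in>J. v (\<phi> j) *\<^sub>F s j x + \<phi> j x *\<^sub>F spencer A W (k0 - 2) x v (s j)))"
      by (rule insert.IH) (use insert.prems in blast)+
    note IH = conjunct1[OF this] conjunct2[OF this, rule_format]
    show ?case
      unfolding e sum.insert[OF insert(1,2)]
    proof (intro conjI ballI)
      show "coords x (\<lambda>y. \<phi> j y *\<^sub>F s j y + ?S y) (\<lambda>y i k. \<phi> j y * w j y i k + ?w y i k)"
        by (rule coords_add[OF coords_scale[OF j] IH(1)])
      fix v assume v: "v \<in> tangent_space A x"
      show "spencer A W (k0 - 2) x v (\<lambda>y. \<phi> j y *\<^sub>F s j y + ?S y) = v (\<phi> j) *\<^sub>F s j x + \<phi> j x *\<^sub>F spencer A W (k0 - 2) x v (s j) +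
        (\<Sum>j\<in>J. v (\<phi> j) *\<^sub>F s j x + \<phi> j x *\<^sub>F spencer A W (k0 - 2) x v (s j))"
        unfolding spencer_add[OF coords_scale[OF j] IH(1) v] spencer_scale[OF j v] IH(2)[OF v] ..
    qed
  next
    case (infinite J)
    show ?case unfolding sum.infinite[OF infinite(1)] using z coords_zero[OF x] by blast
  next
    case empty
    show ?case unfolding sum.empty using z coords_zero[OF x] by blast
  qed
qed

text \<open>Solving for the \<open>\<phi> j\<close> near \<open>m\<close> is \<open>right_inverse\<close> in the square system of the frame coordinates.\<close>

lemma flat_frame:
  assumes m: "m \<in> V" and r: "r = web_pi' CARD('n) k0 d"
    and s: "\<And>j. j < r \<Longrightarrow> coords m (s j) (w j)"
    and ind: "\<And>t. (\<Sum>j<r. t j *\<^sub>F s j m) = 0 \<Longrightarrow> \<forall>j<r. t j = 0"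
  shows "\<forall>\<^sub>F x in nhds m. \<forall>\<sigma> w\<sigma>. coords x \<sigma> w\<sigma> \<longrightarrow>
    (\<exists>\<phi>. (\<forall>j<r. hn x (\<phi> j)) \<and> (\<forall>\<^sub>F y in nhds x. \<sigma> y = (\<Sum>j<r. \<phi> j y *\<^sub>F s j y)))"
proof -
  obtain P b where P: "P \<subseteq> JJ" "card P = web_pi' CARD('n) k0 d"
    and ev: "\<forall>\<^sub>F y in nhds m. y \<in> V \<and> (\<forall>t\<in>P. \<forall>p\<in>JJ. hn y (b t p)) \<and> (\<forall>t\<in>P. \<forall>p\<in>P. b t p y = (if t = p then 1 else 0)) \<and>
      (\<forall>w. eqn (k0 - 1) y w \<longleftrightarrow> (\<forall>p\<in>JJ. w (fst p) (snd p) = (\<Sum>t\<in>P. w (fst t) (snd t) * b t p y)))"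
    using frame[OF m] by (elim exE conjE) (rule that)
  have finP: "finite P" by (rule finite_subset[OF P(1)]) simp
  have cP: "card P = r" using P(2) r by simp
  \<comment> \<open>Solutions with the same free coordinates are equal.\<close>
  have det: "w1 i k = w2 i k"
    if "\<forall>w. eqn (k0 - 1) y w \<longleftrightarrow> (\<forall>p\<in>JJ. w (fst p) (snd p) = (\<Sum>t\<in>P. w (fst t) (snd t) * b t p y))"
      "eqn (k0 - 1) y w1" "eqn (k0 - 1) y w2" "\<And>p. p \<in> P \<Longrightarrow> w1 (fst p) (snd p) = w2 (fst p) (snd p)" "i < d" "k \<in> {1..k0 - 1}" for y w1 w2 i k
  proof -
    have "(i, k) \<in> JJ" using that(5,6) by simp
    hence "w1 i k = (\<Sum>t\<in>P. w1 (fst t) (snd t) * b t (i, k) y)" "w2 i k = (\<Sum>t\<in>P. w2 (fst t) (snd t) * b t (i, k) y)"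
      using that(1-3) by fastforce+
    thus ?thesis using that(4) by simp
  qed
  define lam where "lam p j x = w j x (fst p) (snd p)" for p :: "nat \<times> nat" and j x
  \<comment> \<open>The free coordinates at m, cut off outside P so that they lie in a space of
    dimension \<open>card P\<close>, which is r.\<close>
  define V' where "V' j = (\<lambda>p. if p \<in> P then lam p j m else 0)" for j
  define dl where "dl p = (\<lambda>p'. if p' = p then 1 else 0 :: complex)" for p :: "nat \<times> nat"
  have indV: "inj_on V' {..<r} \<and> cfun.independent (V' ` {..<r})"
  proof (rule cfun_independent_image)
    fix t assume t: "\<And>p. (\<Sum>j\<in>{..<r}. t j * V' j p) = 0"
    have "(\<Sum>j<r. t j *\<^sub>F s j m) = jetw (k0 - 2) m (\<lambda>i k. \<Sum>j<r. t j * w j m i k)"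
      unfolding jetw_sum using coordsD(2)[OF s] by (intro sum.cong refl) auto
    also have "\<dots> = jetw (k0 - 2) m (\<lambda>i k. 0)"
    proof (rule jetw_cong)
      fix i k assume ik: "i < d" "k \<in> {1..Suc (k0 - 2)}"
      show "(\<Sum>j<r. t j * w j m i k) = 0"
      proof (rule det[of m "\<lambda>i k. \<Sum>j<r. t j * w j m i k" "\<lambda>i k. 0"])
        show "eqn (k0 - 1) m (\<lambda>i k. \<Sum>j<r. t j * w j m i k)" using coordsD(3)[OF s] by (intro eqn_sum) auto
        show "(\<Sum>j<r. t j * w j m (fst p) (snd p)) = 0" if "p \<in> P" for p
          using t[of p] that by (simp add: V'_def lam_def)
      qed (use eventually_nhds_x_imp_x[OF ev] ik Suc_k0_minus_2 in auto)
    qed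
    finally have "(\<Sum>j<r. t j *\<^sub>F s j m) = 0" by (simp only: jetw_0)
    from ind[OF this] show "\<forall>j\<in>{..<r}. t j = 0" by blast
  qed simp
  have "V' ` {..<r} \<subseteq> cfun.span (dl ` P)"
  proof
    fix z assume "z \<in> V' ` {..<r}"
    then obtain j where z: "z = V' j" by blast
    have "z p' = (\<Sum>p\<in>P. lam p j m *\<^sub>F dl p) p'" for p'
      unfolding fscale_sum_apply z V'_def dl_def using finP by (simp add: if_distrib eq_commute[of p'] cong: if_cong)
    hence "z = (\<Sum>p\<in>P. lam p j m *\<^sub>F dl p)" by blast
    thus "z \<in> cfun.span (dl ` P)" using cfun_sum_in_span by metis
  qed
  moreover have "card (V' ` {..<r}) = card P" using indV cP by (simp add: card_image)
  \<comment> \<open>There are as many independent vectors as free indices, so they span the unit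
    vectors; this supplies the preimages for \<open>right_inverse\<close>.\<close>
  ultimately have spn: "dl p \<in> cfun.span (V' ` {..<r})" if "p \<in> P" for p
    using cfun_indep_max(3)[of "V' ` {..<r}" P dl] indV finP that by blast
  have "\<exists>N. (\<forall>j<r. \<forall>p\<in>P. hn m (N j p)) \<and>
      (\<forall>\<^sub>F x in nhds m. \<forall>p\<in>P. \<forall>p'\<in>P. (\<Sum>j<r. lam p' j x * N j p x) = (if p' = p then 1 else 0)) \<and>
      (card P = r \<longrightarrow> (\<forall>\<^sub>F x in nhds m. \<forall>w. (\<forall>p\<in>P. (\<Sum>j<r. lam p j x * w j) = 0) \<longrightarrow> (\<forall>j<r. w j = 0)))"
  proof (rule right_inverse[OF finP V_manifold[OF m]])
    show "hn m (lam p j)" if "p \<in> P" "j < r" for p j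
      unfolding lam_def[abs_def] using that P(1) by (intro coordsD(4)[OF s]) auto
    fix p assume p: "p \<in> P"
    obtain t where t: "dl p = (\<Sum>j\<in>{..<r}. t j *\<^sub>F V' j)" using cfun_span_image[OF _ spn[OF p]] by blast
    have "(\<Sum>j<r. lam p' j m * t j) = (if p' = p then 1 else 0)" if "p' \<in> P" for p'
    proof -
      have "dl p p' = (\<Sum>j<r. t j * lam p' j m)" unfolding t fscale_sum_apply V'_def using that by simp
      thus ?thesis by (simp add: dl_def mult.commute)
    qed
    thus "\<exists>w. \<forall>p'\<in>P. (\<Sum>j<r. lam p' j m * w j) = (if p' = p then 1 else 0)" by blast
  qed
  then obtain N where N: "\<forall>j<r. \<forall>p\<in>P. hn m (N j p)"
      "\<forall>\<^sub>F x in nhds m. \<forall>p\<in>P. \<forall>p'\<in>P. (\<Sum>j<r. lam p' j x * N j p x) = (if p' = p then 1 else 0)"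
    by (elim exE conjE) (rule that)
  have "\<forall>\<^sub>F x in nhds m. \<forall>j\<in>{..<r}. \<forall>p\<in>P. hn x (N j p)"
    using N(1) finP by (intro eventually_ball_finite ballI hn_eventually) auto
  moreover have "\<forall>\<^sub>F x in nhds m. \<forall>j\<in>{..<r}. coords x (s j) (w j)"
    using s by (intro eventually_ball_finite ballI coords_ev) auto
  moreover have "\<forall>\<^sub>F x in nhds m. \<forall>\<^sub>F y in nhds x. \<forall>w. eqn (k0 - 1) y w \<longleftrightarrow> (\<forall>p\<in>JJ. w (fst p) (snd p) = (\<Sum>t\<in>P. w (fst t) (snd t) * b t p y))"
    unfolding eventually_eventually using ev by (rule eventually_mono) (elim conjE)
  moreover note N(2)[THEN eventually_eventually[THEN iffD2]]
  ultimately show ?thesis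
  proof eventually_elim
    case (elim x)
    show ?case
    proof (intro allI impI)
      fix \<sigma> w\<sigma> assume \<sigma>: "coords x \<sigma> w\<sigma>"
      \<comment> \<open>The right inverse applied to the free coordinates of \<sigma>: the
        combination of the \<open>s j\<close> then has the free coordinates of \<sigma> and so
        equals it.\<close>
      define \<phi> where "\<phi> j y = (\<Sum>p\<in>P. N j p y * w\<sigma> y (fst p) (snd p))" for j y
      have "hn x (\<phi> j)" if "j < r" for j
        unfolding \<phi>_def[abs_def] using that elim(1) P(1)
        by (intro hn_sum hn_mult V_manifold coordsD(1,4)[OF \<sigma>]) auto
      moreover have "\<forall>\<^sub>F y in nhds x. \<sigma> y = (\<Sum>j<r. \<phi> j y *\<^sub>F s j y)"
      proof -
        have "\<forall>\<^sub>F y in nhds x. \<forall>j\<in>{..<r}. coords y (s j) (w j)"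
          using elim(2) by (intro eventually_ball_finite ballI coords_ev) auto
        with elim(3,4) coords_ev[OF \<sigma>] show ?thesis
        proof eventually_elim
          case (elim y)
          have "(\<Sum>j<r. \<phi> j y *\<^sub>F s j y) = jetw (k0 - 2) y (\<lambda>i k. \<Sum>j<r. \<phi> j y * w j y i k)"
            unfolding jetw_sum using elim(4) coordsD(2) by (intro sum.cong refl) auto
          also have "\<dots> = jetw (k0 - 2) y (w\<sigma> y)"
          proof (rule jetw_cong)
            fix i k assume ik: "i < d" "k \<in> {1..Suc (k0 - 2)}"
            show "(\<Sum>j<r. \<phi> j y * w j y i k) = w\<sigma> y i k"
            proof (rule det[OF elim(1)])
              show "eqn (k0 - 1) y (\<lambda>i k. \<Sum>j<r. \<phi> j y * w j y i k)" using elim(4) coordsD(3) by (intro eqn_sum) auto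
              show "(\<Sum>j<r. \<phi> j y * w j y (fst p) (snd p)) = w\<sigma> y (fst p) (snd p)" if p: "p \<in> P" for p
              proof -
                have "(\<Sum>j<r. \<phi> j y * w j y (fst p) (snd p)) = (\<Sum>j<r. \<Sum>p'\<in>P. lam p j y * N j p' y * w\<sigma> y (fst p') (snd p'))"
                  unfolding \<phi>_def lam_def sum_distrib_right by (intro sum.cong refl) (simp add: algebra_simps)
                also have "\<dots> = (\<Sum>p'\<in>P. (\<Sum>j<r. lam p j y * N j p' y) * w\<sigma> y (fst p') (snd p'))"
                  by (subst sum.swap) (simp add: sum_distrib_right)
                also have "\<dots> = (\<Sum>p'\<in>P. if p' = p then w\<sigma> y (fst p) (snd p) else 0)"
                  using elim(2) p by (intro sum.cong refl) auto
                finally show ?thesis using p finP by simp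
              qed
            qed (use ik Suc_k0_minus_2 coordsD(3)[OF elim(3)] in auto)
          qed
          also have "\<dots> = \<sigma> y" using coordsD(2)[OF elim(3)] by simp
          finally show ?case ..
        qed
      qed
      ultimately show "\<exists>\<phi>. (\<forall>j<r. hn x (\<phi> j)) \<and> (\<forall>\<^sub>F y in nhds x. \<sigma> y = (\<Sum>j<r. \<phi> j y *\<^sub>F s j y))" by blast
    qed
  qed
qed

text \<open>By the Leibniz rule only the coefficients are differentiated when the \<open>s j\<close>
  are flat.\<close>

lemma spencer_comb:
  fixes r :: nat
  assumes s: "\<And>j. j < r \<Longrightarrow> coords x (s j) (w j)" "\<And>j. j < r \<Longrightarrow> flat x (s j)"
    and \<sigma>: "x \<in> V" "\<And>j. j < r \<Longrightarrow> hn x (\<phi> j)" "\<forall>\<^sub>F y in nhds x. \<sigma> y = (\<Sum>j<r. \<phi> j y *\<^sub>F s j y)"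
    and v: "v \<in> tangent_space A x"
  shows "spencer A W (k0 - 2) x v \<sigma> = (\<Sum>j<r. v (\<phi> j) *\<^sub>F s j x)"
proof -
  have c: "coords x (\<lambda>y. \<Sum>j\<in>{..<r}. \<phi> j y *\<^sub>F s j y) (\<lambda>y i k. \<Sum>j\<in>{..<r}. \<phi> j y * w j y i k) \<and>
    (\<forall>v\<in>tangent_space A x. spencer A W (k0 - 2) x v (\<lambda>y. \<Sum>j\<in>{..<r}. \<phi> j y *\<^sub>F s j y) =
      (\<Sum>j\<in>{..<r}. v (\<phi> j) *\<^sub>F s j x + \<phi> j x *\<^sub>F spencer A W (k0 - 2) x v (s j)))"
    by (rule coords_spencer_sum[OF \<sigma>(1)]) (use s \<sigma> in auto)
  have z: "spencer A W (k0 - 2) x v (s j) = 0" if "j < r" for j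
    using eventually_nhds_x_imp_x[OF s(2)[OF that, unfolded flat_def]] v by blast
  have "spencer A W (k0 - 2) x v \<sigma> = spencer A W (k0 - 2) x v (\<lambda>y. \<Sum>j\<in>{..<r}. \<phi> j y *\<^sub>F s j y)"
    by (rule spencer_cong[OF conjunct1[OF c] \<sigma>(3) v])
  also have "\<dots> = (\<Sum>j<r. v (\<phi> j) *\<^sub>F s j x + \<phi> j x *\<^sub>F spencer A W (k0 - 2) x v (s j))" using c v by blast
  also have "\<dots> = (\<Sum>j<r. v (\<phi> j) *\<^sub>F s j x)"
    by (intro sum.cong refl) (simp only: lessThan_iff z cfun.scale_zero_right add_0_right)
  finally show ?thesis .
qed

text \<open>For combinations of flat sections the connection differentiates coefficients only, so
  the curvature acts on them by XY - YX - [X, Y].\<close>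

lemma curvature_zero:
  fixes r :: nat
  assumes s: "\<And>j. j < r \<Longrightarrow> coords x (s j) (w j)" "\<And>j. j < r \<Longrightarrow> flat x (s j)"
    and \<sigma>: "coords x \<sigma> w\<sigma>" "\<And>j. j < r \<Longrightarrow> hn x (\<phi> j)" "\<forall>\<^sub>F y in nhds x. \<sigma> y = (\<Sum>j<r. \<phi> j y *\<^sub>F s j y)"
    and XY: "hol_vector_field A V' X" "hol_vector_field A V' Y" "x \<in> V'"
  shows "curvature A (spencer A W (k0 - 2)) X Y \<sigma> x = 0"
proof -
  note x = coordsD(1)[OF \<sigma>(1)]
  have t: "\<And>y. y \<in> V' \<Longrightarrow> X y \<in> tangent_space A y" "\<And>y. y \<in> V' \<Longrightarrow> Y y \<in> tangent_space A y" "open V'"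
    using XY by (auto simp: hol_vector_field_def)
  have D: "\<forall>\<^sub>F y in nhds x. spencer A W (k0 - 2) y (Z y) \<sigma> = (\<Sum>j<r. Z y (\<phi> j) *\<^sub>F s j y)"
    if Z: "hol_vector_field A V' Z" for Z
  proof -
    have e: "\<forall>\<^sub>F y in nhds x. \<forall>j\<in>{..<r}. coords y (s j) (w j) \<and> flat y (s j) \<and> hn y (\<phi> j)"
    proof (intro eventually_ball_finite ballI)
      fix j assume "j \<in> {..<r}"
      hence j: "j < r" by simp
      have "\<forall>\<^sub>F y in nhds x. flat y (s j)" using s(2)[OF j] unfolding flat_def eventually_eventually .
      with coords_ev[OF s(1)[OF j]] hn_eventually[OF \<sigma>(2)[OF j]]
      show "\<forall>\<^sub>F y in nhds x. coords y (s j) (w j) \<and> flat y (s j) \<and> hn y (\<phi> j)" by eventually_elim simp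
    qed simp
    from e ev_V[OF x] eventually_nhds_in_open[OF t(3) XY(3)] \<sigma>(3)[THEN eventually_eventually[THEN iffD2]]
    show ?thesis
    proof eventually_elim
      case (elim y)
      have "Z y \<in> tangent_space A y" using Z elim(3) by (auto simp: hol_vector_field_def)
      thus ?case using elim by (intro spencer_comb[where w=w]) auto
    qed
  qed
  have DD: "spencer A W (k0 - 2) x (Z' x) (\<lambda>y. spencer A W (k0 - 2) y (Z y) \<sigma>) = (\<Sum>j<r. Z' x (\<lambda>y. Z y (\<phi> j)) *\<^sub>F s j x)"
    if Z: "hol_vector_field A V' Z" "hol_vector_field A V' Z'" for Z Z'
  proof (rule spencer_comb[where w=w, OF s x _ D[OF Z(1)]])
    show "hn x (\<lambda>y. Z y (\<phi> j))" if "j < r" for j by (rule vector_field_hn[OF Z(1) XY(3) \<sigma>(2)[OF that]])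
    show "Z' x \<in> tangent_space A x" using Z(2) XY(3) by (auto simp: hol_vector_field_def)
  qed
  have L: "spencer A W (k0 - 2) x (lie_bracket A X Y x) \<sigma> = (\<Sum>j<r. lie_bracket A X Y x (\<phi> j) *\<^sub>F s j x)"
    by (rule spencer_comb[where w=w, OF s x \<sigma>(2,3) lie_bracket_tangent[OF XY]])
  have "curvature A (spencer A W (k0 - 2)) X Y \<sigma> x z = 0" for z
  proof -
    have "curvature A (spencer A W (k0 - 2)) X Y \<sigma> x z =
      (\<Sum>j<r. X x (\<lambda>y. Y y (\<phi> j)) * s j x z) - (\<Sum>j<r. Y x (\<lambda>y. X y (\<phi> j)) * s j x z) - (\<Sum>j<r. lie_bracket A X Y x (\<phi> j) * s j x z)"
      unfolding curvature_def DD[OF XY(2,1)] DD[OF XY(1,2)] L fun_diff_def fscale_sum_apply ..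
    also have "\<dots> = (\<Sum>j<r. (X x (\<lambda>y. Y y (\<phi> j)) - Y x (\<lambda>y. X y (\<phi> j)) - lie_bracket A X Y x (\<phi> j)) * s j x z)"
      by (simp add: sum_subtractf left_diff_distrib)
    also have "\<dots> = 0" using \<sigma>(2) by (intro sum.neutral) (simp add: lie_bracket_def)
    finally show ?thesis .
  qed
  thus ?thesis by (simp add: fun_eq_iff)
qed

end

context web_setup begin

text \<open>The rank hypothesis speaks of independent germs, while a frame needs jets independent at
  m itself. A linear relation between the values at m is a flat section vanishing at m, hence near
  m, and would be a relation between the germs.\<close>

lemma curvature_vanishes:
  assumes m: "m \<in> UU" and rank: "web_has_rank A W m (web_pi' CARD('n) k0 d)"
  shows "\<exists>V. open V \<and> m \<in> V \<and> V \<subseteq> UU \<and> curvature_vanishes_on A W (k0 - 2) EU (spencer A W (k0 - 2)) V"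
proof -
  obtain c V f where g: "good_web A W d c V f k0" "m \<in> V" "V \<subseteq> UU" using good_web_exists m by blast
  interpret good_web A W d c V f k0 by (rule g(1))
  let ?r = "web_pi' CARD('n) k0 d"
  obtain b where b: "\<forall>j<?r. germ m (b j) \<in> abelian_germs A W m"
    "\<forall>G\<in>abelian_germs A W m. \<exists>!a. a \<in> {..<?r} \<rightarrow>\<^sub>E UNIV \<and> G = germ m (\<lambda>x. \<Sum>j<?r. a j *\<^sub>F b j x)"
    using rank unfolding web_has_rank_def germ_dim_def by blast
  \<comment> \<open>The functions \<open>b j\<close> only have the germs of abelian relations;
    genuine abelian relations u replace them.\<close>
  have "\<exists>u V1. j < ?r \<longrightarrow> germ m (b j) = germ m u \<and> m \<in> V1 \<and> abelian_relation A W V1 u" for j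
    using b(1) unfolding abelian_germs_def by blast
  then obtain u V1 where u: "\<And>j. j < ?r \<longrightarrow> germ m (b j) = germ m (u j) \<and> m \<in> V1 j \<and> abelian_relation A W (V1 j) (u j)" by metis
  define s where "s j y = jet_A A W (k0 - 2) y (u j)" for j y
  have "\<exists>w. j < ?r \<longrightarrow> coords m (s j) w" for j
    using abelian_coords(1)[of "V1 j" "u j" m] u[of j] g(2) unfolding s_def[abs_def] by blast
  then obtain w where w: "\<And>j. j < ?r \<Longrightarrow> coords m (s j) (w j)" by metis
  have fl: "flat m (s j)" if "j < ?r" for j
    using abelian_coords(2)[of "V1 j" "u j" m] u[of j] g(2) that unfolding s_def[abs_def] by blast
  have secu: "\<forall>\<^sub>F x in nhds m. \<forall>j\<in>{..<?r}. sec x (u j)"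
  proof (intro eventually_ball_finite ballI)
    fix j assume "j \<in> {..<?r}"
    hence "sec m (u j)" using u[of j] abelian_sec by blast
    from sec_ev[OF this] show "\<forall>\<^sub>F x in nhds m. sec x (u j)" by (rule eventually_mono) simp
  qed simp
  have bu: "\<forall>\<^sub>F x in nhds m. \<forall>j\<in>{..<?r}. b j x = u j x"
  proof (intro eventually_ball_finite ballI)
    fix j assume "j \<in> {..<?r}"
    hence "germ m (b j) = germ m (u j)" using u[of j] by simp
    thus "\<forall>\<^sub>F x in nhds m. b j x = u j x" unfolding germ_eq_iff .
  qed simp
  have ind: "\<forall>j<?r. t j = 0" if t: "(\<Sum>j<?r. t j *\<^sub>F s j m) = 0" for t
  proof (rule ccontr)
    assume "\<not> (\<forall>j<?r. t j = 0)"
    then obtain j0 where j0: "j0 < ?r" "t j0 \<noteq> 0" by blast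
    \<comment> \<open>With constant coefficients the combination of flat sections is again
      flat.\<close>
    let ?S = "\<lambda>y. \<Sum>j\<in>{..<?r}. t j *\<^sub>F s j y"
    have hc: "hn x (\<lambda>y. t j)" if "x \<in> V" for x j using V_manifold[OF that] by simp
    have cS: "coords m ?S (\<lambda>y i k. \<Sum>j\<in>{..<?r}. t j * w j y i k)"
      using coords_spencer_sum[OF g(2), of "{..<?r}" s w "\<lambda>j y. t j"] w hc[OF g(2)] by auto
    have "\<forall>\<^sub>F y in nhds m. \<forall>j\<in>{..<?r}. coords y (s j) (w j) \<and> (\<forall>v\<in>tangent_space A y. spencer A W (k0 - 2) y v (s j) = 0)"
    proof (intro eventually_ball_finite ballI)
      fix j assume "j \<in> {..<?r}"
      hence j: "j < ?r" by simp
      from coords_ev[OF w[OF j]] fl[OF j, unfolded flat_def]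
      show "\<forall>\<^sub>F y in nhds m. coords y (s j) (w j) \<and> (\<forall>v\<in>tangent_space A y. spencer A W (k0 - 2) y v (s j) = 0)" by eventually_elim simp
    qed simp
    with ev_V[OF g(2)] have "flat m ?S"
      unfolding flat_def
    proof eventually_elim
      case (elim y)
      show ?case
      proof
        fix v assume v: "v \<in> tangent_space A y"
        have "spencer A W (k0 - 2) y v ?S = (\<Sum>j\<in>{..<?r}. v (\<lambda>y. t j) *\<^sub>F s j y + t j *\<^sub>F spencer A W (k0 - 2) y v (s j))"
          using coords_spencer_sum[OF elim(1), of "{..<?r}" s w "\<lambda>j y. t j"] elim(2) hc[OF elim(1)] v by blast
        also have "\<dots> = 0"
          using elim(2) v by (intro sum.neutral ballI) (simp only: tangent_const[OF v] cfun.scale_zero_left cfun.scale_zero_right add_0_left)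
        finally show "spencer A W (k0 - 2) y v ?S = 0" .
      qed
    qed
    from flat_unique[OF cS this t] have "\<forall>\<^sub>F y in nhds m. ?S y = 0" .
    with secu bu ev_V[OF g(2)] have z: "\<forall>\<^sub>F y in nhds m. (\<Sum>j<?r. t j *\<^sub>F b j y) = 0"
    proof eventually_elim
      case (elim y)
      have ss: "sec y (\<lambda>y. \<Sum>j\<in>{..<?r}. t j *\<^sub>F u j y)"
        "jet_A A W (k0 - 2) y (\<lambda>y. \<Sum>j\<in>{..<?r}. t j *\<^sub>F u j y) = (\<Sum>j\<in>{..<?r}. t j *\<^sub>F jet_A A W (k0 - 2) y (u j))"
        by (rule sec_sum_jet[OF elim(3)], use elim(1) in blast)+
      have "(\<Sum>j<?r. t j *\<^sub>F u j y) = 0"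
        by (rule jet_A_zero_imp[OF elim(3) ss(1), where q="k0 - 2"]) (use elim(4) in \<open>simp only: ss(2) s_def\<close>)
      moreover have "(\<Sum>j<?r. t j *\<^sub>F b j y) = (\<Sum>j<?r. t j *\<^sub>F u j y)" using elim(2) by (intro sum.cong refl) simp
      ultimately show ?case by simp
    qed
    \<comment> \<open>Two coefficient vectors for the germ of \<open>b j0\<close>: the unit vector,
      and the unit vector plus the relation t. Uniqueness of coefficients excludes this.\<close>
    define a1 where "a1 = (\<lambda>j\<in>{..<?r}. if j = j0 then 1 else 0 :: complex)"
    define a2 where "a2 = (\<lambda>j\<in>{..<?r}. (if j = j0 then 1 else 0) + t j)"
    have e1: "(\<Sum>j<?r. a1 j *\<^sub>F b j x) = b j0 x" for x
    proof -
      have "(\<Sum>j<?r. a1 j *\<^sub>F b j x) = (\<Sum>j<?r. if j = j0 then b j0 x else 0)"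
        by (intro sum.cong refl) (auto simp: a1_def fscale_def fun_eq_iff)
      thus ?thesis using j0(1) by simp
    qed
    have e2: "(\<Sum>j<?r. a2 j *\<^sub>F b j x) = (\<Sum>j<?r. a1 j *\<^sub>F b j x) + (\<Sum>j<?r. t j *\<^sub>F b j x)" for x
      unfolding sum.distrib[symmetric] by (intro sum.cong refl) (simp only: a1_def a2_def restrict_apply' cfun.scale_left_distrib)
    define Q where "Q a \<longleftrightarrow> a \<in> {..<?r} \<rightarrow>\<^sub>E UNIV \<and> germ m (b j0) = germ m (\<lambda>x. \<Sum>j<?r. a j *\<^sub>F b j x)" for a
    have "Q a1" unfolding Q_def e1 by (auto simp: a1_def)
    moreover have "Q a2"
    proof -
      have "germ m (b j0) = germ m (\<lambda>x. \<Sum>j<?r. a2 j *\<^sub>F b j x)"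
        unfolding germ_eq_iff e2 e1 using z by eventually_elim simp
      moreover have "a2 \<in> {..<?r} \<rightarrow>\<^sub>E UNIV" by (auto simp: a2_def)
      ultimately show ?thesis unfolding Q_def by (intro conjI)
    qed
    moreover have "\<exists>!a. Q a" unfolding Q_def by (rule b(2)[rule_format, OF b(1)[rule_format, OF j0(1)]])
    ultimately have "a1 = a2" by blast
    hence "a1 j0 = a2 j0" by simp
    thus False using j0 by (simp add: a1_def a2_def)
  qed
  have "\<forall>\<^sub>F x in nhds m. \<forall>j\<in>{..<?r}. coords x (s j) (w j) \<and> flat x (s j)"
  proof (intro eventually_ball_finite ballI)
    fix j assume "j \<in> {..<?r}"
    hence j: "j < ?r" by simp
    have "\<forall>\<^sub>F y in nhds m. flat y (s j)" using fl[OF j] unfolding flat_def eventually_eventually .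
    with coords_ev[OF w[OF j]] show "\<forall>\<^sub>F x in nhds m. coords x (s j) (w j) \<and> flat x (s j)" by eventually_elim simp
  qed simp
  moreover have "\<forall>\<^sub>F x in nhds m. \<forall>\<sigma> w\<sigma>. coords x \<sigma> w\<sigma> \<longrightarrow> (\<exists>\<phi>. (\<forall>j<?r. hn x (\<phi> j)) \<and> (\<forall>\<^sub>F y in nhds x. \<sigma> y = (\<Sum>j<?r. \<phi> j y *\<^sub>F s j y)))"
  proof (rule flat_frame[OF g(2) refl])
    show "coords m (s j) (w j)" if "j < ?r" for j using w[OF that] .
    show "\<forall>j<?r. t j = 0" if "(\<Sum>j<?r. t j *\<^sub>F s j m) = 0" for t using ind[OF that] by blast
  qed
  ultimately
  have "\<forall>\<^sub>F x in nhds m. x \<in> V \<and> (\<forall>j<?r. coords x (s j) (w j) \<and> flat x (s j)) \<and>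
    (\<forall>\<sigma> w\<sigma>. coords x \<sigma> w\<sigma> \<longrightarrow> (\<exists>\<phi>. (\<forall>j<?r. hn x (\<phi> j)) \<and> (\<forall>\<^sub>F y in nhds x. \<sigma> y = (\<Sum>j<?r. \<phi> j y *\<^sub>F s j y))))"
    using ev_V[OF g(2)] by eventually_elim blast
  then obtain V2 where V2: "open V2" "m \<in> V2" "\<forall>x\<in>V2. x \<in> V \<and> (\<forall>j<?r. coords x (s j) (w j) \<and> flat x (s j)) \<and>
    (\<forall>\<sigma> w\<sigma>. coords x \<sigma> w\<sigma> \<longrightarrow> (\<exists>\<phi>. (\<forall>j<?r. hn x (\<phi> j)) \<and> (\<forall>\<^sub>F y in nhds x. \<sigma> y = (\<Sum>j<?r. \<phi> j y *\<^sub>F s j y))))"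
    unfolding eventually_nhds by blast
  have "curvature_vanishes_on A W (k0 - 2) EU (spencer A W (k0 - 2)) V2"
    unfolding curvature_vanishes_on_def
  proof (intro allI impI ballI)
    fix V' X Y \<sigma> x assume h: "V' \<subseteq> V2" "hol_vector_field A V' X" "hol_vector_field A V' Y" "bundle_section A W (k0 - 2) EU V' \<sigma>" "x \<in> V'"
    have x: "x \<in> V2" "x \<in> V" using h(1,5) V2(3) by auto
    obtain w\<sigma> where w\<sigma>: "coords x \<sigma> w\<sigma>" using coords_of_section[OF h(4,5) x(2)] by blast
    then obtain \<phi> where \<phi>: "\<forall>j<?r. hn x (\<phi> j)" "\<forall>\<^sub>F y in nhds x. \<sigma> y = (\<Sum>j<?r. \<phi> j y *\<^sub>F s j y)" using V2(3) x(1) by blast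
    have cs: "coords x (s j) (w j)" "flat x (s j)" if "j < ?r" for j using V2(3) x(1) that by auto
    show "curvature A (spencer A W (k0 - 2)) X Y \<sigma> x = 0"
      by (rule curvature_zero[OF cs w\<sigma> \<phi>(1)[rule_format] \<phi>(2) h(2,3,5)])
  qed
  moreover have "V2 \<subseteq> UU" using V2(3) g(3) by blast
  ultimately show ?thesis using V2(1,2) by blast
qed

end

theorem theorem1p2:
  fixes A :: "('m::{t2_space, second_countable_topology}, 'n::finite) chart set"
    and W :: "'m \<Rightarrow> 'm hyp set"
    and d k\<^sub>0 r :: nat
    and S U :: "'m set"
    and E :: "'m \<Rightarrow> ('m, 'n) jet set"
  assumes "CARD('n) \<ge> 2" and "k\<^sub>0 \<ge> 2" and "d = web_c CARD('n) k\<^sub>0"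
    and "complex_atlas A" and "hol_web A d W" and "weak_general_position A W"
    and "ordinary_web A W k\<^sub>0 d"
    and "S = web_S A W k\<^sub>0 d" and "U = manifold A - S"
    and "E = formal_relations A W (k\<^sub>0 - 2)"
    and "r = web_pi' CARD('n) k\<^sub>0 d"
  shows "hol_bundle A W (k\<^sub>0 - 2) E U r \<and>
    (\<exists>nabla. hol_connection A W (k\<^sub>0 - 2) E U nabla \<and>
      (\<forall>m\<in>U. \<exists>\<Phi>.
         (\<forall>u V. m \<in> V \<longrightarrow> abelian_relation A W V u \<longrightarrow>
            \<Phi> (germ m u) = germ m (\<lambda>x. jet_A A W (k\<^sub>0 - 2) x u)) \<and>
         germ_iso m \<Phi> (abelian_germs A W m) (flat_germs A W (k\<^sub>0 - 2) E U nabla m)) \<and>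
      (\<forall>m\<in>U. web_has_rank A W m r \<longrightarrow>
         (\<exists>V. open V \<and> m \<in> V \<and> V \<subseteq> U \<and> curvature_vanishes_on A W (k\<^sub>0 - 2) E nabla V)))"
proof -
  interpret web_setup A W d k\<^sub>0
    by unfold_locales (use assms in auto)
  have U: "U = UU" using assms by simp
  show ?thesis
    unfolding U assms(10,11)
    using relations_bundle spencer_connection jetmap_germ jetmap_iso curvature_vanishes by blast
qed

end
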